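(* Let $\mathcal A$ be an essential arrangement of $d$ lines in $\mathbb P^2_k$, let $H\in\mathcal A$, let $(\mathcal A',\mathcal A,\mathcal A'')$ be the triple with respect to $H$, and let $i:H\simeq\mathbb P^1\hookrightarrow\mathbb P^2$ be the inclusion. Then the sequence of sheaves on $\mathbb P^2$ $$0\longrightarrow \mathcal D'(-1)\longrightarrow \mathcal D\longrightarrow i_*\mathcal D''\longrightarrow 0$$ induced by $0\to D(\mathcal A')(-1)\xrightarrow{\ \cdot\alpha_H\ }D(\mathcal A)\to D(\mathcal A'')$ after dividing out the Euler derivations is exact; that is, it is an elementary modification.
   Context: $k$ is a field of characteristic $0$, $R=k[x_0,x_1,x_2]$. An arrangement $\mathcal A$ of $d$ lines in $\mathbb P^2_k$ is a set of $d$ distinct lines (equivalently, a central arrangement of $d$ planes in $k^3$), with defining polynomial $Q\in R_d$ the product of the $d$ linear forms; it is essential if the lines do not all pass through one point. $\mathrm{Der}_k(R)=\bigoplus_i R\,\partial/\partial x_i$ is graded by $\deg(\sum f_i\,\partial/\partial x_i)=\deg f_i$. $D(\mathcal A)=\{\theta\in \mathrm{Der}_k(R): \theta(Q)\in\langle Q\rangle\}$, and $\theta_E=\sum x_i\,\partial/\partial x_i$ is the Euler derivation. One has $D(\mathcal A)=D_0\oplus R\theta_E$ with $D_0=\{\theta:\theta(Q)=0\}$ the module of syzygies on the three partial derivatives of $Q$, so $D_0\cong D(\mathcal A)/R\theta_E$ as graded modules. $\mathcal D$ is the sheaf on $\mathbb P^2$ associated to $D_0\cong D(\mathcal A)/R\theta_E$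 (a rank two vector bundle). Triple: for $H\in\mathcal A$ with linear form $\alpha_H$, $\mathcal A'=\mathcal A\setminus\{H\}$ and $\mathcal A''=\mathcal A|_H$ is the set of distinct points $\{H\cap H':H'\in\mathcal A'\}$ on $H$ (ignoring multiplicities). $\mathcal D'$ is the sheaf constructed in the same way from $\mathcal A'$. With $S=R/\alpha_H$ (a polynomial ring in two variables), $D(\mathcal A'')\subseteq\mathrm{Der}_k(S)$ is the module of derivations $\theta$ with $\theta(Q'')\in\langle Q''\rangle$, where $Q''\in S$ is the product of the distinct linear forms defining the points of $\mathcal A''$; $\mathcal D''$ is the sheaf on $H=\mathrm{Proj}\,S$ associated to $D(\mathcal A'')/S\theta_E$. The map $D(\mathcal A')(-1)\to D(\mathcal A)$ is multiplication by $\alpha_H$ and $D(\mathcal A)\to D(\mathcal A'')$ is restriction of derivations modulo $\alpha_H$; both induce maps on the quotients by the Euler derivations. Elementary modification: for a smooth variety $X$, an effective divisor $i:Y\hookrightarrow X$, a rank two bundle $V$ on $X$ and a line bundle $L$ on $Y$, an exact sequence $0\to W\to V\to i_*L\to 0$ (with $W$ the kernel, again a rank two bundle). *)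

theory Defs
  imports
    "HOL-Algebra.QuotRing"
    "HOL-Algebra.Module"
    "HOL-Library.Poly_Mapping"
    "HOL-Library.Numeral_Type"
    "HOL-Analysis.Abstract_Topology"
begin

section \<open>Graded rings and graded modules\<close>

record 'a graded_ring = "'a ring" +
  hpart :: "nat \<Rightarrow> 'a set"

record ('a, 'b) graded_module = "('a, 'b) module" +
  mpart :: "int \<Rightarrow> 'b set"

definition homog :: "('a, 'm) graded_ring_scheme \<Rightarrow> 'a set" where
  "homog A = (\<Union>n. hpart A n)"

definition self_module :: "('a, 'm) graded_ring_scheme \<Rightarrow> ('a, 'a) graded_module" where
  "self_module A =
    \<lparr>carrier = carrier A, mult = mult A, one = \<one>\<^bsub>A\<^esub>, zero = \<zero>\<^bsub>A\<^esub>, add = add A, smult = mult A,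
     mpart = (\<lambda>n. if n < 0 then {\<zero>\<^bsub>A\<^esub>} else hpart A (nat n))\<rparr>"

definition quot_graded_ring :: "('a, 'm) graded_ring_scheme \<Rightarrow> 'a set \<Rightarrow> 'a set graded_ring" where
  "quot_graded_ring A I =
    ring.extend (A Quot I) \<lparr>hpart = (\<lambda>n. (\<lambda>a. I +>\<^bsub>A\<^esub> a) ` hpart A n)\<rparr>"

text \<open>HOL-Algebra modules are extensions of rings.  The ring operations \<^const>\<open>mult\<close> and
  \<^const>\<open>one\<close> of a module are irrelevant; they are left undefined below.\<close>

definition quot_graded_module :: "('a, 'b, 'm) graded_module_scheme \<Rightarrow> 'b set \<Rightarrow> ('a, 'b set) graded_module" where
  "quot_graded_module M N =
    \<lparr>carrier = a_rcosets\<^bsub>M\<^esub> N, mult = undefined, one = undefined, zero = N, add = set_add M,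
     smult = (\<lambda>r X. \<Union>x\<in>X. N +>\<^bsub>M\<^esub> (r \<odot>\<^bsub>M\<^esub> x)),
     mpart = (\<lambda>n. (\<lambda>x. N +>\<^bsub>M\<^esub> x) ` mpart M n)\<rparr>"

text \<open>The twist \<open>M(n)\<close>, with \<open>M(n)\<^sub>e = M\<^sub>n\<^sub>+\<^sub>e\<close>.\<close>

definition twist :: "int \<Rightarrow> ('a, 'b) graded_module \<Rightarrow> ('a, 'b) graded_module" where
  "twist n M = M\<lparr>mpart := (\<lambda>e. mpart M (n + e))\<rparr>"

text \<open>The map between cosets induced by \<open>g\<close>, where \<open>N\<close> is the subgroup of the target \<open>M\<close> that is
  divided out: the coset of \<open>x\<close> is sent to the coset \<open>N + g x\<close>.\<close>

definition coset_map :: "('b, 'm) ring_scheme \<Rightarrow> 'b set \<Rightarrow> ('a \<Rightarrow> 'b) \<Rightarrow> 'a set \<Rightarrow> 'b set" where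
  "coset_map M N g X = (\<Union>x\<in>X. N +>\<^bsub>M\<^esub> g x)"


section \<open>Derivations\<close>

text \<open>Derivations over the ground field \<open>k = A\<^sub>0\<close>.\<close>

definition Der :: "('a, 'm) graded_ring_scheme \<Rightarrow> ('a \<Rightarrow> 'a) set" where
  "Der A = {\<theta> \<in> carrier A \<rightarrow>\<^sub>E carrier A.
     (\<forall>a\<in>carrier A. \<forall>b\<in>carrier A. \<theta> (a \<oplus>\<^bsub>A\<^esub> b) = \<theta> a \<oplus>\<^bsub>A\<^esub> \<theta> b) \<and>
     (\<forall>c\<in>hpart A 0. \<forall>a\<in>carrier A. \<theta> (c \<otimes>\<^bsub>A\<^esub> a) = c \<otimes>\<^bsub>A\<^esub> \<theta> a) \<and>
     (\<forall>a\<in>carrier A. \<forall>b\<in>carrier A.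
        \<theta> (a \<otimes>\<^bsub>A\<^esub> b) = (a \<otimes>\<^bsub>A\<^esub> \<theta> b) \<oplus>\<^bsub>A\<^esub> (b \<otimes>\<^bsub>A\<^esub> \<theta> a))}"

text \<open>The graded module \<open>{\<theta> \<in> Der\<^sub>k(A). \<theta>(Q) \<in> \<langle>Q\<rangle>}\<close>.  A derivation has degree \<open>e\<close> if its coefficients,
  that is its values on the linear forms, are homogeneous of degree \<open>e\<close>.\<close>

definition log_der :: "('a, 'm) graded_ring_scheme \<Rightarrow> 'a \<Rightarrow> ('a, 'a \<Rightarrow> 'a) graded_module" where
  "log_der A Q =
    \<lparr>carrier = {\<theta> \<in> Der A. \<theta> Q \<in> PIdl\<^bsub>A\<^esub> Q}, mult = undefined, one = undefined,
     zero = (\<lambda>a\<in>carrier A. \<zero>\<^bsub>A\<^esub>),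
     add = (\<lambda>\<theta> \<eta>. \<lambda>a\<in>carrier A. \<theta> a \<oplus>\<^bsub>A\<^esub> \<eta> a),
     smult = (\<lambda>r \<theta>. \<lambda>a\<in>carrier A. r \<otimes>\<^bsub>A\<^esub> \<theta> a),
     mpart = (\<lambda>e. {\<theta> \<in> Der A. \<theta> Q \<in> PIdl\<^bsub>A\<^esub> Q \<and>
        (\<forall>y\<in>hpart A 1. \<theta> y \<in> mpart (self_module A) e)})\<rparr>"

text \<open>The submodule generated by \<open>\<epsilon>\<close> and the quotient by it; \<open>\<epsilon>\<close> will be the Euler derivation.\<close>

definition der_span :: "('a, 'm) graded_ring_scheme \<Rightarrow> 'a \<Rightarrow> ('a \<Rightarrow> 'a) \<Rightarrow> ('a \<Rightarrow> 'a) set" where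
  "der_span A Q \<epsilon> = {r \<odot>\<^bsub>log_der A Q\<^esub> \<epsilon> | r. r \<in> carrier A}"

definition log_der_quot ::
  "('a, 'm) graded_ring_scheme \<Rightarrow> 'a \<Rightarrow> ('a \<Rightarrow> 'a) \<Rightarrow> ('a, ('a \<Rightarrow> 'a) set) graded_module" where
  "log_der_quot A Q \<epsilon> = quot_graded_module (log_der A Q) (der_span A Q \<epsilon>)"

text \<open>The derivation of \<open>A/I\<close> induced by a derivation \<open>\<theta>\<close> of \<open>A\<close> with \<open>\<theta>(I) \<subseteq> I\<close>.\<close>

definition der_restrict :: "('a, 'm) graded_ring_scheme \<Rightarrow> 'a set \<Rightarrow> ('a \<Rightarrow> 'a) \<Rightarrow> 'a set \<Rightarrow> 'a set" where
  "der_restrict A I \<theta> = (\<lambda>X\<in>carrier (A Quot I). coset_map A I \<theta> X)"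


section \<open>Sheaves of modules on ringed spaces\<close>

record ('p, 'r) ringed_space =
  rs_top :: "'p topology"
  rs_ring :: "'p set \<Rightarrow> 'r ring"
  rs_res :: "'p set \<Rightarrow> 'p set \<Rightarrow> 'r \<Rightarrow> 'r"

text \<open>\<open>sm_res F U V\<close> is the restriction map from \<open>F(U)\<close> to \<open>F(V)\<close>, for \<open>V \<subseteq> U\<close>.\<close>

record ('p, 'r, 's) mod_sheaf =
  sm_sec :: "'p set \<Rightarrow> ('r, 's) module"
  sm_res :: "'p set \<Rightarrow> 'p set \<Rightarrow> 's \<Rightarrow> 's"

definition is_sheaf ::
  "'p topology \<Rightarrow> ('p set \<Rightarrow> 's set) \<Rightarrow> ('p set \<Rightarrow> 'p set \<Rightarrow> 's \<Rightarrow> 's) \<Rightarrow> bool" where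
  "is_sheaf T F \<rho> \<longleftrightarrow>
     (\<forall>U V. openin T U \<and> openin T V \<and> V \<subseteq> U \<longrightarrow> \<rho> U V \<in> F U \<rightarrow> F V) \<and>
     (\<forall>U. openin T U \<longrightarrow> (\<forall>s\<in>F U. \<rho> U U s = s)) \<and>
     (\<forall>U V W. openin T U \<and> openin T V \<and> openin T W \<and> W \<subseteq> V \<and> V \<subseteq> U \<longrightarrow>
        (\<forall>s\<in>F U. \<rho> V W (\<rho> U V s) = \<rho> U W s)) \<and>
     (\<forall>C s. (\<forall>U\<in>C. openin T U \<and> s U \<in> F U) \<and>
        (\<forall>U\<in>C. \<forall>V\<in>C. \<rho> U (U \<inter> V) (s U) = \<rho> V (U \<inter> V) (s V)) \<longrightarrow>
        (\<exists>!t. t \<in> F (\<Union>C) \<and> (\<forall>U\<in>C. \<rho> (\<Union>C) U t = s U)))"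

definition is_ringed_space :: "('p, 'r) ringed_space \<Rightarrow> bool" where
  "is_ringed_space X \<longleftrightarrow>
     (\<forall>U. openin (rs_top X) U \<longrightarrow> cring (rs_ring X U)) \<and>
     (\<forall>U V. openin (rs_top X) U \<and> openin (rs_top X) V \<and> V \<subseteq> U \<longrightarrow>
        rs_res X U V \<in> ring_hom (rs_ring X U) (rs_ring X V)) \<and>
     is_sheaf (rs_top X) (\<lambda>U. carrier (rs_ring X U)) (rs_res X)"

definition sheaf_of_modules :: "('p, 'r) ringed_space \<Rightarrow> ('p, 'r, 's) mod_sheaf \<Rightarrow> bool" where
  "sheaf_of_modules X F \<longleftrightarrow>
     is_ringed_space X \<and>
     (\<forall>U. openin (rs_top X) U \<longrightarrow> Module.module (rs_ring X U) (sm_sec F U)) \<and>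
     (\<forall>U V. openin (rs_top X) U \<and> openin (rs_top X) V \<and> V \<subseteq> U \<longrightarrow>
        (\<forall>s\<in>carrier (sm_sec F U). \<forall>t\<in>carrier (sm_sec F U).
           sm_res F U V (s \<oplus>\<^bsub>sm_sec F U\<^esub> t) = sm_res F U V s \<oplus>\<^bsub>sm_sec F V\<^esub> sm_res F U V t) \<and>
        (\<forall>a\<in>carrier (rs_ring X U). \<forall>s\<in>carrier (sm_sec F U).
           sm_res F U V (a \<odot>\<^bsub>sm_sec F U\<^esub> s) = rs_res X U V a \<odot>\<^bsub>sm_sec F V\<^esub> sm_res F U V s)) \<and>
     is_sheaf (rs_top X) (\<lambda>U. carrier (sm_sec F U)) (sm_res F)"

definition sheaf_hom ::
  "('p, 'r) ringed_space \<Rightarrow> ('p, 'r, 's) mod_sheaf \<Rightarrow> ('p, 'r, 't) mod_sheaf \<Rightarrow>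
   ('p set \<Rightarrow> 's \<Rightarrow> 't) \<Rightarrow> bool" where
  "sheaf_hom X F G \<phi> \<longleftrightarrow>
     (\<forall>U. openin (rs_top X) U \<longrightarrow>
        \<phi> U \<in> carrier (sm_sec F U) \<rightarrow> carrier (sm_sec G U) \<and>
        (\<forall>s\<in>carrier (sm_sec F U). \<forall>t\<in>carrier (sm_sec F U).
           \<phi> U (s \<oplus>\<^bsub>sm_sec F U\<^esub> t) = \<phi> U s \<oplus>\<^bsub>sm_sec G U\<^esub> \<phi> U t) \<and>
        (\<forall>a\<in>carrier (rs_ring X U). \<forall>s\<in>carrier (sm_sec F U).
           \<phi> U (a \<odot>\<^bsub>sm_sec F U\<^esub> s) = a \<odot>\<^bsub>sm_sec G U\<^esub> \<phi> U s)) \<and>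
     (\<forall>U V. openin (rs_top X) U \<and> openin (rs_top X) V \<and> V \<subseteq> U \<longrightarrow>
        (\<forall>s\<in>carrier (sm_sec F U). sm_res G U V (\<phi> U s) = \<phi> V (sm_res F U V s)))"

text \<open>Exactness in the category of sheaves of modules: the image sheaf consists of the sections that
  lift locally.\<close>

definition in_image_sheaf ::
  "('p, 'r) ringed_space \<Rightarrow> ('p, 'r, 's) mod_sheaf \<Rightarrow> ('p, 'r, 't) mod_sheaf \<Rightarrow>
   ('p set \<Rightarrow> 's \<Rightarrow> 't) \<Rightarrow> 'p set \<Rightarrow> 't \<Rightarrow> bool" where
  "in_image_sheaf X F G \<phi> U t \<longleftrightarrow>
     (\<forall>p\<in>U. \<exists>V. openin (rs_top X) V \<and> p \<in> V \<and> V \<subseteq> U \<and>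
        (\<exists>s\<in>carrier (sm_sec F V). \<phi> V s = sm_res G U V t))"

definition short_exact ::
  "('p, 'r) ringed_space \<Rightarrow> ('p, 'r, 's) mod_sheaf \<Rightarrow> ('p set \<Rightarrow> 's \<Rightarrow> 't) \<Rightarrow>
   ('p, 'r, 't) mod_sheaf \<Rightarrow> ('p set \<Rightarrow> 't \<Rightarrow> 'u) \<Rightarrow> ('p, 'r, 'u) mod_sheaf \<Rightarrow> bool" where
  "short_exact X F \<phi> G \<psi> K \<longleftrightarrow>
     sheaf_of_modules X F \<and> sheaf_of_modules X G \<and> sheaf_of_modules X K \<and>
     sheaf_hom X F G \<phi> \<and> sheaf_hom X G K \<psi> \<and>
     (\<forall>U. openin (rs_top X) U \<longrightarrow>
        inj_on (\<phi> U) (carrier (sm_sec F U)) \<and>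
        (\<forall>s\<in>carrier (sm_sec G U).
           \<psi> U s = \<zero>\<^bsub>sm_sec K U\<^esub> \<longleftrightarrow> in_image_sheaf X F G \<phi> U s) \<and>
        (\<forall>t\<in>carrier (sm_sec K U). in_image_sheaf X G K \<psi> U t))"

text \<open>Every point has an open neighbourhood \<open>U\<close> with \<open>F|\<^sub>U \<cong> \<O>\<^sub>U\<^sup>n\<close>, via a basis \<open>e 0, ..., e (n - 1)\<close>.\<close>

definition vector_bundle :: "('p, 'r) ringed_space \<Rightarrow> nat \<Rightarrow> ('p, 'r, 's) mod_sheaf \<Rightarrow> bool" where
  "vector_bundle X n F \<longleftrightarrow>
     sheaf_of_modules X F \<and>
     (\<forall>p\<in>topspace (rs_top X). \<exists>U e. openin (rs_top X) U \<and> p \<in> U \<and>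
        e \<in> {..<n} \<rightarrow> carrier (sm_sec F U) \<and>
        (\<forall>V. openin (rs_top X) V \<and> V \<subseteq> U \<longrightarrow>
           (\<forall>s\<in>carrier (sm_sec F V). \<exists>!c. c \<in> {..<n} \<rightarrow>\<^sub>E carrier (rs_ring X V) \<and>
              s = (\<Oplus>\<^bsub>sm_sec F V\<^esub>j\<in>{..<n}. c j \<odot>\<^bsub>sm_sec F V\<^esub> sm_res F U V (e j)))))"

text \<open>The direct image along a morphism \<open>(f, f\<^sup>#) : Y \<rightarrow> X\<close> of ringed spaces, where
  \<open>f\<^sup>#\<^sub>U : \<O>\<^sub>X(U) \<rightarrow> \<O>\<^sub>Y(f\<^sup>-\<^sup>1 U)\<close>.\<close>

definition pushforward ::
  "('q, 'r') ringed_space \<Rightarrow> ('q \<Rightarrow> 'p) \<Rightarrow> ('p set \<Rightarrow> 'r \<Rightarrow> 'r') \<Rightarrow> ('q, 'r', 's) mod_sheaf \<Rightarrow>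
   ('p, 'r, 's) mod_sheaf" where
  "pushforward Y f f_sharp G =
    (let pre = (\<lambda>U. {y \<in> topspace (rs_top Y). f y \<in> U}) in
     \<lparr>sm_sec = (\<lambda>U. let N = sm_sec G (pre U) in
        \<lparr>carrier = carrier N, mult = mult N, one = one N, zero = zero N, add = add N,
         smult = (\<lambda>a s. f_sharp U a \<odot>\<^bsub>N\<^esub> s)\<rparr>),
      sm_res = (\<lambda>U V. sm_res G (pre U) (pre V))\<rparr>)"

text \<open>The sequence \<open>0 \<rightarrow> W \<rightarrow> V \<rightarrow> i\<^sub>*L \<rightarrow> 0\<close>.  That \<open>X\<close> is a smooth variety and \<open>i : Y \<rightarrow> X\<close> an effective
  divisor is not part of the predicate; it is only applied to a line in the projective plane.\<close>

definition elementary_modification ::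
  "('p, 'r) ringed_space \<Rightarrow> ('q, 'r') ringed_space \<Rightarrow> ('q \<Rightarrow> 'p) \<Rightarrow> ('p set \<Rightarrow> 'r \<Rightarrow> 'r') \<Rightarrow>
   ('p, 'r, 's) mod_sheaf \<Rightarrow> ('p set \<Rightarrow> 's \<Rightarrow> 't) \<Rightarrow>
   ('p, 'r, 't) mod_sheaf \<Rightarrow> ('p set \<Rightarrow> 't \<Rightarrow> 'u) \<Rightarrow> ('q, 'r', 'u) mod_sheaf \<Rightarrow> bool" where
  "elementary_modification X Y i i_sharp W \<phi> V \<psi> L \<longleftrightarrow>
     vector_bundle X 2 V \<and> vector_bundle Y 1 L \<and> vector_bundle X 2 W \<and>
     short_exact X W \<phi> V \<psi> (pushforward Y i i_sharp L)"


section \<open>Proj and the sheaf associated to a graded module\<close>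

text \<open>Homogeneous prime ideals not containing the irrelevant ideal.\<close>

definition Proj :: "('a, 'm) graded_ring_scheme \<Rightarrow> 'a set set" where
  "Proj A = {p. primeideal p A \<and> p = Idl\<^bsub>A\<^esub> (p \<inter> homog A) \<and> \<not> (\<Union>n\<in>{0<..}. hpart A n) \<subseteq> p}"

definition zero_locus :: "('a, 'm) graded_ring_scheme \<Rightarrow> 'a \<Rightarrow> 'a set set" where
  "zero_locus A f = {p \<in> Proj A. f \<in> p}"

definition zariski :: "('a, 'm) graded_ring_scheme \<Rightarrow> 'a set topology" where
  "zariski A = topology_generated_by ((\<lambda>f. Proj A - zero_locus A f) ` homog A)"

text \<open>The degree 0 part of the homogeneous localization of \<open>M\<close> at \<open>p\<close>: its elements are the equivalence
  classes of the pairs \<open>(m, f)\<close>, read as \<open>m/f\<close>, with \<open>m\<close> and \<open>f\<close> homogeneous of the same degree and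
  \<open>f \<notin> p\<close>.\<close>

definition frac_rel ::
  "('a, 'm) graded_ring_scheme \<Rightarrow> ('a, 'b) graded_module \<Rightarrow> 'a set \<Rightarrow> (('b \<times> 'a) \<times> ('b \<times> 'a)) set" where
  "frac_rel A M p =
    {((m, f), (n, g)) | m f n g. (\<exists>i. m \<in> mpart M (int i) \<and> f \<in> hpart A i - p) \<and>
       (\<exists>j. n \<in> mpart M (int j) \<and> g \<in> hpart A j - p) \<and>
       (\<exists>h\<in>homog A - p. h \<odot>\<^bsub>M\<^esub> (g \<odot>\<^bsub>M\<^esub> m) = h \<odot>\<^bsub>M\<^esub> (f \<odot>\<^bsub>M\<^esub> n))}"

definition frac ::
  "('a, 'm) graded_ring_scheme \<Rightarrow> ('a, 'b) graded_module \<Rightarrow> 'a set \<Rightarrow> 'b \<Rightarrow> 'a \<Rightarrow> ('b \<times> 'a) set" where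
  "frac A M p m f = frac_rel A M p `` {(m, f)}"

definition frac_add ::
  "('a, 'm) graded_ring_scheme \<Rightarrow> ('a, 'b) graded_module \<Rightarrow> 'a set \<Rightarrow>
   ('b \<times> 'a) set \<Rightarrow> ('b \<times> 'a) set \<Rightarrow> ('b \<times> 'a) set" where
  "frac_add A M p X Y =
    (\<Union>(m, f)\<in>X. \<Union>(n, g)\<in>Y. frac A M p ((g \<odot>\<^bsub>M\<^esub> m) \<oplus>\<^bsub>M\<^esub> (f \<odot>\<^bsub>M\<^esub> n)) (f \<otimes>\<^bsub>A\<^esub> g))"

definition frac_smult ::
  "('a, 'm) graded_ring_scheme \<Rightarrow> ('a, 'b) graded_module \<Rightarrow> 'a set \<Rightarrow>
   ('a \<times> 'a) set \<Rightarrow> ('b \<times> 'a) set \<Rightarrow> ('b \<times> 'a) set" where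
  "frac_smult A M p X Y = (\<Union>(r, f)\<in>X. \<Union>(n, g)\<in>Y. frac A M p (r \<odot>\<^bsub>M\<^esub> n) (f \<otimes>\<^bsub>A\<^esub> g))"

text \<open>Functions with values in the localizations that are locally given by one fraction.\<close>

definition tilde_sections ::
  "('a, 'm) graded_ring_scheme \<Rightarrow> ('a, 'b) graded_module \<Rightarrow> 'a set set \<Rightarrow>
   ('a set \<Rightarrow> ('b \<times> 'a) set) set" where
  "tilde_sections A M U = {s \<in> extensional U.
     \<forall>p\<in>U. \<exists>V. openin (zariski A) V \<and> p \<in> V \<and> V \<subseteq> U \<and>
       (\<exists>i. \<exists>m\<in>mpart M (int i). \<exists>f\<in>hpart A i. \<forall>q\<in>V. f \<notin> q \<and> s q = frac A M q m f)}"

definition Proj_space :: "('a, 'm) graded_ring_scheme \<Rightarrow> ('a set, 'a set \<Rightarrow> ('a \<times> 'a) set) ringed_space" where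
  "Proj_space A =
    \<lparr>rs_top = zariski A,
     rs_ring = (\<lambda>U.
       \<lparr>carrier = tilde_sections A (self_module A) U,
        mult = (\<lambda>s t. \<lambda>p\<in>U. frac_smult A (self_module A) p (s p) (t p)),
        one = (\<lambda>p\<in>U. frac A (self_module A) p \<one>\<^bsub>A\<^esub> \<one>\<^bsub>A\<^esub>),
        zero = (\<lambda>p\<in>U. frac A (self_module A) p \<zero>\<^bsub>A\<^esub> \<one>\<^bsub>A\<^esub>),
        add = (\<lambda>s t. \<lambda>p\<in>U. frac_add A (self_module A) p (s p) (t p))\<rparr>),
     rs_res = (\<lambda>U V s. restrict s V)\<rparr>"

definition tilde ::
  "('a, 'm) graded_ring_scheme \<Rightarrow> ('a, 'b) graded_module \<Rightarrow>
   ('a set, 'a set \<Rightarrow> ('a \<times> 'a) set, 'a set \<Rightarrow> ('b \<times> 'a) set) mod_sheaf" where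
  "tilde A M =
    \<lparr>sm_sec = (\<lambda>U.
       \<lparr>carrier = tilde_sections A M U, mult = undefined, one = undefined,
        zero = (\<lambda>p\<in>U. frac A M p \<zero>\<^bsub>M\<^esub> \<one>\<^bsub>A\<^esub>),
        add = (\<lambda>s t. \<lambda>p\<in>U. frac_add A M p (s p) (t p)),
        smult = (\<lambda>a s. \<lambda>p\<in>U. frac_smult A M p (a p) (s p))\<rparr>),
     sm_res = (\<lambda>U V s. restrict s V)\<rparr>"

text \<open>For a surjective graded homomorphism \<open>\<pi> : A \<rightarrow> B\<close>, the map \<open>Proj B \<rightarrow> Proj A\<close>; and for a graded
  \<open>\<pi>\<close>-semilinear map \<open>g : M \<rightarrow> N\<close> (\<open>N\<close> a \<open>B\<close>-module) the induced maps from sections of \<open>M\<^sup>~\<close>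
  over \<open>U\<close> to sections of \<open>N\<^sup>~\<close> over the preimage of \<open>U\<close>: the section given by \<open>m/f\<close> is sent to the one given by
  \<open>g m / \<pi> f\<close>.\<close>

definition Proj_map :: "('a, 'm) graded_ring_scheme \<Rightarrow> ('a \<Rightarrow> 'b) \<Rightarrow> 'b set \<Rightarrow> 'a set" where
  "Proj_map A \<pi> q = {a \<in> carrier A. \<pi> a \<in> q}"

definition tilde_map ::
  "('a, 'm) graded_ring_scheme \<Rightarrow> ('b, 'n) graded_ring_scheme \<Rightarrow> ('b, 'd) graded_module \<Rightarrow>
   ('a \<Rightarrow> 'b) \<Rightarrow> ('c \<Rightarrow> 'd) \<Rightarrow> 'a set set \<Rightarrow>
   ('a set \<Rightarrow> ('c \<times> 'a) set) \<Rightarrow> ('b set \<Rightarrow> ('d \<times> 'b) set)" where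
  "tilde_map A B N \<pi> g U s =
    (\<lambda>q\<in>{q \<in> Proj B. Proj_map A \<pi> q \<in> U}.
       \<Union>(m, f)\<in>s (Proj_map A \<pi> q). frac B N q (g m) (\<pi> f))"


section \<open>The coordinate ring of the projective plane\<close>

type_synonym 'k poly3 = "(3 \<Rightarrow>\<^sub>0 nat) \<Rightarrow>\<^sub>0 'k"

definition P2_ring :: "'k::field_char_0 poly3 graded_ring" where
  "P2_ring =
    \<lparr>carrier = UNIV, mult = (*), one = 1, zero = 0, add = (+),
     hpart = (\<lambda>n. {f. \<forall>m\<in>Poly_Mapping.keys f. (\<Sum>i\<in>UNIV. Poly_Mapping.lookup m i) = n})\<rparr>"

definition coord :: "3 \<Rightarrow> 'k::field_char_0 poly3" where
  "coord i = Poly_Mapping.single (Poly_Mapping.single i 1) 1"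

definition partial :: "3 \<Rightarrow> 'k::field_char_0 poly3 \<Rightarrow> 'k poly3" where
  "partial i f = (\<Sum>m\<in>Poly_Mapping.keys f.
     Poly_Mapping.single (m - Poly_Mapping.single i 1)
       (of_nat (Poly_Mapping.lookup m i) * Poly_Mapping.lookup f m))"

definition euler :: "'k::field_char_0 poly3 \<Rightarrow> 'k poly3" where
  "euler f = (\<Sum>i\<in>UNIV. coord i * partial i f)"


lemma P2_ring_cring: "cring (P2_ring :: 'k::field_char_0 poly3 graded_ring)"
proof (rule cringI)
  show "abelian_group (P2_ring :: 'k poly3 graded_ring)"
  proof (rule abelian_groupI)
    fix x :: "'k poly3"
    show "\<exists>y\<in>carrier P2_ring. y \<oplus>\<^bsub>P2_ring\<^esub> x = \<zero>\<^bsub>P2_ring\<^esub>"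
      by (intro bexI[of _ "- x"]) (simp_all add: P2_ring_def)
  qed (simp_all add: P2_ring_def ac_simps)
  show "Group.comm_monoid (P2_ring :: 'k poly3 graded_ring)"
    by (rule comm_monoidI) (simp_all add: P2_ring_def ac_simps)
qed (simp add: P2_ring_def algebra_simps)

lemma euler_homogeneous:
  assumes "f \<in> hpart P2_ring n"
  shows "euler f = of_nat n * f"
proof -
  have coord: "coord i * Poly_Mapping.single (m - Poly_Mapping.single i 1) (of_nat (Poly_Mapping.lookup m i) * c) =
      Poly_Mapping.single m (of_nat (Poly_Mapping.lookup m i) * c)" for i m and c :: 'a
  proof (cases "Poly_Mapping.lookup m i = 0")
    case False
    then have "Poly_Mapping.single i 1 + (m - Poly_Mapping.single i 1) = m"
      by (intro poly_mapping_eqI) (auto simp: lookup_add lookup_minus lookup_single when_def)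
    then show ?thesis
      by (simp add: coord_def mult_single)
  qed simp
  have "euler f = (\<Sum>i\<in>UNIV. \<Sum>m\<in>Poly_Mapping.keys f.
      Poly_Mapping.single m (of_nat (Poly_Mapping.lookup m i) * Poly_Mapping.lookup f m))"
    by (simp only: euler_def partial_def sum_distrib_left coord)
  also have "\<dots> = (\<Sum>m\<in>Poly_Mapping.keys f. \<Sum>i\<in>UNIV.
      Poly_Mapping.single m (of_nat (Poly_Mapping.lookup m i) * Poly_Mapping.lookup f m))"
    by (rule sum.swap)
  also have "\<dots> = (\<Sum>m\<in>Poly_Mapping.keys f. Poly_Mapping.single m (of_nat n * Poly_Mapping.lookup f m))"
  proof (rule sum.cong[OF refl])
    fix m assume "m \<in> Poly_Mapping.keys f"
    with assms have n: "(\<Sum>i\<in>UNIV. Poly_Mapping.lookup m i) = n"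
      by (simp add: P2_ring_def)
    have "(\<Sum>i\<in>S. Poly_Mapping.single m (of_nat (Poly_Mapping.lookup m i) * Poly_Mapping.lookup f m)) =
        Poly_Mapping.single m (of_nat (\<Sum>i\<in>S. Poly_Mapping.lookup m i) * Poly_Mapping.lookup f m)"
      if "finite S" for S
      using that by (induction S rule: finite_induct) (simp_all add: single_add[symmetric] distrib_right)
    from this[of UNIV] show "(\<Sum>i\<in>UNIV. Poly_Mapping.single m
        (of_nat (Poly_Mapping.lookup m i) * Poly_Mapping.lookup f m)) =
        Poly_Mapping.single m (of_nat n * Poly_Mapping.lookup f m)"
      by (simp add: n)
  qed
  also have "\<dots> = of_nat n * f"
  proof (rule poly_mapping_eqI)
    fix m
    have "Poly_Mapping.lookup (of_nat n * f) m = of_nat n * Poly_Mapping.lookup f m"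
      by (induction n) (simp_all add: lookup_add distrib_right)
    moreover have "Poly_Mapping.lookup (\<Sum>m\<in>Poly_Mapping.keys f.
        Poly_Mapping.single m (of_nat n * Poly_Mapping.lookup f m)) m = of_nat n * Poly_Mapping.lookup f m"
      by (cases "m \<in> Poly_Mapping.keys f")
        (simp_all add: lookup_sum lookup_single when_def in_keys_iff)
    ultimately show "Poly_Mapping.lookup (\<Sum>m\<in>Poly_Mapping.keys f.
        Poly_Mapping.single m (of_nat n * Poly_Mapping.lookup f m)) m = Poly_Mapping.lookup (of_nat n * f) m"
      by simp
  qed
  finally show ?thesis .
qed

lemma partial_add: "partial i (f + g) = partial i f + partial i g"
proof -
  let ?K = "Poly_Mapping.keys f \<union> Poly_Mapping.keys g"
  have sup: "partial i h = (\<Sum>m\<in>?K. Poly_Mapping.single (m - Poly_Mapping.single i 1)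
       (of_nat (Poly_Mapping.lookup m i) * Poly_Mapping.lookup h m))"
    if "Poly_Mapping.keys h \<subseteq> ?K" for h :: "'a poly3"
    unfolding partial_def using that
    by (intro sum.mono_neutral_left) (auto simp: in_keys_iff)
  show ?thesis
    by (simp add: sup Poly_Mapping.keys_add lookup_add distrib_left single_add sum.distrib)
qed

lemma euler_add: "euler (f + g) = euler f + euler g"
  by (simp add: euler_def partial_add distrib_left sum.distrib)

lemma poly3_induct [case_names zero add single]:
  fixes P :: "'k::field_char_0 poly3 \<Rightarrow> bool"
  assumes "P 0" and "\<And>f g. P f \<Longrightarrow> P g \<Longrightarrow> P (f + g)" and "\<And>m c. P (Poly_Mapping.single m c)"
  shows "P f"
proof -
  have "P (\<Sum>m\<in>S. Poly_Mapping.single m (Poly_Mapping.lookup f m))" if "finite S" for S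
    using that by (induction S rule: finite_induct) (simp_all add: assms)
  moreover have "(\<Sum>m\<in>Poly_Mapping.keys f. Poly_Mapping.single m (Poly_Mapping.lookup f m)) = f"
    by (rule poly_mapping_eqI) (simp add: lookup_sum lookup_single when_def in_keys_iff)
  ultimately show ?thesis
    by (metis finite_keys)
qed

lemma euler_single:
  "euler (Poly_Mapping.single m c) = of_nat (\<Sum>i\<in>UNIV. Poly_Mapping.lookup m i) * Poly_Mapping.single m c"
  by (rule euler_homogeneous) (simp add: P2_ring_def)

lemma euler_mult: "euler (f * g) = f * euler g + g * euler f"
proof (induction f rule: poly3_induct)
  case zero
  then show ?case by (simp add: euler_def partial_def)
next
  case (add f f')
  then show ?case by (simp add: distrib_right euler_add distrib_left)
next
  case (single m c)
  show ?case
  proof (induction g rule: poly3_induct)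
    case zero
    then show ?case by (simp add: euler_def partial_def)
  next
    case (add g g')
    then show ?case by (simp add: distrib_left euler_add distrib_right)
  next
    case (single m' c')
    have "euler (Poly_Mapping.single m c * Poly_Mapping.single m' c') =
        of_nat (\<Sum>i\<in>UNIV. Poly_Mapping.lookup (m + m') i) * (Poly_Mapping.single m c * Poly_Mapping.single m' c')"
      unfolding mult_single by (rule euler_single)
    then show ?case
      by (simp add: euler_single lookup_add sum.distrib algebra_simps del: mult_single of_nat_sum)
  qed
qed


section \<open>Line arrangements and triples\<close>

text \<open>A set of \<open>d\<close> distinct lines in the plane together with a choice of defining linear forms.\<close>

definition line_arrangement ::
  "nat \<Rightarrow> 'k::field_char_0 poly3 set set set \<Rightarrow> ('k poly3 set set \<Rightarrow> 'k poly3) \<Rightarrow> bool" where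
  "line_arrangement d \<A> \<alpha> \<longleftrightarrow> finite \<A> \<and> card \<A> = d \<and>
     (\<forall>H\<in>\<A>. \<alpha> H \<in> hpart P2_ring 1 \<and> \<alpha> H \<noteq> 0 \<and> H = zero_locus P2_ring (\<alpha> H))"

definition essential :: "'k::field_char_0 poly3 set set set \<Rightarrow> bool" where
  "essential \<A> \<longleftrightarrow> \<not> (\<exists>p\<in>Proj P2_ring. \<forall>H\<in>\<A>. p \<in> H)"

text \<open>The points of the restriction to \<open>H\<close>, without multiplicities; they are points of the plane, in the
  form of one-element closed subsets.\<close>

definition arr_restriction ::
  "'k::field_char_0 poly3 set set set \<Rightarrow> 'k poly3 set set \<Rightarrow> 'k poly3 set set set" where
  "arr_restriction \<A> H = (\<lambda>H'. H \<inter> H') ` (\<A> - {H})"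

text \<open>With \<open>a\<close> the linear form of \<open>H\<close>: the ring \<open>S = R/a\<close>, the projection \<open>R \<rightarrow> S\<close>, the inclusion
  \<open>i : H = Proj S \<rightarrow> Proj R\<close>, and \<open>i\<^sup>#\<close>.\<close>

definition line_ring :: "'k::field_char_0 poly3 \<Rightarrow> 'k poly3 set graded_ring" where
  "line_ring a = quot_graded_ring P2_ring (PIdl\<^bsub>P2_ring\<^esub> a)"

definition line_proj :: "'k::field_char_0 poly3 \<Rightarrow> 'k poly3 \<Rightarrow> 'k poly3 set" where
  "line_proj a f = PIdl\<^bsub>P2_ring\<^esub> a +>\<^bsub>P2_ring\<^esub> f"

definition line_incl :: "'k::field_char_0 poly3 \<Rightarrow> 'k poly3 set set \<Rightarrow> 'k poly3 set" where
  "line_incl a = Proj_map P2_ring (line_proj a)"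

definition line_incl_sharp ::
  "'k::field_char_0 poly3 \<Rightarrow> 'k poly3 set set \<Rightarrow>
   ('k poly3 set \<Rightarrow> ('k poly3 \<times> 'k poly3) set) \<Rightarrow>
   ('k poly3 set set \<Rightarrow> ('k poly3 set \<times> 'k poly3 set) set)" where
  "line_incl_sharp a =
    tilde_map P2_ring (line_ring a) (self_module (line_ring a)) (line_proj a) (line_proj a)"

text \<open>A choice of linear forms on \<open>H\<close> defining the points of the restriction.\<close>

definition point_forms ::
  "'k::field_char_0 poly3 \<Rightarrow> 'k poly3 set set set \<Rightarrow> ('k poly3 set set \<Rightarrow> 'k poly3 set) \<Rightarrow> bool" where
  "point_forms a \<P> \<beta> \<longleftrightarrow>
     (\<forall>P\<in>\<P>. \<beta> P \<in> hpart (line_ring a) 1 \<and> \<beta> P \<noteq> \<zero>\<^bsub>line_ring a\<^esub> \<and>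
        line_incl a ` zero_locus (line_ring a) (\<beta> P) = P)"

text \<open>The modules \<open>D(\<A>)/R\<theta>\<^sub>E\<close> and \<open>D(\<A>'')/S\<theta>\<^sub>E\<close>, for defining polynomials \<open>Q\<close> and \<open>Q''\<close>.  The Euler
  derivation of \<open>S\<close> is the one induced by the Euler derivation of \<open>R\<close>: it is the identity on the linear forms,
  so it is \<open>\<Sum> y\<^sub>i \<partial>/\<partial>y\<^sub>i\<close> for any coordinates \<open>y\<^sub>0, y\<^sub>1\<close> of \<open>S\<close>.\<close>

definition line_euler :: "'k::field_char_0 poly3 \<Rightarrow> 'k poly3 set \<Rightarrow> 'k poly3 set" where
  "line_euler a = der_restrict P2_ring (PIdl\<^bsub>P2_ring\<^esub> a) euler"

lemma line_euler_linear:
  assumes "a \<in> hpart P2_ring 1" "y \<in> hpart P2_ring 1"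
  shows "line_euler a (line_proj a y) = line_proj a y"
proof -
  interpret cring P2_ring by (rule P2_ring_cring)
  have id: "ideal (PIdl\<^bsub>P2_ring\<^esub> a) P2_ring"
    by (rule cgenideal_ideal) (simp add: P2_ring_def)
  then interpret I: ideal "PIdl\<^bsub>P2_ring\<^esub> a" P2_ring .
  have coset: "line_proj a f = {r * a + f | r. True}" for f
    by (auto simp: line_proj_def a_r_coset_def r_coset_def cgenideal_def P2_ring_def)
  have eq: "line_proj a f = line_proj a g" if "g = r * a + f" for f g r
    unfolding coset that
    by (auto simp: set_eq_iff) (metis add.assoc distrib_right diff_add_cancel)+
  have "line_proj a (euler (r * a + y)) = line_proj a y" for r
    by (rule eq[symmetric, of _ "r + euler r"])
      (use assms in \<open>simp add: euler_add euler_mult euler_homogeneous algebra_simps\<close>)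
  moreover have "line_proj a y \<in> carrier (P2_ring Quot PIdl\<^bsub>P2_ring\<^esub> a)"
    by (auto simp: line_proj_def FactRing_def A_RCOSETS_def RCOSETS_def a_r_coset_def P2_ring_def)
  moreover have "line_proj a y \<noteq> {}"
    by (auto simp: coset)
  ultimately show ?thesis
    by (auto simp: line_euler_def der_restrict_def coset_map_def line_proj_def[symmetric] coset[of y])
qed

definition P2_log_mod ::
  "'k::field_char_0 poly3 \<Rightarrow> ('k poly3, ('k poly3 \<Rightarrow> 'k poly3) set) graded_module" where
  "P2_log_mod Q = log_der_quot P2_ring Q euler"

definition line_log_mod ::
  "'k::field_char_0 poly3 \<Rightarrow> 'k poly3 set \<Rightarrow>
   ('k poly3 set, ('k poly3 set \<Rightarrow> 'k poly3 set) set) graded_module" where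
  "line_log_mod a Q'' = log_der_quot (line_ring a) Q'' (line_euler a)"

text \<open>The maps \<open>D(\<A>')/R\<theta>\<^sub>E(-1) \<rightarrow> D(\<A>)/R\<theta>\<^sub>E\<close> and \<open>D(\<A>)/R\<theta>\<^sub>E \<rightarrow> D(\<A>'')/S\<theta>\<^sub>E\<close> induced by
  multiplication by \<open>a\<close> and by restriction of derivations modulo \<open>a\<close>.\<close>

definition mult_map ::
  "'k::field_char_0 poly3 \<Rightarrow> 'k poly3 \<Rightarrow> ('k poly3 \<Rightarrow> 'k poly3) set \<Rightarrow> ('k poly3 \<Rightarrow> 'k poly3) set" where
  "mult_map a Q = coset_map (log_der P2_ring Q) (der_span P2_ring Q euler)
     (\<lambda>\<theta>. a \<odot>\<^bsub>log_der P2_ring Q\<^esub> \<theta>)"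

definition restr_map ::
  "'k::field_char_0 poly3 \<Rightarrow> 'k poly3 set \<Rightarrow> ('k poly3 \<Rightarrow> 'k poly3) set \<Rightarrow>
   ('k poly3 set \<Rightarrow> 'k poly3 set) set" where
  "restr_map a Q'' = coset_map (log_der (line_ring a) Q'') (der_span (line_ring a) Q'' (line_euler a))
     (der_restrict P2_ring (PIdl\<^bsub>P2_ring\<^esub> a))"

end

theory Submission
  imports Defs
begin

text \<open>Everything is reduced to graded modules.  The sequence of sheaves on the plane associated to
  \<open>0 \<rightarrow> L \<rightarrow> M \<rightarrow> N\<close> is short exact as soon as \<open>L \<rightarrow> M\<close> is injective, its image is the kernel of \<open>M \<rightarrow> N\<close>,
  and for every point \<open>q\<close> of the line some form \<open>u \<notin> q\<close> multiplies \<open>N\<close> into the image of \<open>M\<close>.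

  If a logarithmic derivation \<open>\<theta>\<close> of \<open>\<A>\<close> restricts to a multiple of the Euler derivation on \<open>a = 0\<close>, then
  \<open>\<theta> - r \<theta>\<^sub>E = a \<eta>\<close>, and \<open>\<eta>\<close> is logarithmic for \<open>\<A>'\<close> because \<open>a\<close> is coprime to the other forms.  For the
  local lifting at \<open>q\<close>, choose linear coordinates \<open>a, y, z\<close> such that \<open>y\<close> defines a point of \<open>\<A>''\<close>, \<open>z\<close> does
  not vanish at \<open>q\<close>, and \<open>q\<close> is none of the other points of \<open>\<A>''\<close>.  Modulo the Euler derivation every element of
  \<open>D(\<A>'')\<close> is of the form \<open>h \<partial>/\<partial>z\<close>.  The lines whose form involves \<open>z\<close> do not pass through \<open>q\<close>, and if \<open>g\<close>
  is the product of their forms, then \<open>g h \<partial>/\<partial>z\<close> is logarithmic for \<open>\<A>\<close> and lifts the \<open>g\<close>-fold multiple.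

  The same coordinates, at a point \<open>p\<close> of the plane and with \<open>x\<close> the form of a line, give local bases: if \<open>g\<close>
  is the product of the forms involving \<open>z\<close>, and \<open>b\<close> that of the forms in \<open>x, y\<close> other than \<open>x\<close>, then
  \<open>g b \<partial>/\<partial>y\<close> and \<open>g \<partial>/\<partial>z\<close> become a basis of \<open>D(\<A>)/R\<theta>\<^sub>E\<close> after inverting \<open>g\<close>.\<close>

section \<open>Graded modules and fractions\<close>

text \<open>Linear algebra replaces them: a form of the arrangement in \<open>p\<close> is a
  combination of two chosen forms, because its coefficient at a third form \<open>z\<close> outside
  \<open>p\<close> would be a constant in \<open>p\<close>, hence \<open>0\<close>. All divisibility
  arguments rest on one fact: setting a linear form \<open>x\<close> to zero is a ring endomorphism
  with kernel generated by \<open>x\<close>, and its values lie in a domain. So \<open>x\<close> is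
  prime, and an equation modulo \<open>a\<close> becomes an exact equation of polynomials; this
  replaces a theory of divisibility in the quotient ring. Restriction of derivations to the line
  need not be onto as a map of graded modules. A fraction \<open>n/b\<close> lifts to
  \<open>m/(u f)\<close>, where \<open>m\<close> restricts to the \<open>u\<close>-fold multiple of
  \<open>n\<close>, and \<open>u\<close> varies with the point; hence surjectivity is local.
  Essentiality provides a line other than \<open>H\<close>. Then \<open>\<A>'\<close> and the set of
  points of \<open>\<A>''\<close> are nonempty, and each local basis has a form to start
  from.\<close>

locale graded_cring = cring A for A :: "('a, 'm) graded_ring_scheme" (structure) +
  assumes hpart_subset: "hpart A n \<subseteq> carrier A"
    and hpart_zero: "\<zero> \<in> hpart A n"
    and hpart_add: "\<lbrakk>a \<in> hpart A n; b \<in> hpart A n\<rbrakk> \<Longrightarrow> a \<oplus> b \<in> hpart A n"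
    and hpart_minus: "a \<in> hpart A n \<Longrightarrow> \<ominus> a \<in> hpart A n"
    and hpart_one: "\<one> \<in> hpart A 0"
    and hpart_mult: "\<lbrakk>a \<in> hpart A m; b \<in> hpart A n\<rbrakk> \<Longrightarrow> a \<otimes> b \<in> hpart A (m + n)"
begin

lemma hpart_carrier: "a \<in> hpart A n \<Longrightarrow> a \<in> carrier A"
  using hpart_subset by blast

lemma homog_carrier: "a \<in> homog A \<Longrightarrow> a \<in> carrier A"
  by (auto simp: homog_def hpart_carrier)

lemma homog_mult: "\<lbrakk>a \<in> homog A; b \<in> homog A\<rbrakk> \<Longrightarrow> a \<otimes> b \<in> homog A"
  by (auto simp: homog_def intro: hpart_mult)

lemma homog_one: "\<one> \<in> homog A"
  by (auto simp: homog_def intro: hpart_one)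

lemma hpart_pow: "a \<in> hpart A n \<Longrightarrow> a [^] (k::nat) \<in> hpart A (k * n)"
  by (induction k) (auto simp: hpart_one add.commute dest: hpart_mult)

lemma Proj_prime: "p \<in> Proj A \<Longrightarrow> primeideal p A"
  by (simp add: Proj_def)

lemma Proj_one: "p \<in> Proj A \<Longrightarrow> \<one> \<notin> p"
  using primeideal.I_notcarr ideal.one_imp_carrier primeideal.axioms(1)
  by (fastforce simp: Proj_def)

lemma Proj_mult:
  "\<lbrakk>p \<in> Proj A; a \<in> carrier A; b \<in> carrier A; a \<notin> p; b \<notin> p\<rbrakk> \<Longrightarrow> a \<otimes> b \<notin> p"
  using primeideal.I_prime by (fastforce simp: Proj_def)

lemma Proj_mult_iff:
  "\<lbrakk>p \<in> Proj A; a \<in> carrier A; b \<in> carrier A\<rbrakk> \<Longrightarrow> a \<otimes> b \<in> p \<longleftrightarrow> a \<in> p \<or> b \<in> p"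
  using Proj_mult[of p a b] ideal.I_l_closed[OF Proj_prime[THEN primeideal.axioms(1)], of p b a]
    ideal.I_r_closed[OF Proj_prime[THEN primeideal.axioms(1)], of p a b]
  by blast

lemma Proj_pow: "\<lbrakk>p \<in> Proj A; a \<in> carrier A; a \<notin> p\<rbrakk> \<Longrightarrow> a [^] (k::nat) \<notin> p"
  by (induction k) (auto simp: Proj_one Proj_mult)

end

text \<open>Degrees are integers here although those of the ring are natural numbers, because the
  twist by \<open>-1\<close> shifts them. The axioms ask for closure of the parts under the
  operations; the decomposition into components enters for polynomials, through
  \<open>hcomp\<close>.\<close>

locale graded_mod = graded_cring A + Module.module A M
  for A :: "('a, 'm) graded_ring_scheme" (structure) and M :: "('a, 'b) graded_module" +
  assumes mpart_subset: "mpart M e \<subseteq> carrier M"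
    and mpart_zero: "\<zero>\<^bsub>M\<^esub> \<in> mpart M e"
    and mpart_add: "\<lbrakk>x \<in> mpart M e; y \<in> mpart M e\<rbrakk> \<Longrightarrow> x \<oplus>\<^bsub>M\<^esub> y \<in> mpart M e"
    and mpart_smult: "\<lbrakk>a \<in> hpart A n; x \<in> mpart M e\<rbrakk> \<Longrightarrow> a \<odot>\<^bsub>M\<^esub> x \<in> mpart M (int n + e)"

definition fracs :: "('a, 'm) graded_ring_scheme \<Rightarrow> ('a, 'b) graded_module \<Rightarrow> 'a set \<Rightarrow> ('b \<times> 'a) set" where
  "fracs A M p = {(m, f). \<exists>i. m \<in> mpart M (int i) \<and> f \<in> hpart A i - p}"

definition stalk :: "('a, 'm) graded_ring_scheme \<Rightarrow> ('a, 'b) graded_module \<Rightarrow> 'a set \<Rightarrow> ('b \<times> 'a) set set" where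
  "stalk A M p = (\<lambda>(m, f). frac A M p m f) ` fracs A M p"

lemma frac_rel_fracs:
  "frac_rel A M p = {((m, f), (n, g)) | m f n g. (m, f) \<in> fracs A M p \<and> (n, g) \<in> fracs A M p \<and>
     (\<exists>h\<in>homog A - p. h \<odot>\<^bsub>M\<^esub> (g \<odot>\<^bsub>M\<^esub> m) = h \<odot>\<^bsub>M\<^esub> (f \<odot>\<^bsub>M\<^esub> n))}"
  by (auto simp: frac_rel_def fracs_def)

lemma stalkE:
  assumes "X \<in> stalk A M p"
  obtains i m f where "m \<in> mpart M (int i)" "f \<in> hpart A i" "f \<notin> p" "X = frac A M p m f"
  using assms by (auto simp: stalk_def fracs_def)

context graded_mod
begin

lemma mpart_carrier: "x \<in> mpart M e \<Longrightarrow> x \<in> carrier M"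
  using mpart_subset by blast

lemma mpart_smult': "\<lbrakk>a \<in> hpart A n; x \<in> mpart M (int e)\<rbrakk> \<Longrightarrow> a \<odot>\<^bsub>M\<^esub> x \<in> mpart M (int (n + e))"
  using mpart_smult by simp

lemma smult_lcomm:
  "\<lbrakk>a \<in> carrier A; b \<in> carrier A; x \<in> carrier M\<rbrakk> \<Longrightarrow> a \<odot>\<^bsub>M\<^esub> (b \<odot>\<^bsub>M\<^esub> x) = b \<odot>\<^bsub>M\<^esub> (a \<odot>\<^bsub>M\<^esub> x)"
  by (metis smult_assoc1 m_comm)

lemma fracsI: "\<lbrakk>m \<in> mpart M (int i); f \<in> hpart A i; f \<notin> p\<rbrakk> \<Longrightarrow> (m, f) \<in> fracs A M p"
  by (auto simp: fracs_def)

lemma fracs_carrier: "(m, f) \<in> fracs A M p \<Longrightarrow> m \<in> carrier M \<and> f \<in> carrier A \<and> f \<in> homog A \<and> f \<notin> p"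
  by (auto simp: fracs_def mpart_carrier hpart_carrier homog_def)

lemma stalkI: "(m, f) \<in> fracs A M p \<Longrightarrow> frac A M p m f \<in> stalk A M p"
  by (auto simp: stalk_def)

text \<open>Transitivity is the point. If \<open>h\<close> and \<open>k\<close> witness the two
  relations and \<open>g\<close> is the middle denominator, then
  \<open>h \<otimes> k \<otimes> g\<close> witnesses the third, and it stays outside
  \<open>p\<close> by primality. The factor \<open>g\<close> is there because nothing in
  \<open>M\<close> can be cancelled.\<close>

lemma equiv_frac_rel:
  assumes p: "p \<in> Proj A"
  shows "equiv (fracs A M p) (frac_rel A M p)"
proof (rule equivI)
  show "frac_rel A M p \<subseteq> fracs A M p \<times> fracs A M p"
    by (auto simp: frac_rel_fracs)
  show "refl_on (fracs A M p) (frac_rel A M p)"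
    using homog_one Proj_one[OF p] by (auto simp: refl_on_def frac_rel_fracs)
  show "sym (frac_rel A M p)"
    by (auto simp: sym_def frac_rel_fracs intro: sym)
  show "trans (frac_rel A M p)"
  proof (rule transI)
    fix X Y Z assume XY: "(X, Y) \<in> frac_rel A M p" and YZ: "(Y, Z) \<in> frac_rel A M p"
    obtain m f n g o' l where eq: "X = (m, f)" "Y = (n, g)" "Z = (o', l)" by (cases X, cases Y, cases Z)
    from XY YZ obtain h k where
      fr: "(m, f) \<in> fracs A M p" "(n, g) \<in> fracs A M p" "(o', l) \<in> fracs A M p"
      and h: "h \<in> homog A" "h \<notin> p" "h \<odot>\<^bsub>M\<^esub> (g \<odot>\<^bsub>M\<^esub> m) = h \<odot>\<^bsub>M\<^esub> (f \<odot>\<^bsub>M\<^esub> n)"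
      and k: "k \<in> homog A" "k \<notin> p" "k \<odot>\<^bsub>M\<^esub> (l \<odot>\<^bsub>M\<^esub> n) = k \<odot>\<^bsub>M\<^esub> (g \<odot>\<^bsub>M\<^esub> o')"
      by (auto simp: frac_rel_fracs eq)
    note c = fr[THEN fracs_carrier] h(1)[THEN homog_carrier] k(1)[THEN homog_carrier]
    have "(h \<otimes> k \<otimes> g) \<odot>\<^bsub>M\<^esub> (l \<odot>\<^bsub>M\<^esub> m) = (k \<otimes> l) \<odot>\<^bsub>M\<^esub> (h \<odot>\<^bsub>M\<^esub> (g \<odot>\<^bsub>M\<^esub> m))"
      using c by (simp add: smult_assoc1[symmetric] m_ac)
    also have "\<dots> = (h \<otimes> f) \<odot>\<^bsub>M\<^esub> (k \<odot>\<^bsub>M\<^esub> (l \<odot>\<^bsub>M\<^esub> n))"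
      using c h by (simp add: smult_assoc1[symmetric] m_ac)
    also have "\<dots> = (h \<otimes> k \<otimes> g) \<odot>\<^bsub>M\<^esub> (f \<odot>\<^bsub>M\<^esub> o')"
      using c k by (simp add: smult_assoc1[symmetric] m_ac)
    finally have "(h \<otimes> k \<otimes> g) \<odot>\<^bsub>M\<^esub> (l \<odot>\<^bsub>M\<^esub> m) = (h \<otimes> k \<otimes> g) \<odot>\<^bsub>M\<^esub> (f \<odot>\<^bsub>M\<^esub> o')" .
    moreover have "h \<otimes> k \<otimes> g \<in> homog A - p"
      using c h k p by (auto intro!: homog_mult simp: Proj_mult_iff)
    ultimately show "(X, Z) \<in> frac_rel A M p"
      using fr by (auto simp: frac_rel_fracs eq)
  qed
qed

lemma frac_eq_iff:
  assumes "p \<in> Proj A" "(m, f) \<in> fracs A M p" "(n, g) \<in> fracs A M p"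
  shows "frac A M p m f = frac A M p n g \<longleftrightarrow>
    (\<exists>h\<in>homog A - p. h \<odot>\<^bsub>M\<^esub> (g \<odot>\<^bsub>M\<^esub> m) = h \<odot>\<^bsub>M\<^esub> (f \<odot>\<^bsub>M\<^esub> n))"
  using eq_equiv_class_iff[OF equiv_frac_rel[OF assms(1)] assms(2,3)] assms(2,3)
  by (simp add: frac_def) (auto simp: frac_rel_fracs)

lemma frac_eqI:
  assumes "p \<in> Proj A" "(m, f) \<in> fracs A M p" "(n, g) \<in> fracs A M p" "g \<odot>\<^bsub>M\<^esub> m = f \<odot>\<^bsub>M\<^esub> n"
  shows "frac A M p m f = frac A M p n g"
  using frac_eq_iff[OF assms(1-3)] assms homog_one Proj_one by auto

lemma mem_frac:
  assumes "p \<in> Proj A" "(m, f) \<in> fracs A M p"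
  shows "(n, g) \<in> frac A M p m f \<longleftrightarrow> (n, g) \<in> fracs A M p \<and> frac A M p n g = frac A M p m f"
proof -
  have "(n, g) \<in> frac A M p m f \<longleftrightarrow> ((m, f), (n, g)) \<in> frac_rel A M p"
    by (simp add: frac_def)
  also have "\<dots> \<longleftrightarrow> frac_rel A M p `` {(m, f)} = frac_rel A M p `` {(n, g)} \<and>
      (m, f) \<in> fracs A M p \<and> (n, g) \<in> fracs A M p"
    by (rule equiv_class_eq_iff[OF equiv_frac_rel[OF assms(1)]])
  finally show ?thesis
    using assms(2) by (auto simp: frac_def)
qed

lemma frac_self:
  assumes "p \<in> Proj A" "(m, f) \<in> fracs A M p"
  shows "(m, f) \<in> frac A M p m f"
  using mem_frac assms by blast

text \<open>Operations on classes are defined as unions over all representatives; such a union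
  collapses to one value once \<open>F\<close> is constant on the class.\<close>

lemma UN_frac:
  assumes "p \<in> Proj A" "(m, f) \<in> fracs A M p"
    and "\<And>n g. \<lbrakk>(n, g) \<in> fracs A M p; frac A M p n g = frac A M p m f\<rbrakk> \<Longrightarrow> F n g = F m f"
  shows "(\<Union>(n, g)\<in>frac A M p m f. F n g) = F m f"
proof -
  have "F n g = F m f" if "(n, g) \<in> frac A M p m f" for n g
    using that assms(3) mem_frac[OF assms(1,2)] by blast
  then show ?thesis
    using frac_self[OF assms(1,2)] by fast
qed

lemma fracs_smult:
  assumes "p \<in> Proj A" "r \<in> hpart A i" "f \<in> hpart A i" "f \<notin> p" "(n, g) \<in> fracs A M p"
  shows "(r \<odot>\<^bsub>M\<^esub> n, f \<otimes> g) \<in> fracs A M p"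
proof -
  from assms obtain j where j: "n \<in> mpart M (int j)" "g \<in> hpart A j" "g \<notin> p"
    by (auto simp: fracs_def)
  with assms show ?thesis
    by (intro fracsI[of _ "i + j"] mpart_smult' hpart_mult) (auto simp: Proj_mult_iff hpart_carrier)
qed

lemma fracs_expand:
  assumes "p \<in> Proj A" "h \<in> homog A" "h \<notin> p" "(n, g) \<in> fracs A M p"
  shows "(h \<odot>\<^bsub>M\<^esub> n, h \<otimes> g) \<in> fracs A M p"
  using assms by (auto simp: homog_def intro: fracs_smult)

lemma frac_expand:
  assumes "p \<in> Proj A" "h \<in> homog A" "h \<notin> p" "(n, g) \<in> fracs A M p"
  shows "frac A M p (h \<odot>\<^bsub>M\<^esub> n) (h \<otimes> g) = frac A M p n g"
  using assms fracs_carrier[OF assms(4)]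
  by (intro frac_eqI fracs_expand) (auto simp: smult_assoc1[symmetric] homog_carrier m_ac)

lemma fracs_add:
  assumes "p \<in> Proj A" "(m, f) \<in> fracs A M p" "(n, g) \<in> fracs A M p"
  shows "(g \<odot>\<^bsub>M\<^esub> m \<oplus>\<^bsub>M\<^esub> f \<odot>\<^bsub>M\<^esub> n, f \<otimes> g) \<in> fracs A M p"
proof -
  from assms obtain i j where "m \<in> mpart M (int i)" "f \<in> hpart A i" "f \<notin> p"
    "n \<in> mpart M (int j)" "g \<in> hpart A j" "g \<notin> p"
    by (auto simp: fracs_def)
  then show ?thesis
    using assms(1) mpart_smult'[of g j m i] mpart_smult'[of f i n j]
    by (intro fracsI[of _ "i + j"] mpart_add hpart_mult) (auto simp: Proj_mult_iff hpart_carrier add.commute)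
qed

text \<open>Both arguments change representatives at once: with witnesses \<open>h\<close> and
  \<open>k\<close>, the product \<open>h \<otimes> k\<close> equates the cross-multiplied sums, and
  the identities \<open>1\<close> and \<open>2\<close> do this separately for the two
  summands.\<close>

lemma frac_add_frac:
  assumes p: "p \<in> Proj A" and mf: "(m, f) \<in> fracs A M p" and ng: "(n, g) \<in> fracs A M p"
  shows "frac_add A M p (frac A M p m f) (frac A M p n g) =
    frac A M p (g \<odot>\<^bsub>M\<^esub> m \<oplus>\<^bsub>M\<^esub> f \<odot>\<^bsub>M\<^esub> n) (f \<otimes> g)"
proof -
  have *: "frac A M p (g' \<odot>\<^bsub>M\<^esub> m' \<oplus>\<^bsub>M\<^esub> f' \<odot>\<^bsub>M\<^esub> n') (f' \<otimes> g') = frac A M p (g \<odot>\<^bsub>M\<^esub> m \<oplus>\<^bsub>M\<^esub> f \<odot>\<^bsub>M\<^esub> n) (f \<otimes> g)"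
    if m'f': "(m', f') \<in> fracs A M p" and eq1: "frac A M p m' f' = frac A M p m f"
    and n'g': "(n', g') \<in> fracs A M p" and eq2: "frac A M p n' g' = frac A M p n g" for m' f' n' g'
  proof -
    obtain h where h: "h \<in> homog A" "h \<notin> p" "h \<odot>\<^bsub>M\<^esub> (f \<odot>\<^bsub>M\<^esub> m') = h \<odot>\<^bsub>M\<^esub> (f' \<odot>\<^bsub>M\<^esub> m)"
      using eq1 frac_eq_iff[OF p m'f' mf] by auto
    obtain k where k: "k \<in> homog A" "k \<notin> p" "k \<odot>\<^bsub>M\<^esub> (g \<odot>\<^bsub>M\<^esub> n') = k \<odot>\<^bsub>M\<^esub> (g' \<odot>\<^bsub>M\<^esub> n)"
      using eq2 frac_eq_iff[OF p n'g' ng] by auto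
    note c = mf[THEN fracs_carrier] m'f'[THEN fracs_carrier] ng[THEN fracs_carrier]
      n'g'[THEN fracs_carrier] h(1)[THEN homog_carrier] k(1)[THEN homog_carrier]
    have 1: "(h \<otimes> k \<otimes> f \<otimes> g \<otimes> g') \<odot>\<^bsub>M\<^esub> m' = (h \<otimes> k \<otimes> f' \<otimes> g \<otimes> g') \<odot>\<^bsub>M\<^esub> m"
    proof -
      have "(h \<otimes> k \<otimes> f \<otimes> g \<otimes> g') \<odot>\<^bsub>M\<^esub> m' = (k \<otimes> g \<otimes> g') \<odot>\<^bsub>M\<^esub> (h \<odot>\<^bsub>M\<^esub> (f \<odot>\<^bsub>M\<^esub> m'))"
        using c by (simp add: smult_assoc1[symmetric] m_ac)
      also have "\<dots> = (h \<otimes> k \<otimes> f' \<otimes> g \<otimes> g') \<odot>\<^bsub>M\<^esub> m"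
        unfolding h using c by (simp add: smult_assoc1[symmetric] m_ac)
      finally show ?thesis .
    qed
    have 2: "(h \<otimes> k \<otimes> f \<otimes> f' \<otimes> g) \<odot>\<^bsub>M\<^esub> n' = (h \<otimes> k \<otimes> f \<otimes> f' \<otimes> g') \<odot>\<^bsub>M\<^esub> n"
    proof -
      have "(h \<otimes> k \<otimes> f \<otimes> f' \<otimes> g) \<odot>\<^bsub>M\<^esub> n' = (h \<otimes> f \<otimes> f') \<odot>\<^bsub>M\<^esub> (k \<odot>\<^bsub>M\<^esub> (g \<odot>\<^bsub>M\<^esub> n'))"
        using c by (simp add: smult_assoc1[symmetric] m_ac)
      also have "\<dots> = (h \<otimes> k \<otimes> f \<otimes> f' \<otimes> g') \<odot>\<^bsub>M\<^esub> n"
        unfolding k using c by (simp add: smult_assoc1[symmetric] m_ac)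
      finally show ?thesis .
    qed
    show ?thesis
      unfolding frac_eq_iff[OF p fracs_add[OF p m'f' n'g'] fracs_add[OF p mf ng]]
    proof (rule bexI[of _ "h \<otimes> k"])
      have "(h \<otimes> k) \<odot>\<^bsub>M\<^esub> ((f \<otimes> g) \<odot>\<^bsub>M\<^esub> (g' \<odot>\<^bsub>M\<^esub> m' \<oplus>\<^bsub>M\<^esub> f' \<odot>\<^bsub>M\<^esub> n')) =
        (h \<otimes> k \<otimes> f \<otimes> g \<otimes> g') \<odot>\<^bsub>M\<^esub> m' \<oplus>\<^bsub>M\<^esub> (h \<otimes> k \<otimes> f \<otimes> f' \<otimes> g) \<odot>\<^bsub>M\<^esub> n'"
        using c by (simp add: smult_assoc1[symmetric] smult_r_distr m_ac)
      also have "\<dots> = (h \<otimes> k) \<odot>\<^bsub>M\<^esub> ((f' \<otimes> g') \<odot>\<^bsub>M\<^esub> (g \<odot>\<^bsub>M\<^esub> m \<oplus>\<^bsub>M\<^esub> f \<odot>\<^bsub>M\<^esub> n))"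
        unfolding 1 2 using c by (simp add: smult_assoc1[symmetric] smult_r_distr m_ac)
      finally show "(h \<otimes> k) \<odot>\<^bsub>M\<^esub> ((f \<otimes> g) \<odot>\<^bsub>M\<^esub> (g' \<odot>\<^bsub>M\<^esub> m' \<oplus>\<^bsub>M\<^esub> f' \<odot>\<^bsub>M\<^esub> n')) =
        (h \<otimes> k) \<odot>\<^bsub>M\<^esub> ((f' \<otimes> g') \<odot>\<^bsub>M\<^esub> (g \<odot>\<^bsub>M\<^esub> m \<oplus>\<^bsub>M\<^esub> f \<odot>\<^bsub>M\<^esub> n))" .
      show "h \<otimes> k \<in> homog A - p"
        using h k c p by (auto intro!: homog_mult simp: Proj_mult_iff)
    qed
  qed
  have "frac_add A M p (frac A M p m f) (frac A M p n g) =
      (\<Union>(m', f')\<in>frac A M p m f. frac A M p (g \<odot>\<^bsub>M\<^esub> m' \<oplus>\<^bsub>M\<^esub> f' \<odot>\<^bsub>M\<^esub> n) (f' \<otimes> g))"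
  proof -
    have "(\<Union>(n', g')\<in>frac A M p n g. frac A M p (g' \<odot>\<^bsub>M\<^esub> m' \<oplus>\<^bsub>M\<^esub> f' \<odot>\<^bsub>M\<^esub> n') (f' \<otimes> g')) =
        frac A M p (g \<odot>\<^bsub>M\<^esub> m' \<oplus>\<^bsub>M\<^esub> f' \<odot>\<^bsub>M\<^esub> n) (f' \<otimes> g)"
      if "(m', f') \<in> frac A M p m f" for m' f'
    proof (rule UN_frac[OF p ng])
      from that have m': "(m', f') \<in> fracs A M p" "frac A M p m' f' = frac A M p m f"
        using mem_frac[OF p mf] by blast+
      fix n' g' assume n': "(n', g') \<in> fracs A M p" "frac A M p n' g' = frac A M p n g"
      show "frac A M p (g' \<odot>\<^bsub>M\<^esub> m' \<oplus>\<^bsub>M\<^esub> f' \<odot>\<^bsub>M\<^esub> n') (f' \<otimes> g') =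
          frac A M p (g \<odot>\<^bsub>M\<^esub> m' \<oplus>\<^bsub>M\<^esub> f' \<odot>\<^bsub>M\<^esub> n) (f' \<otimes> g)"
        using *[OF m' n'] *[OF m' ng refl] by simp
    qed
    then show ?thesis
      unfolding frac_add_def by (intro SUP_cong refl) auto
  qed
  also have "\<dots> = frac A M p (g \<odot>\<^bsub>M\<^esub> m \<oplus>\<^bsub>M\<^esub> f \<odot>\<^bsub>M\<^esub> n) (f \<otimes> g)"
    by (rule UN_frac[OF p mf]) (rule *[OF _ _ ng refl])
  finally show ?thesis .
qed

end

lemma self_module_simps [simp]:
  "carrier (self_module A) = carrier A" "zero (self_module A) = zero A" "add (self_module A) = add A"
  "smult (self_module A) = mult A" "mpart (self_module A) (int n) = hpart A n"
  by (simp_all add: self_module_def)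

lemma self_module_mpart: "mpart (self_module A) e = (if e < 0 then {\<zero>\<^bsub>A\<^esub>} else hpart A (nat e))"
  by (simp add: self_module_def)

lemma (in graded_cring) self_graded_mod: "graded_mod A (self_module A)"
proof -
  have "abelian_group (self_module A)"
  proof (rule abelian_groupI)
    fix x assume "x \<in> carrier (self_module A)"
    then show "\<exists>y\<in>carrier (self_module A). y \<oplus>\<^bsub>self_module A\<^esub> x = \<zero>\<^bsub>self_module A\<^esub>"
      by (intro bexI[of _ "\<ominus> x"]) (simp_all add: l_neg)
  qed (simp_all add: a_assoc, simp add: a_comm)
  then have "Module.module A (self_module A)"
    by (intro moduleI cring_axioms) (simp_all add: l_distr r_distr m_assoc)
  moreover have "graded_mod_axioms A (self_module A)"
  proof
    fix a x n e assume a: "a \<in> hpart A n" and x: "x \<in> mpart (self_module A) e"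
    show "a \<odot>\<^bsub>self_module A\<^esub> x \<in> mpart (self_module A) (int n + e)"
    \<comment> \<open>In negative degree \<open>x\<close> is zero, and zero lies in the part of
      degree \<open>int n + e\<close> whatever the sign of that number.\<close>
    proof (cases "e < 0")
      case True
      then show ?thesis
        using a x hpart_zero by (simp add: self_module_mpart hpart_carrier)
    next
      case False
      then show ?thesis
        using hpart_mult[OF a, of x "nat e"] x by (simp add: self_module_mpart nat_add_distrib)
    qed
  qed (auto simp: self_module_mpart hpart_zero hpart_carrier intro: hpart_add split: if_splits)
  ultimately show ?thesis
    by (intro graded_mod.intro graded_cring_axioms)
qed

section \<open>Laws of the stalks\<close>

definition stalk_ring :: "('a, 'm) graded_ring_scheme \<Rightarrow> 'a set \<Rightarrow> ('a \<times> 'a) set ring" where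
  "stalk_ring A p =
    \<lparr>carrier = stalk A (self_module A) p, mult = frac_smult A (self_module A) p,
     one = frac A (self_module A) p \<one>\<^bsub>A\<^esub> \<one>\<^bsub>A\<^esub>, zero = frac A (self_module A) p \<zero>\<^bsub>A\<^esub> \<one>\<^bsub>A\<^esub>,
     add = frac_add A (self_module A) p\<rparr>"

definition stalk_mod ::
  "('a, 'm) graded_ring_scheme \<Rightarrow> ('a, 'b) graded_module \<Rightarrow> 'a set \<Rightarrow> (('a \<times> 'a) set, ('b \<times> 'a) set) module" where
  "stalk_mod A M p =
    \<lparr>carrier = stalk A M p, mult = undefined, one = undefined,
     zero = frac A M p \<zero>\<^bsub>M\<^esub> \<one>\<^bsub>A\<^esub>, add = frac_add A M p, smult = frac_smult A M p\<rparr>"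

context graded_mod
begin

lemma frac_expand_hpart:
  assumes "p \<in> Proj A" "h \<in> hpart A j" "h \<notin> p" "m \<in> mpart M (int i)" "f \<in> hpart A i" "f \<notin> p"
  shows "frac A M p (h \<odot>\<^bsub>M\<^esub> m) (h \<otimes> f) = frac A M p m f"
  using assms by (intro frac_expand fracsI) (auto simp: homog_def)

lemma fracs_one:
  assumes "p \<in> Proj A" "m \<in> mpart M 0"
  shows "(m, \<one>) \<in> fracs A M p"
  using assms fracsI[of m 0 \<one> p] by (simp add: hpart_one Proj_one)

lemma frac_smult_frac:
  assumes p: "p \<in> Proj A" and rf: "(r, f) \<in> fracs A (self_module A) p" and ng: "(n, g) \<in> fracs A M p"
  shows "frac_smult A M p (frac A (self_module A) p r f) (frac A M p n g) = frac A M p (r \<odot>\<^bsub>M\<^esub> n) (f \<otimes> g)"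
    and "(r \<odot>\<^bsub>M\<^esub> n, f \<otimes> g) \<in> fracs A M p"
proof -
  interpret S: graded_mod A "self_module A" by (rule self_graded_mod)
  have fr: "(r \<odot>\<^bsub>M\<^esub> n, f \<otimes> g) \<in> fracs A M p"
    if "(r, f) \<in> fracs A (self_module A) p" "(n, g) \<in> fracs A M p" for r f n g
    using that fracs_smult[OF p, of r _ f n g] by (auto simp: fracs_def[of A "self_module A"])
  from fr[OF rf ng] show "(r \<odot>\<^bsub>M\<^esub> n, f \<otimes> g) \<in> fracs A M p" .
  have *: "frac A M p (r' \<odot>\<^bsub>M\<^esub> n') (f' \<otimes> g') = frac A M p (r \<odot>\<^bsub>M\<^esub> n) (f \<otimes> g)"
    if r'f': "(r', f') \<in> fracs A (self_module A) p"
      and eq1: "frac A (self_module A) p r' f' = frac A (self_module A) p r f"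
      and n'g': "(n', g') \<in> fracs A M p" and eq2: "frac A M p n' g' = frac A M p n g" for r' f' n' g'
  proof -
    obtain h where h: "h \<in> homog A" "h \<notin> p" "h \<otimes> (f \<otimes> r') = h \<otimes> (f' \<otimes> r)"
      using eq1 S.frac_eq_iff[OF p r'f' rf] by auto
    obtain k where k: "k \<in> homog A" "k \<notin> p" "k \<odot>\<^bsub>M\<^esub> (g \<odot>\<^bsub>M\<^esub> n') = k \<odot>\<^bsub>M\<^esub> (g' \<odot>\<^bsub>M\<^esub> n)"
      using eq2 frac_eq_iff[OF p n'g' ng] by auto
    note c = rf[THEN S.fracs_carrier] r'f'[THEN S.fracs_carrier] ng[THEN fracs_carrier]
      n'g'[THEN fracs_carrier] h(1)[THEN homog_carrier] k(1)[THEN homog_carrier]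
    show ?thesis
      unfolding frac_eq_iff[OF p fr[OF r'f' n'g'] fr[OF rf ng]]
    proof (rule bexI[of _ "h \<otimes> k"])
      have "(h \<otimes> k) \<odot>\<^bsub>M\<^esub> ((f \<otimes> g) \<odot>\<^bsub>M\<^esub> (r' \<odot>\<^bsub>M\<^esub> n')) = (h \<otimes> (f \<otimes> r')) \<odot>\<^bsub>M\<^esub> (k \<odot>\<^bsub>M\<^esub> (g \<odot>\<^bsub>M\<^esub> n'))"
        using c by (simp add: smult_assoc1[symmetric] m_ac)
      also have "\<dots> = (h \<otimes> k) \<odot>\<^bsub>M\<^esub> ((f' \<otimes> g') \<odot>\<^bsub>M\<^esub> (r \<odot>\<^bsub>M\<^esub> n))"
        unfolding h k using c by (simp add: smult_assoc1[symmetric] m_ac)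
      finally show "(h \<otimes> k) \<odot>\<^bsub>M\<^esub> ((f \<otimes> g) \<odot>\<^bsub>M\<^esub> (r' \<odot>\<^bsub>M\<^esub> n')) = (h \<otimes> k) \<odot>\<^bsub>M\<^esub> ((f' \<otimes> g') \<odot>\<^bsub>M\<^esub> (r \<odot>\<^bsub>M\<^esub> n))" .
      show "h \<otimes> k \<in> homog A - p"
        using h k c p by (auto intro!: homog_mult simp: Proj_mult_iff)
    qed
  qed
  have "(\<Union>(n', g')\<in>frac A M p n g. frac A M p (r' \<odot>\<^bsub>M\<^esub> n') (f' \<otimes> g')) = frac A M p (r' \<odot>\<^bsub>M\<^esub> n) (f' \<otimes> g)"
    if "(r', f') \<in> frac A (self_module A) p r f" for r' f'
  proof (rule UN_frac[OF p ng])
    from that have r': "(r', f') \<in> fracs A (self_module A) p"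
        "frac A (self_module A) p r' f' = frac A (self_module A) p r f"
      using S.mem_frac[OF p rf] by blast+
    fix n' g' assume n': "(n', g') \<in> fracs A M p" "frac A M p n' g' = frac A M p n g"
    show "frac A M p (r' \<odot>\<^bsub>M\<^esub> n') (f' \<otimes> g') = frac A M p (r' \<odot>\<^bsub>M\<^esub> n) (f' \<otimes> g)"
      using *[OF r' n'] *[OF r' ng refl] by simp
  qed
  then have "frac_smult A M p (frac A (self_module A) p r f) (frac A M p n g) =
      (\<Union>(r', f')\<in>frac A (self_module A) p r f. frac A M p (r' \<odot>\<^bsub>M\<^esub> n) (f' \<otimes> g))"
    unfolding frac_smult_def by (intro SUP_cong refl) auto
  also have "\<dots> = frac A M p (r \<odot>\<^bsub>M\<^esub> n) (f \<otimes> g)"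
    by (rule S.UN_frac[OF p rf]) (rule *[OF _ _ ng refl])
  finally show "frac_smult A M p (frac A (self_module A) p r f) (frac A M p n g) = frac A M p (r \<odot>\<^bsub>M\<^esub> n) (f \<otimes> g)" .
qed

text \<open>Over a common denominator only numerators are added. With \<open>stalk_common2\<close>
  and \<open>stalk_common3\<close> this reduces the additive laws of a stalk to those of
  \<open>M\<close>.\<close>

lemma frac_add_same:
  assumes p: "p \<in> Proj A" and m: "m \<in> mpart M (int i)" "n \<in> mpart M (int i)" "f \<in> hpart A i" "f \<notin> p"
  shows "frac_add A M p (frac A M p m f) (frac A M p n f) = frac A M p (m \<oplus>\<^bsub>M\<^esub> n) f"
proof -
  have fr: "(m, f) \<in> fracs A M p" "(n, f) \<in> fracs A M p" "(m \<oplus>\<^bsub>M\<^esub> n, f) \<in> fracs A M p"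
    using m by (auto intro: fracsI mpart_add)
  then have "frac_add A M p (frac A M p m f) (frac A M p n f) = frac A M p (f \<odot>\<^bsub>M\<^esub> (m \<oplus>\<^bsub>M\<^esub> n)) (f \<otimes> f)"
    using m by (simp add: frac_add_frac[OF p] smult_r_distr mpart_carrier hpart_carrier)
  also have "\<dots> = frac A M p (m \<oplus>\<^bsub>M\<^esub> n) f"
    using m fr by (intro frac_expand[OF p]) (auto simp: homog_def)
  finally show ?thesis .
qed

lemma frac_add_fracs:
  assumes p: "p \<in> Proj A" and m: "m \<in> mpart M (int i)" "n \<in> mpart M (int i)" "f \<in> hpart A i" "f \<notin> p"
  shows "(m \<oplus>\<^bsub>M\<^esub> n, f) \<in> fracs A M p"
  using m by (auto intro: fracsI mpart_add)

lemma stalk_common2: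
  assumes p: "p \<in> Proj A" and "X \<in> stalk A M p" "Y \<in> stalk A M p"
  obtains i m n f where "m \<in> mpart M (int i)" "n \<in> mpart M (int i)" "f \<in> hpart A i" "f \<notin> p"
    "X = frac A M p m f" "Y = frac A M p n f"
proof -
  from assms(2) obtain i m f where X: "m \<in> mpart M (int i)" "f \<in> hpart A i" "f \<notin> p" "X = frac A M p m f"
    by (rule stalkE)
  from assms(3) obtain j n g where Y: "n \<in> mpart M (int j)" "g \<in> hpart A j" "g \<notin> p" "Y = frac A M p n g"
    by (rule stalkE)
  have "frac A M p (g \<odot>\<^bsub>M\<^esub> m) (g \<otimes> f) = X" "frac A M p (f \<odot>\<^bsub>M\<^esub> n) (f \<otimes> g) = Y"
    using X(4) Y(4) frac_expand_hpart[OF p Y(2,3) X(1-3)] frac_expand_hpart[OF p X(2,3) Y(1-3)] by simp_all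
  moreover have "g \<otimes> f = f \<otimes> g"
    using X Y by (simp add: hpart_carrier m_comm)
  moreover have "f \<otimes> g \<notin> p"
    using X Y by (simp add: Proj_mult_iff[OF p] hpart_carrier)
  ultimately show thesis
    using that[of "g \<odot>\<^bsub>M\<^esub> m" "i + j" "f \<odot>\<^bsub>M\<^esub> n" "f \<otimes> g"] mpart_smult'[OF Y(2) X(1)]
      mpart_smult'[OF X(2) Y(1)] hpart_mult[OF X(2) Y(2)]
    by (simp add: add.commute)
qed

lemma stalk_common3:
  assumes p: "p \<in> Proj A" and "X \<in> stalk A M p" "Y \<in> stalk A M p" "Z \<in> stalk A M p"
  obtains i m n k f where "m \<in> mpart M (int i)" "n \<in> mpart M (int i)" "k \<in> mpart M (int i)"
    "f \<in> hpart A i" "f \<notin> p" "X = frac A M p m f" "Y = frac A M p n f" "Z = frac A M p k f"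
proof -
  from p assms(2,3) obtain i m n f where X: "m \<in> mpart M (int i)" "n \<in> mpart M (int i)" "f \<in> hpart A i" "f \<notin> p"
    "X = frac A M p m f" "Y = frac A M p n f"
    by (rule stalk_common2)
  from assms(4) obtain j k g where Z: "k \<in> mpart M (int j)" "g \<in> hpart A j" "g \<notin> p" "Z = frac A M p k g"
    by (rule stalkE)
  have "frac A M p (g \<odot>\<^bsub>M\<^esub> m) (g \<otimes> f) = X" "frac A M p (g \<odot>\<^bsub>M\<^esub> n) (g \<otimes> f) = Y"
      "frac A M p (f \<odot>\<^bsub>M\<^esub> k) (f \<otimes> g) = Z"
    using X(5,6) Z(4) frac_expand_hpart[OF p Z(2,3) X(1,3,4)] frac_expand_hpart[OF p Z(2,3) X(2,3,4)]
      frac_expand_hpart[OF p X(3,4) Z(1-3)] by simp_all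
  moreover have "g \<otimes> f = f \<otimes> g"
    using X Z by (simp add: hpart_carrier m_comm)
  moreover have "f \<otimes> g \<notin> p"
    using X Z by (simp add: Proj_mult_iff[OF p] hpart_carrier)
  ultimately show thesis
    using that[of "g \<odot>\<^bsub>M\<^esub> m" "i + j" "g \<odot>\<^bsub>M\<^esub> n" "f \<odot>\<^bsub>M\<^esub> k" "f \<otimes> g"] mpart_smult'[OF Z(2) X(1)]
      mpart_smult'[OF Z(2) X(2)] mpart_smult'[OF X(3) Z(1)] hpart_mult[OF X(3) Z(2)]
    by (simp add: add.commute)
qed

lemma frac_zero:
  assumes p: "p \<in> Proj A" and "f \<in> hpart A i" "f \<notin> p"
  shows "frac A M p \<zero>\<^bsub>M\<^esub> \<one> = frac A M p \<zero>\<^bsub>M\<^esub> f"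
proof (rule frac_eqI[OF p])
  show "(\<zero>\<^bsub>M\<^esub>, \<one>) \<in> fracs A M p" "(\<zero>\<^bsub>M\<^esub>, f) \<in> fracs A M p"
    using assms by (auto intro: fracsI fracs_one mpart_zero)
qed (use assms in \<open>simp add: hpart_carrier\<close>)

lemma frac_eq_zero_iff:
  assumes p: "p \<in> Proj A" and mf: "(m, f) \<in> fracs A M p"
  shows "frac A M p m f = frac A M p \<zero>\<^bsub>M\<^esub> \<one> \<longleftrightarrow> (\<exists>h\<in>homog A - p. h \<odot>\<^bsub>M\<^esub> m = \<zero>\<^bsub>M\<^esub>)"
proof -
  have z: "(\<zero>\<^bsub>M\<^esub>, \<one>) \<in> fracs A M p"
    using p by (auto intro: fracs_one mpart_zero)
  show ?thesis
    unfolding frac_eq_iff[OF p mf z] using fracs_carrier[OF mf] by (intro bex_cong) (auto simp: homog_carrier)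
qed

lemma uminus_mpart: "m \<in> mpart M (int i) \<Longrightarrow> \<ominus>\<^bsub>M\<^esub> m \<in> mpart M (int i)"
  using mpart_smult'[of "\<ominus> \<one>" 0 m i] by (simp add: hpart_minus hpart_one smult_l_minus mpart_carrier)

lemma stalk_abelian_group:
  assumes p: "p \<in> Proj A"
  shows "abelian_group (stalk_mod A M p)"
proof (rule abelian_groupI; simp add: stalk_mod_def)
  show "frac A M p \<zero>\<^bsub>M\<^esub> \<one> \<in> stalk A M p"
    by (auto intro!: stalkI fracs_one mpart_zero p)
next
  fix X Y assume XY: "X \<in> stalk A M p" "Y \<in> stalk A M p"
  with p obtain i m n f where *: "m \<in> mpart M (int i)" "n \<in> mpart M (int i)" "f \<in> hpart A i" "f \<notin> p"
    "X = frac A M p m f" "Y = frac A M p n f"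
    by (rule stalk_common2)
  then show "frac_add A M p X Y \<in> stalk A M p"
    by (auto simp: frac_add_same[OF p] intro!: stalkI fracsI mpart_add)
  from * show "frac_add A M p X Y = frac_add A M p Y X"
    by (simp add: frac_add_same[OF p] mpart_carrier a_comm M.a_comm)
next
  fix X Y Z assume "X \<in> stalk A M p" "Y \<in> stalk A M p" "Z \<in> stalk A M p"
  with p obtain i m n k f where *: "m \<in> mpart M (int i)" "n \<in> mpart M (int i)" "k \<in> mpart M (int i)"
    "f \<in> hpart A i" "f \<notin> p" "X = frac A M p m f" "Y = frac A M p n f" "Z = frac A M p k f"
    by (rule stalk_common3)
  then show "frac_add A M p (frac_add A M p X Y) Z = frac_add A M p X (frac_add A M p Y Z)"
    using frac_add_same[OF p *(1,2,4,5)] frac_add_same[OF p *(2,3,4,5)]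
      frac_add_same[OF p mpart_add[OF *(1,2)] *(3,4,5)] frac_add_same[OF p *(1) mpart_add[OF *(2,3)] *(4,5)]
    by (simp add: M.a_assoc mpart_carrier)
next
  fix X assume "X \<in> stalk A M p"
  then obtain i m f where *: "m \<in> mpart M (int i)" "f \<in> hpart A i" "f \<notin> p" "X = frac A M p m f"
    by (rule stalkE)
  have z: "frac A M p \<zero>\<^bsub>M\<^esub> \<one> = frac A M p \<zero>\<^bsub>M\<^esub> f"
    using * by (intro frac_zero[OF p])
  show "frac_add A M p (frac A M p \<zero>\<^bsub>M\<^esub> \<one>) X = X"
    unfolding z using frac_add_same[OF p mpart_zero *(1-3)] * by (simp add: mpart_carrier)
  show "\<exists>Y\<in>stalk A M p. frac_add A M p Y X = frac A M p \<zero>\<^bsub>M\<^esub> \<one>"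
  proof
    show "frac_add A M p (frac A M p (\<ominus>\<^bsub>M\<^esub> m) f) X = frac A M p \<zero>\<^bsub>M\<^esub> \<one>"
      unfolding z using frac_add_same[OF p uminus_mpart[OF *(1)] *(1-3)] * by (simp add: mpart_carrier M.l_neg)
    show "frac A M p (\<ominus>\<^bsub>M\<^esub> m) f \<in> stalk A M p"
      using * by (auto intro!: stalkI fracsI uminus_mpart)
  qed
qed

lemma frac_smult_closed:
  assumes p: "p \<in> Proj A" and "a \<in> stalk A (self_module A) p" "x \<in> stalk A M p"
  shows "frac_smult A M p a x \<in> stalk A M p"
proof -
  from assms obtain r f n g where "(r, f) \<in> fracs A (self_module A) p" "a = frac A (self_module A) p r f"
    "(n, g) \<in> fracs A M p" "x = frac A M p n g"
    by (auto simp: stalk_def)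
  then show ?thesis
    using frac_smult_frac[OF p] stalkI by metis
qed

lemma frac_smult_assoc:
  assumes p: "p \<in> Proj A" and "a \<in> stalk A (self_module A) p" "b \<in> stalk A (self_module A) p" "x \<in> stalk A M p"
  shows "frac_smult A M p (frac_smult A (self_module A) p a b) x = frac_smult A M p a (frac_smult A M p b x)"
proof -
  interpret S: graded_mod A "self_module A" by (rule self_graded_mod)
  from assms obtain r f s g n h where *: "(r, f) \<in> fracs A (self_module A) p" "a = frac A (self_module A) p r f"
    "(s, g) \<in> fracs A (self_module A) p" "b = frac A (self_module A) p s g"
    "(n, h) \<in> fracs A M p" "x = frac A M p n h"
    by (auto simp: stalk_def)
  show ?thesis
    unfolding * S.frac_smult_frac(1)[OF p *(1,3)] frac_smult_frac(1)[OF p S.frac_smult_frac(2)[OF p *(1,3)] *(5)]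
      frac_smult_frac(1)[OF p *(3,5)] frac_smult_frac(1)[OF p *(1) frac_smult_frac(2)[OF p *(3,5)]]
    using *(1,3)[THEN S.fracs_carrier] *(5)[THEN fracs_carrier] by (simp add: smult_assoc1 m_assoc)
qed

lemma frac_smult_one:
  assumes p: "p \<in> Proj A" and "x \<in> stalk A M p"
  shows "frac_smult A M p (frac A (self_module A) p \<one> \<one>) x = x"
proof -
  interpret S: graded_mod A "self_module A" by (rule self_graded_mod)
  from assms obtain n h where *: "(n, h) \<in> fracs A M p" "x = frac A M p n h"
    by (auto simp: stalk_def)
  have "(\<one>, \<one>) \<in> fracs A (self_module A) p"
    using hpart_one by (intro S.fracs_one p) (simp add: self_module_mpart)
  from frac_smult_frac(1)[OF p this *(1)] show ?thesis
    using *(1)[THEN fracs_carrier] by (simp add: *)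
qed

lemma frac_smult_ldistr:
  assumes p: "p \<in> Proj A" and "a \<in> stalk A (self_module A) p" "b \<in> stalk A (self_module A) p" "x \<in> stalk A M p"
  shows "frac_smult A M p (frac_add A (self_module A) p a b) x =
    frac_add A M p (frac_smult A M p a x) (frac_smult A M p b x)"
proof -
  interpret S: graded_mod A "self_module A" by (rule self_graded_mod)
  from p assms(2,3) obtain i r s f where *: "r \<in> mpart (self_module A) (int i)" "s \<in> mpart (self_module A) (int i)"
    "f \<in> hpart A i" "f \<notin> p" "a = frac A (self_module A) p r f" "b = frac A (self_module A) p s f"
    by (rule S.stalk_common2)
  from assms(4) obtain j n g where x: "n \<in> mpart M (int j)" "g \<in> hpart A j" "g \<notin> p" "x = frac A M p n g"
    by (rule stalkE)
  have c: "f \<in> carrier A" "g \<in> carrier A" "r \<in> carrier A" "s \<in> carrier A" "n \<in> carrier M"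
    using * x by (auto simp: hpart_carrier mpart_carrier)
  have fr: "(r, f) \<in> fracs A (self_module A) p" "(s, f) \<in> fracs A (self_module A) p" "(n, g) \<in> fracs A M p"
    using * x by (auto intro: S.fracsI fracsI)
  have "frac_smult A M p (frac_add A (self_module A) p a b) x = frac A M p ((r \<oplus> s) \<odot>\<^bsub>M\<^esub> n) (f \<otimes> g)"
    unfolding * x S.frac_add_same[OF p *(1-4)]
    by (subst frac_smult_frac(1)[OF p S.frac_add_fracs[OF p *(1-4)] fr(3)]) simp
  also have "\<dots> = frac_add A M p (frac A M p (r \<odot>\<^bsub>M\<^esub> n) (f \<otimes> g)) (frac A M p (s \<odot>\<^bsub>M\<^esub> n) (f \<otimes> g))"
    using * x c by (subst frac_add_same[OF p, of _ "i + j"])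
      (auto simp: smult_l_distr Proj_mult_iff[OF p] intro!: mpart_smult hpart_mult)
  finally show ?thesis
    by (simp add: frac_smult_frac(1)[OF p fr(1,3)] frac_smult_frac(1)[OF p fr(2,3)] * x)
qed

lemma frac_smult_rdistr:
  assumes p: "p \<in> Proj A" and "a \<in> stalk A (self_module A) p" "x \<in> stalk A M p" "y \<in> stalk A M p"
  shows "frac_smult A M p a (frac_add A M p x y) =
    frac_add A M p (frac_smult A M p a x) (frac_smult A M p a y)"
proof -
  interpret S: graded_mod A "self_module A" by (rule self_graded_mod)
  from p assms(3,4) obtain i m n f where *: "m \<in> mpart M (int i)" "n \<in> mpart M (int i)"
    "f \<in> hpart A i" "f \<notin> p" "x = frac A M p m f" "y = frac A M p n f"
    by (rule stalk_common2)
  from assms(2) obtain j r g where x: "r \<in> mpart (self_module A) (int j)" "g \<in> hpart A j" "g \<notin> p"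
      "a = frac A (self_module A) p r g"
    by (rule stalkE)
  have c: "f \<in> carrier A" "g \<in> carrier A" "m \<in> carrier M" "n \<in> carrier M" "r \<in> carrier A"
    using * x by (auto simp: hpart_carrier mpart_carrier)
  have fr: "(m, f) \<in> fracs A M p" "(n, f) \<in> fracs A M p" "(r, g) \<in> fracs A (self_module A) p"
    using * x by (auto intro: S.fracsI fracsI)
  have "frac_smult A M p a (frac_add A M p x y) = frac A M p (r \<odot>\<^bsub>M\<^esub> (m \<oplus>\<^bsub>M\<^esub> n)) (g \<otimes> f)"
    unfolding * x frac_add_same[OF p *(1-4)]
    by (subst frac_smult_frac(1)[OF p fr(3) frac_add_fracs[OF p *(1-4)]]) simp
  also have "\<dots> = frac_add A M p (frac A M p (r \<odot>\<^bsub>M\<^esub> m) (g \<otimes> f)) (frac A M p (r \<odot>\<^bsub>M\<^esub> n) (g \<otimes> f))"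
    using * x c by (subst frac_add_same[OF p, of _ "j + i"])
      (auto simp: smult_r_distr Proj_mult_iff[OF p] intro!: mpart_smult hpart_mult)
  finally show ?thesis
    by (simp add: frac_smult_frac(1)[OF p fr(3,1)] frac_smult_frac(1)[OF p fr(3,2)] * x)
qed

end

lemma (in graded_cring) frac_mult_comm:
  assumes p: "p \<in> Proj A" and "a \<in> stalk A (self_module A) p" "b \<in> stalk A (self_module A) p"
  shows "frac_smult A (self_module A) p a b = frac_smult A (self_module A) p b a"
proof -
  interpret S: graded_mod A "self_module A" by (rule self_graded_mod)
  from assms obtain r f s g where *: "(r, f) \<in> fracs A (self_module A) p" "a = frac A (self_module A) p r f"
    "(s, g) \<in> fracs A (self_module A) p" "b = frac A (self_module A) p s g"
    by (auto simp: stalk_def)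
  show ?thesis
    unfolding * S.frac_smult_frac(1)[OF p *(1,3)] S.frac_smult_frac(1)[OF p *(3,1)]
    using *(1,3)[THEN S.fracs_carrier] by (simp add: m_comm)
qed

lemma (in graded_cring) stalk_ring_cring:
  assumes p: "p \<in> Proj A"
  shows "cring (stalk_ring A p)"
proof -
  interpret S: graded_mod A "self_module A" by (rule self_graded_mod)
  interpret G: abelian_group "stalk_mod A (self_module A) p" by (rule S.stalk_abelian_group[OF p])
  have one: "frac A (self_module A) p \<one> \<one> \<in> stalk A (self_module A) p"
    using hpart_one by (intro S.stalkI S.fracs_one p) (simp add: self_module_mpart)
  note simps = stalk_mod_def stalk_ring_def
  show ?thesis
  proof (rule cringI)
    show "abelian_group (stalk_ring A p)"
    proof (rule abelian_groupI)
      fix x assume "x \<in> carrier (stalk_ring A p)"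
      then show "\<exists>y\<in>carrier (stalk_ring A p). y \<oplus>\<^bsub>stalk_ring A p\<^esub> x = \<zero>\<^bsub>stalk_ring A p\<^esub>"
        using G.l_neg[of x] G.a_inv_closed[of x] by (auto simp: simps)
      show "\<zero>\<^bsub>stalk_ring A p\<^esub> \<oplus>\<^bsub>stalk_ring A p\<^esub> x = x"
        using G.l_zero[of x] \<open>x \<in> _\<close> by (simp add: simps)
    next
      fix x y assume "x \<in> carrier (stalk_ring A p)" "y \<in> carrier (stalk_ring A p)"
      then show "x \<oplus>\<^bsub>stalk_ring A p\<^esub> y = y \<oplus>\<^bsub>stalk_ring A p\<^esub> x" "x \<oplus>\<^bsub>stalk_ring A p\<^esub> y \<in> carrier (stalk_ring A p)"
        using G.a_comm[of x y] G.a_closed[of x y] by (simp_all add: simps)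
    next
      fix x y z
      assume "x \<in> carrier (stalk_ring A p)" "y \<in> carrier (stalk_ring A p)" "z \<in> carrier (stalk_ring A p)"
      then show "x \<oplus>\<^bsub>stalk_ring A p\<^esub> y \<oplus>\<^bsub>stalk_ring A p\<^esub> z = x \<oplus>\<^bsub>stalk_ring A p\<^esub> (y \<oplus>\<^bsub>stalk_ring A p\<^esub> z)"
        using G.a_assoc[of x y z] by (simp add: simps)
    qed (use G.zero_closed in \<open>simp add: simps\<close>)
    show "comm_monoid (stalk_ring A p)"
      by (rule comm_monoidI) (simp_all add: one S.frac_smult_closed[OF p] S.frac_smult_assoc[OF p]
        S.frac_smult_one[OF p] stalk_ring_def, rule frac_mult_comm[OF p])
    fix x y z
    assume "x \<in> carrier (stalk_ring A p)" "y \<in> carrier (stalk_ring A p)" "z \<in> carrier (stalk_ring A p)"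
    then show "(x \<oplus>\<^bsub>stalk_ring A p\<^esub> y) \<otimes>\<^bsub>stalk_ring A p\<^esub> z =
        x \<otimes>\<^bsub>stalk_ring A p\<^esub> z \<oplus>\<^bsub>stalk_ring A p\<^esub> y \<otimes>\<^bsub>stalk_ring A p\<^esub> z"
      by (simp add: stalk_ring_def S.frac_smult_ldistr[OF p])
  qed
qed

lemma (in graded_mod) stalk_module:
  assumes p: "p \<in> Proj A"
  shows "Module.module (stalk_ring A p) (stalk_mod A M p)"
  by (rule moduleI) (simp_all add: stalk_ring_cring[OF p] stalk_abelian_group[OF p], simp_all add:
    frac_smult_closed[OF p] frac_smult_ldistr[OF p] frac_smult_rdistr[OF p] frac_smult_assoc[OF p]
    frac_smult_one[OF p] stalk_ring_def stalk_mod_def)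

section \<open>Associated sheaves\<close>

lemma openin_zariski_subset: "openin (zariski A) V \<Longrightarrow> V \<subseteq> Proj A"
  by (auto dest!: openin_subset simp: zariski_def topology_generated_by_topspace)

lemma openin_basic: "f \<in> homog A \<Longrightarrow> openin (zariski A) {p \<in> Proj A. f \<notin> p}"
proof -
  assume "f \<in> homog A"
  moreover have "{p \<in> Proj A. f \<notin> p} = Proj A - zero_locus A f"
    by (auto simp: zero_locus_def)
  ultimately show ?thesis
    unfolding zariski_def by (intro topology_generated_by_Basis) auto
qed

lemma (in graded_cring) topspace_zariski: "topspace (zariski A) = Proj A"
proof
  show "Proj A \<subseteq> topspace (zariski A)"
    using openin_basic[OF homog_one, THEN openin_subset] Proj_one by auto
qed (auto dest: openin_zariski_subset[OF openin_topspace, THEN subsetD])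

text \<open>The generating sets form a basis: by primality the sets of \<open>f\<close> and
  \<open>g\<close> intersect in the set of \<open>f \<otimes> g\<close>, so intersections produce
  nothing new in the induction over the generated topology.\<close>

lemma (in graded_cring) zariski_basis:
  assumes "openin (zariski A) V" "p \<in> V"
  shows "\<exists>f\<in>homog A. f \<notin> p \<and> {q \<in> Proj A. f \<notin> q} \<subseteq> V"
proof -
  have "generate_topology_on ((\<lambda>f. Proj A - zero_locus A f) ` homog A) V"
    using assms(1) by (simp add: zariski_def openin_topology_generated_by)
  then show ?thesis
    using assms(2)
  proof (induction V)
    case (Int a b)
    then obtain f g where "f \<in> homog A" "f \<notin> p" "{q \<in> Proj A. f \<notin> q} \<subseteq> a"
      "g \<in> homog A" "g \<notin> p" "{q \<in> Proj A. g \<notin> q} \<subseteq> b" by blast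
    moreover from this have "f \<otimes> g \<in> homog A"
      by (intro homog_mult)
    moreover have "p \<in> Proj A"
      using Int.prems Int.hyps openin_zariski_subset[of A a]
      by (auto simp: zariski_def openin_topology_generated_by_iff)
    ultimately show ?case
      by (intro bexI[of _ "f \<otimes> g"]) (auto simp: Proj_mult_iff homog_carrier)
  next
    case (UN K)
    then show ?case by blast
  qed (auto simp: zero_locus_def)
qed

section \<open>Sections and their gluing\<close>

lemma tilde_sectionsI:
  assumes "s \<in> extensional U"
    and "\<And>p. p \<in> U \<Longrightarrow> \<exists>V i m f. openin (zariski A) V \<and> p \<in> V \<and> V \<subseteq> U \<and> m \<in> mpart M (int i) \<and>
       f \<in> hpart A i \<and> (\<forall>q\<in>V. f \<notin> q \<and> s q = frac A M q m f)"
  shows "s \<in> tilde_sections A M U"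
  unfolding tilde_sections_def mem_Collect_eq
proof (intro conjI ballI)
  fix p assume "p \<in> U"
  from assms(2)[OF this] obtain V i m f where "openin (zariski A) V" "p \<in> V" "V \<subseteq> U" "m \<in> mpart M (int i)"
    "f \<in> hpart A i" "\<forall>q\<in>V. f \<notin> q \<and> s q = frac A M q m f"
    by (elim exE conjE) (rule that)
  then show "\<exists>V. openin (zariski A) V \<and> p \<in> V \<and> V \<subseteq> U \<and>
       (\<exists>i. \<exists>m\<in>mpart M (int i). \<exists>f\<in>hpart A i. \<forall>q\<in>V. f \<notin> q \<and> s q = frac A M q m f)"
    by (intro exI[of _ V] conjI exI[of _ i] bexI[of _ m] bexI[of _ f])
qed (fact assms(1))

lemma tilde_sectionsE:
  assumes "s \<in> tilde_sections A M U" "p \<in> U"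
  obtains V m i f where "openin (zariski A) V" "p \<in> V" "V \<subseteq> U" "m \<in> mpart M (int i)"
    "f \<in> hpart A i" "\<forall>q\<in>V. f \<notin> q" "\<forall>q\<in>V. s q = frac A M q m f"
proof -
  have "\<exists>V. openin (zariski A) V \<and> p \<in> V \<and> V \<subseteq> U \<and>
       (\<exists>i. \<exists>m\<in>mpart M (int i). \<exists>f\<in>hpart A i. \<forall>q\<in>V. f \<notin> q \<and> s q = frac A M q m f)"
    using assms by (simp add: tilde_sections_def)
  then show thesis
    using that by (elim exE conjE bexE) simp
qed

lemma tilde_sections_extensional: "s \<in> tilde_sections A M U \<Longrightarrow> s \<in> extensional U"
  by (simp add: tilde_sections_def)

lemma tilde_sections_stalk:
  assumes "s \<in> tilde_sections A M U" "p \<in> U"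
  shows "s p \<in> stalk A M p"
proof -
  from assms obtain V m i f where "openin (zariski A) V" "p \<in> V" "V \<subseteq> U" "m \<in> mpart M (int i)"
    "f \<in> hpart A i" "\<forall>q\<in>V. f \<notin> q" "\<forall>q\<in>V. s q = frac A M q m f"
    by (rule tilde_sectionsE)
  then show ?thesis
    by (auto simp: stalk_def fracs_def)
qed

lemma tilde_sections_restrict:
  assumes "s \<in> tilde_sections A M U" "openin (zariski A) V" "V \<subseteq> U"
  shows "restrict s V \<in> tilde_sections A M V"
proof (rule tilde_sectionsI)
  fix p assume p: "p \<in> V"
  from assms(1) subsetD[OF assms(3) p] obtain W m i f
    where "openin (zariski A) W" "p \<in> W" "W \<subseteq> U" "m \<in> mpart M (int i)"
    "f \<in> hpart A i" "\<forall>q\<in>W. f \<notin> q" "\<forall>q\<in>W. s q = frac A M q m f"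
    by (rule tilde_sectionsE)
  then show "\<exists>W i m f. openin (zariski A) W \<and> p \<in> W \<and> W \<subseteq> V \<and> m \<in> mpart M (int i) \<and>
       f \<in> hpart A i \<and> (\<forall>q\<in>W. f \<notin> q \<and> restrict s V q = frac A M q m f)"
    using p assms(2) by (intro exI[of _ "W \<inter> V"] exI[of _ i] exI[of _ m] exI[of _ f]) (auto intro: openin_Int)
qed simp

text \<open>The cover is a family indexed by \<open>I\<close> instead of a set of open sets, because
  for the direct image it consists of preimages, and different open sets of the plane can have the
  same preimage on the line.\<close>

lemma tilde_sections_glue:
  assumes op: "\<And>i. i \<in> I \<Longrightarrow> openin (zariski A) (W i)"
    and s: "\<And>i. i \<in> I \<Longrightarrow> s i \<in> tilde_sections A M (W i)"
    and eq: "\<And>i j. \<lbrakk>i \<in> I; j \<in> I\<rbrakk> \<Longrightarrow> restrict (s i) (W i \<inter> W j) = restrict (s j) (W i \<inter> W j)"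
  shows "\<exists>!t. t \<in> tilde_sections A M (\<Union>i\<in>I. W i) \<and> (\<forall>i\<in>I. restrict t (W i) = s i)"
proof (rule ex_ex1I)
  define t where "t = (\<lambda>p\<in>(\<Union>i\<in>I. W i). s (SOME i. i \<in> I \<and> p \<in> W i) p)"
  have t: "t p = s i p" if "i \<in> I" "p \<in> W i" for i p
  proof -
    have "(SOME i. i \<in> I \<and> p \<in> W i) \<in> I \<and> p \<in> W (SOME i. i \<in> I \<and> p \<in> W i)"
      using that by (intro someI[of "\<lambda>i. i \<in> I \<and> p \<in> W i" i]) simp
    then show ?thesis
      using that fun_cong[OF eq[of i "SOME i. i \<in> I \<and> p \<in> W i"], of p] unfolding t_def
      by auto
  qed
  have "restrict t (W i) = s i" if "i \<in> I" for i
    using that t tilde_sections_extensional[OF s] by (intro extensionalityI[of _ "W i"]) auto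
  moreover have "t \<in> tilde_sections A M (\<Union>i\<in>I. W i)"
  proof (rule tilde_sectionsI)
    fix p assume "p \<in> (\<Union>i\<in>I. W i)"
    then obtain i where i: "i \<in> I" "p \<in> W i" by blast
    from s[OF i(1)] i(2) obtain V m j f where "openin (zariski A) V" "p \<in> V" "V \<subseteq> W i" "m \<in> mpart M (int j)"
      "f \<in> hpart A j" "\<forall>q\<in>V. f \<notin> q" "\<forall>q\<in>V. s i q = frac A M q m f"
      by (rule tilde_sectionsE)
    then show "\<exists>V j m f. openin (zariski A) V \<and> p \<in> V \<and> V \<subseteq> (\<Union>i\<in>I. W i) \<and> m \<in> mpart M (int j) \<and>
       f \<in> hpart A j \<and> (\<forall>q\<in>V. f \<notin> q \<and> t q = frac A M q m f)"
      using i t by (intro exI[of _ V] exI[of _ j] exI[of _ m] exI[of _ f]) auto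
  qed (simp add: t_def)
  ultimately show "\<exists>t. t \<in> tilde_sections A M (\<Union>i\<in>I. W i) \<and> (\<forall>i\<in>I. restrict t (W i) = s i)"
    by blast
next
  fix t t' assume t: "t \<in> tilde_sections A M (\<Union>i\<in>I. W i) \<and> (\<forall>i\<in>I. restrict t (W i) = s i)"
    and t': "t' \<in> tilde_sections A M (\<Union>i\<in>I. W i) \<and> (\<forall>i\<in>I. restrict t' (W i) = s i)"
  have "t p = t' p" if "i \<in> I" "p \<in> W i" for i p
  proof -
    have "restrict t (W i) p = restrict t' (W i) p"
      using t t' that by simp
    then show ?thesis
      using that by simp
  qed
  then show "t = t'"
    using t t' by (intro extensionalityI[of _ "\<Union>i\<in>I. W i"]) (auto simp: tilde_sections_extensional)
qed

text \<open>Rings and modules of sections inherit their laws pointwise from the stalks.\<close>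

definition pw_ring :: "'p set \<Rightarrow> ('p \<Rightarrow> 'x) set \<Rightarrow> ('p \<Rightarrow> 'x ring) \<Rightarrow> ('p \<Rightarrow> 'x) ring" where
  "pw_ring U C R = \<lparr>carrier = C, mult = (\<lambda>s t. \<lambda>p\<in>U. s p \<otimes>\<^bsub>R p\<^esub> t p), one = (\<lambda>p\<in>U. \<one>\<^bsub>R p\<^esub>),
     zero = (\<lambda>p\<in>U. \<zero>\<^bsub>R p\<^esub>), add = (\<lambda>s t. \<lambda>p\<in>U. s p \<oplus>\<^bsub>R p\<^esub> t p)\<rparr>"

definition pw_mod :: "'p set \<Rightarrow> ('p \<Rightarrow> 'y) set \<Rightarrow> ('p \<Rightarrow> ('x, 'y) module) \<Rightarrow> ('p \<Rightarrow> 'x, 'p \<Rightarrow> 'y) module" where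
  "pw_mod U C R = \<lparr>carrier = C, mult = undefined, one = undefined,
     zero = (\<lambda>p\<in>U. \<zero>\<^bsub>R p\<^esub>), add = (\<lambda>s t. \<lambda>p\<in>U. s p \<oplus>\<^bsub>R p\<^esub> t p),
     smult = (\<lambda>a s. \<lambda>p\<in>U. a p \<odot>\<^bsub>R p\<^esub> s p)\<rparr>"

lemma rs_ring_pw: "rs_ring (Proj_space A) U = pw_ring U (tilde_sections A (self_module A) U) (stalk_ring A)"
  by (simp add: Proj_space_def pw_ring_def stalk_ring_def)

lemma sm_sec_pw: "sm_sec (tilde A M) U = pw_mod U (tilde_sections A M U) (stalk_mod A M)"
  by (simp add: tilde_def pw_mod_def stalk_mod_def)

text \<open>Stated for an arbitrary record \<open>G\<close> with given operations, since it serves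
  \<open>pw_ring\<close> and \<open>pw_mod\<close>, whose record types differ.\<close>

lemma pw_abelian_group:
  fixes R :: "'p \<Rightarrow> ('y, 'm) ring_scheme" and G :: "('p \<Rightarrow> 'y, 'n) ring_scheme"
  assumes R: "\<And>p. p \<in> U \<Longrightarrow> abelian_group (R p)"
    and C: "\<And>s p. \<lbrakk>s \<in> carrier G; p \<in> U\<rbrakk> \<Longrightarrow> s p \<in> carrier (R p)" and ext: "carrier G \<subseteq> extensional U"
    and add: "\<And>s t. s \<oplus>\<^bsub>G\<^esub> t = (\<lambda>p\<in>U. s p \<oplus>\<^bsub>R p\<^esub> t p)" and zero: "\<zero>\<^bsub>G\<^esub> = (\<lambda>p\<in>U. \<zero>\<^bsub>R p\<^esub>)"
    and add_closed: "\<And>s t. \<lbrakk>s \<in> carrier G; t \<in> carrier G\<rbrakk> \<Longrightarrow> s \<oplus>\<^bsub>G\<^esub> t \<in> carrier G"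
    and zero_closed: "\<zero>\<^bsub>G\<^esub> \<in> carrier G"
    and minus_closed: "\<And>s. s \<in> carrier G \<Longrightarrow> (\<lambda>p\<in>U. \<ominus>\<^bsub>R p\<^esub> s p) \<in> carrier G"
  shows "abelian_group G"
proof (rule abelian_groupI)
  fix s assume s: "s \<in> carrier G"
  show "\<exists>t\<in>carrier G. t \<oplus>\<^bsub>G\<^esub> s = \<zero>\<^bsub>G\<^esub>"
    using s minus_closed
    by (intro bexI[of _ "\<lambda>p\<in>U. \<ominus>\<^bsub>R p\<^esub> s p"]) (auto simp: add zero C R abelian_group.l_neg intro!: restrict_ext)
  show "\<zero>\<^bsub>G\<^esub> \<oplus>\<^bsub>G\<^esub> s = s"
    using s ext by (intro extensionalityI[of _ U])
      (auto simp: add zero C R abelian_monoid.l_zero[OF abelian_group.axioms(1)])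
next
  fix s t u assume "s \<in> carrier G" "t \<in> carrier G" "u \<in> carrier G"
  then show "s \<oplus>\<^bsub>G\<^esub> t \<oplus>\<^bsub>G\<^esub> u = s \<oplus>\<^bsub>G\<^esub> (t \<oplus>\<^bsub>G\<^esub> u)"
    by (auto simp: add C R abelian_monoid.a_assoc[OF abelian_group.axioms(1)] intro!: restrict_ext)
next
  fix s t assume "s \<in> carrier G" "t \<in> carrier G"
  then show "s \<oplus>\<^bsub>G\<^esub> t = t \<oplus>\<^bsub>G\<^esub> s"
    unfolding add by (intro restrict_ext abelian_monoid.a_comm[OF abelian_group.axioms(1)]) (auto simp: C R)
qed (fact add_closed zero_closed)+

lemma pw_cring:
  assumes R: "\<And>p. p \<in> U \<Longrightarrow> cring (R p)"
    and C: "\<And>s p. \<lbrakk>s \<in> C; p \<in> U\<rbrakk> \<Longrightarrow> s p \<in> carrier (R p)" and ext: "C \<subseteq> extensional U"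
    and closed: "\<And>s t. \<lbrakk>s \<in> C; t \<in> C\<rbrakk> \<Longrightarrow> (\<lambda>p\<in>U. s p \<oplus>\<^bsub>R p\<^esub> t p) \<in> C"
      "\<And>s t. \<lbrakk>s \<in> C; t \<in> C\<rbrakk> \<Longrightarrow> (\<lambda>p\<in>U. s p \<otimes>\<^bsub>R p\<^esub> t p) \<in> C"
      "(\<lambda>p\<in>U. \<zero>\<^bsub>R p\<^esub>) \<in> C" "(\<lambda>p\<in>U. \<one>\<^bsub>R p\<^esub>) \<in> C" "\<And>s. s \<in> C \<Longrightarrow> (\<lambda>p\<in>U. \<ominus>\<^bsub>R p\<^esub> s p) \<in> C"
  shows "cring (pw_ring U C R)"
proof (rule cringI)
  have ag: "abelian_group (R p)" if "p \<in> U" for p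
    using R[OF that] by (simp add: cring_def ring.is_abelian_group)
  show "abelian_group (pw_ring U C R)"
    by (rule pw_abelian_group[of U R]) (simp_all add: pw_ring_def ag C ext closed)
  have cm: "comm_monoid (R p)" if "p \<in> U" for p
    using R[OF that] by (simp add: cring_def)
  show "comm_monoid (pw_ring U C R)"
  proof (rule comm_monoidI)
    fix s t assume "s \<in> carrier (pw_ring U C R)" "t \<in> carrier (pw_ring U C R)"
    then show "s \<otimes>\<^bsub>pw_ring U C R\<^esub> t = t \<otimes>\<^bsub>pw_ring U C R\<^esub> s"
      by (simp add: pw_ring_def) (intro restrict_ext comm_monoid.m_comm, auto simp: C cm)
  next
    fix s t u assume "s \<in> carrier (pw_ring U C R)" "t \<in> carrier (pw_ring U C R)" "u \<in> carrier (pw_ring U C R)"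
    then show "s \<otimes>\<^bsub>pw_ring U C R\<^esub> t \<otimes>\<^bsub>pw_ring U C R\<^esub> u = s \<otimes>\<^bsub>pw_ring U C R\<^esub> (t \<otimes>\<^bsub>pw_ring U C R\<^esub> u)"
      by (auto simp: pw_ring_def C comm_monoid.axioms(1)[OF cm] monoid.m_assoc intro!: restrict_ext)
  next
    fix s assume s: "s \<in> carrier (pw_ring U C R)"
    then show "\<one>\<^bsub>pw_ring U C R\<^esub> \<otimes>\<^bsub>pw_ring U C R\<^esub> s = s"
      using ext by (intro extensionalityI[of _ U])
        (auto simp: pw_ring_def C comm_monoid.axioms(1)[OF cm] monoid.l_one)
  qed (use closed in \<open>auto simp: pw_ring_def\<close>)
  fix s t u assume "s \<in> carrier (pw_ring U C R)" "t \<in> carrier (pw_ring U C R)" "u \<in> carrier (pw_ring U C R)"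
  then show "(s \<oplus>\<^bsub>pw_ring U C R\<^esub> t) \<otimes>\<^bsub>pw_ring U C R\<^esub> u =
      s \<otimes>\<^bsub>pw_ring U C R\<^esub> u \<oplus>\<^bsub>pw_ring U C R\<^esub> t \<otimes>\<^bsub>pw_ring U C R\<^esub> u"
    using R by (auto simp: pw_ring_def C cring_def ring.ring_simprules(13) intro!: restrict_ext)
qed

lemma pw_module:
  assumes R: "\<And>p. p \<in> U \<Longrightarrow> Module.module (R p) (M p)" and cr: "cring (pw_ring U C R)"
    and C: "\<And>s p. \<lbrakk>s \<in> C; p \<in> U\<rbrakk> \<Longrightarrow> s p \<in> carrier (R p)"
    and E: "\<And>s p. \<lbrakk>s \<in> E; p \<in> U\<rbrakk> \<Longrightarrow> s p \<in> carrier (M p)" and ext: "E \<subseteq> extensional U"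
    and closed: "\<And>s t. \<lbrakk>s \<in> E; t \<in> E\<rbrakk> \<Longrightarrow> (\<lambda>p\<in>U. s p \<oplus>\<^bsub>M p\<^esub> t p) \<in> E"
      "\<And>s t. \<lbrakk>s \<in> C; t \<in> E\<rbrakk> \<Longrightarrow> (\<lambda>p\<in>U. s p \<odot>\<^bsub>M p\<^esub> t p) \<in> E"
      "(\<lambda>p\<in>U. \<zero>\<^bsub>M p\<^esub>) \<in> E" "\<And>s. s \<in> E \<Longrightarrow> (\<lambda>p\<in>U. \<ominus>\<^bsub>M p\<^esub> s p) \<in> E"
  shows "Module.module (pw_ring U C R) (pw_mod U E M)"
proof (rule moduleI[OF cr])
  have ag: "abelian_group (M p)" if "p \<in> U" for p
    using R[OF that] by (rule Module.module.axioms)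
  show "abelian_group (pw_mod U E M)"
    by (rule pw_abelian_group[of U M]) (simp_all add: pw_mod_def ag E ext closed)
  fix x assume x: "x \<in> carrier (pw_mod U E M)"
  then show "\<one>\<^bsub>pw_ring U C R\<^esub> \<odot>\<^bsub>pw_mod U E M\<^esub> x = x"
    using ext by (intro extensionalityI[of _ U])
        (auto simp: pw_mod_def pw_ring_def E Module.module.smult_one[OF R])
  fix a assume a: "a \<in> carrier (pw_ring U C R)"
  show "a \<odot>\<^bsub>pw_mod U E M\<^esub> x \<in> carrier (pw_mod U E M)"
    using a x closed by (simp add: pw_mod_def pw_ring_def)
  {
    fix b assume b: "b \<in> carrier (pw_ring U C R)"
    show "(a \<oplus>\<^bsub>pw_ring U C R\<^esub> b) \<odot>\<^bsub>pw_mod U E M\<^esub> x =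
        (a \<odot>\<^bsub>pw_mod U E M\<^esub> x) \<oplus>\<^bsub>pw_mod U E M\<^esub> (b \<odot>\<^bsub>pw_mod U E M\<^esub> x)"
      using a b x by (auto simp: pw_mod_def pw_ring_def E C Module.module.smult_l_distr[OF R] intro!: restrict_ext)
    show "(a \<otimes>\<^bsub>pw_ring U C R\<^esub> b) \<odot>\<^bsub>pw_mod U E M\<^esub> x =
        a \<odot>\<^bsub>pw_mod U E M\<^esub> (b \<odot>\<^bsub>pw_mod U E M\<^esub> x)"
      using a b x by (auto simp: pw_mod_def pw_ring_def E C Module.module.smult_assoc1[OF R] intro!: restrict_ext)
  }
  fix y assume y: "y \<in> carrier (pw_mod U E M)"
  show "a \<odot>\<^bsub>pw_mod U E M\<^esub> (x \<oplus>\<^bsub>pw_mod U E M\<^esub> y) =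
        (a \<odot>\<^bsub>pw_mod U E M\<^esub> x) \<oplus>\<^bsub>pw_mod U E M\<^esub> (a \<odot>\<^bsub>pw_mod U E M\<^esub> y)"
    using a x y by (auto simp: pw_mod_def pw_ring_def E C Module.module.smult_r_distr[OF R] intro!: restrict_ext)
qed

lemma self_module_mpart_0 [simp]: "mpart (self_module A) 0 = hpart A 0"
  by (simp add: self_module_def)

lemma local_fracI:
  assumes "openin (zariski A) V" "p \<in> V" "V \<subseteq> U" "m \<in> mpart M (int i)" "f \<in> hpart A i"
    and "\<And>q. q \<in> V \<Longrightarrow> f \<notin> q \<and> s q = frac A M q m f"
  shows "\<exists>V i m f. openin (zariski A) V \<and> p \<in> V \<and> V \<subseteq> U \<and> m \<in> mpart M (int i) \<and>
       f \<in> hpart A i \<and> (\<forall>q\<in>V. f \<notin> q \<and> s q = frac A M q m f)"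
  by (rule exI[of _ V], rule exI[of _ i], rule exI[of _ m], rule exI[of _ f]) (intro conjI ballI assms; simp add: assms)

context graded_mod
begin

lemma Proj_openin: "\<lbrakk>openin (zariski A) V; p \<in> V\<rbrakk> \<Longrightarrow> p \<in> Proj A"
  using openin_zariski_subset by blast

lemma tilde_sections_const:
  assumes "openin (zariski A) U" "m \<in> mpart M (int i)" "f \<in> hpart A i" "\<And>q. q \<in> U \<Longrightarrow> f \<notin> q"
  shows "(\<lambda>p\<in>U. frac A M p m f) \<in> tilde_sections A M U"
proof (rule tilde_sectionsI)
  fix p assume "p \<in> U"
  with assms show "\<exists>V i m' f'. openin (zariski A) V \<and> p \<in> V \<and> V \<subseteq> U \<and> m' \<in> mpart M (int i) \<and>
       f' \<in> hpart A i \<and> (\<forall>q\<in>V. f' \<notin> q \<and> (\<lambda>p\<in>U. frac A M p m f) q = frac A M q m' f')"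
    by (intro exI[of _ U] exI[of _ i] exI[of _ m] exI[of _ f]) simp
qed simp

lemma tilde_sections_add:
  assumes s: "s \<in> tilde_sections A M U" and t: "t \<in> tilde_sections A M U"
  shows "(\<lambda>p\<in>U. frac_add A M p (s p) (t p)) \<in> tilde_sections A M U"
proof (rule tilde_sectionsI)
  fix p assume p: "p \<in> U"
  from s p obtain V m i f where 1: "openin (zariski A) V" "p \<in> V" "V \<subseteq> U" "m \<in> mpart M (int i)"
    "f \<in> hpart A i" "\<forall>q\<in>V. f \<notin> q" "\<forall>q\<in>V. s q = frac A M q m f" by (rule tilde_sectionsE)
  from t p obtain W n j g where 2: "openin (zariski A) W" "p \<in> W" "W \<subseteq> U" "n \<in> mpart M (int j)"
    "g \<in> hpart A j" "\<forall>q\<in>W. g \<notin> q" "\<forall>q\<in>W. t q = frac A M q n g" by (rule tilde_sectionsE)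
  have loc: "f \<otimes> g \<notin> q \<and> (\<lambda>p\<in>U. frac_add A M p (s p) (t p)) q = frac A M q (g \<odot>\<^bsub>M\<^esub> m \<oplus>\<^bsub>M\<^esub> f \<odot>\<^bsub>M\<^esub> n) (f \<otimes> g)"
    if "q \<in> V \<inter> W" for q
  proof
    have q: "q \<in> Proj A" "q \<in> U" "f \<notin> q" "g \<notin> q"
      using that 1 2 Proj_openin[OF 1(1)] by auto
    then show "f \<otimes> g \<notin> q"
      using 1 2 by (simp add: Proj_mult_iff hpart_carrier)
    have "s q = frac A M q m f" "t q = frac A M q n g"
      using bspec[OF 1(7), of q] bspec[OF 2(7), of q] that by simp_all
    then show "(\<lambda>p\<in>U. frac_add A M p (s p) (t p)) q = frac A M q (g \<odot>\<^bsub>M\<^esub> m \<oplus>\<^bsub>M\<^esub> f \<odot>\<^bsub>M\<^esub> n) (f \<otimes> g)"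
      using q frac_add_frac[OF q(1) fracsI[OF 1(4,5) q(3)] fracsI[OF 2(4,5) q(4)]] by simp
  qed
  have mf: "g \<odot>\<^bsub>M\<^esub> m \<oplus>\<^bsub>M\<^esub> f \<odot>\<^bsub>M\<^esub> n \<in> mpart M (int (i + j))" "f \<otimes> g \<in> hpart A (i + j)"
    using mpart_smult'[OF 1(5) 2(4)] mpart_smult'[OF 2(5) 1(4)] hpart_mult[OF 1(5) 2(5)]
    by (simp_all add: mpart_add add.commute)
  show "\<exists>V i m' f'. openin (zariski A) V \<and> p \<in> V \<and> V \<subseteq> U \<and> m' \<in> mpart M (int i) \<and>
       f' \<in> hpart A i \<and> (\<forall>q\<in>V. f' \<notin> q \<and> (\<lambda>p\<in>U. frac_add A M p (s p) (t p)) q = frac A M q m' f')"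
  proof (rule local_fracI[OF openin_Int[OF 1(1) 2(1)] _ _ mf])
    show "p \<in> V \<inter> W" "V \<inter> W \<subseteq> U"
      using 1(2,3) 2(2) by blast+
  qed (rule loc)
qed simp

lemma tilde_sections_smult:
  assumes s: "s \<in> tilde_sections A (self_module A) U" and t: "t \<in> tilde_sections A M U"
  shows "(\<lambda>p\<in>U. frac_smult A M p (s p) (t p)) \<in> tilde_sections A M U"
proof (rule tilde_sectionsI)
  interpret S: graded_mod A "self_module A" by (rule self_graded_mod)
  fix p assume p: "p \<in> U"
  from s p obtain V m i f where 1: "openin (zariski A) V" "p \<in> V" "V \<subseteq> U" "m \<in> mpart (self_module A) (int i)"
    "f \<in> hpart A i" "\<forall>q\<in>V. f \<notin> q" "\<forall>q\<in>V. s q = frac A (self_module A) q m f" by (rule tilde_sectionsE)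
  from t p obtain W n j g where 2: "openin (zariski A) W" "p \<in> W" "W \<subseteq> U" "n \<in> mpart M (int j)"
    "g \<in> hpart A j" "\<forall>q\<in>W. g \<notin> q" "\<forall>q\<in>W. t q = frac A M q n g" by (rule tilde_sectionsE)
  have loc: "f \<otimes> g \<notin> q \<and> (\<lambda>p\<in>U. frac_smult A M p (s p) (t p)) q = frac A M q (m \<odot>\<^bsub>M\<^esub> n) (f \<otimes> g)"
    if "q \<in> V \<inter> W" for q
  proof
    have q: "q \<in> Proj A" "q \<in> U" "f \<notin> q" "g \<notin> q"
      using that 1 2 Proj_openin[OF 1(1)] by auto
    then show "f \<otimes> g \<notin> q"
      using 1 2 by (simp add: Proj_mult_iff hpart_carrier)
    have "s q = frac A (self_module A) q m f" "t q = frac A M q n g"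
      using bspec[OF 1(7), of q] bspec[OF 2(7), of q] that by simp_all
    then show "(\<lambda>p\<in>U. frac_smult A M p (s p) (t p)) q = frac A M q (m \<odot>\<^bsub>M\<^esub> n) (f \<otimes> g)"
      using q frac_smult_frac(1)[OF q(1) S.fracsI[OF 1(4,5) q(3)] fracsI[OF 2(4,5) q(4)]] by simp
  qed
  have mf: "m \<odot>\<^bsub>M\<^esub> n \<in> mpart M (int (i + j))" "f \<otimes> g \<in> hpart A (i + j)"
    using 1(4) mpart_smult'[OF _ 2(4), of m i] hpart_mult[OF 1(5) 2(5)] by simp_all
  show "\<exists>V i m' f'. openin (zariski A) V \<and> p \<in> V \<and> V \<subseteq> U \<and> m' \<in> mpart M (int i) \<and>
       f' \<in> hpart A i \<and> (\<forall>q\<in>V. f' \<notin> q \<and> (\<lambda>p\<in>U. frac_smult A M p (s p) (t p)) q = frac A M q m' f')"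
  proof (rule local_fracI[OF openin_Int[OF 1(1) 2(1)] _ _ mf])
    show "p \<in> V \<inter> W" "V \<inter> W \<subseteq> U"
      using 1(2,3) 2(2) by blast+
  qed (rule loc)
qed simp

lemma stalk_uminus:
  assumes p: "p \<in> Proj A" and m: "m \<in> mpart M (int i)" "f \<in> hpart A i" "f \<notin> p"
  shows "\<ominus>\<^bsub>stalk_mod A M p\<^esub> frac A M p m f = frac A M p (\<ominus>\<^bsub>M\<^esub> m) f"
proof -
  interpret S: abelian_group "stalk_mod A M p" by (rule stalk_abelian_group[OF p])
  show ?thesis
  proof (rule S.minus_equality)
    show "frac A M p (\<ominus>\<^bsub>M\<^esub> m) f \<oplus>\<^bsub>stalk_mod A M p\<^esub> frac A M p m f = \<zero>\<^bsub>stalk_mod A M p\<^esub>"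
      using m frac_add_same[OF p uminus_mpart[OF m(1)] m] frac_zero[OF p m(2,3)]
      by (simp add: stalk_mod_def M.l_neg mpart_carrier)
  qed (use m uminus_mpart in \<open>auto simp: stalk_mod_def intro: stalkI fracsI\<close>)
qed

lemma tilde_sections_uminus:
  assumes s: "s \<in> tilde_sections A M U"
  shows "(\<lambda>p\<in>U. \<ominus>\<^bsub>stalk_mod A M p\<^esub> s p) \<in> tilde_sections A M U"
proof (rule tilde_sectionsI)
  fix p assume p: "p \<in> U"
  from s p obtain V m i f where 1: "openin (zariski A) V" "p \<in> V" "V \<subseteq> U" "m \<in> mpart M (int i)"
    "f \<in> hpart A i" "\<forall>q\<in>V. f \<notin> q" "\<forall>q\<in>V. s q = frac A M q m f" by (rule tilde_sectionsE)
  have "(\<lambda>p\<in>U. \<ominus>\<^bsub>stalk_mod A M p\<^esub> s p) q = frac A M q (\<ominus>\<^bsub>M\<^esub> m) f" if "q \<in> V" for q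
    using that 1 stalk_uminus[OF Proj_openin[OF 1(1) that] 1(4,5)] by auto
  then show "\<exists>V i m' f'. openin (zariski A) V \<and> p \<in> V \<and> V \<subseteq> U \<and> m' \<in> mpart M (int i) \<and>
       f' \<in> hpart A i \<and> (\<forall>q\<in>V. f' \<notin> q \<and> (\<lambda>p\<in>U. \<ominus>\<^bsub>stalk_mod A M p\<^esub> s p) q = frac A M q m' f')"
    using 1 by (intro exI[of _ V] exI[of _ i] exI[of _ "\<ominus>\<^bsub>M\<^esub> m"] exI[of _ f] conjI ballI) (auto intro: uminus_mpart)
qed simp

end

text \<open>Negation depends on the additive structure alone; this carries it from
  \<open>stalk_mod\<close> over to \<open>stalk_ring\<close>.\<close>

lemma a_inv_cong:
  assumes "carrier G = carrier H" "add G = add H" "zero G = zero H"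
  shows "a_inv G x = a_inv H x"
  using assms by (simp add: a_inv_def m_inv_def)

context graded_cring
begin

lemma rs_ring_cring:
  assumes U: "openin (zariski A) U"
  shows "cring (rs_ring (Proj_space A) U)"
proof -
  interpret S: graded_mod A "self_module A" by (rule self_graded_mod)
  have inv: "\<ominus>\<^bsub>stalk_ring A p\<^esub> x = \<ominus>\<^bsub>stalk_mod A (self_module A) p\<^esub> x" for p x
    by (rule a_inv_cong) (simp_all add: stalk_ring_def stalk_mod_def)
  show ?thesis
    unfolding rs_ring_pw
  proof (rule pw_cring)
    show "cring (stalk_ring A p)" if "p \<in> U" for p
      using stalk_ring_cring S.Proj_openin[OF U that] .
    show "s p \<in> carrier (stalk_ring A p)" if "s \<in> tilde_sections A (self_module A) U" "p \<in> U" for s p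
      using tilde_sections_stalk[OF that] by (simp add: stalk_ring_def)
    show "tilde_sections A (self_module A) U \<subseteq> extensional U"
      using tilde_sections_extensional by blast
    show "(\<lambda>p\<in>U. \<zero>\<^bsub>stalk_ring A p\<^esub>) \<in> tilde_sections A (self_module A) U"
      "(\<lambda>p\<in>U. \<one>\<^bsub>stalk_ring A p\<^esub>) \<in> tilde_sections A (self_module A) U"
      using S.Proj_openin[OF U] by (auto simp: stalk_ring_def hpart_zero hpart_one Proj_one intro!: S.tilde_sections_const[of _ _ 0] U)
    fix s assume "s \<in> tilde_sections A (self_module A) U"
    then show "(\<lambda>p\<in>U. \<ominus>\<^bsub>stalk_ring A p\<^esub> s p) \<in> tilde_sections A (self_module A) U"
      unfolding inv by (rule S.tilde_sections_uminus)
    fix t assume "t \<in> tilde_sections A (self_module A) U"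
    with \<open>s \<in> _\<close> show "(\<lambda>p\<in>U. s p \<oplus>\<^bsub>stalk_ring A p\<^esub> t p) \<in> tilde_sections A (self_module A) U"
      "(\<lambda>p\<in>U. s p \<otimes>\<^bsub>stalk_ring A p\<^esub> t p) \<in> tilde_sections A (self_module A) U"
      by (simp_all add: stalk_ring_def S.tilde_sections_add S.tilde_sections_smult)
  qed
qed

text \<open>Functions glue uniquely, and being given by one fraction near each point is a local
  condition.\<close>

lemma tilde_is_sheaf: "is_sheaf (zariski A) (tilde_sections A M) (\<lambda>U V s. restrict s V)"
  unfolding is_sheaf_def
proof (intro conjI allI impI ballI)
  fix U s assume "openin (zariski A) U" "s \<in> tilde_sections A M U"
  then show "restrict s U = s"
    using tilde_sections_extensional[of s A M U] by (intro extensionalityI[of _ U]) auto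
next
  fix U V W s assume "openin (zariski A) U \<and> openin (zariski A) V \<and> openin (zariski A) W \<and> W \<subseteq> V \<and> V \<subseteq> U"
  then show "restrict (restrict s V) W = restrict s W"
    by (simp add: restrict_restrict Int_absorb1)
next
  fix C s assume "(\<forall>U\<in>C. openin (zariski A) U \<and> s U \<in> tilde_sections A M U) \<and>
    (\<forall>U\<in>C. \<forall>V\<in>C. restrict (s U) (U \<inter> V) = restrict (s V) (U \<inter> V))"
  then show "\<exists>!t. t \<in> tilde_sections A M (\<Union>C) \<and> (\<forall>U\<in>C. restrict t U = s U)"
    using tilde_sections_glue[of C A "\<lambda>U. U" s M] by auto
qed (auto intro: tilde_sections_restrict)

lemma Proj_space_simps [simp]:
  "rs_top (Proj_space A) = zariski A" "rs_res (Proj_space A) U V s = restrict s V"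
  by (simp_all add: Proj_space_def)

lemma Proj_ringed_space: "is_ringed_space (Proj_space A)"
  unfolding is_ringed_space_def
proof (intro conjI allI impI)
  fix U assume "openin (rs_top (Proj_space A)) U"
  then show "cring (rs_ring (Proj_space A) U)"
    by (intro rs_ring_cring) simp
next
  fix U V assume *: "openin (rs_top (Proj_space A)) U \<and> openin (rs_top (Proj_space A)) V \<and> V \<subseteq> U"
  then show "rs_res (Proj_space A) U V \<in> ring_hom (rs_ring (Proj_space A) U) (rs_ring (Proj_space A) V)"
    by (intro ring_hom_memI) (auto simp: rs_ring_pw pw_ring_def fun_eq_iff intro!: tilde_sections_restrict)
next
  have "is_sheaf (zariski A) (tilde_sections A (self_module A)) (\<lambda>U V s. restrict s V)"
    by (rule tilde_is_sheaf)
  then show "is_sheaf (rs_top (Proj_space A)) (\<lambda>U. carrier (rs_ring (Proj_space A) U)) (rs_res (Proj_space A))"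
    by (simp add: Proj_space_def)
qed

end

context graded_mod
begin

lemma sm_sec_module:
  assumes U: "openin (zariski A) U"
  shows "Module.module (rs_ring (Proj_space A) U) (sm_sec (tilde A M) U)"
  unfolding rs_ring_pw sm_sec_pw
proof (rule pw_module)
  show "Module.module (stalk_ring A p) (stalk_mod A M p)" if "p \<in> U" for p
    using stalk_module Proj_openin[OF U that] .
  show "cring (pw_ring U (tilde_sections A (self_module A) U) (stalk_ring A))"
    using rs_ring_cring[OF U] by (simp add: rs_ring_pw)
  show "s p \<in> carrier (stalk_ring A p)" if "s \<in> tilde_sections A (self_module A) U" "p \<in> U" for s p
    using tilde_sections_stalk[OF that] by (simp add: stalk_ring_def)
  show "s p \<in> carrier (stalk_mod A M p)" if "s \<in> tilde_sections A M U" "p \<in> U" for s p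
    using tilde_sections_stalk[OF that] by (simp add: stalk_mod_def)
  show "tilde_sections A M U \<subseteq> extensional U"
    using tilde_sections_extensional by blast
  show "(\<lambda>p\<in>U. \<zero>\<^bsub>stalk_mod A M p\<^esub>) \<in> tilde_sections A M U"
    using Proj_openin[OF U] by (auto simp: stalk_mod_def mpart_zero hpart_one Proj_one intro!: tilde_sections_const[of _ _ 0] U)
qed (simp_all add: tilde_sections_uminus tilde_sections_add tilde_sections_smult stalk_mod_def[of A M, THEN arg_cong[where f = add]]
    stalk_mod_def[of A M, THEN arg_cong[where f = smult]])

lemma tilde_sheaf_of_modules: "sheaf_of_modules (Proj_space A) (tilde A M)"
  unfolding sheaf_of_modules_def
proof (intro conjI allI impI ballI)
  show "is_ringed_space (Proj_space A)"
    by (rule Proj_ringed_space)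
  show "Module.module (rs_ring (Proj_space A) U) (sm_sec (tilde A M) U)" if "openin (rs_top (Proj_space A)) U" for U
    using that sm_sec_module by simp
  show "is_sheaf (rs_top (Proj_space A)) (\<lambda>U. carrier (sm_sec (tilde A M) U)) (sm_res (tilde A M))"
    using tilde_is_sheaf[of M] by (simp add: tilde_def)
qed (auto simp: sm_sec_pw pw_mod_def fun_eq_iff tilde_def[of A M, THEN arg_cong[where f = sm_res]])

end

section \<open>Semilinear maps and exact sequences\<close>

text \<open>The last axiom says that the kernel is generated by homogeneous elements. This makes the
  preimage of a homogeneous prime homogeneous, and it describes the image of \<open>Proj B\<close>
  as the set of points that contain the kernel.\<close>

locale graded_surj = graded_cring A + B: graded_cring B
  for A :: "('a, 'm) graded_ring_scheme" (structure) and B :: "('b, 'n) graded_ring_scheme" +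
  fixes \<pi> :: "'a \<Rightarrow> 'b"
  assumes hom: "\<pi> \<in> ring_hom A B"
    and hpart_image: "\<pi> ` hpart A n = hpart B n"
    and surj: "\<pi> ` carrier A = carrier B"
    and ker_homog: "\<lbrakk>a \<in> carrier A; \<pi> a = \<zero>\<^bsub>B\<^esub>\<rbrakk> \<Longrightarrow> a \<in> Idl {h \<in> homog A. \<pi> h = \<zero>\<^bsub>B\<^esub>}"
begin

sublocale H: ring_hom_ring A B \<pi>
  by (intro ring_hom_ringI2 ring_axioms B.ring_axioms hom)

lemma hpart_map: "a \<in> hpart A n \<Longrightarrow> \<pi> a \<in> hpart B n"
  using hpart_image by blast

lemma homog_map: "a \<in> homog A \<Longrightarrow> \<pi> a \<in> homog B"
  using hpart_map by (auto simp: homog_def)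

lemma homog_lift: "b \<in> homog B \<Longrightarrow> \<exists>a\<in>homog A. \<pi> a = b"
  unfolding homog_def by (auto simp flip: hpart_image)

lemma Proj_map_mem: "a \<in> carrier A \<Longrightarrow> a \<in> Proj_map A \<pi> q \<longleftrightarrow> \<pi> a \<in> q"
  by (simp add: Proj_map_def)

lemma ideal_image:
  assumes "ideal J A"
  shows "ideal (\<pi> ` J) B"
proof (rule idealI)
  interpret J: ideal J A by fact
  show "subgroup (\<pi> ` J) (add_monoid B)"
    by (rule H.img_is_add_subgroup) (rule J.a_subgroup)
  fix x b assume "x \<in> \<pi> ` J" "b \<in> carrier B"
  then obtain j a where *: "j \<in> J" "x = \<pi> j" "a \<in> carrier A" "b = \<pi> a"
    using surj by blast
  then show "b \<otimes>\<^bsub>B\<^esub> x \<in> \<pi> ` J" "x \<otimes>\<^bsub>B\<^esub> b \<in> \<pi> ` J"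
    by (auto simp: J.I_l_closed J.I_r_closed J.a_Hcarr simp flip: H.hom_mult)
qed (rule B.ring_axioms)

text \<open>Homogeneity of the preimage is what needs work. The homogeneous elements of
  \<open>q\<close> lift to homogeneous elements of the preimage, so every \<open>f\<close> in it
  agrees under \<open>\<pi>\<close> with some \<open>j\<close> in the ideal they generate; the
  difference lies in the kernel, which is generated by homogeneous elements as well.\<close>

lemma Proj_map_Proj:
  assumes q: "q \<in> Proj B"
  shows "Proj_map A \<pi> q \<in> Proj A"
proof -
  interpret q: primeideal q B by (rule B.Proj_prime[OF q])
  let ?p = "Proj_map A \<pi> q"
  have id: "ideal ?p A"
    using H.ideal_vimage[OF q.is_ideal] by (simp add: Proj_map_def)
  have "primeideal ?p A"
  proof (rule primeidealI[OF id])
    have "\<one> \<notin> ?p"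
      using B.Proj_one[OF q] by (simp add: Proj_map_def)
    then show "carrier A \<noteq> ?p" by auto
    fix a b assume "a \<in> carrier A" "b \<in> carrier A" "a \<otimes> b \<in> ?p"
    then show "a \<in> ?p \<or> b \<in> ?p"
      using q.I_prime[of "\<pi> a" "\<pi> b"] by (auto simp: Proj_map_def)
  qed (rule cring_axioms)
  moreover have "?p = Idl (?p \<inter> homog A)"
  proof
    have sub: "?p \<inter> homog A \<subseteq> carrier A"
      using homog_carrier by blast
    interpret J: ideal "Idl (?p \<inter> homog A)" A
      by (rule genideal_ideal[OF sub])
    show "Idl (?p \<inter> homog A) \<subseteq> ?p"
      by (rule genideal_minimal[OF id]) simp
    have "q \<inter> homog B \<subseteq> \<pi> ` (Idl (?p \<inter> homog A))"
    proof
      fix b assume b: "b \<in> q \<inter> homog B"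
      then obtain a where "a \<in> homog A" "\<pi> a = b"
        using homog_lift by blast
      with b have "a \<in> ?p \<inter> homog A"
        by (simp add: Proj_map_def homog_carrier)
      then show "b \<in> \<pi> ` (Idl (?p \<inter> homog A))"
        using genideal_self[OF sub] \<open>\<pi> a = b\<close> by blast
    qed
    then have "Idl\<^bsub>B\<^esub> (q \<inter> homog B) \<subseteq> \<pi> ` (Idl (?p \<inter> homog A))"
      by (rule B.genideal_minimal[OF ideal_image[OF J.is_ideal]])
    then have qsub: "q \<subseteq> \<pi> ` (Idl (?p \<inter> homog A))"
      using q by (simp add: Proj_def)
    show "?p \<subseteq> Idl (?p \<inter> homog A)"
    proof
      fix f assume "f \<in> ?p"
      then have f: "f \<in> carrier A" "\<pi> f \<in> q"
        by (auto simp: Proj_map_def)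
      then obtain j where j: "j \<in> Idl (?p \<inter> homog A)" "\<pi> f = \<pi> j"
        using qsub by blast
      have jc: "j \<in> carrier A"
        using j J.a_Hcarr by blast
      have "f \<ominus> j \<in> Idl {h \<in> homog A. \<pi> h = \<zero>\<^bsub>B\<^esub>}"
        using f j jc by (intro ker_homog) (simp_all add: a_minus_def B.r_neg)
      moreover have "{h \<in> homog A. \<pi> h = \<zero>\<^bsub>B\<^esub>} \<subseteq> ?p \<inter> homog A"
        by (auto simp: Proj_map_def homog_carrier)
      ultimately have "f \<ominus> j \<in> Idl (?p \<inter> homog A)"
        using subset_Idl_subset[OF sub] by blast
      then have "f \<ominus> j \<oplus> j \<in> Idl (?p \<inter> homog A)"
        using j by simp
      then show "f \<in> Idl (?p \<inter> homog A)"
        using f jc by (simp add: a_minus_def a_assoc l_neg)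
    qed
  qed
  moreover have "\<not> (\<Union>n\<in>{0<..}. hpart A n) \<subseteq> ?p"
  proof
    assume *: "(\<Union>n\<in>{0<..}. hpart A n) \<subseteq> ?p"
    have "(\<Union>n\<in>{0<..}. hpart B n) \<subseteq> q"
    proof (clarify)
      fix b and n :: nat assume "0 < n" "b \<in> hpart B n"
      moreover from this obtain a where "a \<in> hpart A n" "\<pi> a = b"
        using hpart_image[of n] by (metis imageE)
      ultimately show "b \<in> q"
        using * by (auto simp: Proj_map_def)
    qed
    then show False
      using q by (simp add: Proj_def)
  qed
  ultimately show ?thesis
    by (simp add: Proj_def)
qed

text \<open>The required point is the image of \<open>p\<close> under \<open>\<pi>\<close>. As
  \<open>p\<close> contains the kernel, \<open>\<pi> a\<close> lies in that image exactly when
  \<open>a\<close> lies in \<open>p\<close> (fact \<open>mem\<close>), and this transfers the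
  properties of a point.\<close>

lemma Proj_map_surj:
  assumes p: "p \<in> Proj A" and ker: "\<And>h. \<lbrakk>h \<in> homog A; \<pi> h = \<zero>\<^bsub>B\<^esub>\<rbrakk> \<Longrightarrow> h \<in> p"
  shows "\<exists>q\<in>Proj B. Proj_map A \<pi> q = p"
proof -
  interpret p: primeideal p A by (rule Proj_prime[OF p])
  have kerp: "a \<in> p" if "a \<in> carrier A" "\<pi> a = \<zero>\<^bsub>B\<^esub>" for a
    using ker_homog[OF that] genideal_minimal[OF p.is_ideal, of "{h \<in> homog A. \<pi> h = \<zero>\<^bsub>B\<^esub>}"] ker
    by auto
  have mem: "a \<in> p" if "a \<in> carrier A" "\<pi> a \<in> \<pi> ` p" for a
  proof -
    from that obtain c where c: "c \<in> p" "\<pi> a = \<pi> c" by blast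
    then have cc: "c \<in> carrier A" by simp
    have "a \<ominus> c \<in> p"
      using that c cc by (intro kerp) (simp_all add: a_minus_def B.r_neg)
    then have "a \<ominus> c \<oplus> c \<in> p"
      using c by simp
    then show ?thesis
      using that cc by (simp add: a_minus_def a_assoc l_neg)
  qed
  have id: "ideal (\<pi> ` p) B"
    by (rule ideal_image[OF p.is_ideal])
  interpret q: ideal "\<pi> ` p" B by (rule id)
  have "primeideal (\<pi> ` p) B"
  proof (rule primeidealI[OF id])
    show "carrier B \<noteq> \<pi> ` p"
      using mem[of \<one>] Proj_one[OF p] by (metis H.hom_one B.one_closed one_closed)
    fix a b assume "a \<in> carrier B" "b \<in> carrier B" "a \<otimes>\<^bsub>B\<^esub> b \<in> \<pi> ` p"
    moreover from this obtain c d where "c \<in> carrier A" "d \<in> carrier A" "a = \<pi> c" "b = \<pi> d"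
      using surj by (metis imageE)
    ultimately show "a \<in> \<pi> ` p \<or> b \<in> \<pi> ` p"
      using mem[of "c \<otimes> d"] p.I_prime[of c d] by auto
  qed (rule B.cring_axioms)
  moreover have "\<pi> ` p = Idl\<^bsub>B\<^esub> (\<pi> ` p \<inter> homog B)"
  proof
    have sub: "\<pi> ` p \<inter> homog B \<subseteq> carrier B"
      using B.homog_carrier by blast
    show "Idl\<^bsub>B\<^esub> (\<pi> ` p \<inter> homog B) \<subseteq> \<pi> ` p"
      by (rule B.genideal_minimal[OF id]) simp
    have "Idl (p \<inter> homog A) \<subseteq> {r \<in> carrier A. \<pi> r \<in> Idl\<^bsub>B\<^esub> (\<pi> ` p \<inter> homog B)}"
    proof (rule genideal_minimal[OF H.ideal_vimage[OF B.genideal_ideal[OF sub]]])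
      show "p \<inter> homog A \<subseteq> {r \<in> carrier A. \<pi> r \<in> Idl\<^bsub>B\<^esub> (\<pi> ` p \<inter> homog B)}"
        using B.genideal_self[OF sub] by (auto simp: homog_carrier homog_map)
    qed
    then show "\<pi> ` p \<subseteq> Idl\<^bsub>B\<^esub> (\<pi> ` p \<inter> homog B)"
      using p unfolding Proj_def by blast
  qed
  moreover have "\<not> (\<Union>n\<in>{0<..}. hpart B n) \<subseteq> \<pi> ` p"
  proof
    assume *: "(\<Union>n\<in>{0<..}. hpart B n) \<subseteq> \<pi> ` p"
    have "(\<Union>n\<in>{0<..}. hpart A n) \<subseteq> p"
    proof clarify
      fix a and n :: nat assume "0 < n" "a \<in> hpart A n"
      then show "a \<in> p"
        using * hpart_map[of a n] by (intro mem) (auto simp: hpart_carrier)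
    qed
    then show False
      using p by (simp add: Proj_def)
  qed
  ultimately have "\<pi> ` p \<in> Proj B"
    by (simp add: Proj_def)
  moreover have "Proj_map A \<pi> (\<pi> ` p) = p"
    using mem by (auto simp: Proj_map_def)
  ultimately show ?thesis by blast
qed

abbreviation pre :: "'a set set \<Rightarrow> 'b set set" where
  "pre U \<equiv> {q \<in> Proj B. Proj_map A \<pi> q \<in> U}"

lemma pre_open:
  assumes "openin (zariski A) U"
  shows "openin (zariski B) (pre U)"
proof (subst openin_subopen, intro ballI)
  fix q assume q: "q \<in> pre U"
  then obtain f where f: "f \<in> homog A" "f \<notin> Proj_map A \<pi> q" "{p \<in> Proj A. f \<notin> p} \<subseteq> U"
    using zariski_basis[OF assms, of "Proj_map A \<pi> q"] by auto
  then show "\<exists>T. openin (zariski B) T \<and> q \<in> T \<and> T \<subseteq> pre U"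
    using q openin_basic[OF homog_map[OF f(1)]]
    by (intro exI[of _ "{q \<in> Proj B. \<pi> f \<notin> q}"]) (auto simp: Proj_map_mem homog_carrier Proj_map_Proj)
qed

text \<open>The closed subscheme carries the induced topology: a basic open set of
  \<open>Proj B\<close> is defined by a homogeneous \<open>b\<close>, and a homogeneous lift of
  \<open>b\<close> defines an open set of \<open>Proj A\<close> with that preimage.\<close>

lemma pre_basis:
  assumes "openin (zariski B) W" "q \<in> W" "openin (zariski A) U" "Proj_map A \<pi> q \<in> U"
  shows "\<exists>V. openin (zariski A) V \<and> Proj_map A \<pi> q \<in> V \<and> V \<subseteq> U \<and> pre V \<subseteq> W"
proof -
  have q: "q \<in> Proj B"
    using assms openin_zariski_subset by blast
  obtain b where b: "b \<in> homog B" "b \<notin> q" "{q \<in> Proj B. b \<notin> q} \<subseteq> W"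
    using B.zariski_basis[OF assms(1,2)] by blast
  then obtain f where f: "f \<in> homog A" "\<pi> f = b"
    using homog_lift by blast
  have "openin (zariski A) ({p \<in> Proj A. f \<notin> p} \<inter> U)"
    by (intro openin_Int openin_basic f assms)
  then show ?thesis
    using b f q assms
    by (intro exI[of _ "{p \<in> Proj A. f \<notin> p} \<inter> U"]) (auto simp: Proj_map_mem homog_carrier Proj_map_Proj)
qed

end

text \<open>One notion for both maps of the sequence: \<open>\<pi>\<close> is the identity for
  multiplication by the linear form, and reduction modulo that form for the restriction of
  derivations.\<close>

locale graded_semilinear = graded_surj A B \<pi> + graded_mod A M + N: graded_mod B N
  for A :: "('a, 'm) graded_ring_scheme" (structure) and B :: "('b, 'n) graded_ring_scheme" and \<pi>
    and M :: "('a, 'c) graded_module" and N :: "('b, 'd) graded_module" +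
  fixes g :: "'c \<Rightarrow> 'd"
  assumes g_closed: "x \<in> carrier M \<Longrightarrow> g x \<in> carrier N"
    and g_add: "\<lbrakk>x \<in> carrier M; y \<in> carrier M\<rbrakk> \<Longrightarrow> g (x \<oplus>\<^bsub>M\<^esub> y) = g x \<oplus>\<^bsub>N\<^esub> g y"
    and g_smult: "\<lbrakk>a \<in> carrier A; x \<in> carrier M\<rbrakk> \<Longrightarrow> g (a \<odot>\<^bsub>M\<^esub> x) = \<pi> a \<odot>\<^bsub>N\<^esub> g x"
    and g_mpart: "x \<in> mpart M e \<Longrightarrow> g x \<in> mpart N e"
begin

definition stalk_map :: "'b set \<Rightarrow> ('c \<times> 'a) set \<Rightarrow> ('d \<times> 'b) set" where
  "stalk_map q X = (\<Union>(m, f)\<in>X. frac B N q (g m) (\<pi> f))"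

lemma tilde_map_stalk:
  "tilde_map A B N \<pi> g U s = (\<lambda>q\<in>pre U. stalk_map q (s (Proj_map A \<pi> q)))"
  by (simp add: tilde_map_def stalk_map_def)

lemma fracs_map:
  assumes "(m, f) \<in> fracs A M (Proj_map A \<pi> q)"
  shows "(g m, \<pi> f) \<in> fracs B N q"
  using assms by (auto simp: fracs_def Proj_map_mem hpart_carrier intro: hpart_map g_mpart)

lemma stalk_map_frac:
  assumes q: "q \<in> Proj B" and mf: "(m, f) \<in> fracs A M (Proj_map A \<pi> q)"
  shows "stalk_map q (frac A M (Proj_map A \<pi> q) m f) = frac B N q (g m) (\<pi> f)"
  unfolding stalk_map_def
proof (rule UN_frac[OF Proj_map_Proj[OF q] mf])
  fix n k assume nk: "(n, k) \<in> fracs A M (Proj_map A \<pi> q)"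
    and "frac A M (Proj_map A \<pi> q) n k = frac A M (Proj_map A \<pi> q) m f"
  then obtain h where h: "h \<in> homog A" "h \<notin> Proj_map A \<pi> q" "h \<odot>\<^bsub>M\<^esub> (f \<odot>\<^bsub>M\<^esub> n) = h \<odot>\<^bsub>M\<^esub> (k \<odot>\<^bsub>M\<^esub> m)"
    using frac_eq_iff[OF Proj_map_Proj[OF q] nk mf] by auto
  note c = fracs_carrier[OF nk] fracs_carrier[OF mf] homog_carrier[OF h(1)]
  have "\<pi> h \<odot>\<^bsub>N\<^esub> (\<pi> f \<odot>\<^bsub>N\<^esub> g n) = g (h \<odot>\<^bsub>M\<^esub> (f \<odot>\<^bsub>M\<^esub> n))"
    using c by (simp add: g_smult)
  also have "\<dots> = \<pi> h \<odot>\<^bsub>N\<^esub> (\<pi> k \<odot>\<^bsub>N\<^esub> g m)"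
    unfolding h using c by (simp add: g_smult)
  finally show "frac B N q (g n) (\<pi> k) = frac B N q (g m) (\<pi> f)"
    unfolding N.frac_eq_iff[OF q fracs_map[OF nk] fracs_map[OF mf]]
    using h c by (intro bexI[of _ "\<pi> h"]) (auto simp: homog_map Proj_map_mem)
qed

lemma stalk_map_add:
  assumes q: "q \<in> Proj B" and X: "X \<in> stalk A M (Proj_map A \<pi> q)" "Y \<in> stalk A M (Proj_map A \<pi> q)"
  shows "stalk_map q (frac_add A M (Proj_map A \<pi> q) X Y) = frac_add B N q (stalk_map q X) (stalk_map q Y)"
proof -
  let ?p = "Proj_map A \<pi> q"
  from Proj_map_Proj[OF q] X obtain i m n f where *: "m \<in> mpart M (int i)" "n \<in> mpart M (int i)" "f \<in> hpart A i" "f \<notin> ?p"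
    "X = frac A M ?p m f" "Y = frac A M ?p n f"
    by (rule stalk_common2)
  have f: "\<pi> f \<notin> q"
    using * by (simp add: Proj_map_mem hpart_carrier)
  have fr: "(m, f) \<in> fracs A M ?p" "(n, f) \<in> fracs A M ?p" "(m \<oplus>\<^bsub>M\<^esub> n, f) \<in> fracs A M ?p"
    using * by (auto intro: fracsI mpart_add)
  show ?thesis
    unfolding *(5,6) frac_add_same[OF Proj_map_Proj[OF q] *(1-4)] fr[THEN stalk_map_frac[OF q]]
      N.frac_add_same[OF q g_mpart[OF *(1)] g_mpart[OF *(2)] hpart_map[OF *(3)] f]
    using * by (simp add: g_add mpart_carrier)
qed

end

lemma rs_ring_carrier: "carrier (rs_ring (Proj_space A) U) = tilde_sections A (self_module A) U"
  by (simp add: Proj_space_def)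

lemma tilde_simps:
  "carrier (sm_sec (tilde A M) U) = tilde_sections A M U"
  "zero (sm_sec (tilde A M) U) = (\<lambda>p\<in>U. frac A M p \<zero>\<^bsub>M\<^esub> \<one>\<^bsub>A\<^esub>)"
  "add (sm_sec (tilde A M) U) = (\<lambda>s t. \<lambda>p\<in>U. frac_add A M p (s p) (t p))"
  "smult (sm_sec (tilde A M) U) = (\<lambda>a s. \<lambda>p\<in>U. frac_smult A M p (a p) (s p))"
  "sm_res (tilde A M) U V s = restrict s V"
  by (simp_all add: tilde_def)

lemma (in graded_surj) self_graded_semilinear:
  "graded_semilinear A B \<pi> (self_module A) (self_module B) \<pi>"
proof -
  interpret SA: graded_mod A "self_module A" by (rule self_graded_mod)
  interpret SB: graded_mod B "self_module B" by (rule B.self_graded_mod)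
  show ?thesis
    by unfold_locales (auto simp: self_module_mpart hpart_map split: if_splits)
qed

context graded_semilinear
begin

lemma stalk_map_smult:
  assumes q: "q \<in> Proj B" and X: "X \<in> stalk A (self_module A) (Proj_map A \<pi> q)" "Y \<in> stalk A M (Proj_map A \<pi> q)"
  shows "stalk_map q (frac_smult A M (Proj_map A \<pi> q) X Y) =
    frac_smult B N q (graded_semilinear.stalk_map B \<pi> (self_module B) \<pi> q X) (stalk_map q Y)"
proof -
  interpret S: graded_semilinear A B \<pi> "self_module A" "self_module B" \<pi> by (rule self_graded_semilinear)
  note p = Proj_map_Proj[OF q]
  from X obtain r f n h where *: "(r, f) \<in> fracs A (self_module A) (Proj_map A \<pi> q)" "X = frac A (self_module A) (Proj_map A \<pi> q) r f"
    "(n, h) \<in> fracs A M (Proj_map A \<pi> q)" "Y = frac A M (Proj_map A \<pi> q) n h"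
    by (auto simp: stalk_def)
  have c: "r \<in> carrier A" "f \<in> carrier A" "n \<in> carrier M" "h \<in> carrier A"
    using S.fracs_carrier[OF *(1)] fracs_carrier[OF *(3)] by auto
  show ?thesis
    unfolding *(2,4) frac_smult_frac(1)[OF p *(1,3)] stalk_map_frac[OF q frac_smult_frac(2)[OF p *(1,3)]]
      S.stalk_map_frac[OF q *(1)] stalk_map_frac[OF q *(3)]
      N.frac_smult_frac(1)[OF q S.fracs_map[OF *(1)] fracs_map[OF *(3)]]
    using c by (simp add: g_smult)
qed

lemma tilde_map_closed:
  assumes U: "openin (zariski A) U" and s: "s \<in> tilde_sections A M U"
  shows "tilde_map A B N \<pi> g U s \<in> tilde_sections B N (pre U)"
proof (rule tilde_sectionsI)
  fix q assume "q \<in> pre U"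
  then have q: "q \<in> Proj B" "Proj_map A \<pi> q \<in> U" by auto
  from s q(2) obtain V m i f where 1: "openin (zariski A) V" "Proj_map A \<pi> q \<in> V" "V \<subseteq> U" "m \<in> mpart M (int i)"
    "f \<in> hpart A i" "\<forall>q\<in>V. f \<notin> q" "\<forall>q\<in>V. s q = frac A M q m f" by (rule tilde_sectionsE)
  show "\<exists>V i m' f'. openin (zariski B) V \<and> q \<in> V \<and> V \<subseteq> pre U \<and> m' \<in> mpart N (int i) \<and>
       f' \<in> hpart B i \<and> (\<forall>q\<in>V. f' \<notin> q \<and> tilde_map A B N \<pi> g U s q = frac B N q m' f')"
  proof (rule local_fracI[OF pre_open[OF 1(1)] _ _ g_mpart[OF 1(4)] hpart_map[OF 1(5)]])
    show "q \<in> pre V" using q 1(2) by simp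
    show "pre V \<subseteq> pre U" using 1(3) by auto
    fix q' assume "q' \<in> pre V"
    then have q': "q' \<in> Proj B" "Proj_map A \<pi> q' \<in> V" by auto
    have f: "f \<notin> Proj_map A \<pi> q'" "s (Proj_map A \<pi> q') = frac A M (Proj_map A \<pi> q') m f"
      using bspec[OF 1(6) q'(2)] bspec[OF 1(7) q'(2)] by simp_all
    then show "\<pi> f \<notin> q' \<and> tilde_map A B N \<pi> g U s q' = frac B N q' (g m) (\<pi> f)"
      using q' 1(3,5) stalk_map_frac[OF q'(1) fracsI[OF 1(4,5)]]
      by (auto simp: tilde_map_stalk Proj_map_mem hpart_carrier)
  qed
qed (simp add: tilde_map_def)

lemma tilde_map_add:
  assumes s: "s \<in> tilde_sections A M U" "t \<in> tilde_sections A M U"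
  shows "tilde_map A B N \<pi> g U (\<lambda>p\<in>U. frac_add A M p (s p) (t p)) =
    (\<lambda>q\<in>pre U. frac_add B N q (tilde_map A B N \<pi> g U s q) (tilde_map A B N \<pi> g U t q))"
  unfolding tilde_map_stalk
  by (intro restrict_ext) (simp add: stalk_map_add tilde_sections_stalk[OF s(1)] tilde_sections_stalk[OF s(2)])

lemma tilde_map_smult:
  assumes s: "a \<in> tilde_sections A (self_module A) U" "t \<in> tilde_sections A M U"
  shows "tilde_map A B N \<pi> g U (\<lambda>p\<in>U. frac_smult A M p (a p) (t p)) =
    (\<lambda>q\<in>pre U. frac_smult B N q (tilde_map A B (self_module B) \<pi> \<pi> U a q) (tilde_map A B N \<pi> g U t q))"
proof -
  interpret S: graded_semilinear A B \<pi> "self_module A" "self_module B" \<pi> by (rule self_graded_semilinear)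
  show ?thesis
    unfolding tilde_map_stalk S.tilde_map_stalk
    by (intro restrict_ext) (simp add: stalk_map_smult tilde_sections_stalk[OF s(1)] tilde_sections_stalk[OF s(2)])
qed

lemma tilde_map_restrict:
  assumes "V \<subseteq> U"
  shows "restrict (tilde_map A B N \<pi> g U s) (pre V) = tilde_map A B N \<pi> g V (restrict s V)"
  using assms by (auto simp: tilde_map_stalk fun_eq_iff)

end

lemma (in graded_surj) Proj_map_sharp_ring_hom:
  assumes U: "openin (zariski A) U"
  shows "tilde_map A B (self_module B) \<pi> \<pi> U \<in> ring_hom (rs_ring (Proj_space A) U) (rs_ring (Proj_space B) (pre U))"
proof -
  interpret S: graded_semilinear A B \<pi> "self_module A" "self_module B" \<pi> by (rule self_graded_semilinear)
  show ?thesis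
  proof (rule ring_hom_memI)
    fix s t assume s: "s \<in> carrier (rs_ring (Proj_space A) U)" "t \<in> carrier (rs_ring (Proj_space A) U)"
    then show "tilde_map A B (self_module B) \<pi> \<pi> U s \<in> carrier (rs_ring (Proj_space B) (pre U))"
      using S.tilde_map_closed[OF U] by (simp add: Proj_space_def)
    show "tilde_map A B (self_module B) \<pi> \<pi> U (s \<oplus>\<^bsub>rs_ring (Proj_space A) U\<^esub> t) =
        tilde_map A B (self_module B) \<pi> \<pi> U s \<oplus>\<^bsub>rs_ring (Proj_space B) (pre U)\<^esub> tilde_map A B (self_module B) \<pi> \<pi> U t"
      "tilde_map A B (self_module B) \<pi> \<pi> U (s \<otimes>\<^bsub>rs_ring (Proj_space A) U\<^esub> t) =
        tilde_map A B (self_module B) \<pi> \<pi> U s \<otimes>\<^bsub>rs_ring (Proj_space B) (pre U)\<^esub> tilde_map A B (self_module B) \<pi> \<pi> U t"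
      using s S.tilde_map_add[of s U t] S.tilde_map_smult[of s U t] by (simp_all add: Proj_space_def)
  next
    have "S.stalk_map q (frac A (self_module A) (Proj_map A \<pi> q) \<one> \<one>) = frac B (self_module B) q \<one>\<^bsub>B\<^esub> \<one>\<^bsub>B\<^esub>"
      if "q \<in> Proj B" for q
      using S.stalk_map_frac[OF that S.fracs_one[OF Proj_map_Proj[OF that], of \<one>]] by (simp add: hpart_one)
    then show "tilde_map A B (self_module B) \<pi> \<pi> U \<one>\<^bsub>rs_ring (Proj_space A) U\<^esub> = \<one>\<^bsub>rs_ring (Proj_space B) (pre U)\<^esub>"
      unfolding S.tilde_map_stalk by (auto simp: Proj_space_def intro!: restrict_ext)
  qed
qed

text \<open>Besides the direct image, where \<open>h\<close> is the map on functions, it transports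
  the module laws to a record with the same operations, such as a twist, with \<open>h\<close> the
  identity.\<close>

lemma module_restrict_scalars:
  assumes "Module.module S N" "cring R" "h \<in> ring_hom R S"
    and M: "carrier M = carrier N" "add M = add N" "zero M = zero N"
      "\<And>a x. a \<in> carrier R \<Longrightarrow> x \<in> carrier N \<Longrightarrow> a \<odot>\<^bsub>M\<^esub> x = h a \<odot>\<^bsub>N\<^esub> x"
  shows "Module.module R M"
proof -
  interpret N: Module.module S N by fact
  interpret R: cring R by fact
  note h = ring_hom_closed[OF assms(3)] ring_hom_mult[OF assms(3)] ring_hom_add[OF assms(3)] ring_hom_one[OF assms(3)]
  have "abelian_group M"
  proof (rule abelian_groupI)
    fix x assume "x \<in> carrier M"
    then show "\<exists>y\<in>carrier M. y \<oplus>\<^bsub>M\<^esub> x = \<zero>\<^bsub>M\<^esub>"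
      by (intro bexI[of _ "\<ominus>\<^bsub>N\<^esub> x"]) (simp_all add: M N.M.l_neg)
  qed (simp_all add: M N.M.a_assoc, simp add: N.M.a_comm)
  then show ?thesis
    by (rule moduleI[OF assms(2)])
      (simp_all add: M(1-3), simp_all add: M(4) h N.smult_l_distr N.smult_r_distr N.smult_assoc1)
qed

context graded_semilinear
begin

abbreviation push :: "('a set, 'a set \<Rightarrow> ('a \<times> 'a) set, 'b set \<Rightarrow> ('d \<times> 'b) set) mod_sheaf" where
  "push \<equiv> pushforward (Proj_space B) (Proj_map A \<pi>) (tilde_map A B (self_module B) \<pi> \<pi>) (tilde B N)"

lemma push_simps:
  "carrier (sm_sec push U) = tilde_sections B N (pre U)"
  "zero (sm_sec push U) = (\<lambda>p\<in>pre U. frac B N p \<zero>\<^bsub>N\<^esub> \<one>\<^bsub>B\<^esub>)"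
  "add (sm_sec push U) = (\<lambda>s t. \<lambda>p\<in>pre U. frac_add B N p (s p) (t p))"
  "smult (sm_sec push U) = (\<lambda>a s. \<lambda>p\<in>pre U. frac_smult B N p (tilde_map A B (self_module B) \<pi> \<pi> U a p) (s p))"
  "sm_res push U V s = restrict s (pre V)"
  by (simp_all add: pushforward_def Let_def tilde_def B.topspace_zariski)

lemma push_sheaf_of_modules: "sheaf_of_modules (Proj_space A) push"
  unfolding sheaf_of_modules_def
proof (intro conjI allI impI ballI)
  show "is_ringed_space (Proj_space A)"
    by (rule Proj_ringed_space)
  fix U assume "openin (rs_top (Proj_space A)) U"
  then have U: "openin (zariski A) U" by simp
  show "Module.module (rs_ring (Proj_space A) U) (sm_sec push U)"
    by (rule module_restrict_scalars[OF N.sm_sec_module[OF pre_open[OF U]] rs_ring_cring[OF U] Proj_map_sharp_ring_hom[OF U]])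
      (simp_all add: push_simps, simp_all add: tilde_def)
next
  fix U V s t assume *: "openin (rs_top (Proj_space A)) U \<and> openin (rs_top (Proj_space A)) V \<and> V \<subseteq> U"
    and "s \<in> carrier (sm_sec push U)" "t \<in> carrier (sm_sec push U)"
  from * have "pre V \<subseteq> pre U" by auto
  then show "sm_res push U V (s \<oplus>\<^bsub>sm_sec push U\<^esub> t) = sm_res push U V s \<oplus>\<^bsub>sm_sec push V\<^esub> sm_res push U V t"
    unfolding push_simps by (auto simp: fun_eq_iff)
next
  interpret S: graded_semilinear A B \<pi> "self_module A" "self_module B" \<pi> by (rule self_graded_semilinear)
  fix U V s a assume *: "openin (rs_top (Proj_space A)) U \<and> openin (rs_top (Proj_space A)) V \<and> V \<subseteq> U"
    and "s \<in> carrier (sm_sec push U)" "a \<in> carrier (rs_ring (Proj_space A) U)"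
  from * have "pre V \<subseteq> pre U" by auto
  then show "sm_res push U V (a \<odot>\<^bsub>sm_sec push U\<^esub> s) = rs_res (Proj_space A) U V a \<odot>\<^bsub>sm_sec push V\<^esub> sm_res push U V s"
    unfolding push_simps using S.tilde_map_restrict[of V U a, symmetric] * by (auto simp: fun_eq_iff)
next
  show "is_sheaf (rs_top (Proj_space A)) (\<lambda>U. carrier (sm_sec push U)) (sm_res push)"
    unfolding is_sheaf_def push_simps Proj_space_simps
  proof (intro conjI allI impI ballI)
    fix U V assume *: "openin (zariski A) U \<and> openin (zariski A) V \<and> V \<subseteq> U"
    then have "pre V \<subseteq> pre U" by auto
    then show "(\<lambda>s. restrict s (pre V)) \<in> tilde_sections B N (pre U) \<rightarrow> tilde_sections B N (pre V)"
      using pre_open[of V] * by (auto simp: push_simps intro: tilde_sections_restrict)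
  next
    fix U s assume "openin (zariski A) U" "s \<in> tilde_sections B N (pre U)"
    then show "restrict s (pre U) = s"
      using tilde_sections_extensional[of s B N "pre U"] by (intro extensionalityI[of _ "pre U"]) auto
  next
    fix U V W and s :: "'b set \<Rightarrow> ('d \<times> 'b) set"
    assume "openin (zariski A) U \<and> openin (zariski A) V \<and> openin (zariski A) W \<and> W \<subseteq> V \<and> V \<subseteq> U"
    then show "restrict (restrict s (pre V)) (pre W) = restrict s (pre W)"
      by (auto simp: fun_eq_iff)
  next
    fix C s assume *: "(\<forall>U\<in>C. openin (zariski A) U \<and> s U \<in> tilde_sections B N (pre U)) \<and>
      (\<forall>U\<in>C. \<forall>V\<in>C. restrict (s U) (pre (U \<inter> V)) = restrict (s V) (pre (U \<inter> V)))"
    \<comment> \<open>The sheaf condition is inherited because preimages commute with unions and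
      intersections: the preimages of a cover form a cover, with the expected overlaps.\<close>
    have i: "pre U \<inter> pre V = pre (U \<inter> V)" for U V by auto
    have un: "(\<Union>U\<in>C. pre U) = pre (\<Union>C)" by auto
    have "\<exists>!t. t \<in> tilde_sections B N (\<Union>U\<in>C. pre U) \<and> (\<forall>U\<in>C. restrict t (pre U) = s U)"
    proof (rule tilde_sections_glue)
      fix U assume "U \<in> C"
      then show "openin (zariski B) (pre U)" "s U \<in> tilde_sections B N (pre U)"
        using * by (auto intro: pre_open)
      fix V assume "V \<in> C"
      show "restrict (s U) (pre U \<inter> pre V) = restrict (s V) (pre U \<inter> pre V)"
        unfolding i using * \<open>U \<in> C\<close> \<open>V \<in> C\<close> by blast
    qed
    then show "\<exists>!t. t \<in> tilde_sections B N (pre (\<Union>C)) \<and> (\<forall>U\<in>C. restrict t (pre U) = s U)"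
      unfolding un .
  qed
qed

lemma push_sheaf_hom: "sheaf_hom (Proj_space A) (tilde A M) push (tilde_map A B N \<pi> g)"
  unfolding sheaf_hom_def Proj_space_simps tilde_simps push_simps
proof (intro conjI allI impI ballI)
  fix U s a assume "s \<in> tilde_sections A M U" "a \<in> carrier (rs_ring (Proj_space A) U)"
  then show "tilde_map A B N \<pi> g U (\<lambda>p\<in>U. frac_smult A M p (a p) (s p)) =
      (\<lambda>p\<in>pre U. frac_smult B N p (tilde_map A B (self_module B) \<pi> \<pi> U a p) (tilde_map A B N \<pi> g U s p))"
    by (intro tilde_map_smult) (simp_all add: Proj_space_def)
qed (auto simp: tilde_map_closed tilde_map_add tilde_map_restrict)

end

section \<open>Sheaf maps over a fixed ring\<close>

lemma (in graded_cring) graded_surj_id: "graded_surj A A (\<lambda>x. x)"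
proof unfold_locales
  fix a assume "a \<in> carrier A" "a = \<zero>"
  moreover have "{h \<in> homog A. h = \<zero>} \<subseteq> carrier A"
    by auto
  ultimately show "a \<in> Idl {h \<in> homog A. h = \<zero>}"
    using additive_subgroup.zero_closed[OF ideal.axioms(1)[OF genideal_ideal]] by blast
qed (auto simp: ring_hom_def)

lemma (in graded_cring) Proj_map_id: "q \<in> Proj A \<Longrightarrow> Proj_map A (\<lambda>x. x) q = q"
  using ideal.Icarr[OF primeideal.axioms(1)[OF Proj_prime]] by (auto simp: Proj_map_def)

lemma tilde_sheaf_hom:
  assumes "graded_semilinear A A (\<lambda>x. x) L M \<phi>"
  shows "sheaf_hom (Proj_space A) (tilde A L) (tilde A M) (tilde_map A A M (\<lambda>x. x) \<phi>)"
proof -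
  interpret graded_semilinear A A "\<lambda>x. x" L M \<phi> by fact
  interpret S: graded_semilinear A A "\<lambda>x. x" "self_module A" "self_module A" "\<lambda>x. x" by (rule self_graded_semilinear)
  have pre: "pre U = U" if "openin (zariski A) U" for U
    using openin_zariski_subset[OF that] Proj_map_id by auto
  \<comment> \<open>Semilinearity over the identity still passes scalars through
    \<open>tilde_map\<close>; comparison on one representing fraction at each point shows that this
    leaves them unchanged.\<close>
  have id: "tilde_map A A (self_module A) (\<lambda>x. x) (\<lambda>x. x) U a = a"
    if U: "openin (zariski A) U" and a: "a \<in> tilde_sections A (self_module A) U" for U a
  proof (rule extensionalityI[of _ U])
    show "tilde_map A A (self_module A) (\<lambda>x. x) (\<lambda>x. x) U a \<in> extensional U"
      using pre[OF U] by (simp add: tilde_map_def)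
    show "a \<in> extensional U"
      using a by (simp add: tilde_sections_extensional)
    fix p assume p: "p \<in> U"
    have pP: "p \<in> Proj A"
      using p openin_zariski_subset[OF U] by blast
    obtain r f where "(r, f) \<in> fracs A (self_module A) p" "a p = frac A (self_module A) p r f"
      using tilde_sections_stalk[OF a p] by (auto simp: stalk_def)
    then show "tilde_map A A (self_module A) (\<lambda>x. x) (\<lambda>x. x) U a p = a p"
      using p pP S.stalk_map_frac[OF pP] by (simp add: S.tilde_map_stalk Proj_map_id)
  qed
  show ?thesis
    unfolding sheaf_hom_def Proj_space_simps tilde_simps
  proof (intro conjI allI impI ballI)
    fix U assume U: "openin (zariski A) U"
    show "tilde_map A A M (\<lambda>x. x) \<phi> U \<in> tilde_sections A L U \<rightarrow> tilde_sections A M U"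
      using tilde_map_closed[OF U] unfolding pre[OF U] by (rule Pi_I)
    fix s assume s: "s \<in> tilde_sections A L U"
    show "tilde_map A A M (\<lambda>x. x) \<phi> U (\<lambda>p\<in>U. frac_add A L p (s p) (t p)) =
        (\<lambda>p\<in>U. frac_add A M p (tilde_map A A M (\<lambda>x. x) \<phi> U s p) (tilde_map A A M (\<lambda>x. x) \<phi> U t p))"
      if "t \<in> tilde_sections A L U" for t
      using tilde_map_add[OF s that] unfolding pre[OF U] .
    fix a assume a: "a \<in> carrier (rs_ring (Proj_space A) U)"
    then have a: "a \<in> tilde_sections A (self_module A) U"
      unfolding rs_ring_carrier .
    show "tilde_map A A M (\<lambda>x. x) \<phi> U (\<lambda>p\<in>U. frac_smult A L p (a p) (s p)) =
        (\<lambda>p\<in>U. frac_smult A M p (a p) (tilde_map A A M (\<lambda>x. x) \<phi> U s p))"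
      using tilde_map_smult[OF a s] unfolding pre[OF U] id[OF U a] .
  next
    fix U V s assume *: "openin (zariski A) U \<and> openin (zariski A) V \<and> V \<subseteq> U"
    then show "restrict (tilde_map A A M (\<lambda>x. x) \<phi> U s) V = tilde_map A A M (\<lambda>x. x) \<phi> V (restrict s V)"
      using tilde_map_restrict[of V U s] unfolding pre[OF conjunct1[OF conjunct2[OF *]]] by simp
  qed
qed

lemma tilde_map_id_value:
  assumes \<phi>: "graded_semilinear A A (\<lambda>x. x) L M \<phi>" and U: "openin (zariski A) U" "p \<in> U"
    and s: "(m, f) \<in> fracs A L p" "s p = frac A L p m f"
  shows "tilde_map A A M (\<lambda>x. x) \<phi> U s p = frac A M p (\<phi> m) f" "(\<phi> m, f) \<in> fracs A M p"
proof -
  have A: "graded_cring A"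
    using \<phi> by (simp add: graded_semilinear_def graded_surj_def)
  have p: "p \<in> Proj A"
    using U openin_zariski_subset by blast
  have id: "Proj_map A (\<lambda>x. x) p = p"
    by (rule graded_cring.Proj_map_id[OF A p])
  show "tilde_map A A M (\<lambda>x. x) \<phi> U s p = frac A M p (\<phi> m) f"
    unfolding graded_semilinear.tilde_map_stalk[OF \<phi>]
    using p U s graded_semilinear.stalk_map_frac[OF \<phi> p, of m f] by (simp add: id)
  show "(\<phi> m, f) \<in> fracs A M p"
    using graded_semilinear.fracs_map[OF \<phi>, of m f p] s by (simp add: id)
qed

lemma tilde_map_id_extensional:
  assumes "graded_semilinear A A (\<lambda>x. x) L M \<phi>" "openin (zariski A) U"
  shows "tilde_map A A M (\<lambda>x. x) \<phi> U s \<in> extensional U"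
proof -
  have A: "graded_cring A"
    using assms by (simp add: graded_semilinear_def graded_surj_def)
  then have "{q \<in> Proj A. Proj_map A (\<lambda>x. x) q \<in> U} = U"
    using openin_zariski_subset[OF assms(2)] graded_cring.Proj_map_id[OF A] by auto
  then show ?thesis
    by (simp add: tilde_map_def)
qed

section \<open>Exactness of the associated sequence\<close>

context graded_semilinear
begin

text \<open>Either \<open>p\<close> lies on the closed subscheme, or a homogeneous element of the
  kernel is nonzero at \<open>p\<close>; in the second case the direct image vanishes near
  \<open>p\<close>.\<close>

lemma kernel_dichotomy:
  assumes "p \<in> Proj A"
  obtains (point) q where "q \<in> Proj B" "Proj_map A \<pi> q = p"
    | (kernel) k h where "h \<in> hpart A k" "\<pi> h = \<zero>\<^bsub>B\<^esub>" "h \<notin> p"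
  using Proj_map_surj[OF assms] by (auto simp: homog_def)

lemma tilde_map_value:
  assumes q: "q \<in> Proj B" "Proj_map A \<pi> q \<in> U"
    and s: "(m, f) \<in> fracs A M (Proj_map A \<pi> q)" "s (Proj_map A \<pi> q) = frac A M (Proj_map A \<pi> q) m f"
  shows "tilde_map A B N \<pi> g U s q = frac B N q (g m) (\<pi> f)"
  unfolding tilde_map_stalk using assms stalk_map_frac by simp

text \<open>Write \<open>s\<close> as \<open>m/f\<close> near \<open>p\<close>. Once a homogeneous
  \<open>h\<close> outside \<open>p\<close> makes \<open>g\<close> vanish on the
  \<open>h\<close>-fold multiple of \<open>m\<close>, that multiple comes from some \<open>y\<close>
  in \<open>L\<close>, and \<open>y/(h f)\<close> is a local lift of \<open>s\<close>.\<close>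

lemma tilde_kernel_local:
  assumes mid: "\<And>i x. \<lbrakk>x \<in> mpart M (int i); g x = \<zero>\<^bsub>N\<^esub>\<rbrakk> \<Longrightarrow> \<exists>y\<in>mpart L (int i). \<phi> y = x"
    and \<phi>: "graded_semilinear A A (\<lambda>x. x) L M \<phi>"
    and U: "openin (zariski A) U" "p \<in> U" and s: "s \<in> tilde_sections A M U"
    and zero: "tilde_map A B N \<pi> g U s = (\<lambda>q\<in>pre U. frac B N q \<zero>\<^bsub>N\<^esub> \<one>\<^bsub>B\<^esub>)"
  shows "\<exists>V. openin (zariski A) V \<and> p \<in> V \<and> V \<subseteq> U \<and>
    (\<exists>t\<in>tilde_sections A L V. tilde_map A A M (\<lambda>x. x) \<phi> V t = restrict s V)"
proof -
  have L: "graded_mod A L"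
    using \<phi> by (simp add: graded_semilinear_def)
  have p: "p \<in> Proj A"
    using U openin_zariski_subset by blast
  from s U(2) obtain V m i f where 1: "openin (zariski A) V" "p \<in> V" "V \<subseteq> U" "m \<in> mpart M (int i)"
    "f \<in> hpart A i" "\<forall>q\<in>V. f \<notin> q" "\<forall>q\<in>V. s q = frac A M q m f" by (rule tilde_sectionsE)
  have mc: "m \<in> carrier M"
    using 1(4) by (rule mpart_carrier)
  have f: "f \<notin> p" "s p = frac A M p m f"
    using bspec[OF 1(6) 1(2)] bspec[OF 1(7) 1(2)] by simp_all
  \<comment> \<open>Off the subscheme, \<open>h\<close> is a kernel element; on it, \<open>h\<close>
    lifts the witness that the fraction of \<open>g m\<close> by \<open>\<pi> f\<close> is zero in
    the stalk.\<close>
  obtain k h where h: "h \<in> hpart A k" "h \<notin> p" "g (h \<odot>\<^bsub>M\<^esub> m) = \<zero>\<^bsub>N\<^esub>"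
    using p
  proof (cases rule: kernel_dichotomy)
    case (kernel k h)
    then show ?thesis
      using that[of h k] mc by (simp add: g_smult hpart_carrier g_closed)
  next
    case (point q)
    have fr: "(m, f) \<in> fracs A M (Proj_map A \<pi> q)"
      using 1 f point by (intro fracsI) auto
    have "frac B N q (g m) (\<pi> f) = frac B N q \<zero>\<^bsub>N\<^esub> \<one>\<^bsub>B\<^esub>"
      using tilde_map_value[OF point(1), of U m f s] fun_cong[OF zero, of q] U point f fr by simp
    then obtain b where b: "b \<in> homog B" "b \<notin> q" "b \<odot>\<^bsub>N\<^esub> g m = \<zero>\<^bsub>N\<^esub>"
      using N.frac_eq_zero_iff[OF point(1) fracs_map[OF fr]] by auto
    then obtain h where "h \<in> homog A" "\<pi> h = b"
      using homog_lift by blast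
    moreover from this obtain k where "h \<in> hpart A k"
      by (auto simp: homog_def)
    ultimately show ?thesis
      using that[of h k] b mc point(2) Proj_map_mem[of h q] by (simp add: g_smult homog_carrier)
  qed
  obtain y where y: "y \<in> mpart L (int (k + i))" "\<phi> y = h \<odot>\<^bsub>M\<^esub> m"
    using mid[OF mpart_smult'[OF h(1) 1(4)] h(3)] by blast
  define W where "W = V \<inter> {q \<in> Proj A. h \<notin> q}"
  have W: "openin (zariski A) W" "p \<in> W" "W \<subseteq> U" "W \<subseteq> V"
    using h(1,2) p 1(1-3) by (auto simp: W_def homog_def intro!: openin_Int openin_basic)
  have hf: "h \<otimes> f \<notin> q" "h \<notin> q" "f \<notin> q" "q \<in> Proj A" if "q \<in> W" for q
    using that bspec[OF 1(6), of q] h(1) 1(5) by (auto simp: W_def Proj_mult_iff hpart_carrier)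
  have hfp: "h \<otimes> f \<in> hpart A (k + i)"
    using h(1) 1(5) by (rule hpart_mult)
  let ?t = "\<lambda>q\<in>W. frac A L q y (h \<otimes> f)"
  have "?t \<in> tilde_sections A L W"
    by (rule graded_mod.tilde_sections_const[OF L W(1) y(1) hfp]) (rule hf)
  moreover have "tilde_map A A M (\<lambda>x. x) \<phi> W ?t = restrict s W"
  proof (rule extensionalityI[OF tilde_map_id_extensional[OF \<phi> W(1)]])
    fix q assume q: "q \<in> W"
    have fr: "(y, h \<otimes> f) \<in> fracs A L q"
      using graded_mod.fracsI[OF L y(1) hfp] hf[OF q] by blast
    have "tilde_map A A M (\<lambda>x. x) \<phi> W ?t q = frac A M q (h \<odot>\<^bsub>M\<^esub> m) (h \<otimes> f)"
      using tilde_map_id_value(1)[OF \<phi> W(1) q fr, of ?t] q by (simp add: y(2))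
    also have "\<dots> = frac A M q m f"
      by (rule frac_expand_hpart[OF hf(4)[OF q] h(1) hf(2)[OF q] 1(4,5) hf(3)[OF q]])
    finally show "tilde_map A A M (\<lambda>x. x) \<phi> W ?t q = restrict s W q"
      using bspec[OF 1(7), of q] q W(4) by auto
  qed simp
  ultimately show ?thesis
    using W by blast
qed

text \<open>A section that is \<open>n/b\<close> near \<open>q\<close> lifts to
  \<open>m/(u f)\<close>, where \<open>f\<close> is a homogeneous lift of \<open>b\<close> and
  \<open>g m\<close> is the \<open>\<pi> u\<close>-fold multiple of \<open>n\<close>.\<close>

lemma tilde_lift_local:
  assumes lift: "\<And>q. q \<in> Proj B \<Longrightarrow> \<exists>k. \<exists>u\<in>hpart A k. \<pi> u \<notin> q \<and>
      (\<forall>i. \<forall>n\<in>mpart N (int i). \<exists>m\<in>mpart M (int (k + i)). g m = \<pi> u \<odot>\<^bsub>N\<^esub> n)"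
    and U: "openin (zariski A) U" "p \<in> U" and t: "t \<in> tilde_sections B N (pre U)"
  shows "\<exists>V. openin (zariski A) V \<and> p \<in> V \<and> V \<subseteq> U \<and>
    (\<exists>s\<in>tilde_sections A M V. tilde_map A B N \<pi> g V s = restrict t (pre V))"
proof -
  have p: "p \<in> Proj A"
    using U openin_zariski_subset by blast
  then show ?thesis
  proof (cases rule: kernel_dichotomy)
    case (kernel k h)
    define V where "V = U \<inter> {q \<in> Proj A. h \<notin> q}"
    have V: "openin (zariski A) V" "p \<in> V" "V \<subseteq> U"
      using kernel p U by (auto simp: V_def homog_def intro!: openin_Int openin_basic)
    have "\<zero>\<^bsub>B\<^esub> \<in> q" if "q \<in> Proj B" for q
      using additive_subgroup.zero_closed[OF ideal.axioms(1)[OF primeideal.axioms(1)[OF B.Proj_prime[OF that]]]] .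
    then have e: "pre V = {}"
      using kernel by (auto simp: V_def Proj_map_mem hpart_carrier)
    \<comment> \<open>Where the kernel element \<open>h\<close> is nonzero the preimage of
      \<open>V\<close> is empty, so any section is a lift; zero is taken.\<close>
    have "(\<lambda>p\<in>V. frac A M p \<zero>\<^bsub>M\<^esub> \<one>) \<in> tilde_sections A M V"
      by (rule tilde_sections_const[OF V(1), of _ 0])
        (auto simp: hpart_one mpart_zero Proj_one dest: Proj_openin[OF V(1)])
    moreover have "tilde_map A B N \<pi> g V s = restrict t (pre V)" for s
      unfolding tilde_map_def e by (simp add: restrict_def)
    ultimately show ?thesis
      using V by blast
  next
    case (point q)
    then have "q \<in> pre U"
      using U by simp
    with t obtain W n i b where 1: "openin (zariski B) W" "q \<in> W" "W \<subseteq> pre U" "n \<in> mpart N (int i)"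
      "b \<in> hpart B i" "\<forall>q\<in>W. b \<notin> q" "\<forall>q\<in>W. t q = frac B N q n b" by (rule tilde_sectionsE)
    from 1(5) obtain f where f: "f \<in> hpart A i" "\<pi> f = b"
      unfolding hpart_image[symmetric] by blast
    obtain k u where u: "u \<in> hpart A k" "\<pi> u \<notin> q"
      and lu: "\<And>i n. n \<in> mpart N (int i) \<Longrightarrow> \<exists>m\<in>mpart M (int (k + i)). g m = \<pi> u \<odot>\<^bsub>N\<^esub> n"
      using lift[OF point(1)] by blast
    obtain m where m: "m \<in> mpart M (int (k + i))" "g m = \<pi> u \<odot>\<^bsub>N\<^esub> n"
      using lu[OF 1(4)] by blast
    \<comment> \<open>At every point of the preimage of \<open>V0\<close> the section
      \<open>t\<close> is the one fraction \<open>n/b\<close>.\<close>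
    obtain V0 where V0: "openin (zariski A) V0" "p \<in> V0" "V0 \<subseteq> U" "pre V0 \<subseteq> W"
      using pre_basis[OF 1(1,2) U(1)] U(2) point by auto
    define V where "V = V0 \<inter> {q \<in> Proj A. u \<otimes> f \<notin> q}"
    have uf: "u \<otimes> f \<in> hpart A (k + i)"
      by (rule hpart_mult[OF u(1) f(1)])
    have "u \<notin> p" "f \<notin> p"
      using u f bspec[OF 1(6,2)] by (auto simp: point(2)[symmetric] Proj_map_mem hpart_carrier)
    then have ufp: "u \<otimes> f \<notin> p"
      using u f p by (simp add: Proj_mult_iff hpart_carrier)
    have "openin (zariski A) {q \<in> Proj A. u \<otimes> f \<notin> q}"
      using uf by (intro openin_basic) (auto simp: homog_def)
    then have V: "openin (zariski A) V" "p \<in> V" "V \<subseteq> U"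
      using ufp V0(1-3) p unfolding V_def by (auto intro!: openin_Int)
    let ?s = "\<lambda>q\<in>V. frac A M q m (u \<otimes> f)"
    have "?s \<in> tilde_sections A M V"
      by (rule tilde_sections_const[OF V(1) m(1) uf]) (simp add: V_def)
    moreover have "tilde_map A B N \<pi> g V ?s = restrict t (pre V)"
    proof (rule extensionalityI[of _ "pre V"])
      show "tilde_map A B N \<pi> g V ?s \<in> extensional (pre V)"
        by (simp add: tilde_map_def)
      fix r assume r: "r \<in> pre V"
      then have rP: "r \<in> Proj B" "Proj_map A \<pi> r \<in> V" "r \<in> W"
        using V0(4) by (auto simp: V_def)
      have fr: "(m, u \<otimes> f) \<in> fracs A M (Proj_map A \<pi> r)"
        using rP by (intro fracsI[OF m(1) uf]) (simp add: V_def)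
      have ur: "\<pi> u \<notin> r" "b \<notin> r"
        using rP(1,2) u f by (auto simp: V_def Proj_map_mem hpart_carrier B.Proj_mult_iff)
      have "tilde_map A B N \<pi> g V ?s r = frac B N r (\<pi> u \<odot>\<^bsub>N\<^esub> n) (\<pi> u \<otimes>\<^bsub>B\<^esub> b)"
        using tilde_map_value[OF rP(1,2) fr, of ?s] rP(2) u f by (simp add: m(2) hpart_carrier)
      also have "\<dots> = frac B N r n b"
        by (rule N.frac_expand_hpart[OF rP(1) hpart_map[OF u(1)] ur(1) 1(4,5) ur(2)])
      finally show "tilde_map A B N \<pi> g V ?s r = restrict t (pre V) r"
        using bspec[OF 1(7) rP(3)] r by simp
    qed simp
    ultimately show ?thesis
      using V by blast
  qed
qed

text \<open>Numerators have the degree of their denominators, hence the degrees of the form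
  \<open>int i\<close> in \<open>mid\<close> and \<open>lift\<close>. The factor \<open>u\<close> in
  \<open>lift\<close> may depend on the point, which surjectivity as a map of sheaves
  permits.\<close>

theorem tilde_short_exact:
  assumes \<phi>: "graded_semilinear A A (\<lambda>x. x) L M \<phi>"
    and inj: "inj_on \<phi> (carrier L)"
    and comp: "\<And>y. y \<in> carrier L \<Longrightarrow> g (\<phi> y) = \<zero>\<^bsub>N\<^esub>"
    and mid: "\<And>i x. \<lbrakk>x \<in> mpart M (int i); g x = \<zero>\<^bsub>N\<^esub>\<rbrakk> \<Longrightarrow> \<exists>y\<in>mpart L (int i). \<phi> y = x"
    and lift: "\<And>q. q \<in> Proj B \<Longrightarrow> \<exists>k. \<exists>u\<in>hpart A k. \<pi> u \<notin> q \<and>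
      (\<forall>i. \<forall>n\<in>mpart N (int i). \<exists>m\<in>mpart M (int (k + i)). g m = \<pi> u \<odot>\<^bsub>N\<^esub> n)"
  shows "short_exact (Proj_space A) (tilde A L) (tilde_map A A M (\<lambda>x. x) \<phi>) (tilde A M)
    (tilde_map A B N \<pi> g) push"
proof -
  have L: "graded_mod A L"
    using \<phi> by (simp add: graded_semilinear_def)
  have inj_sec: "inj_on (tilde_map A A M (\<lambda>x. x) \<phi> U) (tilde_sections A L U)" if U: "openin (zariski A) U" for U
  proof (rule inj_onI, rule extensionalityI[of _ U])
    fix s t assume s: "s \<in> tilde_sections A L U" and t: "t \<in> tilde_sections A L U"
      and eq: "tilde_map A A M (\<lambda>x. x) \<phi> U s = tilde_map A A M (\<lambda>x. x) \<phi> U t"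
    show "s \<in> extensional U" "t \<in> extensional U"
      using s t tilde_sections_extensional by blast+
    fix p assume p: "p \<in> U"
    then have pP: "p \<in> Proj A"
      using openin_zariski_subset[OF U] by blast
    obtain i m n f where 1: "m \<in> mpart L (int i)" "n \<in> mpart L (int i)" "f \<in> hpart A i" "f \<notin> p"
      "s p = frac A L p m f" "t p = frac A L p n f"
      by (rule graded_mod.stalk_common2[OF L pP tilde_sections_stalk[OF s p] tilde_sections_stalk[OF t p]])
    have fr: "(m, f) \<in> fracs A L p" "(n, f) \<in> fracs A L p"
      using graded_mod.fracsI[OF L] 1 by blast+
    have c: "m \<in> carrier L" "n \<in> carrier L" "f \<in> carrier A"
      using graded_mod.mpart_carrier[OF L] 1 hpart_carrier by blast+
    have "frac A M p (\<phi> m) f = frac A M p (\<phi> n) f"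
      using tilde_map_id_value(1)[of A L M \<phi> U p m f s, OF \<phi> U p fr(1) 1(5)]
       tilde_map_id_value(1)[of A L M \<phi> U p n f t, OF \<phi> U p fr(2) 1(6)] eq by simp
    then obtain h where h: "h \<in> homog A" "h \<notin> p" "h \<odot>\<^bsub>M\<^esub> (f \<odot>\<^bsub>M\<^esub> \<phi> m) = h \<odot>\<^bsub>M\<^esub> (f \<odot>\<^bsub>M\<^esub> \<phi> n)"
      using frac_eq_iff[OF pP tilde_map_id_value(2)[of A L M \<phi> U p m f s, OF \<phi> U p fr(1) 1(5)]
        tilde_map_id_value(2)[of A L M \<phi> U p n f t, OF \<phi> U p fr(2) 1(6)]] by auto
    interpret L: graded_mod A L by (rule L)
    note sm = graded_semilinear.g_smult[OF \<phi>]
    have hc: "h \<in> carrier A"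
      using h(1) by (rule homog_carrier)
    \<comment> \<open>Localization keeps injectivity: a witness for equality of the images already
      is one for the original fractions.\<close>
    have "\<phi> (h \<odot>\<^bsub>L\<^esub> (f \<odot>\<^bsub>L\<^esub> m)) = \<phi> (h \<odot>\<^bsub>L\<^esub> (f \<odot>\<^bsub>L\<^esub> n))"
      using h(3) c hc sm[of h "f \<odot>\<^bsub>L\<^esub> m"] sm[of h "f \<odot>\<^bsub>L\<^esub> n"] sm[of f m] sm[of f n] by simp
    then have "h \<odot>\<^bsub>L\<^esub> (f \<odot>\<^bsub>L\<^esub> m) = h \<odot>\<^bsub>L\<^esub> (f \<odot>\<^bsub>L\<^esub> n)"
      using inj c hc by (auto dest: inj_onD)
    then show "s p = t p"
      unfolding 1(5,6) using L.frac_eq_iff[OF pP fr] h by auto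
  qed
  \<comment> \<open>The easy half of exactness in the middle, checked at each point: a local lift to
    \<open>L\<close> and \<open>comp\<close> make the value zero.\<close>
  have zero: "tilde_map A B N \<pi> g U s = (\<lambda>q\<in>pre U. frac B N q \<zero>\<^bsub>N\<^esub> \<one>\<^bsub>B\<^esub>)"
    if U: "openin (zariski A) U" and loc: "\<And>p. p \<in> U \<Longrightarrow> \<exists>V. openin (zariski A) V \<and> p \<in> V \<and> V \<subseteq> U \<and>
      (\<exists>t\<in>tilde_sections A L V. tilde_map A A M (\<lambda>x. x) \<phi> V t = restrict s V)" for U s
  proof (rule extensionalityI[of _ "pre U"])
    fix q assume q: "q \<in> pre U"
    then have qP: "q \<in> Proj B" and pP: "Proj_map A \<pi> q \<in> Proj A"
      by (auto simp: Proj_map_Proj)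
    obtain V t where V: "openin (zariski A) V" "Proj_map A \<pi> q \<in> V" "V \<subseteq> U"
      and t: "t \<in> tilde_sections A L V" "tilde_map A A M (\<lambda>x. x) \<phi> V t = restrict s V"
      using loc[of "Proj_map A \<pi> q"] q by blast
    obtain i m f where mf: "m \<in> mpart L (int i)" "f \<in> hpart A i" "f \<notin> Proj_map A \<pi> q"
      "t (Proj_map A \<pi> q) = frac A L (Proj_map A \<pi> q) m f"
      using tilde_sections_stalk[OF t(1) V(2)] by (rule stalkE)
    have fr: "(m, f) \<in> fracs A L (Proj_map A \<pi> q)"
      using graded_mod.fracsI[OF L] mf by blast
    have "s (Proj_map A \<pi> q) = frac A M (Proj_map A \<pi> q) (\<phi> m) f"
      using tilde_map_id_value(1)[of A L M \<phi> V _ m f t, OF \<phi> V(1,2) fr mf(4)] t(2) V(2) by simp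
    then have "tilde_map A B N \<pi> g U s q = frac B N q (g (\<phi> m)) (\<pi> f)"
      using q tilde_map_value[OF qP _ tilde_map_id_value(2)[of A L M \<phi> V _ m f t, OF \<phi> V(1,2) fr mf(4)], of U s]
      by simp
    also have "\<dots> = frac B N q \<zero>\<^bsub>N\<^esub> (\<pi> f)"
      using comp graded_mod.mpart_carrier[OF L mf(1)] by simp
    also have "\<dots> = frac B N q \<zero>\<^bsub>N\<^esub> \<one>\<^bsub>B\<^esub>"
      using mf by (intro N.frac_zero[OF qP hpart_map[OF mf(2)], symmetric]) (simp add: Proj_map_mem hpart_carrier)
    finally show "tilde_map A B N \<pi> g U s q = (\<lambda>q\<in>pre U. frac B N q \<zero>\<^bsub>N\<^esub> \<one>\<^bsub>B\<^esub>) q"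
      using q by simp
  qed (simp_all add: tilde_map_def)
  show ?thesis
    unfolding short_exact_def in_image_sheaf_def Proj_space_simps tilde_simps push_simps
  proof (intro conjI allI impI ballI)
    show "sheaf_of_modules (Proj_space A) (tilde A L)"
      by (rule graded_mod.tilde_sheaf_of_modules[OF L])
    show "sheaf_of_modules (Proj_space A) (tilde A M)"
      by (rule tilde_sheaf_of_modules)
    show "sheaf_of_modules (Proj_space A) push"
      by (rule push_sheaf_of_modules)
    show "sheaf_hom (Proj_space A) (tilde A L) (tilde A M) (tilde_map A A M (\<lambda>x. x) \<phi>)"
      by (rule tilde_sheaf_hom[OF \<phi>])
    show "sheaf_hom (Proj_space A) (tilde A M) push (tilde_map A B N \<pi> g)"
      by (rule push_sheaf_hom)
  next
    fix U assume U: "openin (zariski A) U"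
    show "inj_on (tilde_map A A M (\<lambda>x. x) \<phi> U) (tilde_sections A L U)"
      by (rule inj_sec[OF U])
    fix s assume s: "s \<in> tilde_sections A M U"
    show "(tilde_map A B N \<pi> g U s = (\<lambda>p\<in>pre U. frac B N p \<zero>\<^bsub>N\<^esub> \<one>\<^bsub>B\<^esub>)) =
      (\<forall>p\<in>U. \<exists>V. openin (zariski A) V \<and> p \<in> V \<and> V \<subseteq> U \<and>
        (\<exists>t\<in>tilde_sections A L V. tilde_map A A M (\<lambda>x. x) \<phi> V t = restrict s V))"
      (is "?lhs = ?rhs")
    proof
      assume ?lhs
      show ?rhs
      proof
        fix p assume "p \<in> U"
        show "\<exists>V. openin (zariski A) V \<and> p \<in> V \<and> V \<subseteq> U \<and>
            (\<exists>t\<in>tilde_sections A L V. tilde_map A A M (\<lambda>x. x) \<phi> V t = restrict s V)"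
          by (rule tilde_kernel_local[OF mid \<phi> U \<open>p \<in> U\<close> s \<open>?lhs\<close>])
      qed
    next
      assume ?rhs
      then show ?lhs
        by (intro zero[OF U]) (rule bspec)
    qed
  next
    fix U t p assume U: "openin (zariski A) U" and t: "t \<in> tilde_sections B N (pre U)" and p: "p \<in> U"
    show "\<exists>V. openin (zariski A) V \<and> p \<in> V \<and> V \<subseteq> U \<and>
        (\<exists>s\<in>tilde_sections A M V. tilde_map A B N \<pi> g V s = restrict t (pre V))"
      by (rule tilde_lift_local[OF lift U p t])
  qed
qed

end

section \<open>Local bases\<close>

context graded_mod
begin

text \<open>Evaluation at a point is additive, so linear relations between sections may be tested in
  the stalks.\<close>

lemma finsum_sections:
  assumes U: "openin (zariski A) U" "p \<in> U" and F: "finite F" and f: "f \<in> F \<rightarrow> tilde_sections A M U"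
  shows "finsum (sm_sec (tilde A M) U) f F p = finsum (stalk_mod A M p) (\<lambda>j. f j p) F"
proof -
  have p: "p \<in> Proj A"
    using U openin_zariski_subset by blast
  interpret S: Module.module "rs_ring (Proj_space A) U" "sm_sec (tilde A M) U"
    by (rule sm_sec_module[OF U(1)])
  interpret T: abelian_group "stalk_mod A M p"
    by (rule stalk_abelian_group[OF p])
  show ?thesis
    using F f
  proof (induction F rule: finite_induct)
    case empty
    then show ?case
      unfolding S.M.finsum_empty T.finsum_empty using U by (simp add: tilde_simps stalk_mod_def)
  next
    case (insert j F)
    have 1: "f \<in> F \<rightarrow> carrier (sm_sec (tilde A M) U)" "f j \<in> carrier (sm_sec (tilde A M) U)"
      using insert.prems by (auto simp: tilde_simps)
    have 2: "(\<lambda>j. f j p) \<in> F \<rightarrow> carrier (stalk_mod A M p)" "f j p \<in> carrier (stalk_mod A M p)"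
      using insert.prems tilde_sections_stalk[OF _ U(2)] by (auto simp: stalk_mod_def)
    have IH: "finsum (sm_sec (tilde A M) U) f F p = finsum (stalk_mod A M p) (\<lambda>j. f j p) F"
      using insert.IH insert.prems by blast
    show ?case
      unfolding S.M.finsum_insert[OF insert.hyps 1] T.finsum_insert[OF insert.hyps 2] IH[symmetric]
      using U by (simp add: tilde_simps stalk_mod_def)
  qed
qed

lemma finsum_frac:
  assumes p: "p \<in> Proj A" and F: "finite F" and m: "\<And>j. j \<in> F \<Longrightarrow> m j \<in> mpart M (int i)"
    and f: "f \<in> hpart A i" "f \<notin> p"
  shows "finsum (stalk_mod A M p) (\<lambda>j. frac A M p (m j) f) F = frac A M p (finsum M m F) f \<and>
    finsum M m F \<in> mpart M (int i)"
proof -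
  interpret T: abelian_group "stalk_mod A M p"
    by (rule stalk_abelian_group[OF p])
  show ?thesis
    using F m
  proof (induction F rule: finite_induct)
    case empty
    then show ?case
      unfolding T.finsum_empty M.finsum_empty using frac_zero[OF p f] mpart_zero by (simp add: stalk_mod_def)
  next
    case (insert j F)
    have IH: "finsum (stalk_mod A M p) (\<lambda>j. frac A M p (m j) f) F = frac A M p (finsum M m F) f"
        "finsum M m F \<in> mpart M (int i)"
      using insert.IH insert.prems by auto
    have "m \<in> F \<rightarrow> carrier M" "m j \<in> carrier M"
      using insert.prems mpart_carrier by auto
    then have 1: "finsum M m (insert j F) = m j \<oplus>\<^bsub>M\<^esub> finsum M m F"
      by (rule M.finsum_insert[OF insert.hyps])
    have "(\<lambda>j. frac A M p (m j) f) \<in> F \<rightarrow> carrier (stalk_mod A M p)"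
        "frac A M p (m j) f \<in> carrier (stalk_mod A M p)"
      using insert.prems f by (auto simp: stalk_mod_def intro!: stalkI fracsI)
    then have 2: "finsum (stalk_mod A M p) (\<lambda>j. frac A M p (m j) f) (insert j F) =
        frac A M p (m j) f \<oplus>\<^bsub>stalk_mod A M p\<^esub> finsum (stalk_mod A M p) (\<lambda>j. frac A M p (m j) f) F"
      by (rule T.finsum_insert[OF insert.hyps])
    have mj: "m j \<in> mpart M (int i)"
      using insert.prems by simp
    show ?case
      unfolding 1 2 IH(1) using frac_add_same[OF p mj IH(2) f] mpart_add[OF mj IH(2)]
      by (simp add: stalk_mod_def)
  qed
qed

lemma stalk_common:
  assumes p: "p \<in> Proj A" and F: "finite F" and X: "\<And>j. j \<in> F \<Longrightarrow> X j \<in> stalk A M p"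
  shows "\<exists>i m f. f \<in> hpart A i \<and> f \<notin> p \<and> (\<forall>j\<in>F. m j \<in> mpart M (int i) \<and> X j = frac A M p (m j) f)"
  using F X
proof (induction F rule: finite_induct)
  case empty
  then show ?case
    using hpart_one Proj_one[OF p] by blast
next
  case (insert k F)
  then obtain i m f where 1: "f \<in> hpart A i" "f \<notin> p" "\<forall>j\<in>F. m j \<in> mpart M (int i) \<and> X j = frac A M p (m j) f"
    by auto
  obtain l n h where 2: "n \<in> mpart M (int l)" "h \<in> hpart A l" "h \<notin> p" "X k = frac A M p n h"
    using insert.prems[of k] by (auto elim: stalkE)
  define m' where "m' = (\<lambda>j. if j = k then f \<odot>\<^bsub>M\<^esub> n else h \<odot>\<^bsub>M\<^esub> m j)"
  have "m' j \<in> mpart M (int (i + l)) \<and> X j = frac A M p (m' j) (f \<otimes> h)" if "j \<in> insert k F" for j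
  proof (cases "j = k")
    case True
    then show ?thesis
      using frac_expand_hpart[OF p 1(1,2) 2(1-3)] mpart_smult'[OF 1(1) 2(1)] 2(4) by (simp add: m'_def)
  next
    case False
    with that have j: "m j \<in> mpart M (int i)" "X j = frac A M p (m j) f"
      using 1(3) by auto
    have "f \<otimes> h = h \<otimes> f"
      using 1 2 by (simp add: m_comm hpart_carrier)
    then show ?thesis
      using frac_expand_hpart[OF p 2(2,3) j(1) 1(1,2)] mpart_smult'[OF 2(2) j(1)] j(2) False
      by (simp add: m'_def add.commute)
  qed
  moreover have "f \<otimes> h \<in> hpart A (i + l)" "f \<otimes> h \<notin> p"
    using 1 2 p by (auto intro: hpart_mult simp: Proj_mult_iff hpart_carrier)
  ultimately show ?case by blast
qed

end

text \<open>The linear form \<open>z\<close> serves to turn \<open>e j\<close> into a fraction of degree \<open>0\<close>.\<close>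

locale local_basis = graded_mod A M for A :: "('a, 'm) graded_ring_scheme" (structure) and M :: "('a, 'b) graded_module" +
  fixes n :: nat and k :: nat and u z :: 'a and d :: "nat \<Rightarrow> nat" and e :: "nat \<Rightarrow> 'b"
  assumes u: "u \<in> hpart A k" and z: "z \<in> hpart A 1"
    and e: "j < n \<Longrightarrow> e j \<in> mpart M (int (d j))"
    and span: "m \<in> mpart M (int i) \<Longrightarrow> \<exists>c. (\<forall>j<n. c j \<in> mpart (self_module A) (int (k + i) - int (d j))) \<and>
       u \<odot>\<^bsub>M\<^esub> m = finsum M (\<lambda>j. c j \<odot>\<^bsub>M\<^esub> e j) {..<n}"
    and indep: "\<lbrakk>\<And>j. j < n \<Longrightarrow> c j \<in> carrier A; \<And>j. j < n \<Longrightarrow> c' j \<in> carrier A;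
       finsum M (\<lambda>j. c j \<odot>\<^bsub>M\<^esub> e j) {..<n} = finsum M (\<lambda>j. c' j \<odot>\<^bsub>M\<^esub> e j) {..<n}; j < n\<rbrakk> \<Longrightarrow> c j = c' j"
begin

definition e_frac :: "'a set \<Rightarrow> nat \<Rightarrow> ('b \<times> 'a) set" where
  "e_frac p j = frac A M p (e j) (z [^] d j)"

lemma zd: "z [^] (i::nat) \<in> hpart A i"
  using hpart_pow[OF z, of i] by simp

lemma zdp: "\<lbrakk>p \<in> Proj A; z \<notin> p\<rbrakk> \<Longrightarrow> z [^] (i::nat) \<notin> p"
  using Proj_pow z hpart_carrier by blast

text \<open>The degree \<open>int i - int j\<close> may be negative; then \<open>c\<close> is zero
  by the convention of \<open>self_module\<close>, and the claims hold trivially.\<close>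

lemma coeff_part:
  assumes "c \<in> mpart (self_module A) (int i - int j)"
  shows "c \<otimes> z [^] j \<in> hpart A i" "x \<in> mpart M (int j) \<Longrightarrow> c \<odot>\<^bsub>M\<^esub> x \<in> mpart M (int i)" "c \<in> carrier A"
proof -
  have "c \<otimes> z [^] j \<in> hpart A i \<and> (x \<in> mpart M (int j) \<longrightarrow> c \<odot>\<^bsub>M\<^esub> x \<in> mpart M (int i)) \<and> c \<in> carrier A"
  proof (cases "i < j")
    case True
    then show ?thesis
      using assms zd[of j] by (auto simp: self_module_mpart hpart_zero hpart_carrier mpart_zero mpart_carrier)
  next
    case False
    then have "c \<in> hpart A (i - j)"
      using assms by (simp add: self_module_mpart nat_diff_distrib)
    then show ?thesis
      using hpart_mult[OF _ zd, of c "i - j" j] mpart_smult'[of c "i - j" x j] False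
      by (simp add: hpart_carrier)
  qed
  then show "c \<otimes> z [^] j \<in> hpart A i" "x \<in> mpart M (int j) \<Longrightarrow> c \<odot>\<^bsub>M\<^esub> x \<in> mpart M (int i)" "c \<in> carrier A"
    by auto
qed

lemma coeff_term:
  assumes p: "p \<in> Proj A" "z \<notin> p" and j: "j < n" and r: "r \<in> hpart A i" "f \<in> hpart A i" "f \<notin> p"
  shows "frac_smult A M p (frac A (self_module A) p r f) (e_frac p j) = frac A M p (r \<odot>\<^bsub>M\<^esub> e j) (f \<otimes> z [^] d j)"
proof -
  interpret S: graded_mod A "self_module A" by (rule self_graded_mod)
  show ?thesis
    unfolding e_frac_def
    using r by (intro frac_smult_frac(1)[OF p(1)] S.fracsI[of _ i] fracsI[OF e[OF j] zd zdp[OF p]]) simp_all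
qed

text \<open>The powers of \<open>z\<close> cancel: \<open>c j z^(d j) / (u f)\<close> times
  \<open>e j / z^(d j)\<close> is \<open>c j e j / (u f)\<close>, and the sum of these is
  \<open>u m / (u f)\<close>, that is \<open>m/f\<close>.\<close>

lemma stalk_span:
  assumes p: "p \<in> Proj A" "z \<notin> p" "u \<notin> p" and m: "m \<in> mpart M (int i)" "f \<in> hpart A i" "f \<notin> p"
    and c: "\<And>j. j < n \<Longrightarrow> c j \<in> mpart (self_module A) (int (k + i) - int (d j))"
    and eq: "u \<odot>\<^bsub>M\<^esub> m = finsum M (\<lambda>j. c j \<odot>\<^bsub>M\<^esub> e j) {..<n}"
  shows "frac A M p m f = finsum (stalk_mod A M p)
    (\<lambda>j. frac_smult A M p (frac A (self_module A) p (c j \<otimes> z [^] d j) (u \<otimes> f)) (e_frac p j)) {..<n}"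
proof -
  interpret T: abelian_group "stalk_mod A M p"
    by (rule stalk_abelian_group[OF p(1)])
  have uf: "u \<otimes> f \<in> hpart A (k + i)" "u \<otimes> f \<notin> p"
    using m p u by (auto intro: hpart_mult simp: Proj_mult_iff hpart_carrier)
  have *: "frac_smult A M p (frac A (self_module A) p (c j \<otimes> z [^] d j) (u \<otimes> f)) (e_frac p j) =
      frac A M p (c j \<odot>\<^bsub>M\<^esub> e j) (u \<otimes> f)" if j: "j < n" for j
  proof -
    note cj = coeff_part[OF c[OF j]]
    have ej: "e j \<in> carrier M"
      using e[OF j] by (rule mpart_carrier)
    have ufc: "u \<otimes> f \<in> carrier A" "z [^] d j \<in> carrier A"
      using uf zd hpart_carrier by blast+
    have "frac_smult A M p (frac A (self_module A) p (c j \<otimes> z [^] d j) (u \<otimes> f)) (e_frac p j) =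
        frac A M p (z [^] d j \<odot>\<^bsub>M\<^esub> (c j \<odot>\<^bsub>M\<^esub> e j)) (z [^] d j \<otimes> (u \<otimes> f))"
      using coeff_term[OF p(1,2) j cj(1) uf] cj(3) ej ufc by (simp add: smult_assoc1 smult_lcomm m_comm)
    also have "\<dots> = frac A M p (c j \<odot>\<^bsub>M\<^esub> e j) (u \<otimes> f)"
      by (rule frac_expand_hpart[OF p(1) zd zdp[OF p(1,2)] cj(2)[OF e[OF j]] uf])
    finally show ?thesis .
  qed
  have ce: "c j \<odot>\<^bsub>M\<^esub> e j \<in> mpart M (int (k + i))" if "j \<in> {..<n}" for j
    using that coeff_part(2)[OF c e] by simp
  have "finsum (stalk_mod A M p)
      (\<lambda>j. frac_smult A M p (frac A (self_module A) p (c j \<otimes> z [^] d j) (u \<otimes> f)) (e_frac p j)) {..<n} =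
      finsum (stalk_mod A M p) (\<lambda>j. frac A M p (c j \<odot>\<^bsub>M\<^esub> e j) (u \<otimes> f)) {..<n}"
    by (rule T.finsum_cong') (auto simp: * stalk_mod_def intro!: stalkI fracsI ce uf)
  also have "\<dots> = frac A M p (u \<odot>\<^bsub>M\<^esub> m) (u \<otimes> f)"
    using finsum_frac[OF p(1) finite_lessThan[of n] ce uf] by (simp add: eq)
  also have "\<dots> = frac A M p m f"
    by (rule frac_expand_hpart[OF p(1) u p(3) m])
  finally show ?thesis ..
qed

text \<open>Clearing all denominators turns a relation between fractions into one in
  \<open>M\<close>, to which \<open>indep\<close> applies. Nothing can be cancelled in
  \<open>A\<close>, so the common factor is kept and becomes the witness for equality of the
  coefficient fractions.\<close>

lemma stalk_indep:
  assumes p: "p \<in> Proj A" "z \<notin> p"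
    and C: "\<And>j. j < n \<Longrightarrow> C j \<in> stalk A (self_module A) p" "\<And>j. j < n \<Longrightarrow> C' j \<in> stalk A (self_module A) p"
    and eq: "finsum (stalk_mod A M p) (\<lambda>j. frac_smult A M p (C j) (e_frac p j)) {..<n} =
      finsum (stalk_mod A M p) (\<lambda>j. frac_smult A M p (C' j) (e_frac p j)) {..<n}"
    and j: "j < n"
  shows "C j = C' j"
proof -
  interpret S: graded_mod A "self_module A" by (rule self_graded_mod)
  interpret T: abelian_group "stalk_mod A M p"
    by (rule stalk_abelian_group[OF p(1)])
  \<comment> \<open>The index set is doubled by a truth value so that \<open>C\<close> and
    \<open>C'\<close> get one common denominator \<open>f\<close>.\<close>
  have "\<exists>i R f. f \<in> hpart A i \<and> f \<notin> p \<and> (\<forall>x\<in>{..<n} \<times> (UNIV :: bool set). R x \<in> mpart (self_module A) (int i) \<and>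
      (if snd x then C (fst x) else C' (fst x)) = frac A (self_module A) p (R x) f)"
    by (rule S.stalk_common[OF p(1)]) (auto simp: C)
  then obtain i f and R :: "nat \<times> bool \<Rightarrow> 'a" where f: "f \<in> hpart A i" "f \<notin> p"
    and R: "\<forall>x\<in>{..<n} \<times> UNIV. R x \<in> mpart (self_module A) (int i) \<and>
      (if snd x then C (fst x) else C' (fst x)) = frac A (self_module A) p (R x) f"
    by blast
  define r where "r = (\<lambda>j. R (j, True))"
  define r' where "r' = (\<lambda>j. R (j, False))"
  have r: "r j \<in> hpart A i" "C j = frac A (self_module A) p (r j) f"
      "r' j \<in> hpart A i" "C' j = frac A (self_module A) p (r' j) f" if "j < n" for j
    using that R[rule_format, of "(j, True)"] R[rule_format, of "(j, False)"] by (auto simp: r_def r'_def)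
  \<comment> \<open>\<open>K\<close> bounds every \<open>d j\<close>, so \<open>z [^] K\<close>
    clears the different powers of \<open>z\<close> in the denominators of the
    \<open>e_frac p j\<close>.\<close>
  define K where "K = (\<Sum>j<n. d j)"
  have dK: "d j \<le> K" if "j < n" for j
    using that unfolding K_def by (intro member_le_sum) auto
  let ?F = "f \<otimes> z [^] K"
  have F: "?F \<in> hpart A (i + K)" "?F \<notin> p"
    using f zd[of K] zdp[OF p, of K] p by (auto intro: hpart_mult simp: Proj_mult_iff hpart_carrier)
  have part: "(z [^] (K - d j) \<otimes> s) \<odot>\<^bsub>M\<^esub> e j \<in> mpart M (int (i + K))" if "j < n" "s \<in> hpart A i" for s j
    using mpart_smult'[OF hpart_mult[OF zd[of "K - d j"] that(2)] e[OF that(1)]] dK[OF that(1)]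
    by (simp add: add.commute add.left_commute)
  have term_eq: "frac_smult A M p (frac A (self_module A) p s f) (e_frac p j) =
      frac A M p ((z [^] (K - d j) \<otimes> s) \<odot>\<^bsub>M\<^esub> e j) ?F" if j: "j < n" and s: "s \<in> hpart A i" for s j
  proof -
    have fr: "(s \<odot>\<^bsub>M\<^esub> e j) \<in> mpart M (int (i + d j))" "f \<otimes> z [^] d j \<in> hpart A (i + d j)" "f \<otimes> z [^] d j \<notin> p"
      using s f zd[of "d j"] zdp[OF p, of "d j"] p mpart_smult'[OF s e[OF j]]
      by (auto intro: hpart_mult simp: Proj_mult_iff hpart_carrier)
    have c: "s \<in> carrier A" "f \<in> carrier A" "z \<in> carrier A" "e j \<in> carrier M"
      using s f z e[OF j] hpart_carrier mpart_carrier by blast+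
    have "z [^] (K - d j) \<otimes> (f \<otimes> z [^] d j) = f \<otimes> (z [^] (K - d j) \<otimes> z [^] d j)"
      using c by (simp add: m_lcomm)
    also have "\<dots> = ?F"
      using c dK[OF j] by (simp add: nat_pow_mult)
    finally have "z [^] (K - d j) \<otimes> (f \<otimes> z [^] d j) = ?F" .
    then show ?thesis
      using coeff_term[OF p j s f] frac_expand_hpart[OF p(1) zd[of "K - d j"] zdp[OF p] fr] c
      by (simp add: smult_assoc1)
  qed
  have sum: "finsum (stalk_mod A M p) (\<lambda>j. frac_smult A M p (X j) (e_frac p j)) {..<n} =
      frac A M p (finsum M (\<lambda>j. (z [^] (K - d j) \<otimes> s j) \<odot>\<^bsub>M\<^esub> e j) {..<n}) ?F \<and>
      finsum M (\<lambda>j. (z [^] (K - d j) \<otimes> s j) \<odot>\<^bsub>M\<^esub> e j) {..<n} \<in> mpart M (int (i + K))"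
    if s: "\<And>j. j < n \<Longrightarrow> s j \<in> hpart A i" "\<And>j. j < n \<Longrightarrow> X j = frac A (self_module A) p (s j) f" for s X
  proof -
    have "finsum (stalk_mod A M p) (\<lambda>j. frac_smult A M p (X j) (e_frac p j)) {..<n} =
        finsum (stalk_mod A M p) (\<lambda>j. frac A M p ((z [^] (K - d j) \<otimes> s j) \<odot>\<^bsub>M\<^esub> e j) ?F) {..<n}"
      by (rule T.finsum_cong') (auto simp: s term_eq stalk_mod_def intro!: stalkI fracsI part F)
    then show ?thesis
      using finsum_frac[OF p(1) finite_lessThan[of n] _ F, of "\<lambda>j. (z [^] (K - d j) \<otimes> s j) \<odot>\<^bsub>M\<^esub> e j"]
        part s by simp
  qed
  note sr = sum[of r C, OF r(1,2)] and sr' = sum[of r' C', OF r(3,4)]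
  let ?m = "finsum M (\<lambda>j. (z [^] (K - d j) \<otimes> r j) \<odot>\<^bsub>M\<^esub> e j) {..<n}"
  let ?m' = "finsum M (\<lambda>j. (z [^] (K - d j) \<otimes> r' j) \<odot>\<^bsub>M\<^esub> e j) {..<n}"
  have fr: "(?m, ?F) \<in> fracs A M p" "(?m', ?F) \<in> fracs A M p"
    using fracsI[OF conjunct2[OF sr] F] fracsI[OF conjunct2[OF sr'] F] by blast+
  have "frac A M p ?m ?F = frac A M p ?m' ?F"
    using sr sr' eq by simp
  then obtain h where h: "h \<in> homog A" "h \<notin> p" "h \<odot>\<^bsub>M\<^esub> (?F \<odot>\<^bsub>M\<^esub> ?m) = h \<odot>\<^bsub>M\<^esub> (?F \<odot>\<^bsub>M\<^esub> ?m')"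
    using frac_eq_iff[OF p(1) fr] by auto
  have c: "h \<in> carrier A" "f \<in> carrier A" "z \<in> carrier A" "?F \<in> carrier A"
    using homog_carrier[OF h(1)] f z F hpart_carrier by blast+
  have dist: "h \<odot>\<^bsub>M\<^esub> (?F \<odot>\<^bsub>M\<^esub> finsum M (\<lambda>j. (z [^] (K - d j) \<otimes> s j) \<odot>\<^bsub>M\<^esub> e j) {..<n}) =
      finsum M (\<lambda>j. (h \<otimes> ?F \<otimes> z [^] (K - d j) \<otimes> s j) \<odot>\<^bsub>M\<^esub> e j) {..<n}"
    if s: "\<And>j. j < n \<Longrightarrow> s j \<in> carrier A" for s
  proof -
    have ec: "e j \<in> carrier M" if "j < n" for j
      using e[OF that] by (rule mpart_carrier)
    have "h \<odot>\<^bsub>M\<^esub> (?F \<odot>\<^bsub>M\<^esub> finsum M (\<lambda>j. (z [^] (K - d j) \<otimes> s j) \<odot>\<^bsub>M\<^esub> e j) {..<n}) =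
      finsum M (\<lambda>j. (h \<otimes> ?F) \<odot>\<^bsub>M\<^esub> ((z [^] (K - d j) \<otimes> s j) \<odot>\<^bsub>M\<^esub> e j)) {..<n}"
      using c s ec by (subst finsum_smult_ldistr[symmetric]) (auto simp: smult_assoc1)
    also have "\<dots> = finsum M (\<lambda>j. (h \<otimes> ?F \<otimes> z [^] (K - d j) \<otimes> s j) \<odot>\<^bsub>M\<^esub> e j) {..<n}"
      using c s ec by (intro M.finsum_cong') (auto simp: smult_assoc1 m_assoc)
    finally show ?thesis .
  qed
  have rc: "r j \<in> carrier A" "r' j \<in> carrier A" if "j < n" for j
    using r[OF that] hpart_carrier by blast+
  have "finsum M (\<lambda>j. (h \<otimes> ?F \<otimes> z [^] (K - d j) \<otimes> r j) \<odot>\<^bsub>M\<^esub> e j) {..<n} =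
      finsum M (\<lambda>j. (h \<otimes> ?F \<otimes> z [^] (K - d j) \<otimes> r' j) \<odot>\<^bsub>M\<^esub> e j) {..<n}"
    using h(3) dist[of r, OF rc(1)] dist[of r', OF rc(2)] by simp
  then have "h \<otimes> ?F \<otimes> z [^] (K - d j) \<otimes> r j = h \<otimes> ?F \<otimes> z [^] (K - d j) \<otimes> r' j"
    using c rc j by (intro indep[of "\<lambda>j. h \<otimes> ?F \<otimes> z [^] (K - d j) \<otimes> r j"
        "\<lambda>j. h \<otimes> ?F \<otimes> z [^] (K - d j) \<otimes> r' j" j]) auto
  \<comment> \<open>Regrouped so that the factor in front is homogeneous and outside
    \<open>p\<close>, as a witness for equality of \<open>r j / f\<close> and
    \<open>r' j / f\<close> has to be.\<close>
  then have "(h \<otimes> (z [^] K \<otimes> z [^] (K - d j))) \<otimes> (f \<otimes> r j) = (h \<otimes> (z [^] K \<otimes> z [^] (K - d j))) \<otimes> (f \<otimes> r' j)"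
    using c rc[OF j] by (simp add: m_ac)
  moreover have "h \<otimes> (z [^] K \<otimes> z [^] (K - d j)) \<in> homog A - p"
  proof
    have zh: "z [^] (i::nat) \<in> homog A" for i
      using zd[of i] by (auto simp: homog_def)
    show "h \<otimes> (z [^] K \<otimes> z [^] (K - d j)) \<in> homog A"
      by (intro homog_mult h(1) zh)
    show "h \<otimes> (z [^] K \<otimes> z [^] (K - d j)) \<notin> p"
      using h(2) c zdp[OF p] p(1) by (simp add: Proj_mult_iff)
  qed
  ultimately have "frac A (self_module A) p (r j) f = frac A (self_module A) p (r' j) f"
    using r[OF j] f by (subst S.frac_eq_iff[OF p(1)]) (auto intro: S.fracsI)
  then show ?thesis
    using r[OF j] by simp
qed

lemma stalk_coordinates:
  assumes p: "p \<in> Proj A" "z \<notin> p" "u \<notin> p" and X: "X \<in> stalk A M p"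
  shows "\<exists>!C. C \<in> {..<n} \<rightarrow>\<^sub>E stalk A (self_module A) p \<and>
    X = finsum (stalk_mod A M p) (\<lambda>j. frac_smult A M p (C j) (e_frac p j)) {..<n}"
proof (rule ex_ex1I)
  interpret S: graded_mod A "self_module A" by (rule self_graded_mod)
  interpret T: abelian_group "stalk_mod A M p"
    by (rule stalk_abelian_group[OF p(1)])
  from X obtain i m f where m: "m \<in> mpart M (int i)" "f \<in> hpart A i" "f \<notin> p" "X = frac A M p m f"
    by (rule stalkE)
  obtain c where c: "\<And>j. j < n \<Longrightarrow> c j \<in> mpart (self_module A) (int (k + i) - int (d j))"
    "u \<odot>\<^bsub>M\<^esub> m = finsum M (\<lambda>j. c j \<odot>\<^bsub>M\<^esub> e j) {..<n}"
    using span[OF m(1)] by blast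
  have uf: "u \<otimes> f \<in> hpart A (k + i)" "u \<otimes> f \<notin> p"
    using m p u by (auto intro: hpart_mult simp: Proj_mult_iff hpart_carrier)
  define C where "C = (\<lambda>j\<in>{..<n}. frac A (self_module A) p (c j \<otimes> z [^] d j) (u \<otimes> f))"
  have mem: "frac A (self_module A) p (c j \<otimes> z [^] d j) (u \<otimes> f) \<in> stalk A (self_module A) p" if "j < n" for j
    using coeff_part(1)[OF c(1)[OF that]] uf by (intro S.stalkI S.fracsI[of _ "k + i"]) (simp_all only: self_module_simps simp_thms)
  have ef: "e_frac p j \<in> stalk A M p" if "j < n" for j
    unfolding e_frac_def by (intro stalkI fracsI[OF e[OF that] zd zdp[OF p(1,2)]])
  have "finsum (stalk_mod A M p) (\<lambda>j. frac_smult A M p (C j) (e_frac p j)) {..<n} =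
      finsum (stalk_mod A M p)
        (\<lambda>j. frac_smult A M p (frac A (self_module A) p (c j \<otimes> z [^] d j) (u \<otimes> f)) (e_frac p j)) {..<n}"
    by (rule T.finsum_cong') (auto simp: C_def stalk_mod_def intro!: frac_smult_closed[OF p(1)] mem ef)
  also have "\<dots> = X"
    using stalk_span[OF p m(1-3) c] m(4) by simp
  finally show "\<exists>C. C \<in> {..<n} \<rightarrow>\<^sub>E stalk A (self_module A) p \<and>
      X = finsum (stalk_mod A M p) (\<lambda>j. frac_smult A M p (C j) (e_frac p j)) {..<n}"
    using mem by (intro exI[of _ C]) (auto simp: C_def)
next
  fix C C' assume "C \<in> {..<n} \<rightarrow>\<^sub>E stalk A (self_module A) p \<and>
      X = finsum (stalk_mod A M p) (\<lambda>j. frac_smult A M p (C j) (e_frac p j)) {..<n}"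
    "C' \<in> {..<n} \<rightarrow>\<^sub>E stalk A (self_module A) p \<and>
      X = finsum (stalk_mod A M p) (\<lambda>j. frac_smult A M p (C' j) (e_frac p j)) {..<n}"
  then have C: "C \<in> {..<n} \<rightarrow>\<^sub>E stalk A (self_module A) p" "C' \<in> {..<n} \<rightarrow>\<^sub>E stalk A (self_module A) p"
    and eq: "finsum (stalk_mod A M p) (\<lambda>j. frac_smult A M p (C j) (e_frac p j)) {..<n} =
      finsum (stalk_mod A M p) (\<lambda>j. frac_smult A M p (C' j) (e_frac p j)) {..<n}"
    by auto
  show "C = C'"
    using stalk_indep[OF p(1,2) _ _ eq] C by (intro PiE_ext[OF C]) auto
qed

definition U where "U = {q \<in> Proj A. u \<otimes> z \<notin> q}"

definition E where "E j = (\<lambda>p\<in>U. e_frac p j)"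

lemma U_open: "openin (zariski A) U"
  unfolding U_def using hpart_mult[OF u z] by (intro openin_basic) (auto simp: homog_def)

lemma U_D: "p \<in> U \<Longrightarrow> p \<in> Proj A \<and> z \<notin> p \<and> u \<notin> p"
  using hpart_carrier[OF u] hpart_carrier[OF z] by (auto simp: U_def Proj_mult_iff)

lemma E_section: "j < n \<Longrightarrow> E j \<in> tilde_sections A M U"
  unfolding E_def e_frac_def using zdp U_D by (intro tilde_sections_const[OF U_open e zd]) auto

text \<open>The coefficients are forced pointwise by \<open>stalk_coordinates\<close>; what remains
  is that they are sections. Where \<open>s\<close> is one fraction \<open>m/f\<close>,
  \<open>stalk_span\<close> gives stalk coordinates whose numerators and denominators do not depend
  on the point, and uniqueness identifies them with the chosen values.\<close>

lemma basis_sections: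
  assumes V: "openin (zariski A) V" "V \<subseteq> U" and s: "s \<in> tilde_sections A M V"
  shows "\<exists>!c. c \<in> {..<n} \<rightarrow>\<^sub>E carrier (rs_ring (Proj_space A) V) \<and>
    s = finsum (sm_sec (tilde A M) V) (\<lambda>j. c j \<odot>\<^bsub>sm_sec (tilde A M) V\<^esub> restrict (E j) V) {..<n}"
proof -
  interpret S: graded_mod A "self_module A" by (rule self_graded_mod)
  have VD: "p \<in> Proj A" "z \<notin> p" "u \<notin> p" if "p \<in> V" for p
    using U_D that V(2) by auto
  have Ev: "restrict (E j) V p = e_frac p j" if "p \<in> V" for p j
    using that V(2) by (auto simp: E_def)
  have sec: "c j \<odot>\<^bsub>sm_sec (tilde A M) V\<^esub> restrict (E j) V \<in> tilde_sections A M V"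
    if "c \<in> {..<n} \<rightarrow> tilde_sections A (self_module A) V" "j < n" for c j
    unfolding tilde_simps using that by (intro tilde_sections_smult tilde_sections_restrict[OF E_section V]) auto
  have val: "finsum (sm_sec (tilde A M) V) (\<lambda>j. c j \<odot>\<^bsub>sm_sec (tilde A M) V\<^esub> restrict (E j) V) {..<n} p =
      finsum (stalk_mod A M p) (\<lambda>j. frac_smult A M p (c j p) (e_frac p j)) {..<n}"
    if c: "c \<in> {..<n} \<rightarrow> tilde_sections A (self_module A) V" and p: "p \<in> V" for c p
  proof -
    have "(c j \<odot>\<^bsub>sm_sec (tilde A M) V\<^esub> restrict (E j) V) p = frac_smult A M p (c j p) (e_frac p j)" for j
      using p Ev[OF p] by (simp add: tilde_simps)
    then show ?thesis
      using finsum_sections[OF V(1) p finite_lessThan[of n], of "\<lambda>j. c j \<odot>\<^bsub>sm_sec (tilde A M) V\<^esub> restrict (E j) V"]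
        sec[OF c] by auto
  qed
  have ext: "finsum (sm_sec (tilde A M) V) (\<lambda>j. c j \<odot>\<^bsub>sm_sec (tilde A M) V\<^esub> restrict (E j) V) {..<n} \<in> extensional V"
    if c: "c \<in> {..<n} \<rightarrow> tilde_sections A (self_module A) V" for c
  proof -
    interpret Mod: Module.module "rs_ring (Proj_space A) V" "sm_sec (tilde A M) V"
      by (rule sm_sec_module[OF V(1)])
    have "finsum (sm_sec (tilde A M) V) (\<lambda>j. c j \<odot>\<^bsub>sm_sec (tilde A M) V\<^esub> restrict (E j) V) {..<n} \<in>
        carrier (sm_sec (tilde A M) V)"
      using sec[OF c] by (intro Mod.M.finsum_closed) (simp add: tilde_simps(1))
    then show ?thesis
      unfolding tilde_simps(1) by (rule tilde_sections_extensional)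
  qed
  define P where "P = (\<lambda>p C. C \<in> {..<n} \<rightarrow>\<^sub>E stalk A (self_module A) p \<and>
    s p = finsum (stalk_mod A M p) (\<lambda>j. frac_smult A M p (C j) (e_frac p j)) {..<n})"
  have ex1: "\<exists>!C. P p C" if "p \<in> V" for p
    unfolding P_def by (rule stalk_coordinates[OF VD[OF that] tilde_sections_stalk[OF s that]])
  define c where "c = (\<lambda>j\<in>{..<n}. \<lambda>p\<in>V. (THE C. P p C) j)"
  have Pc: "P p (THE C. P p C)" if "p \<in> V" for p
    by (rule theI'[OF ex1[OF that]])
  have c_sec: "c j \<in> tilde_sections A (self_module A) V" if j: "j < n" for j
  proof (rule tilde_sectionsI)
    show "c j \<in> extensional V"
      using j by (simp add: c_def)
    fix p assume "p \<in> V"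
    with s obtain W m i f where 1: "openin (zariski A) W" "p \<in> W" "W \<subseteq> V" "m \<in> mpart M (int i)"
      "f \<in> hpart A i" "\<forall>q\<in>W. f \<notin> q" "\<forall>q\<in>W. s q = frac A M q m f" by (rule tilde_sectionsE)
    obtain b where b: "\<And>j. j < n \<Longrightarrow> b j \<in> mpart (self_module A) (int (k + i) - int (d j))"
      "u \<odot>\<^bsub>M\<^esub> m = finsum M (\<lambda>j. b j \<odot>\<^bsub>M\<^esub> e j) {..<n}"
      using span[OF 1(4)] by blast
    have bz: "b j \<otimes> z [^] d j \<in> mpart (self_module A) (int (k + i))" and uf: "u \<otimes> f \<in> hpart A (k + i)"
      using coeff_part(1)[OF b(1)[OF j]] hpart_mult[OF u 1(5)] by (simp_all only: self_module_simps)
    show "\<exists>W i m f. openin (zariski A) W \<and> p \<in> W \<and> W \<subseteq> V \<and> m \<in> mpart (self_module A) (int i) \<and>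
       f \<in> hpart A i \<and> (\<forall>q\<in>W. f \<notin> q \<and> c j q = frac A (self_module A) q m f)"
    proof (rule local_fracI[OF 1(1-3) bz uf])
      fix q assume q: "q \<in> W"
      have qV: "q \<in> V" using q 1(3) by blast
      note qD = VD[OF qV]
      have f: "f \<notin> q" "s q = frac A M q m f"
        using bspec[OF 1(6) q] bspec[OF 1(7) q] by simp_all
      have ufq: "u \<otimes> f \<notin> q"
        using f(1) qD u 1(5) by (simp add: Proj_mult_iff hpart_carrier)
      interpret T: abelian_group "stalk_mod A M q"
        by (rule stalk_abelian_group[OF qD(1)])
      define C where "C = (\<lambda>j\<in>{..<n}. frac A (self_module A) q (b j \<otimes> z [^] d j) (u \<otimes> f))"
      have mem: "frac A (self_module A) q (b j \<otimes> z [^] d j) (u \<otimes> f) \<in> stalk A (self_module A) q" if "j < n" for j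
        using coeff_part(1)[OF b(1)[OF that]] uf ufq by (intro S.stalkI S.fracsI[of _ "k + i"]) (simp_all only: self_module_simps simp_thms)
      have ef: "e_frac q j \<in> stalk A M q" if "j < n" for j
        unfolding e_frac_def by (intro stalkI fracsI[OF e[OF that] zd zdp[OF qD(1,2)]])
      have "finsum (stalk_mod A M q) (\<lambda>j. frac_smult A M q (C j) (e_frac q j)) {..<n} =
          finsum (stalk_mod A M q)
            (\<lambda>j. frac_smult A M q (frac A (self_module A) q (b j \<otimes> z [^] d j) (u \<otimes> f)) (e_frac q j)) {..<n}"
        by (rule T.finsum_cong') (auto simp: C_def stalk_mod_def intro!: frac_smult_closed[OF qD(1)] mem ef)
      also have "\<dots> = s q"
        unfolding f(2) by (rule stalk_span[OF qD 1(4,5) f(1) b, symmetric])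
      finally have "P q C"
        unfolding P_def using mem by (auto simp: C_def)
      then have "(THE C. P q C) = C"
        using ex1[OF qV] by (intro the1_equality)
      then have "c j q = frac A (self_module A) q (b j \<otimes> z [^] d j) (u \<otimes> f)"
        using j qV by (simp add: c_def C_def)
      with ufq show "u \<otimes> f \<notin> q \<and> c j q = frac A (self_module A) q (b j \<otimes> z [^] d j) (u \<otimes> f)" ..
    qed
  qed
  show ?thesis
    unfolding rs_ring_carrier
  proof (rule ex1I[of _ c], intro conjI)
    show c: "c \<in> {..<n} \<rightarrow>\<^sub>E tilde_sections A (self_module A) V"
      using c_sec by (auto simp: c_def)
    then have c': "c \<in> {..<n} \<rightarrow> tilde_sections A (self_module A) V" by auto
    show "s = finsum (sm_sec (tilde A M) V) (\<lambda>j. c j \<odot>\<^bsub>sm_sec (tilde A M) V\<^esub> restrict (E j) V) {..<n}"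
    proof (rule extensionalityI[OF tilde_sections_extensional[OF s] ext[OF c']])
      fix p assume p: "p \<in> V"
      interpret T: abelian_group "stalk_mod A M p"
        by (rule stalk_abelian_group[OF VD(1)[OF p]])
      have ef: "e_frac p j \<in> stalk A M p" if "j < n" for j
        unfolding e_frac_def by (intro stalkI fracsI[OF e[OF that] zd zdp[OF VD(1,2)[OF p]]])
      have "s p = finsum (stalk_mod A M p) (\<lambda>j. frac_smult A M p ((THE C. P p C) j) (e_frac p j)) {..<n}"
        using Pc[OF p] by (simp add: P_def)
      also have "\<dots> = finsum (stalk_mod A M p) (\<lambda>j. frac_smult A M p (c j p) (e_frac p j)) {..<n}"
        using Pc[OF p] p
        by (intro T.finsum_cong') (auto simp: c_def P_def stalk_mod_def intro!: frac_smult_closed[OF VD(1)[OF p]] ef)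
      finally show "s p = finsum (sm_sec (tilde A M) V) (\<lambda>j. c j \<odot>\<^bsub>sm_sec (tilde A M) V\<^esub> restrict (E j) V) {..<n} p"
        using val[OF c' p] by simp
    qed
    fix c'' assume "c'' \<in> {..<n} \<rightarrow>\<^sub>E tilde_sections A (self_module A) V \<and>
      s = finsum (sm_sec (tilde A M) V) (\<lambda>j. c'' j \<odot>\<^bsub>sm_sec (tilde A M) V\<^esub> restrict (E j) V) {..<n}"
    then have c'': "c'' \<in> {..<n} \<rightarrow>\<^sub>E tilde_sections A (self_module A) V"
      and s'': "s = finsum (sm_sec (tilde A M) V) (\<lambda>j. c'' j \<odot>\<^bsub>sm_sec (tilde A M) V\<^esub> restrict (E j) V) {..<n}"
      by auto
    have c''_Pi: "c'' \<in> {..<n} \<rightarrow> tilde_sections A (self_module A) V"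
      using c'' by auto
    have c''_ext: "c'' j \<in> extensional V" if "j < n" for j
      using c''_Pi that by (auto dest: tilde_sections_extensional)
    have "c'' j p = (THE C. P p C) j" if j: "j < n" and p: "p \<in> V" for j p
    proof (rule stalk_indep[OF VD(1,2)[OF p] _ _ _ j])
      show "c'' j p \<in> stalk A (self_module A) p" if "j < n" for j
        using c''_Pi that p by (auto intro: tilde_sections_stalk)
      show "(THE C. P p C) j \<in> stalk A (self_module A) p" if "j < n" for j
        using Pc[OF p] that by (auto simp: P_def)
      have "s p = finsum (stalk_mod A M p) (\<lambda>j. frac_smult A M p (c'' j p) (e_frac p j)) {..<n}"
        using val[OF c''_Pi p] s'' by simp
      then show "finsum (stalk_mod A M p) (\<lambda>j. frac_smult A M p (c'' j p) (e_frac p j)) {..<n} =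
          finsum (stalk_mod A M p) (\<lambda>j. frac_smult A M p ((THE C. P p C) j) (e_frac p j)) {..<n}"
        using Pc[OF p] by (simp add: P_def)
    qed
    then show "c'' = c"
      using c''_ext by (intro PiE_ext[OF c'' c] extensionalityI[of _ V]) (auto simp: c_def)
  qed
qed

end

theorem (in graded_mod) tilde_vector_bundle:
  assumes "\<And>p. p \<in> Proj A \<Longrightarrow> \<exists>k u z d e. local_basis A M n k u z d e \<and> u \<notin> p \<and> z \<notin> p"
  shows "vector_bundle (Proj_space A) n (tilde A M)"
  unfolding vector_bundle_def Proj_space_simps topspace_zariski
proof (intro conjI ballI)
  show "sheaf_of_modules (Proj_space A) (tilde A M)"
    by (rule tilde_sheaf_of_modules)
  fix p assume p: "p \<in> Proj A"
  then obtain k u z d e where "local_basis A M n k u z d e" and up: "u \<notin> p" "z \<notin> p"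
    using assms by blast
  then interpret L: local_basis A M n k u z d e by simp
  have "p \<in> L.U"
    using p up L.u L.z by (simp add: L.U_def Proj_mult_iff hpart_carrier)
  moreover have "L.E \<in> {..<n} \<rightarrow> carrier (sm_sec (tilde A M) L.U)"
    using L.E_section by (simp add: tilde_simps)
  moreover have "\<forall>V. openin (zariski A) V \<and> V \<subseteq> L.U \<longrightarrow> (\<forall>s\<in>carrier (sm_sec (tilde A M) V).
      \<exists>!c. c \<in> {..<n} \<rightarrow>\<^sub>E carrier (rs_ring (Proj_space A) V) \<and>
        s = (\<Oplus>\<^bsub>sm_sec (tilde A M) V\<^esub>j\<in>{..<n}. c j \<odot>\<^bsub>sm_sec (tilde A M) V\<^esub> sm_res (tilde A M) L.U V (L.E j)))"
  proof (intro allI impI ballI)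
    fix V s assume "openin (zariski A) V \<and> V \<subseteq> L.U" "s \<in> carrier (sm_sec (tilde A M) V)"
    then show "\<exists>!c. c \<in> {..<n} \<rightarrow>\<^sub>E carrier (rs_ring (Proj_space A) V) \<and>
        s = (\<Oplus>\<^bsub>sm_sec (tilde A M) V\<^esub>j\<in>{..<n}. c j \<odot>\<^bsub>sm_sec (tilde A M) V\<^esub> sm_res (tilde A M) L.U V (L.E j))"
      using L.basis_sections[of V s] by (simp add: tilde_simps(1,5))
  qed
  ultimately show "\<exists>U e. openin (zariski A) U \<and> p \<in> U \<and> e \<in> {..<n} \<rightarrow> carrier (sm_sec (tilde A M) U) \<and>
      (\<forall>V. openin (zariski A) V \<and> V \<subseteq> U \<longrightarrow> (\<forall>s\<in>carrier (sm_sec (tilde A M) V).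
        \<exists>!c. c \<in> {..<n} \<rightarrow>\<^sub>E carrier (rs_ring (Proj_space A) V) \<and>
          s = (\<Oplus>\<^bsub>sm_sec (tilde A M) V\<^esub>j\<in>{..<n}. c j \<odot>\<^bsub>sm_sec (tilde A M) V\<^esub> sm_res (tilde A M) U V (e j))))"
    using L.U_open by blast
qed

section \<open>Quotient modules and derivations\<close>

locale graded_quot = graded_mod A M + submodule K A M
  for A :: "('a, 'm) graded_ring_scheme" (structure) and M :: "('a, 'b) graded_module" and K
begin

sublocale K: abelian_subgroup K M
proof (rule abelian_subgroupI3)
  show "additive_subgroup K M"
    using subgroup_axioms by (rule additive_subgroupI)
qed (rule M.abelian_group_axioms)

abbreviation coset :: "'b \<Rightarrow> 'b set" where
  "coset x \<equiv> K +>\<^bsub>M\<^esub> x"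

lemma K_smult: "\<lbrakk>a \<in> carrier A; x \<in> K\<rbrakk> \<Longrightarrow> a \<odot>\<^bsub>M\<^esub> x \<in> K"
  by (rule smult_closed)

lemma coset_eq_iff:
  assumes "x \<in> carrier M" "y \<in> carrier M"
  shows "coset x = coset y \<longleftrightarrow> x \<ominus>\<^bsub>M\<^esub> y \<in> K"
proof
  assume "coset x = coset y"
  then have "x \<in> coset y"
    using K.a_rcos_self[OF assms(1)] by simp
  then show "x \<ominus>\<^bsub>M\<^esub> y \<in> K"
    using K.a_rcos_module_imp[OF assms(2)] by (simp add: a_minus_def)
next
  assume "x \<ominus>\<^bsub>M\<^esub> y \<in> K"
  then have "x \<in> coset y"
    using K.a_rcos_module_rev[OF assms(2,1)] by (simp add: a_minus_def)
  then show "coset x = coset y"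
    using K.a_repr_independence'[OF _ assms(2)] by simp
qed

lemma coset_mem: "y \<in> coset x \<Longrightarrow> x \<in> carrier M \<Longrightarrow> y \<in> carrier M \<and> coset y = coset x"
  using K.a_repr_independence'[of y x] K.a_elemrcos_carrier[of x y] by simp

lemma UN_coset:
  assumes "x \<in> carrier M" "\<And>y. \<lbrakk>y \<in> carrier M; coset y = coset x\<rbrakk> \<Longrightarrow> F y = F x"
  shows "(\<Union>y\<in>coset x. F y) = F x"
proof -
  have "F y = F x" if "y \<in> coset x" for y
    using coset_mem[OF that assms(1)] assms(2) by blast
  then show ?thesis
    using K.a_rcos_self[OF assms(1)] by fast
qed

lemma smult_diff:
  assumes "a \<in> carrier A" "x \<in> carrier M" "y \<in> carrier M"
  shows "a \<odot>\<^bsub>M\<^esub> (x \<ominus>\<^bsub>M\<^esub> y) = a \<odot>\<^bsub>M\<^esub> x \<ominus>\<^bsub>M\<^esub> a \<odot>\<^bsub>M\<^esub> y"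
  using assms by (simp add: a_minus_def smult_r_distr smult_r_minus)

lemma quot_simps:
  "carrier (quot_graded_module M K) = coset ` carrier M"
  "zero (quot_graded_module M K) = K"
  "mpart (quot_graded_module M K) e = coset ` mpart M e"
  by (auto simp: quot_graded_module_def A_RCOSETS_def' )

lemma quot_add:
  "\<lbrakk>x \<in> carrier M; y \<in> carrier M\<rbrakk> \<Longrightarrow> coset x \<oplus>\<^bsub>quot_graded_module M K\<^esub> coset y = coset (x \<oplus>\<^bsub>M\<^esub> y)"
  by (simp add: quot_graded_module_def K.a_rcos_sum)

lemma quot_smult:
  assumes "a \<in> carrier A" "x \<in> carrier M"
  shows "a \<odot>\<^bsub>quot_graded_module M K\<^esub> coset x = coset (a \<odot>\<^bsub>M\<^esub> x)"
proof -
  have "(\<Union>y\<in>coset x. coset (a \<odot>\<^bsub>M\<^esub> y)) = coset (a \<odot>\<^bsub>M\<^esub> x)"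
  proof (rule UN_coset[OF assms(2)])
    fix y assume y: "y \<in> carrier M" "coset y = coset x"
    then have "a \<odot>\<^bsub>M\<^esub> (y \<ominus>\<^bsub>M\<^esub> x) \<in> K"
      using assms coset_eq_iff[of y x] by (intro K_smult) auto
    then show "coset (a \<odot>\<^bsub>M\<^esub> y) = coset (a \<odot>\<^bsub>M\<^esub> x)"
      using assms y by (simp add: coset_eq_iff smult_diff)
  qed
  then show ?thesis
    by (simp add: quot_graded_module_def)
qed

lemma coset_zero: "coset \<zero>\<^bsub>M\<^esub> = K"
  using M.a_coset_add_zero K.a_subset by simp

lemma coset_eq_K: "x \<in> carrier M \<Longrightarrow> coset x = K \<longleftrightarrow> x \<in> K"
  using coset_eq_iff[of x "\<zero>\<^bsub>M\<^esub>"] M.minus_equality[of "\<zero>\<^bsub>M\<^esub>" "\<zero>\<^bsub>M\<^esub>"] by (simp add: coset_zero a_minus_def)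

lemma quot_graded_mod: "graded_mod A (quot_graded_module M K)"
proof -
  have "abelian_group (quot_graded_module M K)"
  proof (rule abelian_groupI)
    fix X assume "X \<in> carrier (quot_graded_module M K)"
    then obtain x where x: "x \<in> carrier M" "X = coset x"
      by (auto simp: quot_simps)
    show "\<zero>\<^bsub>quot_graded_module M K\<^esub> \<oplus>\<^bsub>quot_graded_module M K\<^esub> X = X"
      using x quot_add[of "\<zero>\<^bsub>M\<^esub>" x] by (simp add: quot_simps coset_zero)
    show "\<exists>Y\<in>carrier (quot_graded_module M K). Y \<oplus>\<^bsub>quot_graded_module M K\<^esub> X = \<zero>\<^bsub>quot_graded_module M K\<^esub>"
      using x quot_add[of "\<ominus>\<^bsub>M\<^esub> x" x]
      by (intro bexI[of _ "coset (\<ominus>\<^bsub>M\<^esub> x)"]) (auto simp: quot_simps coset_zero M.l_neg)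
  next
    fix X Y Z assume "X \<in> carrier (quot_graded_module M K)" "Y \<in> carrier (quot_graded_module M K)"
      "Z \<in> carrier (quot_graded_module M K)"
    then show "X \<oplus>\<^bsub>quot_graded_module M K\<^esub> Y \<oplus>\<^bsub>quot_graded_module M K\<^esub> Z =
        X \<oplus>\<^bsub>quot_graded_module M K\<^esub> (Y \<oplus>\<^bsub>quot_graded_module M K\<^esub> Z)"
      by (auto simp: quot_simps quot_add M.a_assoc)
  next
    fix X Y assume "X \<in> carrier (quot_graded_module M K)" "Y \<in> carrier (quot_graded_module M K)"
    then show "X \<oplus>\<^bsub>quot_graded_module M K\<^esub> Y = Y \<oplus>\<^bsub>quot_graded_module M K\<^esub> X"
      "X \<oplus>\<^bsub>quot_graded_module M K\<^esub> Y \<in> carrier (quot_graded_module M K)"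
      by (auto simp only: quot_simps quot_add image_iff M.a_comm)
  next
    show "\<zero>\<^bsub>quot_graded_module M K\<^esub> \<in> carrier (quot_graded_module M K)"
      using coset_zero by (auto simp: quot_simps intro!: image_eqI[of _ _ "\<zero>\<^bsub>M\<^esub>"])
  qed
  then have "Module.module A (quot_graded_module M K)"
    by (intro moduleI cring_axioms)
      (auto simp: quot_simps quot_add quot_smult smult_l_distr smult_r_distr smult_assoc1)
  moreover have "graded_mod_axioms A (quot_graded_module M K)"
  proof
    show "mpart (quot_graded_module M K) e \<subseteq> carrier (quot_graded_module M K)" for e
      using mpart_subset by (auto simp: quot_simps)
    show "\<zero>\<^bsub>quot_graded_module M K\<^esub> \<in> mpart (quot_graded_module M K) e" for e
      using mpart_zero coset_zero by (auto simp: quot_simps intro!: image_eqI[of _ _ "\<zero>\<^bsub>M\<^esub>"])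
    fix X Y e assume "X \<in> mpart (quot_graded_module M K) e" "Y \<in> mpart (quot_graded_module M K) e"
    then show "X \<oplus>\<^bsub>quot_graded_module M K\<^esub> Y \<in> mpart (quot_graded_module M K) e"
      by (auto simp: quot_simps quot_add mpart_carrier intro: mpart_add)
  next
    fix a n X e assume "a \<in> hpart A n" "X \<in> mpart (quot_graded_module M K) e"
    then show "a \<odot>\<^bsub>quot_graded_module M K\<^esub> X \<in> mpart (quot_graded_module M K) (int n + e)"
      by (auto simp: quot_simps quot_smult mpart_carrier hpart_carrier intro: mpart_smult)
  qed
  ultimately show ?thesis
    by (intro graded_mod.intro graded_cring_axioms)
qed

end

locale graded_quot_map = graded_semilinear A B \<pi> M N g + K: graded_quot A M K + L: graded_quot B N L
  for A :: "('a, 'm) graded_ring_scheme" (structure) and B :: "('b, 'n) graded_ring_scheme" and \<pi>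
    and M :: "('a, 'c) graded_module" and N :: "('b, 'd) graded_module" and g and K and L +
  assumes g_sub: "x \<in> K \<Longrightarrow> g x \<in> L"
begin

lemma g_uminus: "x \<in> carrier M \<Longrightarrow> g (\<ominus>\<^bsub>M\<^esub> x) = \<ominus>\<^bsub>N\<^esub> g x"
  using g_smult[of "\<ominus> \<one>" x] by (simp add: smult_l_minus N.smult_l_minus g_closed)

lemma coset_map_coset:
  assumes "x \<in> carrier M"
  shows "coset_map N L g (K.coset x) = L.coset (g x)"
  unfolding coset_map_def
proof (rule K.UN_coset[OF assms])
  fix y assume y: "y \<in> carrier M" "K.coset y = K.coset x"
  then have "g (y \<ominus>\<^bsub>M\<^esub> x) \<in> L"
    using assms K.coset_eq_iff[of y x] g_sub by blast
  then show "L.coset (g y) = L.coset (g x)"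
    using assms y by (simp add: L.coset_eq_iff g_closed g_add g_uminus a_minus_def)
qed

lemma quot_semilinear:
  "graded_semilinear A B \<pi> (quot_graded_module M K) (quot_graded_module N L) (coset_map N L g)"
proof -
  interpret QM: graded_mod A "quot_graded_module M K" by (rule K.quot_graded_mod)
  interpret QN: graded_mod B "quot_graded_module N L" by (rule L.quot_graded_mod)
  show ?thesis
  proof unfold_locales
    fix X assume "X \<in> carrier (quot_graded_module M K)"
    then show "coset_map N L g X \<in> carrier (quot_graded_module N L)"
      by (auto simp: K.quot_simps L.quot_simps coset_map_coset g_closed)
    fix Y assume "Y \<in> carrier (quot_graded_module M K)"
    with \<open>X \<in> _\<close> show "coset_map N L g (X \<oplus>\<^bsub>quot_graded_module M K\<^esub> Y) =
        coset_map N L g X \<oplus>\<^bsub>quot_graded_module N L\<^esub> coset_map N L g Y"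
      by (auto simp: K.quot_simps K.quot_add L.quot_add coset_map_coset g_closed g_add)
  next
    fix a X assume "a \<in> carrier A" "X \<in> carrier (quot_graded_module M K)"
    then show "coset_map N L g (a \<odot>\<^bsub>quot_graded_module M K\<^esub> X) = \<pi> a \<odot>\<^bsub>quot_graded_module N L\<^esub> coset_map N L g X"
      by (auto simp: K.quot_simps K.quot_smult L.quot_smult coset_map_coset g_closed g_smult)
  next
    fix X e assume "X \<in> mpart (quot_graded_module M K) e"
    then show "coset_map N L g X \<in> mpart (quot_graded_module N L) e"
      by (auto simp: K.quot_simps L.quot_simps coset_map_coset mpart_carrier g_mpart)
  qed
qed

end

lemma twist_simps [simp]:
  "carrier (twist n M) = carrier M" "add (twist n M) = add M" "zero (twist n M) = zero M"
  "smult (twist n M) = smult M" "mpart (twist n M) e = mpart M (n + e)"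
  by (simp_all add: twist_def)

lemma graded_mod_twist:
  assumes "graded_mod A M"
  shows "graded_mod A (twist n M)"
proof -
  interpret M: graded_mod A M by fact
  have "Module.module A (twist n M)"
    by (rule module_restrict_scalars[OF M.module_axioms M.cring_axioms, of "\<lambda>x. x"]) (auto simp: ring_hom_def)
  moreover have "graded_mod_axioms A (twist n M)"
  proof
    fix a m x e assume "a \<in> hpart A m" "x \<in> mpart (twist n M) e"
    then show "a \<odot>\<^bsub>twist n M\<^esub> x \<in> mpart (twist n M) (int m + e)"
      using M.mpart_smult[of a m x "n + e"] by (simp add: add.left_commute)
  qed (use M.mpart_subset M.mpart_zero M.mpart_add in auto)
  ultimately show ?thesis
    by (intro graded_mod.intro M.graded_cring_axioms)
qed

text \<open>A twist relabels degrees and leaves cosets alone, so it may be moved out of the quotient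
  by the Euler multiples.\<close>

lemma quot_graded_module_twist: "quot_graded_module (twist n M) N = twist n (quot_graded_module M N)"
  by (simp add: quot_graded_module_def twist_def A_RCOSETS_def' a_r_coset_def' set_add_def' fun_eq_iff)

section \<open>Logarithmic derivations as a graded module\<close>

context graded_cring
begin

lemma log_der_simps:
  "carrier (log_der A Q) = {\<theta> \<in> Der A. \<theta> Q \<in> PIdl Q}"
  "\<zero>\<^bsub>log_der A Q\<^esub> = (\<lambda>a\<in>carrier A. \<zero>)"
  "\<theta> \<oplus>\<^bsub>log_der A Q\<^esub> \<eta> = (\<lambda>a\<in>carrier A. \<theta> a \<oplus> \<eta> a)"
  "r \<odot>\<^bsub>log_der A Q\<^esub> \<theta> = (\<lambda>a\<in>carrier A. r \<otimes> \<theta> a)"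
  "mpart (log_der A Q) e = {\<theta> \<in> Der A. \<theta> Q \<in> PIdl Q \<and> (\<forall>y\<in>hpart A 1. \<theta> y \<in> mpart (self_module A) e)}"
  by (simp_all add: log_der_def)

lemma Der_closed: "\<lbrakk>\<theta> \<in> Der A; a \<in> carrier A\<rbrakk> \<Longrightarrow> \<theta> a \<in> carrier A"
  by (auto simp: Der_def)

lemma Der_extensional: "\<theta> \<in> Der A \<Longrightarrow> \<theta> \<in> extensional (carrier A)"
  by (simp add: Der_def PiE_def)

lemma DerD:
  assumes "\<theta> \<in> Der A"
  shows "\<lbrakk>a \<in> carrier A; b \<in> carrier A\<rbrakk> \<Longrightarrow> \<theta> (a \<oplus> b) = \<theta> a \<oplus> \<theta> b"
    "\<lbrakk>c \<in> hpart A 0; a \<in> carrier A\<rbrakk> \<Longrightarrow> \<theta> (c \<otimes> a) = c \<otimes> \<theta> a"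
    "\<lbrakk>a \<in> carrier A; b \<in> carrier A\<rbrakk> \<Longrightarrow> \<theta> (a \<otimes> b) = a \<otimes> \<theta> b \<oplus> b \<otimes> \<theta> a"
  using assms by (auto simp: Der_def)

lemma DerI:
  assumes "\<theta> \<in> extensional (carrier A)" "\<And>a. a \<in> carrier A \<Longrightarrow> \<theta> a \<in> carrier A"
    "\<And>a b. \<lbrakk>a \<in> carrier A; b \<in> carrier A\<rbrakk> \<Longrightarrow> \<theta> (a \<oplus> b) = \<theta> a \<oplus> \<theta> b"
    "\<And>c a. \<lbrakk>c \<in> hpart A 0; a \<in> carrier A\<rbrakk> \<Longrightarrow> \<theta> (c \<otimes> a) = c \<otimes> \<theta> a"
    "\<And>a b. \<lbrakk>a \<in> carrier A; b \<in> carrier A\<rbrakk> \<Longrightarrow> \<theta> (a \<otimes> b) = a \<otimes> \<theta> b \<oplus> b \<otimes> \<theta> a"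
  shows "\<theta> \<in> Der A"
  using assms by (auto simp: Der_def PiE_def)

lemma Der_add: "\<lbrakk>\<theta> \<in> Der A; \<eta> \<in> Der A\<rbrakk> \<Longrightarrow> (\<lambda>a\<in>carrier A. \<theta> a \<oplus> \<eta> a) \<in> Der A"
  by (rule DerI) (simp_all add: Der_closed DerD hpart_carrier a_ac r_distr)

lemma Der_smult: "\<lbrakk>r \<in> carrier A; \<theta> \<in> Der A\<rbrakk> \<Longrightarrow> (\<lambda>a\<in>carrier A. r \<otimes> \<theta> a) \<in> Der A"
  by (rule DerI) (simp_all add: Der_closed DerD hpart_carrier m_ac r_distr)

lemma Der_zero: "(\<lambda>a\<in>carrier A. \<zero>) \<in> Der A"
  by (rule DerI) (simp_all add: hpart_carrier)

lemma log_der_module: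
  assumes Q: "Q \<in> carrier A"
  shows "Module.module A (log_der A Q)"
proof -
  interpret I: ideal "PIdl Q" A
    by (rule cgenideal_ideal[OF Q])
  have ext: "\<theta> = \<eta>" if "\<theta> \<in> Der A" "\<eta> \<in> extensional (carrier A)" "\<And>a. a \<in> carrier A \<Longrightarrow> \<theta> a = \<eta> a" for \<theta> \<eta>
    using that Der_extensional by (intro extensionalityI[of _ "carrier A"]) auto
  have "abelian_group (log_der A Q)"
  proof (rule abelian_groupI; unfold log_der_simps)

    fix \<theta> assume "\<theta> \<in> {\<theta> \<in> Der A. \<theta> Q \<in> PIdl Q}"
    then have t: "\<theta> \<in> Der A" "\<theta> Q \<in> PIdl Q" by auto
    show "\<exists>\<eta>\<in>{\<theta> \<in> Der A. \<theta> Q \<in> PIdl Q}. (\<lambda>a\<in>carrier A. \<eta> a \<oplus> \<theta> a) = (\<lambda>a\<in>carrier A. \<zero>)"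
    \<comment> \<open>The negative is taken as the multiple by \<open>\<ominus> \<one>\<close>, so
      that closure follows from \<open>Der_smult\<close>.\<close>
    proof (intro bexI[of _ "\<lambda>a\<in>carrier A. (\<ominus> \<one>) \<otimes> \<theta> a"] restrict_ext)
      show "(\<lambda>a\<in>carrier A. \<ominus> \<one> \<otimes> \<theta> a) \<in> {\<theta> \<in> Der A. \<theta> Q \<in> PIdl Q}"
        using t Q Der_smult[of "\<ominus> \<one>" \<theta>] I.I_l_closed by simp
      fix a assume "a \<in> carrier A"
      then show "(\<lambda>a\<in>carrier A. \<ominus> \<one> \<otimes> \<theta> a) a \<oplus> \<theta> a = \<zero>"
        using Der_closed[OF t(1)] by (simp add: l_minus l_neg)
    qed
    show "(\<lambda>a\<in>carrier A. (\<lambda>a\<in>carrier A. \<zero>) a \<oplus> \<theta> a) = \<theta>"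
      by (rule ext[OF t(1), symmetric]) (simp_all add: Der_closed[OF t(1)])
  next
    fix \<theta> \<eta> \<zeta> assume "\<theta> \<in> {\<theta> \<in> Der A. \<theta> Q \<in> PIdl Q}" "\<eta> \<in> {\<theta> \<in> Der A. \<theta> Q \<in> PIdl Q}"
      "\<zeta> \<in> {\<theta> \<in> Der A. \<theta> Q \<in> PIdl Q}"
    then show "(\<lambda>a\<in>carrier A. (\<lambda>a\<in>carrier A. \<theta> a \<oplus> \<eta> a) a \<oplus> \<zeta> a) =
        (\<lambda>a\<in>carrier A. \<theta> a \<oplus> (\<lambda>a\<in>carrier A. \<eta> a \<oplus> \<zeta> a) a)"
      by (intro restrict_ext) (simp add: Der_closed a_assoc)
  next
    fix \<theta> \<eta> assume "\<theta> \<in> {\<theta> \<in> Der A. \<theta> Q \<in> PIdl Q}" "\<eta> \<in> {\<theta> \<in> Der A. \<theta> Q \<in> PIdl Q}"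
    then show "(\<lambda>a\<in>carrier A. \<theta> a \<oplus> \<eta> a) = (\<lambda>a\<in>carrier A. \<eta> a \<oplus> \<theta> a)"
        "(\<lambda>a\<in>carrier A. \<theta> a \<oplus> \<eta> a) \<in> {\<theta> \<in> Der A. \<theta> Q \<in> PIdl Q}"
      using Q by (auto simp: Der_closed Der_add intro!: restrict_ext a_comm)
  next
    show "(\<lambda>a\<in>carrier A. \<zero>) \<in> {\<theta> \<in> Der A. \<theta> Q \<in> PIdl Q}"
      using Q Der_zero by simp
  qed
  then show ?thesis
  proof (rule moduleI[OF cring_axioms]; unfold log_der_simps)
    fix r \<theta> assume r: "r \<in> carrier A" and "\<theta> \<in> {\<theta> \<in> Der A. \<theta> Q \<in> PIdl Q}"
    then have t: "\<theta> \<in> Der A" "\<theta> Q \<in> PIdl Q" by auto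
    show "(\<lambda>a\<in>carrier A. r \<otimes> \<theta> a) \<in> {\<theta> \<in> Der A. \<theta> Q \<in> PIdl Q}"
      using r t Q Der_smult I.I_l_closed by simp
    show "(\<lambda>a\<in>carrier A. (r \<oplus> s) \<otimes> \<theta> a) = (\<lambda>a\<in>carrier A. (\<lambda>a\<in>carrier A. r \<otimes> \<theta> a) a \<oplus> (\<lambda>a\<in>carrier A. s \<otimes> \<theta> a) a)"
      "(\<lambda>a\<in>carrier A. r \<otimes> s \<otimes> \<theta> a) = (\<lambda>a\<in>carrier A. r \<otimes> (\<lambda>a\<in>carrier A. s \<otimes> \<theta> a) a)" if "s \<in> carrier A" for s
      using r t that by (auto intro!: restrict_ext simp: Der_closed l_distr m_assoc)
    show "(\<lambda>a\<in>carrier A. r \<otimes> (\<lambda>a\<in>carrier A. \<theta> a \<oplus> \<eta> a) a) =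
        (\<lambda>a\<in>carrier A. (\<lambda>a\<in>carrier A. r \<otimes> \<theta> a) a \<oplus> (\<lambda>a\<in>carrier A. r \<otimes> \<eta> a) a)"
      if "\<eta> \<in> {\<theta> \<in> Der A. \<theta> Q \<in> PIdl Q}" for \<eta>
      using r t that by (auto intro!: restrict_ext simp: Der_closed r_distr)
  next
    fix \<theta> assume "\<theta> \<in> {\<theta> \<in> Der A. \<theta> Q \<in> PIdl Q}"
    then have t: "\<theta> \<in> Der A" by auto
    show "(\<lambda>a\<in>carrier A. \<one> \<otimes> \<theta> a) = \<theta>"
      by (rule ext[OF t(1), symmetric]) (simp_all add: Der_closed[OF t(1)])
  qed
qed

lemma log_der_graded_mod:
  assumes Q: "Q \<in> carrier A"
  shows "graded_mod A (log_der A Q)"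
proof -
  interpret S: graded_mod A "self_module A" by (rule self_graded_mod)
  interpret L: Module.module A "log_der A Q" by (rule log_der_module[OF Q])
  have "graded_mod_axioms A (log_der A Q)"
  proof
    show sub: "mpart (log_der A Q) e \<subseteq> carrier (log_der A Q)" for e
      by (auto simp: log_der_simps)
    show "\<zero>\<^bsub>log_der A Q\<^esub> \<in> mpart (log_der A Q) e" for e
      using L.M.zero_closed S.mpart_zero[of e] by (auto simp: log_der_simps hpart_carrier)
    fix \<theta> \<eta> e assume t: "\<theta> \<in> mpart (log_der A Q) e" "\<eta> \<in> mpart (log_der A Q) e"
    then have "\<theta> \<oplus>\<^bsub>log_der A Q\<^esub> \<eta> \<in> carrier (log_der A Q)"
      using sub by blast
    then show "\<theta> \<oplus>\<^bsub>log_der A Q\<^esub> \<eta> \<in> mpart (log_der A Q) e"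
      using t S.mpart_add[of _ e] by (auto simp: log_der_simps hpart_carrier)
  next
    fix r n \<theta> e assume r: "r \<in> hpart A n" and t: "\<theta> \<in> mpart (log_der A Q) e"
    then have "r \<odot>\<^bsub>log_der A Q\<^esub> \<theta> \<in> carrier (log_der A Q)"
      by (intro L.smult_closed hpart_carrier[OF r]) (auto simp: log_der_simps)
    then show "r \<odot>\<^bsub>log_der A Q\<^esub> \<theta> \<in> mpart (log_der A Q) (int n + e)"
      using r t S.mpart_smult[OF r, of _ e] by (auto simp: log_der_simps hpart_carrier)
  qed
  then show ?thesis
    by (intro graded_mod.intro graded_cring_axioms L.module_axioms)
qed

lemma der_span_submodule:
  assumes Q: "Q \<in> carrier A" and e: "\<epsilon> \<in> carrier (log_der A Q)"
  shows "graded_quot A (log_der A Q) (der_span A Q \<epsilon>)"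
proof -
  interpret L: graded_mod A "log_der A Q" by (rule log_der_graded_mod[OF Q])
  have "submodule (der_span A Q \<epsilon>) A (log_der A Q)"
  proof (rule L.submoduleI)
    show "der_span A Q \<epsilon> \<subseteq> carrier (log_der A Q)"
      using e by (auto simp: der_span_def)
    show "\<zero>\<^bsub>log_der A Q\<^esub> \<in> der_span A Q \<epsilon>"
      unfolding der_span_def using e by (auto intro!: exI[of _ \<zero>])
    show "\<ominus>\<^bsub>log_der A Q\<^esub> x \<in> der_span A Q \<epsilon>" if x: "x \<in> der_span A Q \<epsilon>" for x
    proof -
      obtain r where "r \<in> carrier A" "x = r \<odot>\<^bsub>log_der A Q\<^esub> \<epsilon>"
        using x by (auto simp: der_span_def)
      then show ?thesis
        unfolding der_span_def using e L.smult_l_minus[of r \<epsilon>] by (auto intro!: exI[of _ "\<ominus> r"])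
    qed
    show "x \<oplus>\<^bsub>log_der A Q\<^esub> y \<in> der_span A Q \<epsilon>" if xy: "x \<in> der_span A Q \<epsilon>" "y \<in> der_span A Q \<epsilon>" for x y
    proof -
      obtain r s where "r \<in> carrier A" "x = r \<odot>\<^bsub>log_der A Q\<^esub> \<epsilon>" "s \<in> carrier A" "y = s \<odot>\<^bsub>log_der A Q\<^esub> \<epsilon>"
        using xy by (auto simp: der_span_def)
      then show ?thesis
        unfolding der_span_def using e L.smult_l_distr[of r s \<epsilon>] by (auto intro!: exI[of _ "r \<oplus> s"])
    qed
    show "a \<odot>\<^bsub>log_der A Q\<^esub> x \<in> der_span A Q \<epsilon>" if ax: "a \<in> carrier A" "x \<in> der_span A Q \<epsilon>" for a x
    proof -
      obtain r where "r \<in> carrier A" "x = r \<odot>\<^bsub>log_der A Q\<^esub> \<epsilon>"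
        using ax by (auto simp: der_span_def)
      then show ?thesis
        unfolding der_span_def using e ax L.smult_assoc1[of a r \<epsilon>] by (auto intro!: exI[of _ "a \<otimes> r"])
    qed
  qed
  then show ?thesis
    by (intro graded_quot.intro L.graded_mod_axioms)
qed

end

section \<open>Polynomials in three variables\<close>

lemma UNIV_3: "(UNIV :: 3 set) = {0, 1, 2}"
proof -
  have "card {0, 1, 2 :: 3} = CARD(3)"
    by simp
  then show ?thesis
    by (intro card_subset_eq[symmetric]) simp_all
qed

lemma sum_3: "(\<Sum>i\<in>(UNIV :: 3 set). f i) = f 0 + f 1 + f 2"
  unfolding UNIV_3 by (simp add: add.assoc)

lemma all_3: "(\<forall>i::3. P i) \<longleftrightarrow> P 0 \<and> P 1 \<and> P 2"
  using UNIV_3 by (metis UNIV_I empty_iff insert_iff)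

lemma P2_simps [simp]:
  "carrier P2_ring = UNIV" "mult P2_ring = (*)" "one P2_ring = 1" "zero P2_ring = 0" "add P2_ring = (+)"
  by (simp_all add: P2_ring_def)

lemma P2_uminus [simp]: "\<ominus>\<^bsub>P2_ring\<^esub> f = - f"
proof -
  interpret cring P2_ring by (rule P2_ring_cring)
  show ?thesis
    by (rule minus_equality) simp_all
qed

definition mdeg :: "(3 \<Rightarrow>\<^sub>0 nat) \<Rightarrow> nat" where
  "mdeg m = (\<Sum>i\<in>UNIV. Poly_Mapping.lookup m i)"

lemma mdeg_add: "mdeg (m + n) = mdeg m + mdeg n"
  by (simp add: mdeg_def lookup_add sum.distrib)

lemma mdeg_zero [simp]: "mdeg 0 = 0"
  by (simp add: mdeg_def)

lemma mdeg_single [simp]: "mdeg (Poly_Mapping.single i n) = n"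
  by (simp add: mdeg_def lookup_single when_def)

abbreviation hp :: "nat \<Rightarrow> 'k::field_char_0 poly3 set" where
  "hp n \<equiv> hpart P2_ring n"

lemma hp_def: "hp n = {f. \<forall>m\<in>Poly_Mapping.keys f. mdeg m = n}"
  by (simp add: P2_ring_def mdeg_def)

lemma hp_single: "mdeg m = n \<Longrightarrow> Poly_Mapping.single m c \<in> hp n"
  by (simp add: hp_def)

lemma hp_add: "\<lbrakk>f \<in> hp n; g \<in> hp n\<rbrakk> \<Longrightarrow> f + g \<in> hp n"
  using Poly_Mapping.keys_add[of f g] by (auto simp: hp_def)

lemma hp_minus: "f \<in> hp n \<Longrightarrow> - f \<in> hp n"
  by (simp add: hp_def)

lemma hp_diff: "\<lbrakk>f \<in> hp n; g \<in> hp n\<rbrakk> \<Longrightarrow> f - g \<in> hp n"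
  using hp_add[of f n "- g"] hp_minus[of g n] by simp

lemma hp_mult: "\<lbrakk>f \<in> hp m; g \<in> hp n\<rbrakk> \<Longrightarrow> f * g \<in> hp (m + n)"
  using Poly_Mapping.keys_mult[of f g] by (fastforce simp: hp_def mdeg_add)

lemma hp_zero [simp]: "0 \<in> hp n"
  by (simp add: hp_def)

lemma hp_one [simp]: "1 \<in> hp 0"
  by (simp add: hp_def)

lemma P2_graded: "graded_cring P2_ring"
  by (intro graded_cring.intro P2_ring_cring, unfold_locales)
    (simp_all add: hp_add hp_minus hp_mult)

lemma hp_prod: "(\<And>i. i \<in> F \<Longrightarrow> f i \<in> hp (d i)) \<Longrightarrow> prod f F \<in> hp (\<Sum>i\<in>F. d i)"
  by (induction F rule: infinite_finite_induct) (auto intro: hp_mult)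

lemma hp_power: "f \<in> hp n \<Longrightarrow> f ^ k \<in> hp (k * n)"
  by (induction k) (auto intro: hp_mult)

lemma PIdl_P2: "f \<in> PIdl\<^bsub>P2_ring\<^esub> a \<longleftrightarrow> a dvd f"
  by (auto simp: cgenideal_def dvd_def mult.commute)

abbreviation const :: "'k::field_char_0 \<Rightarrow> 'k poly3" where
  "const c \<equiv> Poly_Mapping.single 0 c"

lemma const_hp [simp]: "const c \<in> hp 0"
  by (simp add: hp_def)

lemma hp_0_const: "f \<in> hp 0 \<Longrightarrow> f = const (Poly_Mapping.lookup f 0)"
proof (rule poly_mapping_eqI)
  fix m assume f: "f \<in> hp 0"
  show "Poly_Mapping.lookup f m = Poly_Mapping.lookup (const (Poly_Mapping.lookup f 0)) m"
  proof (cases "m = 0")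
    case False
    then obtain i where "Poly_Mapping.lookup m i \<noteq> 0"
      by (metis lookup_zero poly_mapping_eqI)
    then have "mdeg m \<noteq> 0"
      by (auto simp: mdeg_def)
    then show ?thesis
      using f False by (cases "m \<in> Poly_Mapping.keys f") (auto simp: hp_def lookup_single when_def in_keys_iff)
  qed simp
qed

lemma const_mult: "const c * const d = const (c * d)"
  by (simp add: mult_single)

lemma const_add: "const c + const d = const (c + d)"
  by (simp add: single_add)

lemma const_eq_0_iff [simp]: "const c = 0 \<longleftrightarrow> c = 0"
  by (metis lookup_single_eq single_zero lookup_zero)

lemma const_inverse: "c \<noteq> 0 \<Longrightarrow> const (inverse c) * const c = 1"
  by (simp add: const_mult)

lemma coord_hp [simp]: "coord i \<in> hp 1"
  by (simp add: hp_def coord_def)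

lemma mdeg_ex: "mdeg m \<noteq> 0 \<Longrightarrow> \<exists>i. m = Poly_Mapping.single i 1 + (m - Poly_Mapping.single i 1)"
proof -
  assume "mdeg m \<noteq> 0"
  then obtain i where "Poly_Mapping.lookup m i \<noteq> 0"
    by (auto simp: mdeg_def)
  then have "m = Poly_Mapping.single i 1 + (m - Poly_Mapping.single i 1)"
    by (intro poly_mapping_eqI) (auto simp: lookup_add lookup_minus lookup_single when_def)
  then show ?thesis by blast
qed

text \<open>Induction along the generators, for claims about ring homomorphisms and derivations: a
  monomial is split into one variable and a monomial of smaller degree.\<close>

lemma poly3_generate [case_names const coord add mult]:
  fixes P :: "'k::field_char_0 poly3 \<Rightarrow> bool"
  assumes "\<And>c. P (const c)" "\<And>i. P (coord i)" "\<And>f g. P f \<Longrightarrow> P g \<Longrightarrow> P (f + g)"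
    "\<And>f g. P f \<Longrightarrow> P g \<Longrightarrow> P (f * g)"
  shows "P f"
proof (induction f rule: poly3_induct)
  case zero
  then show ?case using assms(1)[of 0] by simp
next
  case (add f g)
  then show ?case by (rule assms(3))
next
  case (single m c)
  show ?case
  proof (induction "mdeg m" arbitrary: m)
    case 0
    then have "Poly_Mapping.single m c \<in> hp 0"
      by (intro hp_single) simp
    then show ?case
      using hp_0_const assms(1) by metis
  next
    case (Suc n)
    then obtain i where i: "m = Poly_Mapping.single i 1 + (m - Poly_Mapping.single i 1)"
      using mdeg_ex[of m] by auto
    then have "Poly_Mapping.single m c = coord i * Poly_Mapping.single (m - Poly_Mapping.single i 1) c"
      by (simp add: coord_def mult_single)
    moreover have "n = mdeg (m - Poly_Mapping.single i 1)"
      using Suc(2) mdeg_add[of "Poly_Mapping.single i 1" "m - Poly_Mapping.single i 1"] i by simp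
    ultimately show ?case
      using Suc(1) assms(2,4) by simp
  qed
qed

text \<open>The \<open>k\<close>-algebra endomorphism sending \<open>coord i\<close> to
  \<open>l i\<close>. It serves to set a linear form to zero (\<open>elim\<close>) and to evaluate
  along the line spanned by a vector (\<open>point_prime\<close>).\<close>

definition psubst :: "(3 \<Rightarrow> 'k::field_char_0 poly3) \<Rightarrow> 'k poly3 \<Rightarrow> 'k poly3" where
  "psubst l f = (\<Sum>m\<in>Poly_Mapping.keys f. const (Poly_Mapping.lookup f m) * (\<Prod>i\<in>UNIV. l i ^ Poly_Mapping.lookup m i))"

lemma psubst_single: "psubst l (Poly_Mapping.single m c) = const c * (\<Prod>i\<in>UNIV. l i ^ Poly_Mapping.lookup m i)"
  by (simp add: psubst_def)

lemma psubst_add: "psubst l (f + g) = psubst l f + psubst l g"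
proof -
  let ?K = "Poly_Mapping.keys f \<union> Poly_Mapping.keys g"
  have sup: "psubst l h = (\<Sum>m\<in>?K. const (Poly_Mapping.lookup h m) * (\<Prod>i\<in>UNIV. l i ^ Poly_Mapping.lookup m i))"
    if "Poly_Mapping.keys h \<subseteq> ?K" for h
    unfolding psubst_def using that by (intro sum.mono_neutral_left) (auto simp: in_keys_iff)
  show ?thesis
    by (simp add: sup Poly_Mapping.keys_add lookup_add single_add distrib_right sum.distrib)
qed

lemma psubst_zero [simp]: "psubst l 0 = 0"
  by (simp add: psubst_def)

lemma psubst_mult: "psubst l (f * g) = psubst l f * psubst l g"
proof (induction f rule: poly3_induct)
  case (single m c)
  show ?case
  proof (induction g rule: poly3_induct)
    case (single n d)
    show ?case
      unfolding mult_single[of m c n d] psubst_single const_mult[of c d, symmetric]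
      by (simp add: lookup_add power_add prod.distrib ac_simps del: mult_single)
  qed (simp_all add: distrib_left psubst_add)
qed (simp_all add: distrib_right psubst_add)

lemma psubst_const [simp]: "psubst l (const c) = const c"
  by (simp add: psubst_single)

lemma psubst_coord [simp]: "psubst l (coord i) = l i"
proof -
  have "(\<Prod>j\<in>UNIV. l j ^ Poly_Mapping.lookup (Poly_Mapping.single i 1) j) = (\<Prod>j\<in>UNIV. if j = i then l j else 1)"
    by (intro prod.cong) (auto simp: lookup_single when_def)
  then show ?thesis
    by (simp add: coord_def psubst_single)
qed

lemma psubst_hp:
  assumes "\<And>i. l i \<in> hp 1" "f \<in> hp n"
  shows "psubst l f \<in> hp n"
proof -
  have "const c * (\<Prod>i\<in>UNIV. l i ^ Poly_Mapping.lookup m i) \<in> hp (0 + (\<Sum>i\<in>UNIV. Poly_Mapping.lookup m i * 1))" for m c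
    by (intro hp_mult hp_prod hp_power assms const_hp)
  then have *: "const c * (\<Prod>i\<in>UNIV. l i ^ Poly_Mapping.lookup m i) \<in> hp (mdeg m)" for m c
    by (simp add: mdeg_def)
  have "(\<Sum>m\<in>F. const (Poly_Mapping.lookup f m) * (\<Prod>i\<in>UNIV. l i ^ Poly_Mapping.lookup m i)) \<in> hp n"
    if "finite F" "F \<subseteq> Poly_Mapping.keys f" for F
    using that
  proof (induction F rule: finite_induct)
    case (insert m F)
    then have "mdeg m = n"
      using assms(2) by (auto simp: hp_def)
    then show ?case
      using insert *[of _ m] by (auto intro!: hp_add)
  qed simp
  then show ?thesis
    by (simp add: psubst_def)
qed

definition hcomp :: "nat \<Rightarrow> 'k::field_char_0 poly3 \<Rightarrow> 'k poly3" where
  "hcomp n f = (\<Sum>m\<in>{m \<in> Poly_Mapping.keys f. mdeg m = n}. Poly_Mapping.single m (Poly_Mapping.lookup f m))"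

lemma lookup_hcomp: "Poly_Mapping.lookup (hcomp n f) m = (if mdeg m = n then Poly_Mapping.lookup f m else 0)"
proof -
  have fin: "finite {m \<in> Poly_Mapping.keys f. mdeg m = n}"
    by simp
  have "Poly_Mapping.lookup (hcomp n f) m =
      (\<Sum>m'\<in>{m \<in> Poly_Mapping.keys f. mdeg m = n}. if m = m' then Poly_Mapping.lookup f m' else 0)"
    unfolding hcomp_def lookup_sum by (intro sum.cong) (auto simp: lookup_single when_def)
  then show ?thesis
    using fin by (auto simp: sum.delta' in_keys_iff)
qed

lemma hcomp_hp: "hcomp n f \<in> hp n"
  by (auto simp: hp_def in_keys_iff lookup_hcomp split: if_splits)

lemma hcomp_add: "hcomp n (f + g) = hcomp n f + hcomp n g"
  by (rule poly_mapping_eqI) (simp add: lookup_hcomp lookup_add)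

lemma hcomp_id: "f \<in> hp n \<Longrightarrow> hcomp n f = f"
  by (rule poly_mapping_eqI) (auto simp: lookup_hcomp hp_def in_keys_iff)

lemma hcomp_other: "f \<in> hp m \<Longrightarrow> m \<noteq> n \<Longrightarrow> hcomp n f = 0"
  by (rule poly_mapping_eqI) (auto simp: lookup_hcomp hp_def in_keys_iff)

lemma hcomp_sum: "f = (\<Sum>n\<in>mdeg ` Poly_Mapping.keys f. hcomp n f)"
proof (rule poly_mapping_eqI)
  fix m
  show "Poly_Mapping.lookup f m = Poly_Mapping.lookup (\<Sum>n\<in>mdeg ` Poly_Mapping.keys f. hcomp n f) m"
    by (auto simp: lookup_sum lookup_hcomp in_keys_iff)
qed

text \<open>A substitution by linear forms preserves degrees. Hence its kernel contains the
  homogeneous components of its elements, which makes the ideal in \<open>point_prime\<close>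
  homogeneous.\<close>

lemma psubst_hcomp:
  assumes "\<And>i. l i \<in> hp 1"
  shows "psubst l (hcomp n f) = hcomp n (psubst l f)"
proof (induction f rule: poly3_induct)
  case zero
  have "hcomp n (0 :: 'a poly3) = 0"
    by (rule hcomp_id) simp
  then show ?case by simp
next
  case (add f g)
  then show ?case by (simp add: hcomp_add psubst_add)
next
  case (single m c)
  have m: "Poly_Mapping.single m c \<in> hp (mdeg m)"
    by (rule hp_single) simp
  note m' = psubst_hp[OF assms m]
  show ?case
    by (cases "mdeg m = n") (use hcomp_id[OF m] hcomp_id[OF m'] hcomp_other[OF m] hcomp_other[OF m'] in auto)
qed

section \<open>Components in integer degrees\<close>

abbreviation hpz :: "int \<Rightarrow> 'k::field_char_0 poly3 set" where
  "hpz e \<equiv> mpart (self_module P2_ring) e"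

text \<open>The projection to degree \<open>e\<close>, extended by zero to negative degrees in
  accordance with \<open>self_module\<close>, so that degrees can be subtracted freely.\<close>

definition hz :: "int \<Rightarrow> 'k::field_char_0 poly3 \<Rightarrow> 'k poly3" where
  "hz e f = (if e < 0 then 0 else hcomp (nat e) f)"

lemma hz_hpz: "hz e f \<in> hpz e"
  by (simp add: hz_def self_module_mpart hcomp_hp)

lemma hz_add: "hz e (f + g) = hz e f + hz e g"
  by (simp add: hz_def hcomp_add)

lemma hz_id: "f \<in> hpz e \<Longrightarrow> hz e f = f"
  by (auto simp: hz_def self_module_mpart hcomp_id split: if_splits)

text \<open>Applied to an equation with homogeneous outer factors, this replaces unknown cofactors
  by homogeneous ones of the right degree.\<close>

lemma hz_mult:
  assumes y: "y \<in> hp k"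
  shows "hz e (y * f) = y * hz (e - int k) f"
proof (induction f rule: poly3_induct)
  case zero
  have "hcomp n (0 :: 'a poly3) = 0" for n
    by (rule hcomp_id) simp
  then show ?case by (simp add: hz_def)
next
  case (add f g)
  then show ?case by (simp add: hz_add distrib_left)
next
  case (single m c)
  have m: "Poly_Mapping.single m c \<in> hp (mdeg m)"
    by (rule hp_single) simp
  note m' = hp_mult[OF y m]
  show ?case
  proof (cases "e = int (k + mdeg m)")
    case True
    then show ?thesis
      using hcomp_id[OF m] hcomp_id[OF m'] by (simp add: hz_def nat_add_distrib)
  next
    case False
    then have "e < 0 \<or> k + mdeg m \<noteq> nat e" "e - int k < 0 \<or> mdeg m \<noteq> nat (e - int k)"
      by linarith+
    then show ?thesis
      using hcomp_other[OF m] hcomp_other[OF m'] by (auto simp: hz_def)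
  qed
qed

section \<open>Derivations and linear coordinates\<close>

declare One_nat_def [simp del]

lemma Der_P2_iff:
  "\<theta> \<in> Der P2_ring \<longleftrightarrow> (\<forall>f g. \<theta> (f + g) = \<theta> f + \<theta> g) \<and> (\<forall>c\<in>hp 0. \<forall>f. \<theta> (c * f) = c * \<theta> f) \<and>
    (\<forall>f g. \<theta> (f * g) = f * \<theta> g + g * \<theta> f)"
  by (auto simp: Der_def)

lemma Der_P2D:
  assumes "\<theta> \<in> Der P2_ring"
  shows "\<theta> (f + g) = \<theta> f + \<theta> g" "\<theta> (const c * f) = const c * \<theta> f" "\<theta> (f * g) = f * \<theta> g + g * \<theta> f"
  using assms by (auto simp: Der_P2_iff)

text \<open>The Leibniz rule for \<open>1 * 1\<close> gives \<open>\<theta> 1 = 0\<close>; the other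
  constants follow by linearity over degree \<open>0\<close>.\<close>

lemma Der_const:
  assumes "\<theta> \<in> Der P2_ring"
  shows "\<theta> (const c) = 0"
  using Der_P2D(2)[OF assms, of c 1] Der_P2D(3)[OF assms, of 1 1] by simp

lemma Der_P2_zero: "\<theta> \<in> Der P2_ring \<Longrightarrow> \<theta> 0 = 0"
  using Der_const[of \<theta> 0] by simp

text \<open>The Leibniz rule makes every value of a derivation a combination of its values at the
  variables. The case \<open>a = 0\<close> yields equality of derivations.\<close>

lemma Der_dvd_coord:
  assumes "\<theta> \<in> Der P2_ring" "\<And>i. a dvd \<theta> (coord i)"
  shows "a dvd \<theta> f"
  by (induction f rule: poly3_generate) (simp_all add: assms Der_const Der_P2D)

lemma Der_P2_diff:
  assumes "\<theta> \<in> Der P2_ring" "\<eta> \<in> Der P2_ring"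
  shows "(\<lambda>f. \<theta> f - r * \<eta> f) \<in> Der P2_ring"
  using assms by (auto simp: Der_P2_iff algebra_simps)

lemma Der_P2_eqI:
  assumes "\<theta> \<in> Der P2_ring" "\<eta> \<in> Der P2_ring" "\<And>i. \<theta> (coord i) = \<eta> (coord i)"
  shows "\<theta> = \<eta>"
proof
  fix f
  have "0 dvd \<theta> f - 1 * \<eta> f"
    by (rule Der_dvd_coord[OF Der_P2_diff]) (simp_all add: assms)
  then show "\<theta> f = \<eta> f" by simp
qed

text \<open>Exponents are subtracted with truncation at zero. On monomials this does no harm,
  because the coefficient \<open>lookup n i\<close> vanishes where truncation would occur.\<close>

lemma partial_mult: "partial i (f * g) = f * partial i g + g * partial i f"
proof -
  have zero: "partial i 0 = 0"
    by (simp add: partial_def)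
  have sg: "partial i (Poly_Mapping.single m c) =
      Poly_Mapping.single (m - Poly_Mapping.single i 1) (of_nat (Poly_Mapping.lookup m i) * c)" for m and c :: 'a
    by (simp add: partial_def)
  have m: "Poly_Mapping.single m c * Poly_Mapping.single (n - Poly_Mapping.single i 1) (of_nat (Poly_Mapping.lookup n i) * d) =
      Poly_Mapping.single (m + n - Poly_Mapping.single i 1) (of_nat (Poly_Mapping.lookup n i) * (c * d))" for m n and c d :: 'a
  proof (cases "Poly_Mapping.lookup n i = 0")
    case False
    then have "m + (n - Poly_Mapping.single i 1) = m + n - Poly_Mapping.single i 1"
      by (intro poly_mapping_eqI) (auto simp: lookup_add lookup_minus lookup_single when_def)
    then show ?thesis
      by (simp add: mult_single ac_simps)
  qed simp
  show ?thesis
  proof (induction f rule: poly3_induct)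
    case (single m c)
    show ?case
    proof (induction g rule: poly3_induct)
      case (single n d)
      show ?case
        unfolding mult_single[of m c n d] sg m
        by (simp add: lookup_add add.commute[of n m] mult.commute[of d c] single_add[symmetric] distrib_right add.commute)
    qed (simp_all add: zero partial_add distrib_left distrib_right)
  qed (simp_all add: zero partial_add distrib_left distrib_right)
qed

definition coeff_der :: "(3 \<Rightarrow> 'k::field_char_0 poly3) \<Rightarrow> 'k poly3 \<Rightarrow> 'k poly3" where
  "coeff_der F f = (\<Sum>i\<in>UNIV. F i * partial i f)"

lemma partial_const: "partial i (const c) = 0"
  by (simp add: partial_def)

lemma partial_coord: "partial i (coord j) = (if i = j then 1 else 0)"
  by (simp add: partial_def coord_def lookup_single when_def)

lemma coeff_der_Der:
  fixes F :: "3 \<Rightarrow> 'k::field_char_0 poly3"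
  shows "coeff_der F \<in> Der P2_ring"
  unfolding Der_P2_iff
proof (intro conjI allI ballI)
  show "coeff_der F (f + g) = coeff_der F f + coeff_der F g" for f g
    by (simp add: coeff_der_def partial_add distrib_left sum.distrib)
  show mult: "coeff_der F (f * g) = f * coeff_der F g + g * coeff_der F f" for f g
    by (simp add: coeff_der_def partial_mult distrib_left sum.distrib sum_distrib_left ac_simps)
  fix c f :: "'k poly3" assume "c \<in> hp 0"
  then obtain c' where "c = const c'"
    using hp_0_const by blast
  then have "coeff_der F c = 0"
    by (simp add: coeff_der_def partial_const)
  then show "coeff_der F (c * f) = c * coeff_der F f"
    by (simp add: mult)
qed

lemma coeff_der_coord: "coeff_der F (coord i) = F i"
  by (simp add: coeff_der_def partial_coord if_distrib[of "\<lambda>x. _ * x"] cong: if_cong)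

lemma euler_Der: "(euler :: 'k::field_char_0 poly3 \<Rightarrow> 'k poly3) \<in> Der P2_ring"
proof -
  have e: "(euler :: 'k poly3 \<Rightarrow> 'k poly3) = coeff_der coord"
    by (rule ext) (simp add: euler_def coeff_der_def)
  show ?thesis
    unfolding e by (rule coeff_der_Der)
qed

lemma euler_linear: "l \<in> hp 1 \<Longrightarrow> euler l = l"
  using euler_homogeneous[of l 1] by simp

definition lcoeff :: "'k::field_char_0 poly3 \<Rightarrow> 3 \<Rightarrow> 'k" where
  "lcoeff l i = Poly_Mapping.lookup l (Poly_Mapping.single i 1)"

lemma linear_form_eq:
  assumes "l \<in> hp 1"
  shows "l = (\<Sum>i\<in>UNIV. const (lcoeff l i) * coord i)"
proof (rule poly_mapping_eqI)
  fix m
  have eq: "(\<Sum>i\<in>UNIV. const (lcoeff l i) * coord i) = (\<Sum>i\<in>UNIV. Poly_Mapping.single (Poly_Mapping.single i 1) (lcoeff l i))"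
    by (simp add: coord_def mult_single)
  show "Poly_Mapping.lookup l m = Poly_Mapping.lookup (\<Sum>i\<in>UNIV. const (lcoeff l i) * coord i) m"
  proof (cases "mdeg m = 1")
    case True
    then obtain i where i: "m = Poly_Mapping.single i 1 + (m - Poly_Mapping.single i 1)"
      using mdeg_ex[of m] by auto
    then have "mdeg (m - Poly_Mapping.single i 1) = 0"
      using True mdeg_add[of "Poly_Mapping.single i 1" "m - Poly_Mapping.single i 1"] by simp
    then have "m - Poly_Mapping.single i 1 = 0"
      using mdeg_ex by (intro poly_mapping_eqI) (auto simp: mdeg_def)
    with i have m: "m = Poly_Mapping.single i 1" by simp
    have inj: "Poly_Mapping.single j (1::nat) = Poly_Mapping.single i 1 \<longleftrightarrow> j = i" for j :: 3
      by (metis lookup_single_eq lookup_single_not_eq zero_neq_one)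
    show ?thesis
      unfolding eq by (simp add: m lookup_sum lookup_single when_def inj lcoeff_def)
  next
    case False
    then have "Poly_Mapping.lookup l m = 0"
      using assms by (auto simp: hp_def in_keys_iff)
    moreover have "Poly_Mapping.single i 1 \<noteq> m" for i
      using False by auto
    ultimately show ?thesis
      unfolding eq by (simp add: lookup_sum lookup_single when_def)
  qed
qed

lemma lcoeff_nonzero: "l \<in> hp 1 \<Longrightarrow> l \<noteq> 0 \<Longrightarrow> \<exists>i. lcoeff l i \<noteq> 0"
proof (rule ccontr)
  assume "l \<in> hp 1" "l \<noteq> 0" "\<not> (\<exists>i. lcoeff l i \<noteq> 0)"
  then show False
    using linear_form_eq[of l] by simp
qed

lemma Der_linear:
  assumes "\<theta> \<in> Der P2_ring" "l \<in> hp 1"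
  shows "\<theta> l = (\<Sum>i\<in>UNIV. const (lcoeff l i) * \<theta> (coord i))"
proof -
  have "\<theta> l = \<theta> (\<Sum>i\<in>UNIV. const (lcoeff l i) * coord i)"
    using linear_form_eq[OF assms(2)] by simp
  then show ?thesis
    by (simp add: sum_3 Der_P2D[OF assms(1)] del: Der_P2D(3)) (simp add: Der_const[OF assms(1)])
qed

section \<open>Linear coordinates and dual derivations\<close>

definition vector_der :: "(3 \<Rightarrow> 'k::field_char_0) \<Rightarrow> 'k poly3 \<Rightarrow> 'k poly3" where
  "vector_der w = coeff_der (\<lambda>i. const (w i))"

definition pairing :: "(3 \<Rightarrow> 'k::field) \<Rightarrow> (3 \<Rightarrow> 'k) \<Rightarrow> 'k" where
  "pairing v w = (\<Sum>i\<in>UNIV. v i * w i)"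

lemma vector_der_Der: "vector_der w \<in> Der P2_ring"
  by (simp add: vector_der_def coeff_der_Der)

lemma vector_der_linear: "l \<in> hp 1 \<Longrightarrow> vector_der w l = const (pairing (lcoeff l) w)"
  using Der_linear[OF vector_der_Der]
  by (simp add: vector_der_def coeff_der_coord const_mult pairing_def sum_3 const_add)

text \<open>The cross product. \<open>pairing u (cross v w)\<close> is the determinant of the three
  vectors, and \<open>cross v w\<close> is nonzero exactly when \<open>v\<close> and
  \<open>w\<close> are linearly independent.\<close>

definition cross :: "(3 \<Rightarrow> 'k::field) \<Rightarrow> (3 \<Rightarrow> 'k) \<Rightarrow> 3 \<Rightarrow> 'k" where
  "cross v w i = (if i = 0 then v 1 * w 2 - v 2 * w 1 else if i = 1 then v 2 * w 0 - v 0 * w 2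
     else v 0 * w 1 - v 1 * w 0)"

lemma cross_simps:
  "cross v w 0 = v 1 * w 2 - v 2 * w 1" "cross v w 1 = v 2 * w 0 - v 0 * w 2" "cross v w 2 = v 0 * w 1 - v 1 * w 0"
  by (simp_all add: cross_def)

lemma pairing_cross:
  "pairing v (cross v w) = 0" "pairing w (cross v w) = 0" "pairing u (cross v w) = pairing v (cross w u)"
  by (simp_all add: pairing_def sum_3 cross_simps algebra_simps)

text \<open>Linear coordinates together with the partial derivatives with respect to them. On linear
  forms these take values in \<open>hp 0\<close>, polynomials that play the role of scalars.\<close>

locale coordinates =
  fixes x y z :: "'k::field_char_0 poly3" and dx dy dz :: "'k poly3 \<Rightarrow> 'k poly3"
  assumes linear: "x \<in> hp 1" "y \<in> hp 1" "z \<in> hp 1"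
    and Der: "dx \<in> Der P2_ring" "dy \<in> Der P2_ring" "dz \<in> Der P2_ring"
    and dual: "dx x = 1" "dx y = 0" "dx z = 0" "dy x = 0" "dy y = 1" "dy z = 0" "dz x = 0" "dz y = 0" "dz z = 1"
    and expand: "l \<in> hp 1 \<Longrightarrow> l = dx l * x + dy l * y + dz l * z"
    and const: "l \<in> hp 1 \<Longrightarrow> dx l \<in> hp 0" "l \<in> hp 1 \<Longrightarrow> dy l \<in> hp 0" "l \<in> hp 1 \<Longrightarrow> dz l \<in> hp 0"

text \<open>Cramer's rule: the coefficient of \<open>x\<close> in a form is the determinant with
  that form in place of \<open>x\<close>, divided by \<open>D\<close>. So the dual derivations are
  the constant vector fields along \<open>cross v w\<close>, \<open>cross w u\<close> and
  \<open>cross u v\<close>, divided by \<open>D\<close>.\<close>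

lemma coordinates_exist:
  assumes x: "x \<in> hp 1" and y: "y \<in> hp 1" and z: "z \<in> hp 1"
    and det: "pairing (lcoeff z) (cross (lcoeff x) (lcoeff y)) \<noteq> 0"
  shows "\<exists>dx dy dz. coordinates x y z dx dy dz"
proof -
  define D where "D = pairing (lcoeff z) (cross (lcoeff x) (lcoeff y))"
  define u v w where "u = lcoeff x" "v = lcoeff y" "w = lcoeff z"
  define d where "d = (\<lambda>a b. vector_der (\<lambda>i. inverse D * cross a b i :: 'a))"
  have d: "d a b l = const (inverse D * pairing (lcoeff l) (cross a b))" if "l \<in> hp 1" for a b l
    using vector_der_linear[OF that] by (simp add: d_def pairing_def sum_3 algebra_simps)
  have D1: "D \<noteq> 0" and D4: "pairing w (cross u v) = D"
    using det by (simp_all add: D_def u_v_w_def)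
  have D: "D \<noteq> 0" "pairing u (cross v w) = D" "pairing v (cross w u) = D" "pairing w (cross u v) = D"
    using D1 D4 pairing_cross(3)[of u v w] pairing_cross(3)[of v w u] by simp_all
  have ex: "l = d v w l * x + d w u l * y + d u v l * z" if l: "l \<in> hp 1" for l
  proof -
    have "D * lcoeff l i = pairing (lcoeff l) (cross v w) * u i + pairing (lcoeff l) (cross w u) * v i +
        pairing (lcoeff l) (cross u v) * w i" for i
    proof -
      have "\<forall>i. D * lcoeff l i = pairing (lcoeff l) (cross v w) * u i + pairing (lcoeff l) (cross w u) * v i +
          pairing (lcoeff l) (cross u v) * w i"
        unfolding D(4)[symmetric] all_3 by (simp add: pairing_def sum_3 cross_simps algebra_simps)
      then show ?thesis by blast
    qed
    then have "lcoeff l i = inverse D * (pairing (lcoeff l) (cross v w) * u i + pairing (lcoeff l) (cross w u) * v i +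
        pairing (lcoeff l) (cross u v) * w i)" for i
      using D(1) by (simp add: field_simps)
    then have "const (lcoeff l i) = d v w l * const (u i) + d w u l * const (v i) + d u v l * const (w i)" for i
      unfolding d[OF l] const_mult const_add by (simp add: algebra_simps)
    then have "(\<Sum>i\<in>UNIV. const (lcoeff l i) * coord i) =
        d v w l * (\<Sum>i\<in>UNIV. const (u i) * coord i) + d w u l * (\<Sum>i\<in>UNIV. const (v i) * coord i) +
        d u v l * (\<Sum>i\<in>UNIV. const (w i) * coord i)"
      by (simp add: sum_distrib_left sum.distrib distrib_left distrib_right algebra_simps)
    then show ?thesis
      using linear_form_eq[OF l] linear_form_eq[OF x] linear_form_eq[OF y] linear_form_eq[OF z]
      unfolding u_v_w_def by simp
  qed
  have "coordinates x y z (d v w) (d w u) (d u v)"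
  proof
    show "d v w x = 1" "d w u y = 1" "d u v z = 1" "d v w y = 0" "d v w z = 0" "d w u x = 0" "d w u z = 0"
      "d u v x = 0" "d u v y = 0"
      using D by (simp_all add: d x y z u_v_w_def[symmetric] pairing_cross)
    show "d v w \<in> Der P2_ring" "d w u \<in> Der P2_ring" "d u v \<in> Der P2_ring"
      by (simp_all add: d_def vector_der_Der)
    show "l = d v w l * x + d w u l * y + d u v l * z" if "l \<in> hp 1" for l
      by (rule ex[OF that])
  qed (simp_all add: x y z d)
  then show ?thesis by blast
qed

lemma Proj_P2_const: "p \<in> Proj P2_ring \<Longrightarrow> const c \<in> p \<Longrightarrow> c = 0"
proof (rule ccontr)
  interpret graded_cring P2_ring by (rule P2_graded)
  assume p: "p \<in> Proj P2_ring" "const c \<in> p" "c \<noteq> 0"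
  interpret p: primeideal p P2_ring by (rule Proj_prime[OF p(1)])
  have "const (inverse c) * const c \<in> p"
    using p.I_l_closed[OF p(2), of "const (inverse c)"] by simp
  then show False
    using const_inverse[OF p(3)] Proj_one[OF p(1)] by simp
qed

lemma Proj_P2_add: "p \<in> Proj P2_ring \<Longrightarrow> f \<in> p \<Longrightarrow> g \<in> p \<Longrightarrow> f + g \<in> p"
  using additive_subgroup.a_closed[OF ideal.axioms(1)[OF primeideal.axioms(1)[OF graded_cring.Proj_prime[OF P2_graded]]]]
  by fastforce

lemma Proj_P2_diff: "p \<in> Proj P2_ring \<Longrightarrow> f \<in> p \<Longrightarrow> g \<in> p \<Longrightarrow> f - g \<in> p"
  using additive_subgroup.a_inv_closed[OF ideal.axioms(1)[OF primeideal.axioms(1)[OF graded_cring.Proj_prime[OF P2_graded]]], of p g]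
    Proj_P2_add[of p f "- g"] by simp

lemma Proj_P2_mult: "p \<in> Proj P2_ring \<Longrightarrow> f * g \<in> p \<longleftrightarrow> f \<in> p \<or> g \<in> p"
  using graded_cring.Proj_mult_iff[OF P2_graded, of p f g] by simp

text \<open>Otherwise every monomial of positive degree, and with it the irrelevant ideal, would lie
  in \<open>p\<close>.\<close>

lemma Proj_P2_coord:
  assumes p: "p \<in> Proj P2_ring"
  shows "\<exists>i. coord i \<notin> p"
proof (rule ccontr)
  assume "\<nexists>i. coord i \<notin> p"
  then have c: "coord i \<in> p" for i by simp
  have zero: "0 \<in> p"
    using Proj_P2_diff[OF p c[of 0] c[of 0]] by simp
  have single: "Poly_Mapping.single m c \<in> p" if m: "mdeg m > 0" for m and c :: 'a
  proof -
    obtain i where "m = Poly_Mapping.single i 1 + (m - Poly_Mapping.single i 1)"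
      using mdeg_ex[of m] m by auto
    then have "Poly_Mapping.single m c = coord i * Poly_Mapping.single (m - Poly_Mapping.single i 1) c"
      by (simp add: coord_def mult_single)
    then show ?thesis
      using c Proj_P2_mult[OF p] by simp
  qed
  have "f \<in> p" if f: "f \<in> hp n" "n > 0" for f n
  proof -
    have sum: "(\<Sum>m\<in>F. Poly_Mapping.single m (Poly_Mapping.lookup f m)) \<in> p"
      if "finite F" "F \<subseteq> Poly_Mapping.keys f" for F
      using that
    proof (induction F rule: finite_induct)
      case (insert m F)
      then have "mdeg m > 0"
        using f by (auto simp: hp_def)
      then show ?case
        using insert by (simp add: Proj_P2_add[OF p] single)
    qed (simp add: zero)
    have "(\<Sum>m\<in>Poly_Mapping.keys f. Poly_Mapping.single m (Poly_Mapping.lookup f m)) \<in> p"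
      by (rule sum) simp_all
    moreover have "(\<Sum>m\<in>Poly_Mapping.keys f. Poly_Mapping.single m (Poly_Mapping.lookup f m)) = f"
      by (rule poly_mapping_eqI) (simp add: lookup_sum lookup_single when_def in_keys_iff)
    ultimately show ?thesis by simp
  qed
  then show False
    using p by (auto simp: Proj_def)
qed

lemma lcoeff_add: "lcoeff (f + g) = (\<lambda>i. lcoeff f i + lcoeff g i)"
  by (simp add: lcoeff_def lookup_add fun_eq_iff)

lemma lcoeff_coord: "lcoeff (coord i) j = (if i = j then 1 else 0)"
proof -
  have "Poly_Mapping.single i (1::nat) = Poly_Mapping.single j 1 \<longleftrightarrow> i = j"
    by (metis lookup_single_eq lookup_single_not_eq zero_neq_one)
  then show ?thesis
    by (auto simp: lcoeff_def coord_def lookup_single when_def)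
qed

lemma pairing_coord: "pairing (lcoeff (coord i)) w = w i"
  by (simp add: pairing_def lcoeff_coord if_distrib[of "\<lambda>x. x * _"] cong: if_cong)

text \<open>Two conditions on \<open>z\<close>: a nonzero determinant with \<open>x\<close> and
  \<open>y\<close>, and \<open>z \<notin> p\<close>. One variable satisfies the first and one the
  second; if neither of them satisfies both, their sum does.\<close>

lemma coordinates_point:
  assumes x: "x \<in> hp 1" and y: "y \<in> hp 1" and ind: "cross (lcoeff x) (lcoeff y) \<noteq> (\<lambda>i. 0)"
    and p: "p \<in> Proj P2_ring"
  shows "\<exists>z dx dy dz. z \<notin> p \<and> coordinates x y z dx dy dz"
proof -
  let ?w = "cross (lcoeff x) (lcoeff y)"
  obtain i where i: "?w i \<noteq> 0"
    using ind by auto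
  obtain j where j: "coord j \<notin> p"
    using Proj_P2_coord[OF p] by blast
  have pa: "pairing (lcoeff (f + g)) ?w = pairing (lcoeff f) ?w + pairing (lcoeff g) ?w" for f g
    by (simp add: pairing_def lcoeff_add distrib_right sum.distrib)
  have "\<exists>z\<in>hp 1. z \<notin> p \<and> pairing (lcoeff z) ?w \<noteq> 0"
  proof (cases "coord i \<notin> p \<or> ?w j \<noteq> 0")
    case True
    then show ?thesis
      using i j by (metis coord_hp pairing_coord)
  next
    case False
    then have "coord i + coord j \<notin> p"
      using j Proj_P2_diff[OF p, of "coord i + coord j" "coord i"] by auto
    moreover have "pairing (lcoeff (coord i + coord j)) ?w \<noteq> 0"
      using False i by (simp add: pa pairing_coord)
    ultimately show ?thesis
      by (meson coord_hp hp_add)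
  qed
  then show ?thesis
    using coordinates_exist[OF x y] by blast
qed

text \<open>Vanishing of the cross product is vanishing of all two-by-two minors, and the factor is
  read off at an index where \<open>x\<close> has a nonzero coefficient.\<close>

lemma cross_zero_proportional:
  assumes x: "x \<in> hp 1" "x \<noteq> 0" and y: "y \<in> hp 1" and zero: "cross (lcoeff x) (lcoeff y) = (\<lambda>i. 0)"
  shows "\<exists>c. y = const c * x"
proof -
  obtain i where i: "lcoeff x i \<noteq> 0"
    using lcoeff_nonzero[OF x] by blast
  have c: "cross (lcoeff x) (lcoeff y) 0 = 0" "cross (lcoeff x) (lcoeff y) 1 = 0" "cross (lcoeff x) (lcoeff y) 2 = 0"
    using zero by simp_all
  have "\<forall>i j. lcoeff x i * lcoeff y j = lcoeff y i * lcoeff x j"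
    using c unfolding all_3 by (simp add: cross_simps algebra_simps)
  then have e: "lcoeff x i * lcoeff y j = lcoeff y i * lcoeff x j" for j by blast
  have "lcoeff y j = lcoeff y i / lcoeff x i * lcoeff x j" for j
  proof -
    have "lcoeff y j = lcoeff x i * lcoeff y j / lcoeff x i"
      using i by simp
    then show ?thesis
      by (simp add: e)
  qed
  then have "const (lcoeff y j) = const (lcoeff y i / lcoeff x i) * const (lcoeff x j)" for j
    unfolding const_mult by (rule arg_cong)
  then have "(\<Sum>j\<in>UNIV. const (lcoeff y j) * coord j) =
      const (lcoeff y i / lcoeff x i) * (\<Sum>j\<in>UNIV. const (lcoeff x j) * coord j)"
    by (simp only: mult.assoc sum_distrib_left)
  then have "y = const (lcoeff y i / lcoeff x i) * x"
    by (simp only: linear_form_eq[OF x(1), symmetric] linear_form_eq[OF y, symmetric])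
  then show ?thesis by blast
qed

lemma cross_coord_nonzero:
  assumes x: "x \<in> hp 1" "x \<noteq> 0"
  shows "\<exists>y\<in>hp 1. cross (lcoeff x) (lcoeff y) \<noteq> (\<lambda>i. 0)"
proof (rule ccontr)
  assume "\<not> ?thesis"
  then have "cross (lcoeff x) (lcoeff (coord i)) = (\<lambda>i. 0)" for i
    by simp
  then have c: "cross (lcoeff x) (lcoeff (coord i)) j = 0" for i j
    by metis
  have "\<forall>i. lcoeff x i = 0"
    unfolding all_3 using c[of 0 1] c[of 0 2] c[of 1 0] c[of 1 2] by (simp add: cross_simps lcoeff_coord)
  then show False
    using lcoeff_nonzero[OF x] by simp
qed

lemma Der_P2_smult: "\<theta> \<in> Der P2_ring \<Longrightarrow> (\<lambda>f. r * \<theta> f) \<in> Der P2_ring"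
  by (auto simp: Der_P2_iff algebra_simps)

lemma Der_P2_add: "\<theta> \<in> Der P2_ring \<Longrightarrow> \<eta> \<in> Der P2_ring \<Longrightarrow> (\<lambda>f. \<theta> f + \<eta> f) \<in> Der P2_ring"
  by (auto simp: Der_P2_iff algebra_simps)

lemma coordinates_extend:
  assumes x: "x \<in> hp 1" and y: "y \<in> hp 1" and ind: "cross (lcoeff x) (lcoeff y) \<noteq> (\<lambda>i. 0)"
  shows "\<exists>z dx dy dz. coordinates x y z dx dy dz"
proof -
  obtain i where "cross (lcoeff x) (lcoeff y) i \<noteq> 0"
    using ind by auto
  then show ?thesis
    using coordinates_exist[OF x y coord_hp, of i] by (auto simp: pairing_coord)
qed

context coordinates
begin

lemma Der_linear_eq:
  assumes "\<theta> \<in> Der P2_ring" "l \<in> hp 1"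
  shows "\<theta> l = dx l * \<theta> x + dy l * \<theta> y + dz l * \<theta> z"
proof -
  have c: "\<theta> (c * f) = c * \<theta> f" if "c \<in> hp 0" for c f
    using iffD1[OF Der_P2_iff assms(1)] that by blast
  have "\<theta> l = \<theta> (dx l * x + dy l * y + dz l * z)"
    using expand[OF assms(2)] by simp
  also have "\<dots> = dx l * \<theta> x + dy l * \<theta> y + dz l * \<theta> z"
    unfolding Der_P2D(1)[OF assms(1)] using const[OF assms(2)] by (simp add: c)
  finally show ?thesis .
qed

lemma Der_eqI:
  assumes "\<theta> \<in> Der P2_ring" "\<eta> \<in> Der P2_ring" "\<theta> x = \<eta> x" "\<theta> y = \<eta> y" "\<theta> z = \<eta> z"
  shows "\<theta> = \<eta>"
  by (rule Der_P2_eqI[OF assms(1,2)]) (simp add: Der_linear_eq[OF assms(1)] Der_linear_eq[OF assms(2)] assms(3-5))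

lemma x_nonzero: "x \<noteq> 0"
  using dual(1) Der_P2_zero[OF Der(1)] by auto

text \<open>Sets \<open>x\<close> to zero and fixes \<open>y\<close> and \<open>z\<close>, written
  in the standard variables. It identifies the quotient by \<open>x\<close> with a subring of the
  polynomial ring.\<close>

definition elim :: "'k poly3 \<Rightarrow> 'k poly3" where
  "elim = psubst (\<lambda>i. coord i - dx (coord i) * x)"

lemma elim_simps: "elim (f + g) = elim f + elim g" "elim (f * g) = elim f * elim g" "elim (const c) = const c" "elim 0 = 0"
  by (simp_all add: elim_def psubst_add psubst_mult)

lemma elim_linear:
  assumes l: "l \<in> hp 1"
  shows "elim l = l - dx l * x"
proof -
  have "elim l = elim (\<Sum>i\<in>UNIV. const (lcoeff l i) * coord i)"
    using linear_form_eq[OF l] by simp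
  also have "\<dots> = (\<Sum>i\<in>UNIV. const (lcoeff l i) * coord i) - (\<Sum>i\<in>UNIV. const (lcoeff l i) * dx (coord i)) * x"
    by (simp add: sum_3 elim_simps) (simp add: elim_def algebra_simps)
  also have "\<dots> = l - dx l * x"
    using linear_form_eq[OF l] Der_linear[OF Der(1) l] by simp
  finally show ?thesis .
qed

lemma elim_x: "elim x = 0"
  using elim_linear[OF linear(1)] dual by simp

lemma elim_cong: "x dvd f - elim f"
proof (induction f rule: poly3_generate)
  case (coord i)
  then show ?case by (simp add: elim_def)
next
  case (add f g)
  have "f + g - elim (f + g) = (f - elim f) + (g - elim g)"
    by (simp add: elim_simps)
  with add show ?case by (simp only: dvd_add)
next
  case (mult f g)
  have "f * g - elim (f * g) = f * (g - elim g) + (f - elim f) * elim g"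
    by (simp add: elim_simps algebra_simps)
  then show ?case
    using mult by (simp only: dvd_add dvd_mult dvd_mult2)
qed (simp add: elim_simps)

lemma x_dvd_iff: "x dvd f \<longleftrightarrow> elim f = 0"
proof
  assume "x dvd f"
  then show "elim f = 0"
    by (auto simp: dvd_def elim_simps elim_x)
next
  assume "elim f = 0"
  then show "x dvd f"
    using elim_cong[of f] by simp
qed

end

lemma linear_coordinates:
  assumes "x \<in> hp 1" "x \<noteq> 0"
  obtains y z dx dy dz where "coordinates x y z dx dy dz"
  using cross_coord_nonzero[OF assms] coordinates_extend[OF assms(1)] by blast

text \<open>\<open>elim\<close> is a ring endomorphism with kernel generated by \<open>x\<close>,
  and polynomials have no zero divisors.\<close>

lemma linear_prime:
  assumes x: "x \<in> hp 1" "x \<noteq> 0"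
  shows "x dvd f * g \<longleftrightarrow> x dvd f \<or> x dvd g" "\<not> x dvd 1"
proof -
  obtain y z dx dy dz where "coordinates x y z dx dy dz"
    by (rule linear_coordinates[OF x])
  then interpret coordinates x y z dx dy dz .
  show "x dvd f * g \<longleftrightarrow> x dvd f \<or> x dvd g"
    by (simp add: x_dvd_iff elim_simps)
  have "elim 1 = 1"
    using elim_simps(3)[of 1] by simp
  then show "\<not> x dvd 1"
    by (simp add: x_dvd_iff)
qed

text \<open>Taking components of degree \<open>e\<close> and cancelling \<open>y\<close> shows that
  the cofactor is homogeneous. With integer degrees a cofactor of degree below zero comes out as
  \<open>0\<close>, which is how non-divisibility is later derived from degrees.\<close>

lemma hz_dvd:
  assumes y: "y \<in> hp k" "y \<noteq> 0" and f: "y * f \<in> hpz e"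
  shows "f \<in> hpz (e - int k)"
proof -
  have "y * f = y * hz (e - int k) f"
    using hz_mult[OF y(1), of e f] hz_id[OF f] by simp
  then have "f = hz (e - int k) f"
    using y(2) by simp
  then show ?thesis
    using hz_hpz by metis
qed

lemma linear_dvd_linear:
  assumes "x \<in> hp 1" "x \<noteq> 0" "y \<in> hp 1" "x dvd y"
  obtains c where "y = const c * x"
proof -
  obtain f where f: "y = x * f"
    using assms(4) by (elim dvdE)
  have "x * f \<in> hpz (int 1)"
    using assms(3) f by (simp only: self_module_simps)
  then have "f \<in> hpz (int 1 - int 1)"
    by (rule hz_dvd[OF assms(1,2)])
  then have "f = const (Poly_Mapping.lookup f 0)"
    by (intro hp_0_const) simp
  then show thesis
    using that f by (metis mult.commute)
qed

lemma zero_locus_const: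
  assumes "c \<noteq> 0"
  shows "zero_locus P2_ring (const c * x) = zero_locus P2_ring x"
  using assms by (auto simp: zero_locus_def Proj_P2_mult dest: Proj_P2_const)

section \<open>Logarithmic derivations along linear forms\<close>

text \<open>The index type is left open: indices are lines for the arrangements and points for the
  lifted forms on \<open>H\<close>. The axiom \<open>distinct\<close> says that the forms are not
  proportional, in the shape that divisibility arguments call for.\<close>

locale linear_forms =
  fixes A :: "'i set" and \<alpha> :: "'i \<Rightarrow> 'k::field_char_0 poly3"
  assumes fin: "finite A" and form: "L \<in> A \<Longrightarrow> \<alpha> L \<in> hp 1" and nonzero: "L \<in> A \<Longrightarrow> \<alpha> L \<noteq> 0"
    and distinct: "\<lbrakk>L \<in> A; L' \<in> A; L \<noteq> L'\<rbrakk> \<Longrightarrow> \<not> \<alpha> L dvd \<alpha> L'"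
begin

lemma subforms: "B \<subseteq> A \<Longrightarrow> linear_forms B \<alpha>"
proof
  assume B: "B \<subseteq> A"
  show "finite B"
    using B fin by (rule finite_subset)
  show "\<alpha> L \<in> hp 1" "\<alpha> L \<noteq> 0" if "L \<in> B" for L
    using that B form nonzero by blast+
  show "\<not> \<alpha> L dvd \<alpha> L'" if "L \<in> B" "L' \<in> B" "L \<noteq> L'" for L L'
    using that B distinct[of L L'] by blast
qed

lemma prime_prod:
  assumes "L \<in> A" "B \<subseteq> A" "\<alpha> L dvd prod \<alpha> B"
  shows "L \<in> B"
proof -
  have "finite B"
    using assms fin finite_subset by blast
  then show ?thesis
    using assms(2,3)
  proof (induction B rule: finite_induct)
    case (insert M B)
    then show ?case
      using distinct[OF assms(1), of M] by (auto simp: linear_prime[OF form nonzero, OF assms(1,1)])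
  qed (simp add: linear_prime[OF form nonzero, OF assms(1,1)])
qed

text \<open>Forms that are not proportional are coprime primes; when one form is added at a time, it
  cannot divide the product of the earlier ones.\<close>

lemma prod_dvd:
  assumes "B \<subseteq> A" "\<And>L. L \<in> B \<Longrightarrow> \<alpha> L dvd f"
  shows "prod \<alpha> B dvd f"
proof -
  have "finite B"
    using assms fin finite_subset by blast
  then show ?thesis
    using assms
  proof (induction B rule: finite_induct)
    case (insert L B)
    then obtain g where g: "f = prod \<alpha> B * g"
      by auto
    have L: "L \<in> A"
      using insert by auto
    have "\<alpha> L dvd prod \<alpha> B * g"
      using insert.prems g by simp
    then have "\<alpha> L dvd g"
      using prime_prod[OF L] insert by (auto simp: linear_prime[OF form nonzero, OF L L])
    then show ?case
      using insert g by (simp add: mult.commute mult_dvd_mono)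
  qed simp
qed

text \<open>Modulo \<open>\<alpha> L\<close> the Leibniz rule leaves only
  \<open>\<theta> (\<alpha> L)\<close> times the product of the other forms, and
  \<open>\<alpha> L\<close> is prime and divides none of them. So being logarithmic can be tested
  line by line.\<close>

lemma log_der_iff:
  assumes "\<theta> \<in> Der P2_ring"
  shows "prod \<alpha> A dvd \<theta> (prod \<alpha> A) \<longleftrightarrow> (\<forall>L\<in>A. \<alpha> L dvd \<theta> (\<alpha> L))"
proof
  assume *: "prod \<alpha> A dvd \<theta> (prod \<alpha> A)"
  show "\<forall>L\<in>A. \<alpha> L dvd \<theta> (\<alpha> L)"
  proof
    fix L assume L: "L \<in> A"
    have Q: "prod \<alpha> A = \<alpha> L * prod \<alpha> (A - {L})"
      using fin L by (rule prod.remove)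
    then have "\<alpha> L dvd \<theta> (\<alpha> L * prod \<alpha> (A - {L}))"
      using * by (metis dvd_mult_left)
    then have "\<alpha> L dvd prod \<alpha> (A - {L}) * \<theta> (\<alpha> L)"
      by (simp add: Der_P2D[OF assms] dvd_add_right_iff)
    then show "\<alpha> L dvd \<theta> (\<alpha> L)"
      using prime_prod[OF L, of "A - {L}"] by (auto simp: linear_prime[OF form nonzero, OF L L])
  qed
next
  assume *: "\<forall>L\<in>A. \<alpha> L dvd \<theta> (\<alpha> L)"
  show "prod \<alpha> A dvd \<theta> (prod \<alpha> A)"
    using fin *
  proof (induction A rule: finite_induct)
    case (insert L B)
    have "prod \<alpha> (insert L B) = \<alpha> L * prod \<alpha> B"
      using insert by simp
    moreover have "\<alpha> L * prod \<alpha> B dvd \<alpha> L * \<theta> (prod \<alpha> B)" "prod \<alpha> B * \<alpha> L dvd prod \<alpha> B * \<theta> (\<alpha> L)"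
      using insert by (auto intro: mult_dvd_mono)
    then have "\<alpha> L * prod \<alpha> B dvd \<alpha> L * \<theta> (prod \<alpha> B) + prod \<alpha> B * \<theta> (\<alpha> L)"
      by (intro dvd_add) (simp_all add: mult.commute)
    ultimately show ?case
      by (simp add: Der_P2D[OF assms])
  qed simp
qed

lemma prod_hp: "B \<subseteq> A \<Longrightarrow> prod \<alpha> B \<in> hp (card B)"
  using hp_prod[of B \<alpha> "\<lambda>_. 1"] form by auto

lemma prod_nonzero: "B \<subseteq> A \<Longrightarrow> prod \<alpha> B \<noteq> 0"
  using fin nonzero by (metis finite_subset prod_zero_iff subsetD)

lemma Proj_prod:
  assumes p: "p \<in> Proj P2_ring" and B: "B \<subseteq> A" and "\<And>L. L \<in> B \<Longrightarrow> \<alpha> L \<notin> p"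
  shows "prod \<alpha> B \<notin> p"
proof -
  have "finite B"
    using assms fin finite_subset by blast
  then show ?thesis
    using assms(3) graded_cring.Proj_one[OF P2_graded p]
    by (induction B rule: finite_induct) (auto simp: Proj_P2_mult[OF p])
qed

lemma cross_nonzero: "\<lbrakk>L \<in> A; L' \<in> A; L \<noteq> L'\<rbrakk> \<Longrightarrow> cross (lcoeff (\<alpha> L)) (lcoeff (\<alpha> L')) \<noteq> (\<lambda>i. 0)"
  using cross_zero_proportional[OF form[of L] nonzero[of L] form[of L']] distinct[of L L'] by (metis dvd_triv_right)

lemma adapted_coordinates:
  assumes ne: "A \<noteq> {}" and p: "p \<in> Proj P2_ring"
  shows "\<exists>L\<in>A. \<exists>y z dx dy dz. coordinates (\<alpha> L) y z dx dy dz \<and> z \<notin> p \<and> (\<forall>M\<in>A. \<alpha> M \<in> p \<longrightarrow> dz (\<alpha> M) = 0)"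
proof -
  \<comment> \<open>A line through \<open>p\<close> if there is one, and any line otherwise.\<close>
  obtain L where L: "L \<in> A" "\<And>M. M \<in> A \<Longrightarrow> \<alpha> M \<in> p \<Longrightarrow> \<alpha> L \<in> p"
    using ne by blast
  \<comment> \<open>Likewise, \<open>y\<close> is the form of a second line through \<open>p\<close>
    if there is one, and otherwise any form independent of the first.\<close>
  obtain y where y: "y \<in> hp 1" "cross (lcoeff (\<alpha> L)) (lcoeff y) \<noteq> (\<lambda>i. 0)"
    and yp: "\<And>M. M \<in> A \<Longrightarrow> \<alpha> M \<in> p \<Longrightarrow> M \<noteq> L \<Longrightarrow> y \<in> p"
  proof (cases "\<exists>M\<in>A. \<alpha> M \<in> p \<and> M \<noteq> L")
    case True
    then obtain M where M: "M \<in> A" "\<alpha> M \<in> p" "M \<noteq> L" by blast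
    then show thesis
      using that[of "\<alpha> M"] form cross_nonzero[of L M] L by auto
  next
    case False
    then show thesis
      using that cross_coord_nonzero[OF form nonzero, OF L(1,1)] by blast
  qed
  obtain z dx dy dz where z: "z \<notin> p" and co: "coordinates (\<alpha> L) y z dx dy dz"
    using coordinates_point[OF form y p] L by blast
  interpret coordinates "\<alpha> L" y z dx dy dz by (rule co)
  \<comment> \<open>The product \<open>dz (\<alpha> M) * z\<close> lies in \<open>p\<close> while
    \<open>z\<close> does not, and the coefficient \<open>dz (\<alpha> M)\<close> is a constant; a
    constant in \<open>p\<close> is zero.\<close>
  have "dz (\<alpha> M) = 0" if M: "M \<in> A" "\<alpha> M \<in> p" for M
  proof (cases "M = L")
    case True
    then show ?thesis using dual by simp
  next
    case False
    have "\<alpha> M - (dx (\<alpha> M) * \<alpha> L + dy (\<alpha> M) * y) \<in> p"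
      using L(2)[OF M] yp[OF M False] M(2) by (intro Proj_P2_diff[OF p] Proj_P2_add[OF p]) (simp_all add: Proj_P2_mult[OF p])
    moreover have "\<alpha> M - (dx (\<alpha> M) * \<alpha> L + dy (\<alpha> M) * y) = dz (\<alpha> M) * z"
      using expand[OF form[OF M(1)]] by (simp add: algebra_simps)
    ultimately have "dz (\<alpha> M) \<in> p"
      using z by (simp add: Proj_P2_mult[OF p])
    then show ?thesis
      using hp_0_const[OF const(3)[OF form[OF M(1)]]] Proj_P2_const[OF p] by (metis const_eq_0_iff)
  qed
  then show ?thesis
    using L(1) co z by blast
qed

end

lemma P2_finprod:
  assumes "finite F"
  shows "finprod P2_ring f F = prod f F"
proof -
  interpret cring P2_ring by (rule P2_ring_cring)
  show ?thesis
    using assms by (induction F rule: finite_induct) (simp_all add: Pi_def)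
qed

lemma (in abelian_monoid) finsum_lessThan_2:
  assumes "f 0 \<in> carrier G" "f 1 \<in> carrier G"
  shows "finsum G f {..<2::nat} = f 0 \<oplus> f 1"
proof -
  have "{..<2::nat} = insert 1 {0}"
    by auto
  then show ?thesis
    using assms by (simp add: Pi_def a_comm)
qed

lemma (in graded_quot) coset_eq_iff_add:
  assumes "x \<in> carrier M" "y \<in> carrier M"
  shows "coset x = coset y \<longleftrightarrow> (\<exists>k\<in>K. x = k \<oplus>\<^bsub>M\<^esub> y)"
proof
  assume "coset x = coset y"
  then have "x \<ominus>\<^bsub>M\<^esub> y \<in> K"
    using assms coset_eq_iff by blast
  moreover have "x = (x \<ominus>\<^bsub>M\<^esub> y) \<oplus>\<^bsub>M\<^esub> y"
    using assms by (simp add: a_minus_def M.a_assoc M.l_neg)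
  ultimately show "\<exists>k\<in>K. x = k \<oplus>\<^bsub>M\<^esub> y"
    by blast
next
  assume "\<exists>k\<in>K. x = k \<oplus>\<^bsub>M\<^esub> y"
  then obtain k where k: "k \<in> K" "x = k \<oplus>\<^bsub>M\<^esub> y" by blast
  then have "x \<ominus>\<^bsub>M\<^esub> y = k"
    using assms K.a_Hcarr by (simp add: a_minus_def M.a_assoc M.r_neg)
  then show "coset x = coset y"
    using k assms coset_eq_iff by blast
qed

section \<open>The module of an arrangement and its local bases\<close>

context linear_forms
begin

abbreviation "Q \<equiv> prod \<alpha> A"

abbreviation "LD \<equiv> log_der P2_ring Q"

abbreviation "ES \<equiv> der_span P2_ring Q euler"

lemma LD_carrier: "\<theta> \<in> carrier LD \<longleftrightarrow> \<theta> \<in> Der P2_ring \<and> (\<forall>L\<in>A. \<alpha> L dvd \<theta> (\<alpha> L))"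
  unfolding graded_cring.log_der_simps[OF P2_graded] using log_der_iff by (auto simp: PIdl_P2)

lemma LD_mpart: "\<theta> \<in> mpart LD e \<longleftrightarrow> \<theta> \<in> carrier LD \<and> (\<forall>l\<in>hp 1. \<theta> l \<in> hpz e)"
  unfolding graded_cring.log_der_simps[OF P2_graded] by auto

lemma LD_simps:
  "\<theta> \<oplus>\<^bsub>LD\<^esub> \<eta> = (\<lambda>f. \<theta> f + \<eta> f)" "r \<odot>\<^bsub>LD\<^esub> \<theta> = (\<lambda>f. r * \<theta> f)"
  unfolding graded_cring.log_der_simps[OF P2_graded] by (simp_all add: restrict_def)

lemma euler_LD: "euler \<in> carrier LD"
  unfolding LD_carrier using euler_Der euler_linear[OF form] by simp

lemma ES_iff: "\<kappa> \<in> ES \<longleftrightarrow> (\<exists>r. \<kappa> = (\<lambda>f. r * euler f))"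
  by (simp add: der_span_def LD_simps)

lemma LD_quot: "graded_quot P2_ring LD ES"
  by (rule graded_cring.der_span_submodule[OF P2_graded _ euler_LD]) simp

sublocale LQ: graded_quot P2_ring LD ES
  by (rule LD_quot)

lemma coset_eq:
  assumes "\<theta> \<in> carrier LD" "\<eta> \<in> carrier LD"
  shows "LQ.coset \<theta> = LQ.coset \<eta> \<longleftrightarrow> (\<exists>r. \<forall>f. \<theta> f = r * euler f + \<eta> f)"
  unfolding LQ.coset_eq_iff_add[OF assms] Bex_def ES_iff LD_simps by (auto simp: fun_eq_iff)

end

text \<open>After subtraction of \<open>t\<close> times the Euler derivation,
  \<open>\<theta>\<close> kills \<open>x\<close>, and a form in \<open>x\<close> and
  \<open>y\<close> alone is sent to \<open>dy (\<alpha> M)\<close> times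
  \<open>\<theta> y - t * y\<close>. The factor \<open>dy (\<alpha> M)\<close> is a nonzero
  constant, so each form from \<open>B\<close>, and therefore their product, divides
  \<open>\<theta> y - t * y\<close>.\<close>

lemma (in coordinates) saito_coefficients:
  assumes forms: "linear_forms A \<alpha>" and L: "L \<in> A" "\<alpha> L = x"
    and \<theta>: "\<theta> \<in> Der P2_ring" "\<And>M. M \<in> A \<Longrightarrow> \<alpha> M dvd \<theta> (\<alpha> M)"
    and B: "B \<subseteq> A - {L}" "\<And>M. M \<in> B \<Longrightarrow> dz (\<alpha> M) = 0"
  shows "\<exists>t s. \<theta> x = x * t \<and> \<theta> y = t * y + prod \<alpha> B * s"
proof -
  interpret linear_forms A \<alpha> by fact
  obtain t where t: "\<theta> x = x * t"
    using \<theta>(2)[OF L(1)] L(2) by (auto elim: dvdE)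
  have "\<alpha> M dvd \<theta> y - t * y" if M: "M \<in> B" for M
  proof -
    have MA: "M \<in> A" "M \<noteq> L"
      using M B by auto
    note f = form[OF MA(1)]
    have e: "\<alpha> M = dx (\<alpha> M) * x + dy (\<alpha> M) * y"
      using expand[OF f] B(2)[OF M] by simp
    have "\<theta> (\<alpha> M) = dx (\<alpha> M) * \<theta> x + dy (\<alpha> M) * \<theta> y"
      using Der_linear_eq[OF \<theta>(1) f] B(2)[OF M] by simp
    also have "\<dots> = t * (dx (\<alpha> M) * x + dy (\<alpha> M) * y) + dy (\<alpha> M) * (\<theta> y - t * y)"
      by (simp add: t algebra_simps)
    finally have "\<theta> (\<alpha> M) = t * \<alpha> M + dy (\<alpha> M) * (\<theta> y - t * y)"
      using e by simp
    then have "\<alpha> M dvd dy (\<alpha> M) * (\<theta> y - t * y)"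
      using \<theta>(2)[OF MA(1)] by (simp add: dvd_add_right_iff)
    \<comment> \<open>A cofactor would have degree \<open>-1\<close> and vanish; then
      \<open>\<alpha> M\<close> would be a multiple of \<open>\<alpha> L\<close>.\<close>
    moreover have "\<not> \<alpha> M dvd dy (\<alpha> M)"
    proof
      assume "\<alpha> M dvd dy (\<alpha> M)"
      then obtain h where h: "dy (\<alpha> M) = \<alpha> M * h" by (elim dvdE)
      have "\<alpha> M * h \<in> hpz (int 0)"
        using const(2)[OF f] h by (simp only: self_module_simps)
      then have "h \<in> hpz (int 0 - int 1)"
        by (rule hz_dvd[OF f nonzero[OF MA(1)]])
      then have "dy (\<alpha> M) = 0"
        using h by (simp add: self_module_mpart)
      then have "\<alpha> M = dx (\<alpha> M) * \<alpha> L"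
        using e L(2) by simp
      then have "\<alpha> L dvd \<alpha> M"
        by (metis dvd_triv_right)
      then show False
        using distinct[OF L(1) MA(1)] MA(2) by blast
    qed
    ultimately show ?thesis
      using linear_prime(1)[OF f nonzero[OF MA(1)]] by blast
  qed
  then have "prod \<alpha> B dvd \<theta> y - t * y"
    using B by (intro prod_dvd) auto
  then obtain s where "\<theta> y - t * y = prod \<alpha> B * s"
    by (elim dvdE)
  then have "\<theta> y = t * y + prod \<alpha> B * s"
    by (simp add: algebra_simps)
  with t show ?thesis by blast
qed

lemma hpz_int: "f \<in> hpz (int n) \<longleftrightarrow> f \<in> hp n"
  by (simp only: self_module_simps)

lemma hpz_mult: "f \<in> hp n \<Longrightarrow> g \<in> hpz e \<Longrightarrow> f * g \<in> hpz (int n + e)"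
  using graded_mod.mpart_smult[OF graded_cring.self_graded_mod[OF P2_graded], of f n g e] by simp

lemma hpz_add: "f \<in> hpz e \<Longrightarrow> g \<in> hpz e \<Longrightarrow> f + g \<in> hpz e"
  using graded_mod.mpart_add[OF graded_cring.self_graded_mod[OF P2_graded], of f e g] by simp

lemma hpz_diff: "f \<in> hpz e \<Longrightarrow> g \<in> hpz e \<Longrightarrow> f - g \<in> hpz e"
  using hpz_add[of f e "- g"] hp_minus[of g "nat e"] by (auto simp: self_module_mpart split: if_splits)

text \<open>In contrast to \<open>local_basis\<close>, the family spans in all integer degrees, so that it can be twisted.\<close>

definition basis_at :: "('k::field_char_0 poly3, 'b) graded_module \<Rightarrow> nat \<Rightarrow> 'k poly3 set \<Rightarrow>
    nat \<Rightarrow> 'k poly3 \<Rightarrow> 'k poly3 \<Rightarrow> (nat \<Rightarrow> nat) \<Rightarrow> (nat \<Rightarrow> 'b) \<Rightarrow> bool" where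
  "basis_at M n p k u z d e \<longleftrightarrow> u \<in> hp k \<and> z \<in> hp 1 \<and> u \<notin> p \<and> z \<notin> p \<and>
     (\<forall>j<n. e j \<in> mpart M (int (d j))) \<and>
     (\<forall>i. \<forall>m\<in>mpart M i. \<exists>c. (\<forall>j<n. c j \<in> hpz (int k + i - int (d j))) \<and>
        u \<odot>\<^bsub>M\<^esub> m = finsum M (\<lambda>j. c j \<odot>\<^bsub>M\<^esub> e j) {..<n}) \<and>
     (\<forall>c c'. finsum M (\<lambda>j. c j \<odot>\<^bsub>M\<^esub> e j) {..<n} = finsum M (\<lambda>j. c' j \<odot>\<^bsub>M\<^esub> e j) {..<n} \<longrightarrow> (\<forall>j<n. c j = c' j))"

lemma basis_at_local_basis:
  assumes "graded_mod P2_ring M" "basis_at M n p k u z d e"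
  shows "local_basis P2_ring M n k u z d e"
  using assms(2) unfolding basis_at_def
  by (intro local_basis.intro assms(1) local_basis_axioms.intro) auto

text \<open>An element of degree \<open>i\<close> in the twist has degree \<open>i - 1\<close> in
  \<open>M\<close>, so the same family has its degrees raised by one.\<close>

lemma basis_at_twist:
  assumes "basis_at M n p k u z d e"
  shows "basis_at (twist (-1) M) n p k u z (\<lambda>j. d j + 1) e"
proof -
  have f: "finsum (twist (-1) M) g {..<n} = finsum M g {..<n}" for g
    by (simp add: finsum_def finprod_def)
  have "\<exists>c. (\<forall>j<n. c j \<in> hpz (int k + i - int (d j + 1))) \<and> u \<odot>\<^bsub>M\<^esub> m = finsum M (\<lambda>j. c j \<odot>\<^bsub>M\<^esub> e j) {..<n}"
    if "m \<in> mpart M (i - 1)" for i m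
  proof -
    have eq: "int k + (i - 1) - int (d j) = int k + i - int (d j + 1)" for j
      by simp
    have "\<forall>i. \<forall>m\<in>mpart M i. \<exists>c. (\<forall>j<n. c j \<in> hpz (int k + i - int (d j))) \<and>
        u \<odot>\<^bsub>M\<^esub> m = finsum M (\<lambda>j. c j \<odot>\<^bsub>M\<^esub> e j) {..<n}"
      using assms unfolding basis_at_def by (elim conjE)
    from bspec[OF spec[OF this, of "i - 1"] that] show ?thesis
      unfolding eq .
  qed
  then show ?thesis
    using assms unfolding basis_at_def f twist_simps by simp
qed

context linear_forms
begin

lemma log_mod_eq: "P2_log_mod Q = quot_graded_module LD ES"
  by (simp add: P2_log_mod_def log_der_quot_def)

lemma log_mod_graded: "graded_mod P2_ring (P2_log_mod Q)"
  unfolding log_mod_eq by (rule LQ.quot_graded_mod)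

lemma log_mod_mpart:
  "X \<in> mpart (P2_log_mod Q) e \<longleftrightarrow> (\<exists>\<theta>\<in>mpart LD e. X = LQ.coset \<theta>)"
  by (auto simp: log_mod_eq LQ.quot_simps)

lemma LD_smult_closed: "\<theta> \<in> carrier LD \<Longrightarrow> (\<lambda>f. r * \<theta> f) \<in> carrier LD"
  using Module.module.smult_closed[OF LQ.module_axioms, of r \<theta>] by (simp add: LD_simps)

lemma log_mod_smult: "\<theta> \<in> carrier LD \<Longrightarrow> r \<odot>\<^bsub>P2_log_mod Q\<^esub> LQ.coset \<theta> = LQ.coset (\<lambda>f. r * \<theta> f)"
  using LQ.quot_smult[of r \<theta>] by (simp add: log_mod_eq LD_simps)

lemma log_mod_add: "\<theta> \<in> carrier LD \<Longrightarrow> \<eta> \<in> carrier LD \<Longrightarrow>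
    LQ.coset \<theta> \<oplus>\<^bsub>P2_log_mod Q\<^esub> LQ.coset \<eta> = LQ.coset (\<lambda>f. \<theta> f + \<eta> f)"
  using LQ.quot_add[of \<theta> \<eta>] by (simp add: log_mod_eq LD_simps)

lemma log_mod_sum2:
  assumes "\<theta> \<in> carrier LD" "\<eta> \<in> carrier LD"
  shows "finsum (P2_log_mod Q) (\<lambda>j. c j \<odot>\<^bsub>P2_log_mod Q\<^esub> (if j = 0 then LQ.coset \<theta> else LQ.coset \<eta>)) {..<2::nat} =
    LQ.coset (\<lambda>f. c 0 * \<theta> f + c 1 * \<eta> f)"
proof -
  interpret M: graded_mod P2_ring "P2_log_mod Q" by (rule log_mod_graded)
  have "LQ.coset \<theta> \<in> carrier (P2_log_mod Q)" "LQ.coset \<eta> \<in> carrier (P2_log_mod Q)"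
    using assms by (auto simp: log_mod_eq LQ.quot_simps)
  then have "finsum (P2_log_mod Q) (\<lambda>j. c j \<odot>\<^bsub>P2_log_mod Q\<^esub> (if j = 0 then LQ.coset \<theta> else LQ.coset \<eta>)) {..<2::nat} =
      c 0 \<odot>\<^bsub>P2_log_mod Q\<^esub> LQ.coset \<theta> \<oplus>\<^bsub>P2_log_mod Q\<^esub> c 1 \<odot>\<^bsub>P2_log_mod Q\<^esub> LQ.coset \<eta>"
    by (subst M.M.finsum_lessThan_2) simp_all
  then show ?thesis
    using assms by (simp add: log_mod_smult log_mod_add LD_smult_closed)
qed

lemma basis_at_point:
  assumes ne: "A \<noteq> {}" and p: "p \<in> Proj P2_ring"
  shows "\<exists>k u z d e. basis_at (P2_log_mod Q) 2 p k u z d e"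
proof -
  obtain L y z dx dy dz where L: "L \<in> A" and co: "coordinates (\<alpha> L) y z dx dy dz" and zp: "z \<notin> p"
    and through: "\<And>M. M \<in> A \<Longrightarrow> \<alpha> M \<in> p \<Longrightarrow> dz (\<alpha> M) = 0"
    using adapted_coordinates[OF ne p] by blast
  interpret C: coordinates "\<alpha> L" y z dx dy dz by (rule co)
  define B where "B = {M \<in> A. M \<noteq> L \<and> dz (\<alpha> M) = 0}"
  define C where "C = {M \<in> A. dz (\<alpha> M) \<noteq> 0}"
  define b where "b = prod \<alpha> B"
  define g where "g = prod \<alpha> C"
  have sub: "B \<subseteq> A - {L}" "B \<subseteq> A" "C \<subseteq> A"
    by (auto simp: B_def C_def)
  \<comment> \<open>By the choice of coordinates, no form that involves \<open>z\<close> lies in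
    \<open>p\<close>.\<close>
  have "g \<notin> p"
    unfolding g_def by (rule Proj_prod[OF p sub(3)]) (use through in \<open>auto simp: C_def\<close>)
  then have b: "b \<in> hp (card B)" "b \<noteq> 0" and g: "g \<in> hp (card C)" "g \<noteq> 0" "g \<notin> p"
    unfolding b_def g_def using sub by (simp_all add: prod_hp prod_nonzero)
  define e1 where "e1 = (\<lambda>f. g * b * dy f)"
  define e2 where "e2 = (\<lambda>f. g * dz f)"
  have dvd: "\<alpha> M dvd prod \<alpha> B" if "M \<in> B" for M
    using that sub(2) fin finite_subset by (metis dvd_prodI)
  have dvd': "\<alpha> M dvd prod \<alpha> C" if "M \<in> C" for M
    using that sub(3) fin finite_subset by (metis dvd_prodI)
  have e1: "e1 \<in> carrier LD"
    unfolding LD_carrier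
  proof (intro conjI ballI)
    show "e1 \<in> Der P2_ring"
      unfolding e1_def by (intro Der_P2_smult C.Der)
    fix M assume M: "M \<in> A"
    consider "M = L" | "M \<in> B" | "M \<in> C"
      using M by (auto simp: B_def C_def)
    then show "\<alpha> M dvd e1 (\<alpha> M)"
      using dvd[of M] dvd'[of M] by cases (auto simp: e1_def b_def g_def C.dual)
  qed
  have e2: "e2 \<in> carrier LD"
    unfolding LD_carrier
  proof (intro conjI ballI)
    show "e2 \<in> Der P2_ring"
      unfolding e2_def by (intro Der_P2_smult C.Der)
    fix M assume M: "M \<in> A"
    then show "\<alpha> M dvd e2 (\<alpha> M)"
      using dvd'[of M] by (cases "dz (\<alpha> M) = 0") (auto simp: e2_def g_def C_def)
  qed
  have e1_part: "e1 \<in> mpart LD (int (card C + card B))"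
    unfolding LD_mpart hpz_int using e1 hp_mult[OF hp_mult[OF g(1) b(1)] C.const(2)] by (auto simp: e1_def)
  have e2_part: "e2 \<in> mpart LD (int (card C))"
    unfolding LD_mpart hpz_int using e2 hp_mult[OF g(1) C.const(3)] by (auto simp: e2_def)
  define d where "d = (\<lambda>j::nat. if j = 0 then card C + card B else card C)"
  define e where "e = (\<lambda>j::nat. if j = 0 then LQ.coset e1 else LQ.coset e2)"
  have span: "\<exists>c. (\<forall>j<2. c j \<in> hpz (int (card C) + i - int (d j))) \<and>
        g \<odot>\<^bsub>P2_log_mod Q\<^esub> X = finsum (P2_log_mod Q) (\<lambda>j. c j \<odot>\<^bsub>P2_log_mod Q\<^esub> e j) {..<2}"
    if X: "X \<in> mpart (P2_log_mod Q) i" for X i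
  proof -
    obtain \<theta> where \<theta>: "\<theta> \<in> mpart LD i" "X = LQ.coset \<theta>"
      using X unfolding log_mod_mpart by blast
    then have \<theta>': "\<theta> \<in> Der P2_ring" "\<And>M. M \<in> A \<Longrightarrow> \<alpha> M dvd \<theta> (\<alpha> M)" and \<theta>c: "\<theta> \<in> carrier LD"
      by (auto simp: LD_mpart LD_carrier)
    have \<theta>d: "\<theta> l \<in> hpz i" if "l \<in> hp 1" for l
      using \<theta> that by (simp add: LD_mpart)
    obtain t s where ts: "\<theta> (\<alpha> L) = \<alpha> L * t" "\<theta> y = t * y + b * s"
      using C.saito_coefficients[OF linear_forms_axioms L refl \<theta>' sub(1)] by (auto simp: B_def b_def)
    \<comment> \<open>The cofactors \<open>t\<close> and \<open>s\<close> come without degrees;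
      these are forced, since \<open>\<alpha> L * t\<close> and \<open>b * s\<close> are
      homogeneous.\<close>
    have t: "t \<in> hpz (i - int 1)"
      using \<theta>d[OF C.linear(1)] ts(1) by (intro hz_dvd[OF C.linear(1) C.x_nonzero]) simp
    have ty: "l * t \<in> hpz i" if "l \<in> hp 1" for l
      using hpz_mult[OF that t] by simp
    have "b * s = \<theta> y - y * t"
      using ts(2) by (simp add: mult.commute)
    then have "b * s \<in> hpz i"
      using hpz_diff[OF \<theta>d ty] C.linear by simp
    then have s: "s \<in> hpz (i - int (card B))"
      by (rule hz_dvd[OF b])
    define c where "c = (\<lambda>j::nat. if j = 0 then s else \<theta> z - z * t)"
    \<comment> \<open>Derivations are compared on the three coordinates: the Euler term accounts for
      the value at \<open>\<alpha> L\<close>, then \<open>e1\<close> corrects the value at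
      \<open>y\<close> and \<open>e2\<close> that at \<open>z\<close>.\<close>
    have "(\<lambda>f. g * \<theta> f) = (\<lambda>f. g * t * euler f + (s * e1 f + (\<theta> z - z * t) * e2 f))"
      using \<theta>' by (intro C.Der_eqI Der_P2_smult Der_P2_add euler_Der)
        (use e1 e2 C.linear in \<open>auto simp: LD_carrier e1_def e2_def C.dual euler_linear ts algebra_simps\<close>)
    then have "LQ.coset (\<lambda>f. g * \<theta> f) = LQ.coset (\<lambda>f. s * e1 f + (\<theta> z - z * t) * e2 f)"
      using LD_smult_closed[OF \<theta>c, of g] LQ.M.a_closed[OF LD_smult_closed[OF e1, of s] LD_smult_closed[OF e2, of "\<theta> z - z * t"]]
      by (subst coset_eq) (auto simp: LD_simps fun_eq_iff)
    then have "g \<odot>\<^bsub>P2_log_mod Q\<^esub> X = finsum (P2_log_mod Q) (\<lambda>j. c j \<odot>\<^bsub>P2_log_mod Q\<^esub> e j) {..<2}"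
      unfolding e_def log_mod_sum2[OF e1 e2] \<theta>(2) log_mod_smult[OF \<theta>c] by (simp add: c_def)
    moreover have "c j \<in> hpz (int (card C) + i - int (d j))" for j
      using s hpz_diff[OF \<theta>d ty] C.linear by (simp add: c_def d_def)
    ultimately show ?thesis by blast
  qed
  have indep: "\<forall>j<2. c j = c' j"
    if eq: "finsum (P2_log_mod Q) (\<lambda>j. c j \<odot>\<^bsub>P2_log_mod Q\<^esub> e j) {..<2} =
      finsum (P2_log_mod Q) (\<lambda>j. c' j \<odot>\<^bsub>P2_log_mod Q\<^esub> e j) {..<2}" for c c'
  proof -
    have cl: "(\<lambda>f. c 0 * e1 f + c 1 * e2 f) \<in> carrier LD" for c :: "nat \<Rightarrow> 'k poly3"
      using LQ.M.a_closed[OF LD_smult_closed[OF e1, of "c 0"] LD_smult_closed[OF e2, of "c 1"]] by (simp add: LD_simps)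
    obtain r where r: "\<And>f. c 0 * e1 f + c 1 * e2 f = r * euler f + (c' 0 * e1 f + c' 1 * e2 f)"
      using eq unfolding e_def log_mod_sum2[OF e1 e2] coset_eq[OF cl cl] by blast
    \<comment> \<open>Both basis derivations kill \<open>\<alpha> L\<close>, while the Euler
      derivation does not.\<close>
    have "r = 0"
      using r[of "\<alpha> L"] C.x_nonzero by (simp add: e1_def e2_def C.dual euler_linear C.linear)
    then have "c 0 * (g * b) = c' 0 * (g * b)" "c 1 * g = c' 1 * g"
      using r[of y] r[of z] by (simp_all add: e1_def e2_def C.dual)
    then have "c 0 = c' 0" "c 1 = c' 1"
      using b g by simp_all
    moreover have "j = 0 \<or> j = 1" if "j < 2" for j :: nat
      using that by auto
    ultimately show ?thesis by metis
  qed
  have "basis_at (P2_log_mod Q) 2 p (card C) g z d e"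
    unfolding basis_at_def
  proof (intro conjI allI impI ballI)
    show "e j \<in> mpart (P2_log_mod Q) (int (d j))" for j
      unfolding log_mod_mpart using e1_part e2_part by (auto simp: e_def d_def)
    show "g \<in> hp (card C)" "z \<in> hp 1" "g \<notin> p" "z \<notin> p"
      by (fact g C.linear zp)+
    fix i X assume "X \<in> mpart (P2_log_mod Q) i"
    then show "\<exists>c. (\<forall>j<2. c j \<in> hpz (int (card C) + i - int (d j))) \<and>
        g \<odot>\<^bsub>P2_log_mod Q\<^esub> X = finsum (P2_log_mod Q) (\<lambda>j. c j \<odot>\<^bsub>P2_log_mod Q\<^esub> e j) {..<2}"
      by (rule span)
  next
    fix c c' and j :: nat
    assume "finsum (P2_log_mod Q) (\<lambda>j. c j \<odot>\<^bsub>P2_log_mod Q\<^esub> e j) {..<2} =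
      finsum (P2_log_mod Q) (\<lambda>j. c' j \<odot>\<^bsub>P2_log_mod Q\<^esub> e j) {..<2}" "j < 2"
    then show "c j = c' j"
      using indep by blast
  qed
  then show ?thesis by blast
qed

theorem log_mod_vector_bundle:
  assumes "A \<noteq> {}"
  shows "vector_bundle (Proj_space P2_ring) 2 (tilde P2_ring (P2_log_mod Q))"
    and "vector_bundle (Proj_space P2_ring) 2 (tilde P2_ring (twist (-1) (P2_log_mod Q)))"
proof -
  show "vector_bundle (Proj_space P2_ring) 2 (tilde P2_ring (P2_log_mod Q))"
  proof (rule graded_mod.tilde_vector_bundle[OF log_mod_graded])
    fix p :: "'k poly3 set" assume "p \<in> Proj P2_ring"
    then obtain k u z d e where b: "basis_at (P2_log_mod Q) 2 p k u z d e"
      using basis_at_point[OF assms] by blast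
    then show "\<exists>k u z d e. local_basis P2_ring (P2_log_mod Q) 2 k u z d e \<and> u \<notin> p \<and> z \<notin> p"
      using basis_at_local_basis[OF log_mod_graded b] unfolding basis_at_def by blast
  qed
  show "vector_bundle (Proj_space P2_ring) 2 (tilde P2_ring (twist (-1) (P2_log_mod Q)))"
  proof (rule graded_mod.tilde_vector_bundle[OF graded_mod_twist[OF log_mod_graded]])
    fix p :: "'k poly3 set" assume "p \<in> Proj P2_ring"
    then obtain k u z d e where "basis_at (P2_log_mod Q) 2 p k u z d e"
      using basis_at_point[OF assms] by blast
    then have b: "basis_at (twist (-1) (P2_log_mod Q)) 2 p k u z (\<lambda>j. d j + 1) e"
      by (rule basis_at_twist)
    then show "\<exists>k u z d e. local_basis P2_ring (twist (-1) (P2_log_mod Q)) 2 k u z d e \<and> u \<notin> p \<and> z \<notin> p"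
      using basis_at_local_basis[OF graded_mod_twist[OF log_mod_graded] b] unfolding basis_at_def by blast
  qed
qed

end

lemma graded_quot_twist:
  assumes "graded_quot A M K"
  shows "graded_quot A (twist n M) K"
proof -
  interpret graded_quot A M K by fact
  have "submodule K A (twist n M)"
    using submodule_axioms by (simp add: submodule_def submodule_axioms_def)
  then show ?thesis
    by (intro graded_quot.intro graded_mod_twist graded_mod_axioms)
qed

section \<open>Multiplication by the form of \<open>H\<close>\<close>

locale linear_forms_triple = linear_forms A \<alpha>
  for A :: "'i set" and \<alpha> :: "'i \<Rightarrow> 'k::field_char_0 poly3" +
  fixes H :: 'i
  assumes H: "H \<in> A"
begin

abbreviation "a \<equiv> \<alpha> H"

lemma a_linear: "a \<in> hp 1" and a_nonzero: "a \<noteq> 0"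
  using H form nonzero by auto

sublocale D': linear_forms "A - {H}" \<alpha>
  by (rule subforms) auto

text \<open>For \<open>L\<close> other than \<open>H\<close> the prime \<open>\<alpha> L\<close>
  does not divide \<open>a\<close>, so the factor \<open>a\<close> changes nothing; at
  \<open>H\<close> the condition becomes automatic.\<close>

lemma mult_LD:
  assumes "\<theta> \<in> Der P2_ring"
  shows "(\<lambda>f. a * \<theta> f) \<in> carrier LD \<longleftrightarrow> \<theta> \<in> carrier D'.LD"
proof -
  have "\<alpha> L dvd a * \<theta> (\<alpha> L) \<longleftrightarrow> L = H \<or> \<alpha> L dvd \<theta> (\<alpha> L)" if L: "L \<in> A" for L
    using distinct[OF L H] by (auto simp: linear_prime(1)[OF form[OF L] nonzero[OF L]])
  then show ?thesis
    unfolding LD_carrier D'.LD_carrier using assms Der_P2_smult[OF assms, of a] by auto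
qed

lemma mult_graded_quot_map:
  "graded_quot_map P2_ring P2_ring (\<lambda>x. x) (twist (-1) D'.LD) LD (\<lambda>\<theta>. a \<odot>\<^bsub>LD\<^esub> \<theta>) D'.ES ES"
proof (intro graded_quot_map.intro graded_semilinear.intro)
  show "graded_surj P2_ring P2_ring (\<lambda>x. x)"
    by (rule graded_cring.graded_surj_id[OF P2_graded])
  show "graded_mod P2_ring (twist (-1) D'.LD)"
    by (rule graded_mod_twist[OF D'.LQ.graded_mod_axioms])
  show "graded_quot P2_ring (twist (-1) D'.LD) D'.ES"
    by (rule graded_quot_twist[OF D'.LD_quot])
  have cl: "(\<lambda>f. a * \<theta> f) \<in> carrier LD" if "\<theta> \<in> carrier D'.LD" for \<theta>
    using mult_LD[of \<theta>] that unfolding D'.LD_carrier by blast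
  show "graded_semilinear_axioms P2_ring (\<lambda>x. x) (twist (-1) D'.LD) LD ((\<odot>\<^bsub>LD\<^esub>) a)"
  proof
    fix \<theta> e assume "\<theta> \<in> mpart (twist (-1) D'.LD) e"
    then have "\<theta> \<in> carrier D'.LD" "\<forall>l\<in>hp 1. \<theta> l \<in> hpz (- 1 + e)"
      by (simp_all add: D'.LD_mpart)
    then show "a \<odot>\<^bsub>LD\<^esub> \<theta> \<in> mpart LD e"
      unfolding LD_mpart LD_simps using cl hpz_mult[OF a_linear, of _ "- 1 + e"] by simp
  qed (auto simp: cl LD_simps D'.LD_simps distrib_left mult.left_commute)
  show "graded_quot_map_axioms ((\<odot>\<^bsub>LD\<^esub>) a) D'.ES ES"
  proof
    fix \<kappa> assume "\<kappa> \<in> D'.ES"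
    then obtain r where "\<kappa> = (\<lambda>f. r * euler f)"
      using D'.ES_iff by blast
    then show "a \<odot>\<^bsub>LD\<^esub> \<kappa> \<in> ES"
      unfolding ES_iff LD_simps by (intro exI[of _ "a * r"]) (simp add: mult.assoc)
  qed
qed (rule LQ.graded_mod_axioms LD_quot)+

lemma mult_map_semilinear:
  "graded_semilinear P2_ring P2_ring (\<lambda>x. x) (twist (-1) (P2_log_mod D'.Q)) (P2_log_mod Q) (mult_map a Q)"
  using graded_quot_map.quot_semilinear[OF mult_graded_quot_map]
  by (simp add: quot_graded_module_twist log_mod_eq D'.log_mod_eq mult_map_def)

lemma mult_map_coset:
  assumes "\<theta> \<in> carrier D'.LD"
  shows "mult_map a Q (D'.LQ.coset \<theta>) = LQ.coset (\<lambda>f. a * \<theta> f)"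
proof -
  have "D'.ES +>\<^bsub>twist (-1) D'.LD\<^esub> \<theta> = D'.LQ.coset \<theta>"
    by (simp add: a_r_coset_def')
  then show ?thesis
    using graded_quot_map.coset_map_coset[OF mult_graded_quot_map, of \<theta>] assms
    by (simp add: mult_map_def LD_simps)
qed

text \<open>If \<open>a * \<theta> f\<close> and \<open>a * \<eta> f\<close> differ by
  \<open>r * euler f\<close>, evaluation at a linear form \<open>y\<close> not divisible by
  \<open>a\<close> shows that \<open>a\<close> divides \<open>r * y\<close>, hence \<open>r\<close>.
  Then \<open>a\<close> can be cancelled.\<close>

lemma mult_map_inj: "inj_on (mult_map a Q) (carrier (P2_log_mod D'.Q))"
proof (rule inj_onI)
  fix X Y assume XY: "X \<in> carrier (P2_log_mod D'.Q)" "Y \<in> carrier (P2_log_mod D'.Q)"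
    and eq: "mult_map a Q X = mult_map a Q Y"
  obtain \<theta> \<eta> where t: "\<theta> \<in> carrier D'.LD" "X = D'.LQ.coset \<theta>" "\<eta> \<in> carrier D'.LD" "Y = D'.LQ.coset \<eta>"
    using XY by (auto simp: D'.log_mod_eq D'.LQ.quot_simps)
  have D: "\<theta> \<in> Der P2_ring" "\<eta> \<in> Der P2_ring"
    using t by (auto simp: D'.LD_carrier)
  have "LQ.coset (\<lambda>f. a * \<theta> f) = LQ.coset (\<lambda>f. a * \<eta> f)"
    using eq t mult_map_coset by simp
  then obtain r where r: "\<And>f. a * \<theta> f = r * euler f + a * \<eta> f"
    using coset_eq mult_LD D t(1,3) by blast
  obtain y where y: "y \<in> hp 1" "cross (lcoeff a) (lcoeff y) \<noteq> (\<lambda>i. 0)"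
    using cross_coord_nonzero[OF a_linear a_nonzero] by blast
  \<comment> \<open>The derivation dual to \<open>y\<close> takes the value \<open>1\<close> at
    \<open>y\<close> but \<open>0\<close> at constant multiples of \<open>a\<close>.\<close>
  have "\<not> a dvd y"
  proof
    assume "a dvd y"
    then obtain c where c: "y = const c * a"
      using linear_dvd_linear[OF a_linear a_nonzero y(1)] by blast
    obtain z dx dy dz where "coordinates a y z dx dy dz"
      using coordinates_extend[OF a_linear y] by blast
    then interpret C: coordinates a y z dx dy dz .
    have "dy y = const c * dy a"
      using Der_P2D(2)[OF C.Der(2)] c by simp
    then show False
      by (simp add: C.dual)
  qed
  moreover have "a dvd r * y"
  proof
    show "r * y = a * (\<theta> y - \<eta> y)"
      using r[of y] euler_linear[OF y(1)] by (simp add: algebra_simps)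
  qed
  ultimately obtain s where s: "r = a * s"
    using linear_prime(1)[OF a_linear a_nonzero] by (auto elim: dvdE)
  have "\<theta> f = s * euler f + \<eta> f" for f
  proof -
    have "a * \<theta> f = a * (s * euler f + \<eta> f)"
      using r[of f] s by (simp add: algebra_simps)
    then show ?thesis
      using a_nonzero by simp
  qed
  then show "X = Y"
    using t D'.coset_eq by blast
qed

text \<open>The multiple \<open>r\<close> of the Euler derivation need not be homogeneous, but may be replaced by one of its
  homogeneous components.\<close>

lemma mult_map_lift:
  assumes \<theta>: "\<theta> \<in> mpart LD e" and r: "\<And>f. a dvd \<theta> f - r * euler f"
  shows "\<exists>Y\<in>mpart (twist (-1) (P2_log_mod D'.Q)) e. mult_map a Q Y = LQ.coset \<theta>"
proof -
  define t where "t = hz (e - 1) r"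
  have \<theta>D: "\<theta> \<in> Der P2_ring" "\<theta> \<in> carrier LD"
    using \<theta> by (auto simp: LD_mpart LD_carrier)
  \<comment> \<open>Only the components of degree \<open>e\<close> of the equation
    \<open>\<theta> l = l * r + a * v\<close> are kept; its left side is homogeneous
    already.\<close>
  have lin: "\<exists>w\<in>hpz (e - 1). \<theta> l - t * euler l = a * w" if l: "l \<in> hp 1" for l
  proof -
    obtain v where v: "\<theta> l - r * euler l = a * v"
      using r[of l] by (elim dvdE)
    then have "\<theta> l = l * r + a * v"
      using euler_linear[OF l] by (simp add: algebra_simps)
    moreover have "hz e (\<theta> l) = \<theta> l"
      using \<theta> l by (intro hz_id) (simp add: LD_mpart)
    ultimately have "\<theta> l = l * t + a * hz (e - 1) v"
      using hz_mult[OF l, of e r] hz_mult[OF a_linear, of e v] by (simp add: hz_add t_def)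
    then show ?thesis
      using euler_linear[OF l] hz_hpz by (intro bexI[of _ "hz (e - 1) v"]) (simp_all add: algebra_simps)
  qed
  define \<theta>' where "\<theta>' = (\<lambda>f. \<theta> f - t * euler f)"
  have \<theta>'D: "\<theta>' \<in> Der P2_ring"
    unfolding \<theta>'_def by (rule Der_P2_diff[OF \<theta>D(1) euler_Der])
  have "a dvd \<theta>' (coord i)" for i
    using lin[OF coord_hp, of i] by (auto simp: \<theta>'_def)
  then have dvd: "a dvd \<theta>' f" for f
    by (rule Der_dvd_coord[OF \<theta>'D])
  \<comment> \<open>The quotient is chosen value by value; that it is a derivation follows by
    cancelling \<open>a\<close> from the rules for \<open>\<theta>'\<close>.\<close>
  then obtain \<eta> where \<eta>: "\<And>f. \<theta>' f = a * \<eta> f"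
    unfolding dvd_def by metis
  have "\<eta> \<in> Der P2_ring"
  proof -
    note D = iffD1[OF Der_P2_iff \<theta>'D, unfolded \<eta>]
    have 1: "a * \<eta> (f + g) = a * (\<eta> f + \<eta> g)" for f g
      using conjunct1[OF D] by (simp add: distrib_left)
    have 2: "a * \<eta> (c * f) = a * (c * \<eta> f)" if "c \<in> hp 0" for f c
    proof -
      have "a * \<eta> (c * f) = c * (a * \<eta> f)"
        using conjunct1[OF conjunct2[OF D]] that by blast
      then show ?thesis
        by (simp only: mult.left_commute)
    qed
    have 3: "a * \<eta> (f * g) = a * (f * \<eta> g + g * \<eta> f)" for f g
    proof -
      have "a * \<eta> (f * g) = f * (a * \<eta> g) + g * (a * \<eta> f)"
        using conjunct2[OF conjunct2[OF D]] by blast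
      then show ?thesis
        by (simp only: distrib_left mult.left_commute)
    qed
    have cancel: "v = w" if "a * v = a * w" for v w
      using that a_nonzero by simp
    show ?thesis
      unfolding Der_P2_iff using cancel[OF 1] cancel[OF 2] cancel[OF 3] by blast
  qed
  have \<theta>'_eq: "(\<lambda>f. a * \<eta> f) = \<theta>'"
    using \<eta> by (simp add: fun_eq_iff)
  have "LQ.coset \<theta>' = LQ.coset \<theta> \<and> \<theta>' \<in> carrier LD"
  proof
    show "\<theta>' \<in> carrier LD"
      unfolding LD_carrier
    proof (intro conjI \<theta>'D ballI)
      fix L assume L: "L \<in> A"
      then show "\<alpha> L dvd \<theta>' (\<alpha> L)"
        using \<theta>D(2) euler_linear[OF form[OF L]] unfolding \<theta>'_def LD_carrier by (auto intro!: dvd_diff)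
    qed
    then show "LQ.coset \<theta>' = LQ.coset \<theta>"
      using coset_eq[OF _ \<theta>D(2)] by (auto simp: \<theta>'_def intro!: exI[of _ "- t"])
  qed
  moreover from this have \<eta>c: "\<eta> \<in> carrier D'.LD"
    using mult_LD[OF \<open>\<eta> \<in> _\<close>] unfolding \<theta>'_eq by simp
  moreover have "\<eta> l \<in> hpz (- 1 + e)" if l: "l \<in> hp 1" for l
  proof -
    obtain w where "w \<in> hpz (e - 1)" "a * \<eta> l = a * w"
      using lin[OF l] \<eta>[of l] by (auto simp: \<theta>'_def)
    then show ?thesis
      using a_nonzero by (simp add: add.commute)
  qed
  then have "D'.LQ.coset \<eta> \<in> mpart (twist (-1) (P2_log_mod D'.Q)) e"
    using \<eta>c by (auto simp: D'.log_mod_mpart D'.LD_mpart)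
  ultimately show ?thesis
    using mult_map_coset[OF \<eta>c] \<theta>'_eq by (metis (no_types, lifting))
qed

end

section \<open>The restriction to a line\<close>

locale line =
  fixes a :: "'k::field_char_0 poly3"
  assumes a_linear: "a \<in> hp 1" and a_nonzero: "a \<noteq> 0"
begin

abbreviation "S \<equiv> line_ring a"
abbreviation "\<pi> \<equiv> line_proj a"
abbreviation "I \<equiv> PIdl\<^bsub>P2_ring\<^esub> a"

lemma I_ideal: "ideal I P2_ring"
  using cring.cgenideal_ideal[OF P2_ring_cring, of a] by simp

sublocale I: ideal I P2_ring
  by (rule I_ideal)

lemma proj_eq: "\<pi> f = \<pi> g \<longleftrightarrow> a dvd f - g"
proof -
  have "f \<ominus>\<^bsub>P2_ring\<^esub> g = f - g"
    by (simp add: a_minus_def)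
  then show ?thesis
    unfolding line_proj_def using I.quotient_eq_iff_same_a_r_cos[OF I_ideal, of f g] by (simp add: PIdl_P2)
qed

lemma mem_proj: "g \<in> \<pi> f \<longleftrightarrow> a dvd g - f"
proof -
  have "g \<in> \<pi> f \<longleftrightarrow> g \<ominus>\<^bsub>P2_ring\<^esub> f \<in> I"
    unfolding line_proj_def using I.a_rcos_module[of f g] by (simp add: a_minus_def)
  then show ?thesis
    by (simp add: a_minus_def PIdl_P2)
qed

lemma carrier_quot: "carrier (P2_ring Quot I) = range \<pi>"
  by (auto simp: FactRing_def A_RCOSETS_def' line_proj_def)

lemma S_simps:
  "carrier S = range \<pi>" "\<pi> f \<otimes>\<^bsub>S\<^esub> \<pi> g = \<pi> (f * g)" "\<pi> f \<oplus>\<^bsub>S\<^esub> \<pi> g = \<pi> (f + g)"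
  "\<zero>\<^bsub>S\<^esub> = \<pi> 0" "\<one>\<^bsub>S\<^esub> = \<pi> 1" "hpart S n = \<pi> ` hp n"
proof -
  have z: "I = \<pi> 0"
    using I.a_coset_add_zero[of I] I.a_subset by (simp add: line_proj_def)
  show "carrier S = range \<pi>"
    using carrier_quot by (simp add: line_ring_def quot_graded_ring_def ring.extend_def)
  show "\<pi> f \<otimes>\<^bsub>S\<^esub> \<pi> g = \<pi> (f * g)"
    using I.rcoset_mult_add[of f g] by (simp add: line_ring_def quot_graded_ring_def ring.extend_def FactRing_def line_proj_def)
  show "\<pi> f \<oplus>\<^bsub>S\<^esub> \<pi> g = \<pi> (f + g)"
    using I.a_rcos_sum[of f g] by (simp add: line_ring_def quot_graded_ring_def ring.extend_def FactRing_def line_proj_def)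
  show "\<zero>\<^bsub>S\<^esub> = \<pi> 0"
    using z by (simp add: line_ring_def quot_graded_ring_def ring.extend_def FactRing_def)
  show "\<one>\<^bsub>S\<^esub> = \<pi> 1"
    by (simp add: line_ring_def quot_graded_ring_def ring.extend_def FactRing_def line_proj_def)
  show "hpart S n = \<pi> ` hp n"
    by (auto simp: line_ring_def quot_graded_ring_def ring.extend_def line_proj_def)
qed

lemma S_cring: "cring S"
proof (rule cringI)
  show "abelian_group S"
  proof (rule abelian_groupI)
    fix x assume "x \<in> carrier S"
    then obtain f where "x = \<pi> f"
      by (auto simp: S_simps)
    then show "\<exists>y\<in>carrier S. y \<oplus>\<^bsub>S\<^esub> x = \<zero>\<^bsub>S\<^esub>"
      by (intro bexI[of _ "\<pi> (- f)"]) (simp_all add: S_simps)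
  qed (auto simp: S_simps ac_simps)
  show "comm_monoid S"
    by (rule comm_monoidI) (auto simp: S_simps ac_simps)
qed (auto simp: S_simps distrib_right)

lemma S_uminus: "\<ominus>\<^bsub>S\<^esub> \<pi> f = \<pi> (- f)"
proof -
  interpret cring S by (rule S_cring)
  show ?thesis
    by (rule minus_equality) (simp_all add: S_simps)
qed

lemma S_graded: "graded_cring S"
proof (intro graded_cring.intro S_cring, unfold_locales)
  fix x y m n assume "x \<in> hpart S m" "y \<in> hpart S n"
  then show "x \<otimes>\<^bsub>S\<^esub> y \<in> hpart S (m + n)"
    by (auto simp: S_simps intro: hp_mult)
next
  fix x y n assume "x \<in> hpart S n" "y \<in> hpart S n"
  then show "x \<oplus>\<^bsub>S\<^esub> y \<in> hpart S n"
    by (auto simp: S_simps intro: hp_add)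
next
  fix x n assume "x \<in> hpart S n"
  then show "\<ominus>\<^bsub>S\<^esub> x \<in> hpart S n"
    by (auto simp: S_simps S_uminus intro: hp_minus)
qed (auto simp: S_simps)

lemma proj_surj: "graded_surj P2_ring S \<pi>"
proof (intro graded_surj.intro P2_graded S_graded, unfold_locales)
  show "\<pi> \<in> ring_hom P2_ring S"
    by (rule ring_hom_memI) (simp_all add: S_simps)
  show "\<pi> ` hpart P2_ring n = hpart S n" for n
    by (simp add: S_simps)
  show "\<pi> ` carrier P2_ring = carrier S"
    by (simp add: S_simps)
  fix f assume "\<pi> f = \<zero>\<^bsub>S\<^esub>"
  then have "a dvd f"
    using proj_eq[of f 0] by (simp add: S_simps)
  then obtain g where g: "f = a * g"
    by (elim dvdE)
  let ?J = "Idl\<^bsub>P2_ring\<^esub> {h \<in> homog P2_ring. \<pi> h = \<zero>\<^bsub>S\<^esub>}"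
  have J: "ideal ?J P2_ring" and sub: "{h \<in> homog P2_ring. \<pi> h = \<zero>\<^bsub>S\<^esub>} \<subseteq> ?J"
    using I.genideal_ideal I.genideal_self by simp_all
  \<comment> \<open>The kernel is the principal ideal of \<open>a\<close>, and \<open>a\<close> is
    itself homogeneous.\<close>
  have "a \<in> {h \<in> homog P2_ring. \<pi> h = \<zero>\<^bsub>S\<^esub>}"
    using a_linear proj_eq[of a 0] by (auto simp: S_simps homog_def)
  then have "a \<in> ?J"
    using sub by blast
  then show "f \<in> ?J"
    using ideal.I_r_closed[OF J, of a g] g by simp
qed

sublocale GS: graded_surj P2_ring S \<pi>
  by (rule proj_surj)

lemma S_zero_iff: "\<pi> f = \<pi> 0 \<longleftrightarrow> a dvd f"
  using proj_eq[of f 0] by simp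

definition \<rho> :: "('k poly3 \<Rightarrow> 'k poly3) \<Rightarrow> 'k poly3 set \<Rightarrow> 'k poly3 set" where
  "\<rho> = der_restrict P2_ring I"

lemma \<rho>_extensional: "\<rho> \<theta> \<in> extensional (carrier S)"
  by (simp add: \<rho>_def der_restrict_def carrier_quot S_simps)

text \<open>The hypothesis \<open>a dvd \<theta> a\<close> says that \<open>\<theta>\<close>
  preserves the ideal of \<open>a\<close>: the values \<open>\<theta> (f + a * h)\<close> and
  \<open>\<theta> f\<close> differ by \<open>a * \<theta> h + h * \<theta> a\<close>.\<close>

lemma \<rho>_proj:
  assumes "\<theta> \<in> Der P2_ring" "a dvd \<theta> a"
  shows "\<rho> \<theta> (\<pi> f) = \<pi> (\<theta> f)"
proof -
  have "\<pi> (\<theta> g) = \<pi> (\<theta> f)" if g: "g \<in> \<pi> f" for g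
  proof -
    obtain h where "g - f = a * h"
      using g unfolding mem_proj by (elim dvdE)
    then have "g = f + a * h"
      by (simp add: algebra_simps)
    then have "\<theta> g - \<theta> f = a * \<theta> h + h * \<theta> a"
      by (simp add: Der_P2D[OF assms(1)])
    then show ?thesis
      using assms(2) by (simp add: proj_eq)
  qed
  moreover have "f \<in> \<pi> f"
    by (simp add: mem_proj)
  ultimately have "(\<Union>g\<in>\<pi> f. \<pi> (\<theta> g)) = \<pi> (\<theta> f)"
    by fast
  then show ?thesis
    by (simp add: \<rho>_def der_restrict_def carrier_quot coset_map_def line_proj_def)
qed

lemma \<rho>_Der:
  assumes "\<theta> \<in> Der P2_ring" "a dvd \<theta> a"
  shows "\<rho> \<theta> \<in> Der S"
  using iffD1[OF Der_P2_iff assms(1)]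
  by (intro graded_cring.DerI[OF S_graded] \<rho>_extensional) (auto simp: S_simps \<rho>_proj[OF assms])

lemma Der_S_const: "\<eta> \<in> Der S \<Longrightarrow> \<eta> (\<pi> (const c)) = \<pi> 0"
proof -
  assume \<eta>: "\<eta> \<in> Der S"
  note D = graded_cring.DerD[OF S_graded \<eta>]
  obtain g where g: "\<eta> (\<pi> 1) = \<pi> g"
    using graded_cring.Der_closed[OF S_graded \<eta>, of "\<pi> 1"] by (auto simp: S_simps)
  have "\<pi> g = \<pi> (g + g)"
    using D(3)[of "\<pi> 1" "\<pi> 1"] g by (simp add: S_simps)
  then have "a dvd g"
    using proj_eq[of "g + g" g] by simp
  moreover have "\<eta> (\<pi> (const c)) = \<pi> (const c * g)"
    using D(2)[of "\<pi> (const c)" "\<pi> 1"] g by (simp add: S_simps)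
  ultimately show ?thesis
    by (simp add: S_zero_iff)
qed

end

section \<open>Points on the line and their logarithmic derivations\<close>

locale line_coordinates = line a + coordinates a y z dx dy dz
  for a y z :: "'k::field_char_0 poly3" and dx dy dz
begin

text \<open>\<open>\<pi> y\<close> and \<open>\<pi> z\<close> generate the quotient ring over its
  constants, so the values there determine a derivation.\<close>

lemma Der_S_eqI:
  assumes \<eta>: "\<eta> \<in> Der S" "\<eta>' \<in> Der S" and eq: "\<eta> (\<pi> y) = \<eta>' (\<pi> y)" "\<eta> (\<pi> z) = \<eta>' (\<pi> z)"
  shows "\<eta> = \<eta>'"
proof (rule extensionalityI)
  show "\<eta> \<in> extensional (carrier S)" "\<eta>' \<in> extensional (carrier S)"
    using graded_cring.Der_extensional[OF S_graded] \<eta> by blast+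
  note D = graded_cring.DerD[OF S_graded \<eta>(1)] and D' = graded_cring.DerD[OF S_graded \<eta>(2)]
  have lin: "\<eta> (\<pi> l) = \<eta>' (\<pi> l)" if l: "l \<in> hp 1" for l
  proof -
    have "\<pi> l = \<pi> (dy l * y + dz l * z)"
    proof -
      have "dx l * a + dy l * y + dz l * z - (dy l * y + dz l * z) = dx l * a"
        by simp
      then show ?thesis
        unfolding proj_eq expand[OF l, symmetric] by simp
    qed
    also have "\<dots> = (\<pi> (dy l) \<otimes>\<^bsub>S\<^esub> \<pi> y) \<oplus>\<^bsub>S\<^esub> (\<pi> (dz l) \<otimes>\<^bsub>S\<^esub> \<pi> z)"
      by (simp add: S_simps)
    finally have e: "\<pi> l = (\<pi> (dy l) \<otimes>\<^bsub>S\<^esub> \<pi> y) \<oplus>\<^bsub>S\<^esub> (\<pi> (dz l) \<otimes>\<^bsub>S\<^esub> \<pi> z)" .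
    have m: "\<pi> (dy l) \<otimes>\<^bsub>S\<^esub> \<pi> y \<in> carrier S" "\<pi> (dz l) \<otimes>\<^bsub>S\<^esub> \<pi> z \<in> carrier S"
      "\<pi> (dy l) \<in> hpart S 0" "\<pi> (dz l) \<in> hpart S 0" "\<pi> y \<in> carrier S" "\<pi> z \<in> carrier S"
      using const[OF l] by (auto simp: S_simps)
    show ?thesis
      unfolding e D(1)[OF m(1,2)] D'(1)[OF m(1,2)] D(2)[OF m(3,5)] D'(2)[OF m(3,5)] D(2)[OF m(4,6)] D'(2)[OF m(4,6)] eq ..
  qed
  have "\<eta> (\<pi> f) = \<eta>' (\<pi> f)" for f
  proof (induction f rule: poly3_generate)
    case (const c)
    then show ?case
      using Der_S_const[OF \<eta>(1), of c] Der_S_const[OF \<eta>(2), of c] by simp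
  next
    case (coord i)
    then show ?case by (rule lin) simp
  next
    case (add f g)
    then show ?case
      using D(1)[of "\<pi> f" "\<pi> g"] D'(1)[of "\<pi> f" "\<pi> g"] by (simp add: S_simps)
  next
    case (mult f g)
    then show ?case
      using D(3)[of "\<pi> f" "\<pi> g"] D'(3)[of "\<pi> f" "\<pi> g"] by (simp add: S_simps)
  qed
  then show "\<eta> x = \<eta>' x" if "x \<in> carrier S" for x
    using that by (auto simp: S_simps)
qed

end

text \<open>Points on the line \<open>a = 0\<close>, given by linear forms not involving the first coordinate \<open>a\<close>, so that
  divisibility modulo \<open>a\<close> reduces to divisibility of polynomials via the elimination map.\<close>

locale line_points = line_coordinates a y0 z0 dx0 dy0 dz0 + linear_forms P b
  for a y0 z0 :: "'k::field_char_0 poly3" and dx0 dy0 dz0 and P :: "'p set" and b :: "'p \<Rightarrow> 'k poly3" +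
  assumes elim_b: "p \<in> P \<Longrightarrow> elim (b p) = b p"
begin

lemma a_dvd_iff: "a dvd f \<longleftrightarrow> elim f = 0"
  by (rule x_dvd_iff)

lemma elim_diff: "elim (f - g) = elim f - elim g"
  using elim_simps(1)[of "f - g" g] by simp

lemma a_not_dvd_b: "p \<in> P \<Longrightarrow> \<not> a dvd b p"
  using a_dvd_iff elim_b nonzero by simp

lemma elim_prod: "B \<subseteq> P \<Longrightarrow> elim (prod b B) = prod b B"
proof -
  assume B: "B \<subseteq> P"
  then have "finite B"
    using fin finite_subset by blast
  then show ?thesis
    using B elim_simps(3)[of 1] by (induction B rule: finite_induct) (auto simp: elim_simps elim_b)
qed

text \<open>The counterpart of \<open>log_der_iff\<close> on the line. An equation in the quotient
  lifts to a congruence modulo \<open>a\<close>, and applying \<open>elim\<close>, which fixes every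
  \<open>b p\<close>, makes it an equation of polynomials, where \<open>b p\<close> is
  prime.\<close>

lemma log_S_iff:
  assumes \<eta>: "\<eta> \<in> Der S"
  shows "\<eta> (\<pi> (prod b P)) \<in> PIdl\<^bsub>S\<^esub> (\<pi> (prod b P)) \<longleftrightarrow> (\<forall>p\<in>P. \<exists>s. \<eta> (\<pi> (b p)) = \<pi> (s * b p))"
    (is "?lhs \<longleftrightarrow> ?rhs")
proof -
  have idl: "x \<in> PIdl\<^bsub>S\<^esub> (\<pi> f) \<longleftrightarrow> (\<exists>s. x = \<pi> (s * f))" for x f
    unfolding cgenideal_def S_simps(1) mem_Collect_eq by (auto simp flip: S_simps(2))
  note D = graded_cring.DerD(3)[OF S_graded \<eta>] and cl = graded_cring.Der_closed[OF S_graded \<eta>]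
  obtain h where h: "\<And>f. \<eta> (\<pi> f) = \<pi> (h f)"
  proof -
    have "\<exists>g. \<eta> (\<pi> f) = \<pi> g" for f
      using cl[of "\<pi> f"] by (auto simp: S_simps)
    then show thesis
      using that by metis
  qed
  have mult: "\<eta> (\<pi> (f * g)) = \<pi> (f * h g + g * h f)" for f g
    using D[of "\<pi> f" "\<pi> g"] by (simp add: S_simps h)
  show ?thesis
  proof
    assume ?lhs
    then obtain s where s: "\<eta> (\<pi> (prod b P)) = \<pi> (s * prod b P)"
      unfolding idl by blast
    show ?rhs
    proof
      fix p assume p: "p \<in> P"
      let ?q = "prod b (P - {p})"
      have Q: "prod b P = b p * ?q"
        using fin p by (rule prod.remove)
      have "\<pi> (b p * h ?q + ?q * h (b p)) = \<pi> (s * (b p * ?q))"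
        using s mult[of "b p" ?q] unfolding Q by simp
      then have "elim (b p * h ?q + ?q * h (b p) - s * (b p * ?q)) = 0"
        by (simp add: proj_eq a_dvd_iff)
      then have "b p * elim (h ?q) + ?q * elim (h (b p)) = elim s * (b p * ?q)"
        using elim_b[OF p] elim_prod[of "P - {p}"] by (simp add: elim_diff elim_simps)
      then have "?q * elim (h (b p)) = b p * (elim s * ?q - elim (h ?q))"
        by (simp add: algebra_simps)
      then have "b p dvd ?q * elim (h (b p))"
        by simp
      then have "b p dvd elim (h (b p))"
        using linear_prime(1)[OF form nonzero, OF p p] prime_prod[OF p, of "P - {p}"] by auto
      then obtain k where k: "elim (h (b p)) = b p * k"
        by (elim dvdE)
      have "\<pi> (h (b p)) = \<pi> (elim (h (b p)))"
        unfolding proj_eq by (rule elim_cong)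
      then show "\<exists>s. \<eta> (\<pi> (b p)) = \<pi> (s * b p)"
        using h[of "b p"] k by (intro exI[of _ k]) (simp add: mult.commute)
    qed
  next
    assume ?rhs
    have "\<exists>s. \<eta> (\<pi> (prod b P)) = \<pi> (s * prod b P)"
      using fin \<open>?rhs\<close>
    proof (induction P rule: finite_induct)
      case empty
      then show ?case
        using Der_S_const[OF \<eta>, of 1] by (intro exI[of _ 0]) simp
    next
      case (insert p P)
      then obtain s t where s: "\<eta> (\<pi> (prod b P)) = \<pi> (s * prod b P)" "\<eta> (\<pi> (b p)) = \<pi> (t * b p)"
        by auto
      have "\<eta> (\<pi> (b p * prod b P)) = (\<pi> (b p) \<otimes>\<^bsub>S\<^esub> \<eta> (\<pi> (prod b P))) \<oplus>\<^bsub>S\<^esub> (\<pi> (prod b P) \<otimes>\<^bsub>S\<^esub> \<eta> (\<pi> (b p)))"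
        using D[of "\<pi> (b p)" "\<pi> (prod b P)"] by (simp add: S_simps)
      also have "\<dots> = \<pi> ((s + t) * (b p * prod b P))"
        unfolding s by (simp add: S_simps algebra_simps)
      finally show ?case
        using insert by (intro exI[of _ "s + t"]) simp
    qed
    then show ?lhs
      unfolding idl .
  qed
qed

abbreviation "QS \<equiv> \<pi> (prod b P)"
abbreviation "LS \<equiv> log_der S QS"
abbreviation "ESS \<equiv> der_span S QS (\<rho> euler)"

lemma LS_carrier: "\<eta> \<in> carrier LS \<longleftrightarrow> \<eta> \<in> Der S \<and> (\<forall>p\<in>P. \<exists>s. \<eta> (\<pi> (b p)) = \<pi> (s * b p))"
  unfolding graded_cring.log_der_simps[OF S_graded] using log_S_iff by auto

lemma \<rho>_LS_carrier:
  assumes "\<theta> \<in> Der P2_ring" "a dvd \<theta> a"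
  shows "\<rho> \<theta> \<in> carrier LS \<longleftrightarrow> (\<forall>p\<in>P. \<exists>s. a dvd \<theta> (b p) - s * b p)"
  unfolding LS_carrier using \<rho>_Der[OF assms] by (simp add: \<rho>_proj[OF assms] proj_eq)

lemma a_dvd_euler: "a dvd euler a"
  by (simp add: euler_linear[OF a_linear])

lemma euler_LS: "\<rho> euler \<in> carrier LS"
  unfolding \<rho>_LS_carrier[OF euler_Der a_dvd_euler]
proof
  fix p assume "p \<in> P"
  then show "\<exists>s. a dvd euler (b p) - s * b p"
    by (intro exI[of _ 1]) (simp add: euler_linear[OF form])
qed

lemma LS_quot: "graded_quot S LS ESS"
  by (rule graded_cring.der_span_submodule[OF S_graded _ euler_LS]) (simp add: S_simps)

sublocale SQ: graded_quot S LS ESS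
  by (rule LS_quot)

lemma \<rho>_smult:
  assumes "\<theta> \<in> Der P2_ring" "a dvd \<theta> a"
  shows "\<pi> r \<odot>\<^bsub>LS\<^esub> \<rho> \<theta> = \<rho> (\<lambda>f. r * \<theta> f)"
proof (rule extensionalityI[OF _ \<rho>_extensional])
  show "\<pi> r \<odot>\<^bsub>LS\<^esub> \<rho> \<theta> \<in> extensional (carrier S)"
    unfolding graded_cring.log_der_simps[OF S_graded] by simp
  fix x assume "x \<in> carrier S"
  then show "(\<pi> r \<odot>\<^bsub>LS\<^esub> \<rho> \<theta>) x = \<rho> (\<lambda>f. r * \<theta> f) x"
    unfolding graded_cring.log_der_simps[OF S_graded]
    using assms by (auto simp: S_simps \<rho>_proj Der_P2_smult)
qed

lemma \<rho>_add:
  assumes "\<theta> \<in> Der P2_ring" "a dvd \<theta> a" "\<eta> \<in> Der P2_ring" "a dvd \<eta> a"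
  shows "\<rho> \<theta> \<oplus>\<^bsub>LS\<^esub> \<rho> \<eta> = \<rho> (\<lambda>f. \<theta> f + \<eta> f)"
proof (rule extensionalityI[OF _ \<rho>_extensional])
  show "\<rho> \<theta> \<oplus>\<^bsub>LS\<^esub> \<rho> \<eta> \<in> extensional (carrier S)"
    unfolding graded_cring.log_der_simps[OF S_graded] by simp
  fix x assume "x \<in> carrier S"
  then show "(\<rho> \<theta> \<oplus>\<^bsub>LS\<^esub> \<rho> \<eta>) x = \<rho> (\<lambda>f. \<theta> f + \<eta> f) x"
    unfolding graded_cring.log_der_simps[OF S_graded]
    using assms by (auto simp: S_simps \<rho>_proj Der_P2_add)
qed

text \<open>Scalars of the quotient ring lift, so the Euler multiples on the line are the
  restrictions of those on the plane.\<close>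

lemma ESS_iff: "\<kappa> \<in> ESS \<longleftrightarrow> (\<exists>r. \<kappa> = \<rho> (\<lambda>f. r * euler f))"
proof
  assume "\<kappa> \<in> ESS"
  then obtain r where "\<kappa> = \<pi> r \<odot>\<^bsub>LS\<^esub> \<rho> euler"
    unfolding der_span_def by (auto simp: S_simps)
  then show "\<exists>r. \<kappa> = \<rho> (\<lambda>f. r * euler f)"
    using \<rho>_smult[OF euler_Der a_dvd_euler] by blast
next
  assume "\<exists>r. \<kappa> = \<rho> (\<lambda>f. r * euler f)"
  then obtain r where "\<kappa> = \<pi> r \<odot>\<^bsub>LS\<^esub> \<rho> euler"
    using \<rho>_smult[OF euler_Der a_dvd_euler] by metis
  moreover have "\<pi> r \<in> carrier S"
    by (simp add: S_simps)
  ultimately show "\<kappa> \<in> ESS"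
    unfolding der_span_def by blast
qed

text \<open>Translates equality in the quotient module on the line into divisibility by
  \<open>a\<close> among polynomials.\<close>

lemma \<rho>_coset_eq:
  assumes \<theta>: "\<theta> \<in> Der P2_ring" "a dvd \<theta> a" "\<rho> \<theta> \<in> carrier LS"
    and \<eta>: "\<eta> \<in> Der P2_ring" "a dvd \<eta> a" "\<rho> \<eta> \<in> carrier LS"
  shows "SQ.coset (\<rho> \<theta>) = SQ.coset (\<rho> \<eta>) \<longleftrightarrow> (\<exists>r. \<forall>f. a dvd \<theta> f - (r * euler f + \<eta> f))"
proof -
  have d: "(\<lambda>f. r * euler f) \<in> Der P2_ring" "a dvd r * euler a" for r
    using Der_P2_smult[OF euler_Der] a_dvd_euler by simp_all
  have "\<rho> \<theta> = \<rho> (\<lambda>f. r * euler f) \<oplus>\<^bsub>LS\<^esub> \<rho> \<eta> \<longleftrightarrow> (\<forall>f. a dvd \<theta> f - (r * euler f + \<eta> f))" for r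
  proof -
    have s: "(\<lambda>f. r * euler f + \<eta> f) \<in> Der P2_ring" "a dvd r * euler a + \<eta> a"
      using d[of r] \<eta> by (simp_all add: Der_P2_add)
    have "\<rho> \<theta> = \<rho> (\<lambda>f. r * euler f + \<eta> f) \<longleftrightarrow> (\<forall>f. \<rho> \<theta> (\<pi> f) = \<rho> (\<lambda>f. r * euler f + \<eta> f) (\<pi> f))"
      using \<rho>_extensional by (auto simp: S_simps intro!: extensionalityI[of _ "carrier S"])
    then show ?thesis
      unfolding \<rho>_add[OF d \<eta>(1,2)] \<rho>_proj[OF \<theta>(1,2)] \<rho>_proj[OF s] proj_eq .
  qed
  then show ?thesis
    unfolding SQ.coset_eq_iff_add[OF \<theta>(3) \<eta>(3)] Bex_def ESS_iff by auto
qed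

end

lemma (in abelian_monoid) finsum_lessThan_1:
  assumes "f 0 \<in> carrier G"
  shows "finsum G f {..<1::nat} = f 0"
proof -
  have "{..<1::nat} = {0}"
    by auto
  then show ?thesis
    using assms by (simp add: Pi_def)
qed

context line_points
begin

abbreviation "DS \<equiv> line_log_mod a QS"

lemma DS_eq: "DS = quot_graded_module LS ESS"
  by (simp add: line_log_mod_def log_der_quot_def line_euler_def \<rho>_def)

lemma DS_graded: "graded_mod S DS"
  unfolding DS_eq by (rule SQ.quot_graded_mod)

lemma DS_mpart: "X \<in> mpart DS e \<longleftrightarrow> (\<exists>\<eta>\<in>mpart LS e. X = SQ.coset \<eta>)"
  by (auto simp: DS_eq SQ.quot_simps)

lemma LS_mpart: "\<eta> \<in> mpart LS (int i) \<longleftrightarrow> \<eta> \<in> carrier LS \<and> (\<forall>l\<in>hp 1. \<eta> (\<pi> l) \<in> \<pi> ` hp i)"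
  unfolding graded_cring.log_der_simps[OF S_graded] by (auto simp: S_simps)

lemma \<rho>_smult_closed:
  assumes "\<theta> \<in> Der P2_ring" "a dvd \<theta> a" "\<rho> \<theta> \<in> carrier LS"
  shows "\<rho> (\<lambda>f. r * \<theta> f) \<in> carrier LS"
  using Module.module.smult_closed[OF SQ.module_axioms, of "\<pi> r" "\<rho> \<theta>"] assms \<rho>_smult[OF assms(1,2)]
  by (simp add: S_simps)

lemma DS_smult:
  assumes "\<theta> \<in> Der P2_ring" "a dvd \<theta> a" "\<rho> \<theta> \<in> carrier LS"
  shows "\<pi> r \<odot>\<^bsub>DS\<^esub> SQ.coset (\<rho> \<theta>) = SQ.coset (\<rho> (\<lambda>f. r * \<theta> f))"
  using SQ.quot_smult[of "\<pi> r" "\<rho> \<theta>"] assms \<rho>_smult[OF assms(1,2)] by (simp add: S_simps DS_eq)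

text \<open>At most one of the forms vanishes at \<open>q\<close>; choose \<open>p\<close> to be its
  point if there is one. Any other such form would be a combination of \<open>a\<close> and
  \<open>b p\<close>, because its coefficient of \<open>z\<close> is a constant vanishing at
  \<open>q\<close>, and eliminating \<open>a\<close> would make it a multiple of
  \<open>b p\<close>.\<close>

lemma adapted_point:
  assumes ne: "P \<noteq> {}" and q: "q \<in> Proj S"
  shows "\<exists>p\<in>P. \<exists>z dx dy dz. line_coordinates a (b p) z dx dy dz \<and> \<pi> z \<notin> q \<and>
    (\<forall>p'\<in>P. \<pi> (b p') \<in> q \<longrightarrow> p' = p)"
proof -
  let ?p = "Proj_map P2_ring \<pi> q"
  have pP: "?p \<in> Proj P2_ring"
    by (rule GS.Proj_map_Proj[OF q])
  have mem: "f \<in> ?p \<longleftrightarrow> \<pi> f \<in> q" for f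
    by (simp add: Proj_map_def)
  have ap: "a \<in> ?p"
  proof -
    have "\<pi> a = \<zero>\<^bsub>S\<^esub>"
      by (simp add: S_simps proj_eq)
    then show ?thesis
      unfolding mem using additive_subgroup.zero_closed[OF ideal.axioms(1)[OF primeideal.axioms(1)[OF graded_cring.Proj_prime[OF S_graded q]]]]
      by simp
  qed
  obtain p where p: "p \<in> P" "\<And>p'. p' \<in> P \<Longrightarrow> b p' \<in> ?p \<Longrightarrow> b p \<in> ?p"
    using ne by blast
  have "cross (lcoeff a) (lcoeff (b p)) \<noteq> (\<lambda>i. 0)"
    using cross_zero_proportional[OF a_linear a_nonzero form[OF p(1)]] a_not_dvd_b[OF p(1)] by (metis dvd_triv_right)
  then obtain z dx dy dz where z: "z \<notin> ?p" and co: "coordinates a (b p) z dx dy dz"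
    using coordinates_point[OF a_linear form[OF p(1)] _ pP] by blast
  interpret C: coordinates a "b p" z dx dy dz by (rule co)
  have "p' = p" if p': "p' \<in> P" "b p' \<in> ?p" for p'
  proof -
    have "b p' - (dx (b p') * a + dy (b p') * b p) \<in> ?p"
      using p(2)[OF p'] p'(2) ap by (intro Proj_P2_diff[OF pP] Proj_P2_add[OF pP]) (simp_all add: Proj_P2_mult[OF pP])
    moreover have "b p' - (dx (b p') * a + dy (b p') * b p) = dz (b p') * z"
    proof -
      have "dx (b p') * a + dy (b p') * b p + dz (b p') * z - (dx (b p') * a + dy (b p') * b p) = dz (b p') * z"
        by simp
      then show ?thesis
        unfolding C.expand[OF form[OF p'(1)], symmetric] .
    qed
    ultimately have "dz (b p') \<in> ?p"
      using z by (simp add: Proj_P2_mult[OF pP])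
    then have "dz (b p') = 0"
      using hp_0_const[OF C.const(3)[OF form[OF p'(1)]]] Proj_P2_const[OF pP] by (metis const_eq_0_iff)
    then have "b p' = dx (b p') * a + dy (b p') * b p"
      using C.expand[OF form[OF p'(1)]] by simp
    then have "elim (b p') = elim (dx (b p') * a + dy (b p') * b p)"
      by simp
    then have "b p' = elim (dy (b p')) * b p"
      using elim_b[OF p'(1)] elim_b[OF p(1)] by (simp add: elim_simps elim_x)
    then have "b p dvd b p'"
      by (metis dvd_triv_right)
    then show ?thesis
      using distinct[OF p(1) p'(1)] by blast
  qed
  then show ?thesis
    using p(1) z co line_axioms unfolding mem line_coordinates_def by blast
qed

text \<open>Modulo the Euler derivation, a logarithmic derivation on the line is a multiple of \<open>\<partial>/\<partial>z\<close>, where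
  \<open>z\<close> completes the form of a point to coordinates on the line.\<close>

lemma log_der_normal_form:
  assumes co: "line_coordinates a (b p) z dx dy dz" and p: "p \<in> P" and \<eta>: "\<eta> \<in> mpart LS (int i)"
  obtains h where "h \<in> hp i" "\<rho> (\<lambda>f. h * dz f) \<in> carrier LS" "SQ.coset \<eta> = SQ.coset (\<rho> (\<lambda>f. h * dz f))"
proof -
  interpret C: line_coordinates a "b p" z dx dy dz by (rule co)
  have \<eta>D: "\<eta> \<in> Der S" "\<eta> \<in> carrier LS"
    using \<eta> by (auto simp: LS_mpart LS_carrier)
  obtain s where s: "\<eta> (\<pi> (b p)) = \<pi> (s * b p)"
    using \<eta>D(2) p unfolding LS_carrier by blast
  have "\<eta> (\<pi> (b p)) \<in> \<pi> ` hp i" "\<eta> (\<pi> z) \<in> \<pi> ` hp i"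
    using \<eta> C.linear unfolding LS_mpart by blast+
  then obtain f k where f: "\<eta> (\<pi> (b p)) = \<pi> f" "f \<in> hp i" and k: "\<eta> (\<pi> z) = \<pi> k" "k \<in> hp i"
    by blast
  have "a dvd f - s * b p"
    using s f(1) by (simp add: proj_eq)
  then obtain r where "f - s * b p = a * r"
    by (elim dvdE)
  then have "f = b p * s + a * r"
    by (simp add: algebra_simps)
  moreover have "hz (int i) f = f"
    using f(2) by (intro hz_id) (simp only: hpz_int)
  \<comment> \<open>\<open>s\<close> is replaced by its component of degree \<open>i - 1\<close>, so
    that \<open>t\<close> times the Euler derivation has the degree \<open>i\<close> of
    \<open>\<eta>\<close>.\<close>
  moreover define t where "t = hz (int i - int 1) s"
  ultimately have ft: "f = b p * t + a * hz (int i - int 1) r"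
    using hz_mult[OF C.linear(2), of "int i" s] hz_mult[OF a_linear, of "int i" r] by (simp add: hz_add)
  have "z * t \<in> hpz (int 1 + (int i - int 1))"
    unfolding t_def by (rule hpz_mult[OF C.linear(3) hz_hpz])
  then have zt: "z * t \<in> hp i"
    by (simp only: hpz_int diff_add_cancel add_diff_cancel_left' add.commute[of "int 1"])
  define h where "h = k - z * t"
  have h: "h \<in> hp i"
    unfolding h_def by (rule hp_diff[OF k(2) zt])
  have hd: "(\<lambda>f. h * dz f) \<in> Der P2_ring" "a dvd h * dz a" and te: "(\<lambda>f. t * euler f) \<in> Der P2_ring" "a dvd t * euler a"
    using Der_P2_smult[OF C.Der(3)] Der_P2_smult[OF euler_Der] a_dvd_euler C.dual by simp_all
  have sm: "(\<lambda>f. t * euler f + h * dz f) \<in> Der P2_ring" "a dvd t * euler a + h * dz a"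
    using Der_P2_add[OF te(1) hd(1)] hd te by simp_all
  have eq: "\<eta> = \<rho> (\<lambda>f. t * euler f + h * dz f)"
  proof (rule C.Der_S_eqI[OF \<eta>D(1) \<rho>_Der[OF sm]])
    show "\<eta> (\<pi> (b p)) = \<rho> (\<lambda>f. t * euler f + h * dz f) (\<pi> (b p))"
      unfolding \<rho>_proj[OF sm] f(1) proj_eq euler_linear[OF C.linear(2)] C.dual by (simp add: ft)
    show "\<eta> (\<pi> z) = \<rho> (\<lambda>f. t * euler f + h * dz f) (\<pi> z)"
      unfolding \<rho>_proj[OF sm] k(1) proj_eq euler_linear[OF C.linear(3)] C.dual by (simp add: h_def)
  qed
  \<comment> \<open>A difference of two logarithmic derivations, hence logarithmic itself.\<close>
  have "\<rho> (\<lambda>f. h * dz f) = \<eta> \<oplus>\<^bsub>LS\<^esub> \<rho> (\<lambda>f. - t * euler f)"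
  proof -
    have "(\<lambda>f. - t * euler f) \<in> Der P2_ring" "a dvd - t * euler a"
      using Der_P2_smult[OF euler_Der, of "- t"] a_dvd_euler by simp_all
    then show ?thesis
      unfolding eq by (subst \<rho>_add[OF sm]) simp_all
  qed
  then have hc: "\<rho> (\<lambda>f. h * dz f) \<in> carrier LS"
    using SQ.M.a_closed[OF \<eta>D(2) \<rho>_smult_closed[OF euler_Der a_dvd_euler euler_LS, of "- t"]] by simp
  moreover have "SQ.coset \<eta> = SQ.coset (\<rho> (\<lambda>f. h * dz f))"
    using \<rho>_coset_eq[OF sm _ hd hc] \<eta>D(2) unfolding eq by (auto intro!: exI[of _ t])
  ultimately show thesis
    using that h by blast
qed

text \<open>The generator is \<open>v\<close> times \<open>dz\<close>, with \<open>v\<close> the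
  product of the forms of the other points. The same \<open>v\<close> serves as \<open>u\<close>: by
  the normal form an element is the class of \<open>h\<close> times \<open>dz\<close>, so its
  \<open>v\<close>-fold multiple is \<open>h\<close> times the generator.\<close>

lemma DS_local_basis:
  assumes ne: "P \<noteq> {}" and q: "q \<in> Proj S"
  shows "\<exists>k u z d e. local_basis S DS 1 k u z d e \<and> u \<notin> q \<and> z \<notin> q"
proof -
  obtain p z dx dy dz where p: "p \<in> P" and co: "line_coordinates a (b p) z dx dy dz" and z: "\<pi> z \<notin> q"
    and only: "\<And>p'. p' \<in> P \<Longrightarrow> \<pi> (b p') \<in> q \<Longrightarrow> p' = p"
    using adapted_point[OF ne q] by blast
  interpret C: line_coordinates a "b p" z dx dy dz by (rule co)
  interpret DS: graded_mod S DS by (rule DS_graded)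
  define B where "B = P - {p}"
  define v where "v = prod b B"
  have B: "B \<subseteq> P" by (auto simp: B_def)
  have v: "v \<in> hp (card B)" "v \<noteq> 0"
    unfolding v_def using B by (simp_all add: prod_hp prod_nonzero)
  have a_v: "\<not> a dvd v"
    unfolding a_dvd_iff using elim_prod[OF B] v(2) by (simp add: v_def)
  have vq: "\<pi> v \<notin> q"
  proof -
    have "v \<notin> Proj_map P2_ring \<pi> q"
      unfolding v_def
      by (rule Proj_prod[OF GS.Proj_map_Proj[OF q] B]) (use only in \<open>auto simp: B_def Proj_map_def\<close>)
    then show ?thesis
      by (simp add: Proj_map_def)
  qed
  have vd: "(\<lambda>f. v * dz f) \<in> Der P2_ring" "a dvd v * dz a"
    using Der_P2_smult[OF C.Der(3)] C.dual by simp_all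
  have vLS: "\<rho> (\<lambda>f. v * dz f) \<in> carrier LS"
    unfolding \<rho>_LS_carrier[OF vd]
  proof
    fix p' assume p': "p' \<in> P"
    show "\<exists>s. a dvd v * dz (b p') - s * b p'"
    proof (cases "p' = p")
      case True
      then show ?thesis
        using C.dual by (intro exI[of _ 0]) simp
    next
      case False
      then have "b p' dvd v"
        unfolding v_def using p' fin by (intro dvd_prodI) (auto simp: B_def)
      then obtain w where "v = b p' * w"
        by (elim dvdE)
      then show ?thesis
        by (intro exI[of _ "w * dz (b p')"]) (simp add: algebra_simps)
    qed
  qed
  define e where "e = SQ.coset (\<rho> (\<lambda>f. v * dz f))"
  have e_mpart: "e \<in> mpart DS (int (card B))"
    unfolding DS_mpart e_def LS_mpart
  proof (intro bexI[of _ "\<rho> (\<lambda>f. v * dz f)"] refl CollectI)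
    have "v * dz l \<in> hp (card B)" if "l \<in> hp 1" for l
      using hp_mult[OF v(1) C.const(3)[OF that]] by simp
    then show "\<rho> (\<lambda>f. v * dz f) \<in> mpart LS (int (card B))"
      unfolding LS_mpart using vLS by (auto simp: \<rho>_proj[OF vd])
  qed
  have ec: "e \<in> carrier DS"
    using DS.mpart_carrier[OF e_mpart] .
  have e_smult: "\<pi> r \<odot>\<^bsub>DS\<^esub> e = SQ.coset (\<rho> (\<lambda>f. r * (v * dz f)))" for r
    unfolding e_def by (rule DS_smult[OF vd vLS])
  have fs: "finsum DS (\<lambda>j. c j \<odot>\<^bsub>DS\<^esub> e) {..<1::nat} = c 0 \<odot>\<^bsub>DS\<^esub> e" if "c 0 \<in> carrier S" for c
    using that ec by (intro DS.M.finsum_lessThan_1) simp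
  have "local_basis S DS 1 (card B) (\<pi> v) (\<pi> z) (\<lambda>_. card B) (\<lambda>_. e)"
  proof (intro local_basis.intro DS_graded local_basis_axioms.intro)
    show "\<pi> v \<in> hpart S (card B)" "\<pi> z \<in> hpart S 1"
      using v C.linear by (simp_all add: S_simps)
    show "e \<in> mpart DS (int (card B))"
      by (rule e_mpart)
  next
    fix X i assume "X \<in> mpart DS (int i)"
    then obtain \<eta> where \<eta>: "\<eta> \<in> mpart LS (int i)" "X = SQ.coset \<eta>"
      unfolding DS_mpart by blast
    obtain h where h: "h \<in> hp i" "\<rho> (\<lambda>f. h * dz f) \<in> carrier LS" "SQ.coset \<eta> = SQ.coset (\<rho> (\<lambda>f. h * dz f))"
      by (rule log_der_normal_form[OF co p \<eta>(1)])
    have hd: "(\<lambda>f. h * dz f) \<in> Der P2_ring" "a dvd h * dz a"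
      using Der_P2_smult[OF C.Der(3)] C.dual by simp_all
    have "\<pi> v \<odot>\<^bsub>DS\<^esub> X = SQ.coset (\<rho> (\<lambda>f. v * (h * dz f)))"
      unfolding \<eta>(2) h(3) by (rule DS_smult[OF hd h(2)])
    also have "(\<lambda>f. v * (h * dz f)) = (\<lambda>f. h * (v * dz f))"
      by (simp add: mult.left_commute)
    finally have "\<pi> v \<odot>\<^bsub>DS\<^esub> X = \<pi> h \<odot>\<^bsub>DS\<^esub> e"
      unfolding e_smult .
    moreover have "\<pi> h \<in> carrier S"
      by (simp add: S_simps)
    moreover have "\<pi> h \<in> mpart (self_module S) (int (card B + i) - int (card B))"
    proof -
      have "int (card B + i) - int (card B) = int i" by simp
      then show ?thesis
        using h(1) by (simp only: self_module_simps S_simps) simp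
    qed
    ultimately show "\<exists>c. (\<forall>j<1::nat. c j \<in> mpart (self_module S) (int (card B + i) - int (card B))) \<and>
        \<pi> v \<odot>\<^bsub>DS\<^esub> X = (\<Oplus>\<^bsub>DS\<^esub>j\<in>{..<1}. c j \<odot>\<^bsub>DS\<^esub> e)"
      using fs[of "\<lambda>_. \<pi> h"] by (intro exI[of _ "\<lambda>_. \<pi> h"]) simp
  next
    fix c c' :: "nat \<Rightarrow> 'k poly3 set" and j :: nat
    assume c: "\<And>j. j < 1 \<Longrightarrow> c j \<in> carrier S" "\<And>j. j < 1 \<Longrightarrow> c' j \<in> carrier S" and "j < 1"
      and eq: "(\<Oplus>\<^bsub>DS\<^esub>j\<in>{..<1::nat}. c j \<odot>\<^bsub>DS\<^esub> e) = (\<Oplus>\<^bsub>DS\<^esub>j\<in>{..<1}. c' j \<odot>\<^bsub>DS\<^esub> e)"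
    obtain r r' where r: "c 0 = \<pi> r" "c' 0 = \<pi> r'"
      using c(1)[of 0] c(2)[of 0] by (auto simp: S_simps)
    have cl: "(\<lambda>f. r * (v * dz f)) \<in> Der P2_ring" "a dvd r * (v * dz a)" "\<rho> (\<lambda>f. r * (v * dz f)) \<in> carrier LS" for r
      using Der_P2_smult[OF vd(1)] vd(2) \<rho>_smult_closed[OF vd vLS] by simp_all
    have "SQ.coset (\<rho> (\<lambda>f. r * (v * dz f))) = SQ.coset (\<rho> (\<lambda>f. r' * (v * dz f)))"
      using eq fs[of c] fs[of c'] c(1)[of 0] c(2)[of 0] r e_smult by simp
    then obtain s where s: "\<And>f. a dvd r * (v * dz f) - (s * euler f + r' * (v * dz f))"
      using \<rho>_coset_eq[OF cl cl] by blast
    \<comment> \<open>At \<open>b p\<close> both multiples of the generator vanish, which leaves the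
      Euler coefficient \<open>s\<close>; once \<open>a\<close> divides \<open>s\<close>, evaluation
      at \<open>z\<close> compares \<open>r\<close> with \<open>r'\<close>.\<close>
    have "a dvd s * b p"
      using s[of "b p"] by (simp add: C.dual euler_linear[OF C.linear(2)])
    then have "a dvd s"
      using linear_prime(1)[OF a_linear a_nonzero] a_not_dvd_b[OF p] by blast
    have "a dvd r * v - (s * z + r' * v) + s * z"
      using s[of z] \<open>a dvd s\<close> by (intro dvd_add) (simp_all add: C.dual euler_linear[OF C.linear(3)])
    then have "a dvd (r - r') * v"
      by (simp add: algebra_simps)
    then have "a dvd r - r'"
      using linear_prime(1)[OF a_linear a_nonzero] a_v by blast
    then show "c j = c' j"
      using \<open>j < 1\<close> r proj_eq by simp
  qed
  then show ?thesis
    using vq z by blast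
qed

theorem DS_line_bundle:
  assumes "P \<noteq> {}"
  shows "vector_bundle (Proj_space S) 1 (tilde S DS)"
  by (rule graded_mod.tilde_vector_bundle[OF DS_graded]) (rule DS_local_basis[OF assms])

end

section \<open>The elementary modification\<close>

text \<open>The map \<open>pt\<close> sends a line to its intersection point with \<open>H\<close>.\<close>

locale line_restriction = linear_forms_triple A \<alpha> H + LP: line_points "\<alpha> H" y0 z0 dx0 dy0 dz0 P b
  for A :: "'i set" and \<alpha> :: "'i \<Rightarrow> 'k::field_char_0 poly3" and H y0 z0 dx0 dy0 dz0
    and P :: "'p set" and b :: "'p \<Rightarrow> 'k poly3" +
  fixes pt :: "'i \<Rightarrow> 'p"
  assumes pt_image: "pt ` (A - {H}) = P"
    and pt_form: "L \<in> A - {H} \<Longrightarrow> \<exists>c. c \<noteq> 0 \<and> \<alpha> H dvd b (pt L) - const c * \<alpha> L"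
begin

lemma a_dvd_LD: "\<theta> \<in> carrier LD \<Longrightarrow> \<theta> \<in> Der P2_ring \<and> a dvd \<theta> a"
  using H by (simp add: LD_carrier)

text \<open>On the line, \<open>b p\<close> is a nonzero constant multiple of the form of any line
  through the point. If \<open>\<theta>\<close> multiplies that form by \<open>s\<close>, then
  modulo \<open>a\<close> it multiplies \<open>b p\<close> by \<open>s\<close> too, since
  \<open>\<theta>\<close> preserves the ideal of \<open>a\<close>.\<close>

lemma \<rho>_LD:
  assumes \<theta>: "\<theta> \<in> carrier LD"
  shows "LP.\<rho> \<theta> \<in> carrier LP.LS"
proof -
  have D: "\<theta> \<in> Der P2_ring" "a dvd \<theta> a"
    using a_dvd_LD[OF \<theta>] by auto
  show ?thesis
    unfolding LP.\<rho>_LS_carrier[OF D]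
  proof
    fix p assume "p \<in> P"
    then obtain L where L: "L \<in> A - {H}" "p = pt L"
      using pt_image by blast
    obtain c w where "b p - const c * \<alpha> L = a * w"
      using pt_form[OF L(1)] L(2) by (auto elim: dvdE)
    then have bp: "b p = const c * \<alpha> L + a * w"
      by (simp add: algebra_simps)
    obtain s where s: "\<theta> (\<alpha> L) = \<alpha> L * s"
      using \<theta> L(1) unfolding LD_carrier by (auto elim: dvdE)
    have "\<theta> (b p) - s * b p = a * (\<theta> w - s * w) + w * \<theta> a"
      unfolding bp Der_P2D(1)[OF D(1)] Der_P2D(2)[OF D(1)] s Der_P2D(3)[OF D(1), of a w] by (simp add: algebra_simps)
    then have "a dvd \<theta> (b p) - s * b p"
      using D(2) by simp
    then show "\<exists>s. a dvd \<theta> (b p) - s * b p" by blast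
  qed
qed

lemma restr_graded_quot_map:
  "graded_quot_map P2_ring LP.S LP.\<pi> LD LP.LS (der_restrict P2_ring LP.I) ES LP.ESS"
  unfolding LP.\<rho>_def[symmetric]
proof (intro graded_quot_map.intro graded_semilinear.intro)
  show "graded_semilinear_axioms P2_ring LP.\<pi> LD LP.LS LP.\<rho>"
  proof
    fix \<theta> assume \<theta>: "\<theta> \<in> carrier LD"
    then show "LP.\<rho> \<theta> \<in> carrier LP.LS"
      by (rule \<rho>_LD)
    fix \<eta> assume "\<eta> \<in> carrier LD"
    then show "LP.\<rho> (\<theta> \<oplus>\<^bsub>LD\<^esub> \<eta>) = LP.\<rho> \<theta> \<oplus>\<^bsub>LP.LS\<^esub> LP.\<rho> \<eta>"
      using a_dvd_LD[OF \<theta>] a_dvd_LD[of \<eta>] by (simp add: LD_simps LP.\<rho>_add)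
  next
    fix r \<theta> assume "\<theta> \<in> carrier LD"
    then show "LP.\<rho> (r \<odot>\<^bsub>LD\<^esub> \<theta>) = LP.\<pi> r \<odot>\<^bsub>LP.LS\<^esub> LP.\<rho> \<theta>"
      using a_dvd_LD[of \<theta>] by (simp add: LD_simps LP.\<rho>_smult)
  next
    fix \<theta> e assume "\<theta> \<in> mpart LD e"
    then have \<theta>: "\<theta> \<in> carrier LD" "\<And>l. l \<in> hp 1 \<Longrightarrow> \<theta> l \<in> hpz e"
      by (auto simp: LD_mpart)
    have "LP.\<pi> f \<in> mpart (self_module LP.S) e" if "f \<in> hpz e" for f
      using that by (auto simp: self_module_mpart LP.S_simps split: if_splits)
    then show "LP.\<rho> \<theta> \<in> mpart LP.LS e"
      using \<rho>_LD[OF \<theta>(1)] \<theta> a_dvd_LD[OF \<theta>(1)]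
      unfolding graded_cring.log_der_simps[OF LP.S_graded] by (auto simp: LP.S_simps(6) LP.\<rho>_proj)
  qed
  show "graded_quot_map_axioms LP.\<rho> ES LP.ESS"
  proof
    fix \<kappa> assume "\<kappa> \<in> ES"
    then show "LP.\<rho> \<kappa> \<in> LP.ESS"
      unfolding ES_iff LP.ESS_iff by blast
  qed
qed (rule LQ.graded_mod_axioms LD_quot LP.LS_quot LP.proj_surj LP.SQ.graded_mod_axioms)+

lemma restr_map_semilinear:
  "graded_semilinear P2_ring LP.S LP.\<pi> (P2_log_mod Q) LP.DS (restr_map a LP.QS)"
  using graded_quot_map.quot_semilinear[OF restr_graded_quot_map]
  by (simp add: log_mod_eq LP.DS_eq restr_map_def LP.\<rho>_def line_euler_def)

lemma restr_map_coset:
  assumes "\<theta> \<in> carrier LD"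
  shows "restr_map a LP.QS (LQ.coset \<theta>) = LP.SQ.coset (LP.\<rho> \<theta>)"
  using graded_quot_map.coset_map_coset[OF restr_graded_quot_map assms]
  by (simp add: restr_map_def LP.\<rho>_def line_euler_def)

lemma restr_mult_zero:
  assumes "X \<in> carrier (twist (-1) (P2_log_mod D'.Q))"
  shows "restr_map a LP.QS (mult_map a Q X) = \<zero>\<^bsub>LP.DS\<^esub>"
proof -
  obtain \<eta> where \<eta>: "\<eta> \<in> carrier D'.LD" "X = D'.LQ.coset \<eta>"
    using assms by (auto simp: D'.log_mod_eq D'.LQ.quot_simps)
  then have D: "\<eta> \<in> Der P2_ring" and c: "(\<lambda>f. a * \<eta> f) \<in> carrier LD"
    using mult_LD by (auto simp: D'.LD_carrier)
  have d: "(\<lambda>f. a * \<eta> f) \<in> Der P2_ring" "a dvd a * \<eta> a"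
    using Der_P2_smult[OF D, of a] by simp_all
  have e: "(\<lambda>f. 0 * euler f) \<in> Der P2_ring" "a dvd 0 * euler a"
    using Der_P2_smult[OF euler_Der, of 0] by simp_all
  have "LP.\<rho> (\<lambda>f. a * \<eta> f) (LP.\<pi> f) = LP.\<rho> (\<lambda>f. 0 * euler f) (LP.\<pi> f)" for f
    unfolding LP.\<rho>_proj[OF d] LP.\<rho>_proj[OF e] LP.proj_eq by simp
  then have "LP.\<rho> (\<lambda>f. a * \<eta> f) = LP.\<rho> (\<lambda>f. 0 * euler f)"
    by (intro extensionalityI[OF LP.\<rho>_extensional LP.\<rho>_extensional]) (auto simp only: LP.S_simps)
  then have "LP.\<rho> (\<lambda>f. a * \<eta> f) \<in> LP.ESS"
    unfolding LP.ESS_iff by blast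
  then show ?thesis
    using LP.SQ.coset_eq_K[OF \<rho>_LD[OF c]] restr_map_coset[OF c] mult_map_coset[OF \<eta>(1)] \<eta>(2)
    by (simp add: LP.DS_eq LP.SQ.quot_simps)
qed

lemma restr_kernel:
  assumes X: "X \<in> mpart (P2_log_mod Q) e" and zero: "restr_map a LP.QS X = \<zero>\<^bsub>LP.DS\<^esub>"
  shows "\<exists>Y\<in>mpart (twist (-1) (P2_log_mod D'.Q)) e. mult_map a Q Y = X"
proof -
  obtain \<theta> where \<theta>: "\<theta> \<in> mpart LD e" "X = LQ.coset \<theta>"
    using X unfolding log_mod_mpart by blast
  then have c: "\<theta> \<in> carrier LD"
    by (simp add: LD_mpart)
  then have D: "\<theta> \<in> Der P2_ring" "a dvd \<theta> a"
    using a_dvd_LD by auto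
  have "LP.\<rho> \<theta> \<in> LP.ESS"
    using LP.SQ.coset_eq_K[OF \<rho>_LD[OF c]] zero restr_map_coset[OF c] \<theta>(2)
    by (simp add: LP.DS_eq LP.SQ.quot_simps)
  then obtain r where r: "LP.\<rho> \<theta> = LP.\<rho> (\<lambda>f. r * euler f)"
    unfolding LP.ESS_iff by blast
  have e: "(\<lambda>f. r * euler f) \<in> Der P2_ring" "a dvd r * euler a"
    using Der_P2_smult[OF euler_Der, of r] LP.a_dvd_euler by simp_all
  have "a dvd \<theta> f - r * euler f" for f
    using fun_cong[OF r, of "LP.\<pi> f"] unfolding LP.\<rho>_proj[OF D] LP.\<rho>_proj[OF e] LP.proj_eq .
  then show ?thesis
    using mult_map_lift[OF \<theta>(1)] \<theta>(2) by blast
qed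

lemma restr_lift:
  assumes ne: "P \<noteq> {}" and q: "q \<in> Proj LP.S"
  shows "\<exists>k. \<exists>u\<in>hp k. LP.\<pi> u \<notin> q \<and>
    (\<forall>i. \<forall>Y\<in>mpart LP.DS (int i). \<exists>X\<in>mpart (P2_log_mod Q) (int (k + i)). restr_map a LP.QS X = LP.\<pi> u \<odot>\<^bsub>LP.DS\<^esub> Y)"
proof -
  obtain p z dx dy dz where p: "p \<in> P" and co: "line_coordinates a (b p) z dx dy dz" and z: "LP.\<pi> z \<notin> q"
    and only: "\<And>p'. p' \<in> P \<Longrightarrow> LP.\<pi> (b p') \<in> q \<Longrightarrow> p' = p"
    using LP.adapted_point[OF ne q] by blast
  interpret C: line_coordinates a "b p" z dx dy dz by (rule co)
  have pP: "Proj_map P2_ring LP.\<pi> q \<in> Proj P2_ring"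
    by (rule LP.GS.Proj_map_Proj[OF q])
  define B where "B = {L \<in> A. dz (\<alpha> L) \<noteq> 0}"
  define g where "g = prod \<alpha> B"
  have B: "B \<subseteq> A" by (auto simp: B_def)
  have g: "g \<in> hp (card B)"
    unfolding g_def by (rule prod_hp[OF B])
  \<comment> \<open>If \<open>\<alpha> L\<close> vanished at \<open>q\<close>, its point would be
    \<open>p\<close>, so \<open>b p\<close> would be \<open>c\<close> times
    \<open>\<alpha> L\<close> modulo \<open>a\<close>. Applying \<open>dz\<close>, which kills
    \<open>a\<close> and \<open>b p\<close>, would make the nonzero constant
    \<open>dz (\<alpha> L)\<close> a multiple of \<open>a\<close>, which degrees exclude.\<close>
  have off: "\<alpha> L \<notin> Proj_map P2_ring LP.\<pi> q" if L: "L \<in> B" for L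
  proof
    assume in_q: "\<alpha> L \<in> Proj_map P2_ring LP.\<pi> q"
    have LA: "L \<in> A - {H}" "dz (\<alpha> L) \<noteq> 0" "L \<in> A"
      using L C.dual by (auto simp: B_def)
    obtain c where c: "c \<noteq> 0" "a dvd b (pt L) - const c * \<alpha> L"
      using pt_form[OF LA(1)] by blast
    have "const c * \<alpha> L \<in> Proj_map P2_ring LP.\<pi> q"
      using in_q by (simp add: Proj_P2_mult[OF pP])
    then have "LP.\<pi> (b (pt L)) \<in> q"
      using c(2) by (simp add: Proj_map_def LP.proj_eq[symmetric])
    then have "pt L = p"
      using only[of "pt L"] pt_image LA(1) by blast
    then obtain w where w: "b p - const c * \<alpha> L = a * w"
      using c(2) by (auto elim: dvdE)
    then have "b p = const c * \<alpha> L + a * w"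
      by (simp add: algebra_simps)
    then have "dz (b p) = dz (const c * \<alpha> L + a * w)"
      by simp
    then have "0 = const c * dz (\<alpha> L) + a * dz w"
      unfolding Der_P2D(1)[OF C.Der(3)] Der_P2D(2)[OF C.Der(3)] Der_P2D(3)[OF C.Der(3), of a w] C.dual by simp
    then have "const c * dz (\<alpha> L) = a * (- dz w)"
      by (simp add: eq_neg_iff_add_eq_0)
    then have "const (inverse c) * (const c * dz (\<alpha> L)) = a * (const (inverse c) * - dz w)"
      by simp
    then have e: "dz (\<alpha> L) = a * (const (inverse c) * - dz w)"
      using const_inverse[OF c(1)] by (simp only: mult.assoc[symmetric]) simp
    then have "a * (const (inverse c) * - dz w) \<in> hpz (int 0)"
      using C.const(3)[OF form[OF LA(3)]] by (simp only: hpz_int)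
    then have "const (inverse c) * - dz w \<in> hpz (int 0 - int 1)"
      by (rule hz_dvd[OF a_linear a_nonzero])
    then have "const (inverse c) * - dz w = 0"
      by (simp add: self_module_mpart)
    then show False
      using LA(2) e by simp
  qed
  have gq: "LP.\<pi> g \<notin> q"
  proof -
    have "g \<notin> Proj_map P2_ring LP.\<pi> q"
      unfolding g_def by (rule Proj_prod[OF pP B off])
    then show ?thesis
      by (simp add: Proj_map_def)
  qed
  have "\<exists>X\<in>mpart (P2_log_mod Q) (int (card B + i)). restr_map a LP.QS X = LP.\<pi> g \<odot>\<^bsub>LP.DS\<^esub> Y"
    if Y: "Y \<in> mpart LP.DS (int i)" for i Y
  proof -
    obtain \<eta> where \<eta>: "\<eta> \<in> mpart LP.LS (int i)" "Y = LP.SQ.coset \<eta>"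
      using Y unfolding LP.DS_mpart by blast
    obtain h where h: "h \<in> hp i" "LP.\<rho> (\<lambda>f. h * dz f) \<in> carrier LP.LS" "LP.SQ.coset \<eta> = LP.SQ.coset (LP.\<rho> (\<lambda>f. h * dz f))"
      by (rule LP.log_der_normal_form[OF co p \<eta>(1)])
    have hd: "(\<lambda>f. h * dz f) \<in> Der P2_ring" "a dvd h * dz a"
      using Der_P2_smult[OF C.Der(3)] C.dual by simp_all
    \<comment> \<open>A form outside \<open>B\<close> is killed by \<open>dz\<close>, and one in
      \<open>B\<close> divides \<open>g\<close>, so the factor \<open>g\<close> makes this
      logarithmic for the whole arrangement.\<close>
    define \<theta> where "\<theta> = (\<lambda>f. g * (h * dz f))"
    have \<theta>c: "\<theta> \<in> carrier LD"
      unfolding LD_carrier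
    proof (intro conjI ballI)
      show "\<theta> \<in> Der P2_ring"
        unfolding \<theta>_def by (rule Der_P2_smult[OF hd(1)])
      fix L assume L: "L \<in> A"
      show "\<alpha> L dvd \<theta> (\<alpha> L)"
      proof (cases "L \<in> B")
        case True
        then have "\<alpha> L dvd g"
          unfolding g_def using fin finite_subset[OF B] by (intro dvd_prodI) auto
        then show ?thesis
          by (simp add: \<theta>_def)
      next
        case False
        then show ?thesis
          using L by (simp add: \<theta>_def B_def)
      qed
    qed
    have "\<theta> l \<in> hp (card B + i)" if "l \<in> hp 1" for l
      using hp_mult[OF g hp_mult[OF h(1) C.const(3)[OF that]]] by (simp add: \<theta>_def)
    then have "\<theta> \<in> mpart LD (int (card B + i))"
      unfolding LD_mpart hpz_int using \<theta>c by blast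
    then have "LQ.coset \<theta> \<in> mpart (P2_log_mod Q) (int (card B + i))"
      unfolding log_mod_mpart by blast
    moreover have "restr_map a LP.QS (LQ.coset \<theta>) = LP.\<pi> g \<odot>\<^bsub>LP.DS\<^esub> Y"
      unfolding restr_map_coset[OF \<theta>c] \<eta>(2) h(3) LP.DS_smult[OF hd h(2)] by (simp add: \<theta>_def)
    ultimately show ?thesis by blast
  qed
  then show ?thesis
    using g gq by blast
qed

theorem elementary_modification_restriction:
  assumes ne: "A - {H} \<noteq> {}"
  shows "elementary_modification (Proj_space P2_ring) (Proj_space LP.S) (line_incl a) (line_incl_sharp a)
    (tilde P2_ring (twist (-1) (P2_log_mod D'.Q)))
    (tilde_map P2_ring P2_ring (P2_log_mod Q) (\<lambda>f. f) (mult_map a Q))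
    (tilde P2_ring (P2_log_mod Q))
    (tilde_map P2_ring LP.S LP.DS LP.\<pi> (restr_map a LP.QS))
    (tilde LP.S LP.DS)"
proof -
  have P: "P \<noteq> {}"
    using ne pt_image by blast
  have "A \<noteq> {}"
    using H by blast
  have inj: "inj_on (mult_map a Q) (carrier (twist (-1) (P2_log_mod D'.Q)))"
    using mult_map_inj by simp
  have lift: "\<exists>k. \<exists>u\<in>hp k. LP.\<pi> u \<notin> q \<and>
      (\<forall>i. \<forall>n\<in>mpart LP.DS (int i). \<exists>m\<in>mpart (P2_log_mod Q) (int (k + i)). restr_map a LP.QS m = LP.\<pi> u \<odot>\<^bsub>LP.DS\<^esub> n)"
    if "q \<in> Proj LP.S" for q
    by (rule restr_lift[OF P that])
  show ?thesis
    unfolding elementary_modification_def line_incl_def line_incl_sharp_def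
    using log_mod_vector_bundle(1)[OF \<open>A \<noteq> {}\<close>] LP.DS_line_bundle[OF P] D'.log_mod_vector_bundle(2)[OF ne]
      graded_semilinear.tilde_short_exact[OF restr_map_semilinear mult_map_semilinear inj restr_mult_zero restr_kernel lift]
    by blast
qed

end

text \<open>The homogeneous prime of the rational point \<open>w\<close>: the kernel of the
  substitution of \<open>w j\<close> times \<open>t\<close> for each variable, with
  \<open>coord 0\<close> in the role of \<open>t\<close>. Multiples of \<open>t\<close> instead of
  scalars keep the map compatible with degrees, so that the kernel is homogeneous.\<close>

lemma point_prime:
  fixes w :: "3 \<Rightarrow> 'k::field_char_0"
  assumes w: "w i \<noteq> 0"
  shows "\<exists>p\<in>Proj P2_ring. \<forall>l\<in>hp 1. l \<in> p \<longleftrightarrow> pairing (lcoeff l) w = 0"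
proof
  let ?ev = "psubst (\<lambda>j. const (w j) * coord 0)"
  have lin: "const (w j) * coord 0 \<in> hp 1" for j
    using hp_mult[OF const_hp coord_hp] by simp
  define p where "p = {f. ?ev f = 0}"
  have ev1: "?ev 1 = 1"
    using psubst_const[of _ 1] by simp
  have coord0: "(coord 0 :: 'k poly3) \<noteq> 0"
  proof
    assume "(coord 0 :: 'k poly3) = 0"
    then have "Poly_Mapping.lookup (coord 0 :: 'k poly3) (Poly_Mapping.single 0 1) = 0"
      by simp
    then show False
      by (simp add: coord_def)
  qed
  interpret R: graded_cring P2_ring by (rule P2_graded)
  have id: "ideal p P2_ring"
  proof (rule idealI)
    show "subgroup p (add_monoid P2_ring)"
    proof (rule R.add.subgroupI)
      have neg: "- f \<in> p" if "f \<in> p" for f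
      proof -
        have "?ev f + ?ev (- f) = 0"
          unfolding psubst_add[symmetric] by simp
        then show ?thesis
          using that by (simp add: p_def)
      qed
      show "\<ominus>\<^bsub>P2_ring\<^esub> f \<in> p" if "f \<in> p" for f
        unfolding P2_uminus by (rule neg[OF that])
    qed (auto simp: p_def psubst_add intro!: exI[of _ 0])
  qed (auto simp: p_def psubst_mult R.ring_axioms)
  have prime: "primeideal p P2_ring"
  proof (rule primeidealI[OF id R.cring_axioms])
    have "1 \<notin> p"
      by (simp add: p_def ev1)
    then show "carrier P2_ring \<noteq> p"
      by auto
  qed (auto simp: p_def psubst_mult)
  interpret p: ideal p P2_ring by (rule id)
  have gen: "p = Idl\<^bsub>P2_ring\<^esub> (p \<inter> homog P2_ring)"
  proof
    show "Idl\<^bsub>P2_ring\<^esub> (p \<inter> homog P2_ring) \<subseteq> p"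
      by (rule R.genideal_minimal[OF id]) simp
    show "p \<subseteq> Idl\<^bsub>P2_ring\<^esub> (p \<inter> homog P2_ring)"
    proof
      fix f assume f: "f \<in> p"
      have J: "ideal (Idl\<^bsub>P2_ring\<^esub> (p \<inter> homog P2_ring)) P2_ring"
        by (rule R.genideal_ideal) simp
      interpret J: ideal "Idl\<^bsub>P2_ring\<^esub> (p \<inter> homog P2_ring)" P2_ring by (rule J)
      have zero: "hcomp n (0 :: 'k poly3) = 0" for n
        by (rule hcomp_id) simp
      have "hcomp n f \<in> p \<inter> homog P2_ring" for n
        using f hcomp_hp[of n f] psubst_hcomp[of "\<lambda>j. const (w j) * coord 0" n f] lin
        by (auto simp: p_def zero homog_def)
      then have mem: "hcomp n f \<in> Idl\<^bsub>P2_ring\<^esub> (p \<inter> homog P2_ring)" for n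
        using R.genideal_self[of "p \<inter> homog P2_ring"] by auto
      have "(\<Sum>n\<in>F. hcomp n f) \<in> Idl\<^bsub>P2_ring\<^esub> (p \<inter> homog P2_ring)" if "finite F" for F
        using that
      proof (induction F rule: finite_induct)
        case empty
        then show ?case using J.zero_closed by simp
      next
        case (insert n F)
        then show ?case using J.a_closed[OF mem[of n]] by simp
      qed
      then show "f \<in> Idl\<^bsub>P2_ring\<^esub> (p \<inter> homog P2_ring)"
        by (subst hcomp_sum[of f]) simp
    qed
  qed
  have ev_lin: "l \<in> p \<longleftrightarrow> pairing (lcoeff l) w = 0" if l: "l \<in> hp 1" for l
  proof -
    have "?ev l = ?ev (\<Sum>i\<in>UNIV. const (lcoeff l i) * coord i)"
      using linear_form_eq[OF l] by simp
    also have "\<dots> = (\<Sum>i\<in>UNIV. const (lcoeff l i) * const (w i)) * coord 0"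
      by (simp only: sum_3 psubst_add psubst_mult psubst_const psubst_coord distrib_right mult.assoc)
    also have "\<dots> = const (pairing (lcoeff l) w) * coord 0"
      by (simp only: const_mult const_add sum_3 pairing_def)
    finally show ?thesis
      using coord0 by (simp add: p_def)
  qed
  \<comment> \<open>The nonzero entry \<open>w i\<close> keeps a variable, and so the irrelevant
    ideal, from lying in \<open>p\<close>.\<close>
  have "coord i \<notin> p"
    using ev_lin[OF coord_hp, of i] w by (simp add: pairing_coord)
  moreover have "coord i \<in> (\<Union>n\<in>{0<..}. hp n)"
    by (rule UN_I[of 1]) (simp_all add: coord_hp)
  ultimately have "\<not> (\<Union>n\<in>{0<..}. hp n) \<subseteq> p"
    by blast
  then show "p \<in> Proj P2_ring"
    using prime gen by (simp add: Proj_def)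
  show "\<forall>l\<in>hp 1. l \<in> p \<longleftrightarrow> pairing (lcoeff l) w = 0"
    using ev_lin by blast
qed

text \<open>Proportional forms have the same zero locus, so different lines have forms that do not
  divide each other.\<close>

lemma line_arrangement_linear_forms:
  assumes "line_arrangement d \<A> \<alpha>"
  shows "linear_forms \<A> \<alpha>"
proof
  have arr: "finite \<A>" "\<And>L. L \<in> \<A> \<Longrightarrow> \<alpha> L \<in> hp 1" "\<And>L. L \<in> \<A> \<Longrightarrow> \<alpha> L \<noteq> 0"
    "\<And>L. L \<in> \<A> \<Longrightarrow> zero_locus P2_ring (\<alpha> L) = L"
    using assms by (auto simp: line_arrangement_def)
  show "finite \<A>"
    by (rule arr(1))
  show "\<alpha> L \<in> hp 1" "\<alpha> L \<noteq> 0" if "L \<in> \<A>" for L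
    using arr(2,3)[OF that] .
  show "\<not> \<alpha> L dvd \<alpha> L'" if L: "L \<in> \<A>" "L' \<in> \<A>" and ne: "L \<noteq> L'" for L L'
  proof
    assume "\<alpha> L dvd \<alpha> L'"
    then obtain c where c: "\<alpha> L' = const c * \<alpha> L"
      using linear_dvd_linear[OF arr(2,3,2)] L by metis
    then have "c \<noteq> 0"
      using arr(3)[OF L(2)] by auto
    then show False
      using arr(4)[OF L(1)] arr(4)[OF L(2)] c ne by (simp add: zero_locus_const)
  qed
qed

text \<open>A single line has a rational point, given by the cross product of its form with an
  independent one, and this point would lie on all lines of the arrangement.\<close>

lemma essential_not_singleton:
  assumes arr: "line_arrangement d \<A> \<alpha>" and ess: "essential \<A>" and H: "H \<in> \<A>"
  shows "\<A> - {H} \<noteq> {}"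
proof
  assume "\<A> - {H} = {}"
  then have A: "\<A> = {H}"
    using H by blast
  have h: "\<alpha> H \<in> hp 1" "\<alpha> H \<noteq> 0" "H = zero_locus P2_ring (\<alpha> H)"
    using arr H by (simp_all add: line_arrangement_def)
  obtain y where y: "cross (lcoeff (\<alpha> H)) (lcoeff y) \<noteq> (\<lambda>i. 0)"
    using cross_coord_nonzero[OF h(1,2)] by blast
  then obtain i where i: "cross (lcoeff (\<alpha> H)) (lcoeff y) i \<noteq> 0"
    by auto
  obtain p where p: "p \<in> Proj P2_ring"
    "\<And>l. l \<in> hp 1 \<Longrightarrow> l \<in> p \<longleftrightarrow> pairing (lcoeff l) (cross (lcoeff (\<alpha> H)) (lcoeff y)) = 0"
    using point_prime[where w = "cross (lcoeff (\<alpha> H)) (lcoeff y)", OF i] by blast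
  have "p \<in> H"
    using p(1) p(2)[OF h(1)] by (subst h(3)) (simp add: zero_locus_def pairing_cross)
  then show False
    using ess p(1) A by (auto simp: essential_def)
qed

lemma (in line) S_finprod:
  assumes "finite F"
  shows "finprod S (\<lambda>p. \<pi> (f p)) F = \<pi> (prod f F)"
proof -
  interpret R: cring S by (rule S_cring)
  show ?thesis
    using assms
  proof (induction F rule: finite_induct)
    case (insert p F)
    then show ?case
      by (simp add: Pi_def S_simps(1)) (simp add: S_simps(2))
  qed (simp add: S_simps(5))
qed

text \<open>Every linear form on the line has a lift free of \<open>a\<close>. The given forms of
  the points are replaced by such lifts, as \<open>line_points\<close> requires.\<close>

lemma (in line_coordinates) elim_form:
  assumes l: "l \<in> hp 1"
  shows "elim l \<in> hp 1" "\<pi> (elim l) = \<pi> l" "elim (elim l) = elim l"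
proof -
  have e: "elim l = l - dx l * a"
    by (rule elim_linear[OF l])
  have "dx l * a \<in> hp 1"
    using hp_mult[OF const(1)[OF l] a_linear] by simp
  then show "elim l \<in> hp 1"
    unfolding e by (rule hp_diff[OF l])
  show "\<pi> (elim l) = \<pi> l"
    using proj_eq elim_cong by metis
  have "elim (l - elim l) = 0"
    using elim_cong[of l] unfolding x_dvd_iff .
  then show "elim (elim l) = elim l"
    using elim_simps(1)[of "l - elim l" "elim l"] by simp
qed

text \<open>Turns an equality of point sets into linear algebra. \<open>H \<inter> L\<close>
  contains the rational point given by the cross product, so \<open>b\<close> vanishes there; in
  coordinates completed by a form \<open>z\<close> nonzero at that point, the coefficient of
  \<open>z\<close> in \<open>b\<close> is therefore zero.\<close>

lemma intersection_point_form:
  assumes arr: "line_arrangement d \<A> \<alpha>" and H: "H \<in> \<A>" and L: "L \<in> \<A>" "L \<noteq> H"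
    and b: "b \<in> hp 1" "\<not> \<alpha> H dvd b"
    and pt: "line_incl (\<alpha> H) ` zero_locus (line_ring (\<alpha> H)) (line_proj (\<alpha> H) b) = H \<inter> L"
  shows "\<exists>c. c \<noteq> 0 \<and> \<alpha> H dvd b - const c * \<alpha> L"
proof -
  interpret linear_forms \<A> \<alpha>
    by (rule line_arrangement_linear_forms[OF arr])
  let ?a = "\<alpha> H" and ?y = "\<alpha> L"
  let ?w = "cross (lcoeff ?a) (lcoeff ?y)"
  have zl: "H = zero_locus P2_ring ?a" "L = zero_locus P2_ring ?y"
    using arr H L by (simp_all add: line_arrangement_def)
  have w: "?w \<noteq> (\<lambda>i. 0)"
    by (rule cross_nonzero) (use H L in auto)
  then obtain i where i: "?w i \<noteq> 0"
    by auto
  obtain p where p: "p \<in> Proj P2_ring" "\<And>l. l \<in> hp 1 \<Longrightarrow> l \<in> p \<longleftrightarrow> pairing (lcoeff l) ?w = 0"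
    using point_prime[where w = "?w", OF i] by blast
  have ap: "?a \<in> p" and yp: "?y \<in> p"
    using p(2) form H L by (simp_all add: pairing_cross)
  then have "p \<in> H \<inter> L"
    using p(1) zl unfolding zero_locus_def by blast
  then obtain q where "p = line_incl ?a q" "q \<in> zero_locus (line_ring ?a) (line_proj ?a b)"
    unfolding pt[symmetric] by blast
  then have bp: "b \<in> p"
    by (simp add: line_incl_def Proj_map_def zero_locus_def)
  obtain z dx dy dz where z: "z \<notin> p" and co: "coordinates ?a ?y z dx dy dz"
    using coordinates_point[OF form[OF H] form[OF L(1)] w p(1)] by blast
  interpret C: coordinates ?a ?y z dx dy dz by (rule co)
  obtain cx cy cz where c: "dx b = const cx" "dy b = const cy" "dz b = const cz"
    using C.const[OF b(1)] hp_0_const by metis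
  have e: "b = const cx * ?a + const cy * ?y + const cz * z"
    using C.expand[OF b(1)] unfolding c .
  have "b - (const cx * ?a + const cy * ?y) \<in> p"
    by (intro Proj_P2_diff[OF p(1)] Proj_P2_add[OF p(1)] bp) (simp_all add: Proj_P2_mult[OF p(1)] ap yp)
  then have "const cz * z \<in> p"
    using e by (simp add: algebra_simps)
  then have "cz = 0"
    using z Proj_P2_mult[OF p(1)] Proj_P2_const[OF p(1)] by blast
  then have e': "b - const cy * ?y = const cx * ?a"
    using e by simp
  \<comment> \<open>Otherwise \<open>b\<close> would be a multiple of \<open>\<alpha> H\<close>,
    that is, zero on the line.\<close>
  have "cy \<noteq> 0"
  proof
    assume "cy = 0"
    then have "b = const cx * ?a"
      using e' by simp
    then show False
      using b(2) by simp
  qed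
  moreover have "?a dvd b - const cy * ?y"
    unfolding e' by simp
  ultimately show ?thesis by blast
qed

theorem theorem3p2:
  fixes \<A> :: "'k::field_char_0 poly3 set set set"
    and H :: "'k poly3 set set"
    and \<alpha> :: "'k poly3 set set \<Rightarrow> 'k poly3"
    and \<beta> :: "'k poly3 set set \<Rightarrow> 'k poly3 set"
    and d :: nat
  assumes "line_arrangement d \<A> \<alpha>"
    and "essential \<A>"
    and "H \<in> \<A>"
    and "point_forms (\<alpha> H) (arr_restriction \<A> H) \<beta>"
  shows "let a = \<alpha> H;
             S = line_ring a;
             Q = (\<Otimes>\<^bsub>P2_ring\<^esub>L\<in>\<A>. \<alpha> L);
             Q' = (\<Otimes>\<^bsub>P2_ring\<^esub>L\<in>\<A> - {H}. \<alpha> L);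
             Q'' = (\<Otimes>\<^bsub>S\<^esub>P\<in>arr_restriction \<A> H. \<beta> P);
             D = P2_log_mod Q;
             D' = P2_log_mod Q';
             D'' = line_log_mod a Q''
         in elementary_modification (Proj_space P2_ring) (Proj_space S)
              (line_incl a) (line_incl_sharp a)
              (tilde P2_ring (twist (-1) D'))
              (tilde_map P2_ring P2_ring D (\<lambda>f. f) (mult_map a Q))
              (tilde P2_ring D)
              (tilde_map P2_ring S D'' (line_proj a) (restr_map a Q''))
              (tilde S D'')"
proof -
  interpret linear_forms_triple \<A> \<alpha> H
    using line_arrangement_linear_forms[OF assms(1)] assms(3)
    by (simp add: linear_forms_triple_def linear_forms_triple_axioms_def)
  let ?P = "arr_restriction \<A> H"
  have finP: "finite ?P"
    using fin by (simp add: arr_restriction_def)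
  obtain y0 z0 dx0 dy0 dz0 where co: "coordinates a y0 z0 dx0 dy0 dz0"
    by (rule linear_coordinates[OF a_linear a_nonzero])
  interpret C: line_coordinates a y0 z0 dx0 dy0 dz0
    using a_linear a_nonzero co by (simp add: line_coordinates_def line_def)
  have \<beta>: "\<beta> P \<in> C.\<pi> ` hp 1" "\<beta> P \<noteq> C.\<pi> 0" "line_incl a ` zero_locus C.S (\<beta> P) = P" if "P \<in> ?P" for P
    using assms(4) that by (auto simp: point_forms_def C.S_simps)
  have "\<exists>l\<in>hp 1. \<beta> P = C.\<pi> l" if "P \<in> ?P" for P
    using \<beta>(1)[OF that] by blast
  then obtain l where l: "\<And>P. P \<in> ?P \<Longrightarrow> l P \<in> hp 1" "\<And>P. P \<in> ?P \<Longrightarrow> \<beta> P = C.\<pi> (l P)"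
    by metis
  \<comment> \<open>The data \<open>\<beta>\<close> are classes modulo \<open>a\<close>. Eliminating
    \<open>a\<close> from arbitrary linear lifts gives representatives fixed by \<open>elim\<close>,
    and \<open>QS\<close> confirms that they define the same polynomial on the line.\<close>
  define b where "b P = C.elim (l P)" for P
  have b: "b P \<in> hp 1" "C.\<pi> (b P) = \<beta> P" "C.elim (b P) = b P" if "P \<in> ?P" for P
    unfolding b_def using C.elim_form[OF l(1)[OF that]] l(2)[OF that] by simp_all
  have ndvd: "\<not> a dvd b P" if "P \<in> ?P" for P
    using \<beta>(2)[OF that] b(2)[OF that] C.S_zero_iff by metis
  have nz: "b P \<noteq> 0" if "P \<in> ?P" for P
    using ndvd[OF that] by auto
  have lp: "linear_forms ?P b"
  proof
    show "\<not> b P dvd b P'" if P: "P \<in> ?P" "P' \<in> ?P" and ne: "P \<noteq> P'" for P P'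
    proof
      assume "b P dvd b P'"
      then obtain c where c: "b P' = const c * b P"
        using linear_dvd_linear[OF b(1) nz b(1)] P by metis
      then have "c \<noteq> 0"
        using nz[OF P(2)] by auto
      \<comment> \<open>Proportional forms vanish at the same points of the line, so the two points
        of the restriction would coincide.\<close>
      have "C.\<pi> (b P') \<in> q \<longleftrightarrow> C.\<pi> (b P) \<in> q" if q: "q \<in> Proj C.S" for q
      proof -
        have m: "Proj_map P2_ring C.\<pi> q \<in> Proj P2_ring"
          by (rule C.GS.Proj_map_Proj[OF q])
        have "b P' \<in> Proj_map P2_ring C.\<pi> q \<longleftrightarrow> b P \<in> Proj_map P2_ring C.\<pi> q"
          unfolding c Proj_P2_mult[OF m] using Proj_P2_const[OF m] \<open>c \<noteq> 0\<close> by blast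
        then show ?thesis
          by (simp add: Proj_map_def)
      qed
      then have "zero_locus C.S (\<beta> P') = zero_locus C.S (\<beta> P)"
        unfolding b(2)[OF P(1), symmetric] b(2)[OF P(2), symmetric] zero_locus_def by blast
      then show False
        using \<beta>(3)[OF P(1)] \<beta>(3)[OF P(2)] ne by simp
    qed
  qed (use finP b nz in auto)
  \<comment> \<open>A line is sent to its intersection with \<open>H\<close>; lines that meet
    \<open>H\<close> in one point share the form of that point, in accordance with the restriction
    without multiplicities.\<close>
  interpret LR: line_restriction \<A> \<alpha> H y0 z0 dx0 dy0 dz0 ?P b "\<lambda>L. H \<inter> L"
  proof (intro line_restriction.intro line_points.intro line_restriction_axioms.intro
      line_points_axioms.intro lp C.line_coordinates_axioms linear_forms_triple_axioms b(3))
    show "(\<lambda>L. H \<inter> L) ` (\<A> - {H}) = ?P"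
      by (simp add: arr_restriction_def)
    fix L assume L: "L \<in> \<A> - {H}"
    then have "H \<inter> L \<in> ?P"
      by (simp add: arr_restriction_def)
    then show "\<exists>c. c \<noteq> 0 \<and> a dvd b (H \<inter> L) - const c * \<alpha> L"
      using L b ndvd \<beta>(3) by (intro intersection_point_form[OF assms(1,3)]) auto
  qed
  have QS: "(\<Otimes>\<^bsub>C.S\<^esub>P\<in>?P. \<beta> P) = C.\<pi> (prod b ?P)"
  proof -
    have "(\<Otimes>\<^bsub>C.S\<^esub>P\<in>?P. \<beta> P) = (\<Otimes>\<^bsub>C.S\<^esub>P\<in>?P. C.\<pi> (b P))"
      using b(2) by (intro comm_monoid.finprod_cong'[OF cring.axioms(2)[OF C.S_cring]]) (auto simp: C.S_simps(1))
    then show ?thesis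
      using C.S_finprod[OF finP, of b] by simp
  qed
  show ?thesis
    unfolding Let_def QS
    using LR.elementary_modification_restriction[OF essential_not_singleton[OF assms(1-3)]] fin
    by (simp add: P2_finprod)
qed

end
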